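(* Let $X$ be a contracted pseudotriangulation of a closed $3$-manifold $M$. If $M$ is $S^3/Q_8$, $S^1\times S^1\times S^1$, or $L(p,q)$ for some $p\ge3$, then $h_2(X)>6\,m(M)$.
   Context: For relatively prime $p,q$, $L(p,q)=S^3/\mathbb Z_p$ is the lens space, where a generator of $\mathbb Z_p$ acts on $S^3=\{(z_1,z_2)\in\mathbb C^2:|z_1|^2+|z_2|^2=1\}$ by $(z_1,z_2)\mapsto(e^{2\pi i/p}z_1,e^{2\pi iq/p}z_2)$. $Q_8=\{\pm1,\pm i,\pm j,\pm k\}$ is the quaternion group and $S^3/Q_8$ is the quotient of the unit quaternions $S^3$ by multiplication by $Q_8$. A simplicial cell complex $K$ of dimension $d$ is the face poset (closed cells together with the empty set, ordered by inclusion) of a $d$-dimensional regular CW complex $W$ such that the boundary complex of each cell is isomorphic, as a poset, to the boundary complex of a simplex of the same dimension; write $|K|=W$. If a space $X$ is homeomorphic to $|K|$, then $K$ is a pseudotriangulation of $X$. A $d$-dimensional simplicial cell complex is contracted if it has exactly $d+1$ vertices ($0$-cells). $f_j(K)$ is the number of $j$-cells of $K$, and $h_2(K)=f_1(K)-d\,f_0(K)+\binom{d+1}{2}$ (here $d=3$). $m(M)$ is the minimal number of generators of $\pi_1(M)$. *)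

theory Defs
  imports "HOL-Analysis.Analysis" "HOL-Algebra.Generated_Groups"
begin

section \<open>Regular CW complexes and simplicial cell complexes\<close>

definition nball :: "nat \<Rightarrow> (nat \<Rightarrow> real) topology" where
  "nball n = subtopology (Euclidean_space n) {x. (\<Sum>i<n. (x i)\<^sup>2) \<le> 1}"

definition nball_interior :: "nat \<Rightarrow> (nat \<Rightarrow> real) set" where
  "nball_interior n = {x \<in> topspace (nball n). (\<Sum>i<n. (x i)\<^sup>2) < 1}"

definition nball_boundary :: "nat \<Rightarrow> (nat \<Rightarrow> real) set" where
  "nball_boundary n = {x \<in> topspace (nball n). (\<Sum>i<n. (x i)\<^sup>2) = 1}"

text \<open>
  The cells of a regular CW complex are recorded by their closures (in a regular complex distinct
  cells have distinct closures), each with its dimension and a characteristic map. The underlying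
  space \<open>W\<close> is kept together with the set of closed cells, so that one record carries both the
  poset \<open>K\<close> and \<open>W = |K|\<close>.
\<close>

record 'a cell_complex =
  realization :: "'a topology"
  cells :: "'a set set"
  cell_dim :: "'a set \<Rightarrow> nat"
  char_map :: "'a set \<Rightarrow> (nat \<Rightarrow> real) \<Rightarrow> 'a"

definition open_cell :: "'a cell_complex \<Rightarrow> 'a set \<Rightarrow> 'a set" where
  "open_cell K c = char_map K c ` nball_interior (cell_dim K c)"

definition cell_boundary :: "'a cell_complex \<Rightarrow> 'a set \<Rightarrow> 'a set" where
  "cell_boundary K c = char_map K c ` nball_boundary (cell_dim K c)"

text \<open>
  The usual characterization of a CW structure by characteristic maps: the open cells partition a
  Hausdorff space, the boundary of each cell lies in finitely many cells of smaller dimension, and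
  the topology is the weak one. Regularity is the requirement that the characteristic maps embed
  the closed balls.
\<close>

definition regular_CW_complex :: "'a cell_complex \<Rightarrow> bool" where
  "regular_CW_complex K \<longleftrightarrow>
     Hausdorff_space (realization K) \<and>
     (\<forall>c\<in>cells K.
        embedding_map (nball (cell_dim K c)) (realization K) (char_map K c) \<and>
        char_map K c ` topspace (nball (cell_dim K c)) = c) \<and>
     (\<forall>c\<in>cells K. \<forall>c'\<in>cells K. c \<noteq> c' \<longrightarrow> open_cell K c \<inter> open_cell K c' = {}) \<and>
     (\<Union>c\<in>cells K. open_cell K c) = topspace (realization K) \<and>
     (\<forall>c\<in>cells K. \<exists>F\<subseteq>cells K. finite F \<and> (\<forall>e\<in>F. cell_dim K e < cell_dim K c) \<and>
        cell_boundary K c \<subseteq> (\<Union>e\<in>F. open_cell K e)) \<and>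
     (\<forall>A\<subseteq>topspace (realization K).
        closedin (realization K) A \<longleftrightarrow>
        (\<forall>c\<in>cells K. closedin (subtopology (realization K) c) (A \<inter> c)))"

definition face_poset :: "'a cell_complex \<Rightarrow> 'a set set" where
  "face_poset K = insert {} (cells K)"

definition boundary_complex :: "'a cell_complex \<Rightarrow> 'a set \<Rightarrow> 'a set set" where
  "boundary_complex K c = {e \<in> face_poset K. e \<subseteq> cell_boundary K c}"

text \<open>The proper faces (including the empty one) of a simplex on the \<open>n + 1\<close> vertices \<open>0, \<dots>, n\<close>.\<close>

definition simplex_boundary_complex :: "nat \<Rightarrow> nat set set" where
  "simplex_boundary_complex n = {S. S \<subset> {..n}}"

definition isomorphic_set_posets :: "'a set set \<Rightarrow> 'b set set \<Rightarrow> bool" where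
  "isomorphic_set_posets P Q \<longleftrightarrow>
     (\<exists>f. bij_betw f P Q \<and> (\<forall>x\<in>P. \<forall>y\<in>P. x \<subseteq> y \<longleftrightarrow> f x \<subseteq> f y))"

definition simplicial_cell_complex :: "nat \<Rightarrow> 'a cell_complex \<Rightarrow> bool" where
  "simplicial_cell_complex d K \<longleftrightarrow>
     regular_CW_complex K \<and>
     (\<forall>c\<in>cells K. cell_dim K c \<le> d) \<and> (\<exists>c\<in>cells K. cell_dim K c = d) \<and>
     (\<forall>c\<in>cells K. isomorphic_set_posets (boundary_complex K c)
                     (simplex_boundary_complex (cell_dim K c)))"

definition pseudotriangulation :: "nat \<Rightarrow> 'a cell_complex \<Rightarrow> 'b topology \<Rightarrow> bool" where
  "pseudotriangulation d K X \<longleftrightarrow>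
     simplicial_cell_complex d K \<and> X homeomorphic_space realization K"

definition f_number :: "'a cell_complex \<Rightarrow> nat \<Rightarrow> nat" where
  "f_number K j = card {c \<in> cells K. cell_dim K c = j}"

definition contracted :: "nat \<Rightarrow> 'a cell_complex \<Rightarrow> bool" where
  "contracted d K \<longleftrightarrow> simplicial_cell_complex d K \<and> f_number K 0 = d + 1"

definition h2 :: "nat \<Rightarrow> 'a cell_complex \<Rightarrow> int" where
  "h2 d K = int (f_number K 1) - int d * int (f_number K 0) + int ((d + 1) choose 2)"


section \<open>Closed manifolds and the fundamental group\<close>

definition closed_manifold :: "nat \<Rightarrow> 'a topology \<Rightarrow> bool" where
  "closed_manifold n M \<longleftrightarrow>
     compact_space M \<and> Hausdorff_space M \<and> second_countable M \<and>
     (\<forall>x\<in>topspace M. \<exists>U. openin M U \<and> x \<in> U \<and>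
        subtopology M U homeomorphic_space Euclidean_space n)"

text \<open>
  The library's path homotopies are for type-class topologies only, so loops and their homotopies
  rel base point are set up here for an arbitrary topology. Loops are functions on all of the
  reals; neither \<^const>\<open>pathin\<close> nor the homotopy relation depends on the values outside the unit
  interval.
\<close>

definition loops :: "'a topology \<Rightarrow> 'a \<Rightarrow> (real \<Rightarrow> 'a) set" where
  "loops M x = {p. pathin M p \<and> p 0 = x \<and> p 1 = x}"

definition loop_homotopy :: "'a topology \<Rightarrow> 'a \<Rightarrow> ((real \<Rightarrow> 'a) \<times> (real \<Rightarrow> 'a)) set" where
  "loop_homotopy M x = {(p, q). p \<in> loops M x \<and> q \<in> loops M x \<and>
     homotopic_with (\<lambda>r. r 0 = x \<and> r 1 = x) (top_of_set {0..1}) M p q}"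

definition loop_concat :: "(real \<Rightarrow> 'a) \<Rightarrow> (real \<Rightarrow> 'a) \<Rightarrow> real \<Rightarrow> 'a" where
  "loop_concat p q = (\<lambda>t. if t \<le> 1/2 then p (2 * t) else q (2 * t - 1))"

definition fundamental_group :: "'a topology \<Rightarrow> 'a \<Rightarrow> (real \<Rightarrow> 'a) set monoid" where
  "fundamental_group M x =
     \<lparr>carrier = loops M x // loop_homotopy M x,
      mult = (\<lambda>A B. loop_homotopy M x `` {loop_concat p q |p q. p \<in> A \<and> q \<in> B}),
      one = loop_homotopy M x `` {\<lambda>t. x}\<rparr>"

text \<open>Meaningful for finitely generated groups, such as the fundamental group of a closed manifold.\<close>

definition min_generators :: "('g, 'm) monoid_scheme \<Rightarrow> nat" where
  "min_generators G =
     (LEAST n. \<exists>S\<subseteq>carrier G. finite S \<and> card S = n \<and> generate G S = carrier G)"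


section \<open>The manifolds\<close>

definition quotient_topology :: "'a topology \<Rightarrow> ('a \<Rightarrow> 'b) \<Rightarrow> 'b topology" where
  "quotient_topology X q =
     topology (\<lambda>U. U \<subseteq> q ` topspace X \<and> openin X {x \<in> topspace X. q x \<in> U})"

lemma openin_quotient_topology:
  "openin (quotient_topology X q) U \<longleftrightarrow>
     U \<subseteq> q ` topspace X \<and> openin X {x \<in> topspace X. q x \<in> U}"
proof -
  have "istopology (\<lambda>U. U \<subseteq> q ` topspace X \<and> openin X {x \<in> topspace X. q x \<in> U})"
    unfolding istopology_def
  proof (rule conjI; intro allI impI conjI)
    fix S T
    assume S: "S \<subseteq> q ` topspace X \<and> openin X {x \<in> topspace X. q x \<in> S}"
      and T: "T \<subseteq> q ` topspace X \<and> openin X {x \<in> topspace X. q x \<in> T}"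
    show "S \<inter> T \<subseteq> q ` topspace X" using S by blast
    have "{x \<in> topspace X. q x \<in> S \<inter> T} =
        {x \<in> topspace X. q x \<in> S} \<inter> {x \<in> topspace X. q x \<in> T}" by blast
    then show "openin X {x \<in> topspace X. q x \<in> S \<inter> T}" using S T by (simp add: openin_Int)
  next
    fix \<U>
    assume U: "\<forall>S\<in>\<U>. S \<subseteq> q ` topspace X \<and> openin X {x \<in> topspace X. q x \<in> S}"
    show "\<Union>\<U> \<subseteq> q ` topspace X" using U by blast
    have "openin X (\<Union>S\<in>\<U>. {x \<in> topspace X. q x \<in> S})"
      by (rule openin_Union) (use U in auto)
    moreover have "{x \<in> topspace X. q x \<in> \<Union>\<U>} = (\<Union>S\<in>\<U>. {x \<in> topspace X. q x \<in> S})" by blast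
    ultimately show "openin X {x \<in> topspace X. q x \<in> \<Union>\<U>}" by (simp only:)
  qed
  then show ?thesis by (simp add: quotient_topology_def topology_inverse')
qed

lemma topspace_quotient_topology: "topspace (quotient_topology X q) = q ` topspace X"
proof
  show "topspace (quotient_topology X q) \<subseteq> q ` topspace X"
    using openin_quotient_topology[of X q "topspace (quotient_topology X q)"] by simp
  have "{x \<in> topspace X. q x \<in> q ` topspace X} = topspace X" by blast
  then have "openin (quotient_topology X q) (q ` topspace X)"
    by (simp add: openin_quotient_topology)
  then show "q ` topspace X \<subseteq> topspace (quotient_topology X q)" by (rule openin_subset)
qed

lemma quotient_map_quotient_topology: "quotient_map X (quotient_topology X q) q"
  by (auto simp: quotient_map_def topspace_quotient_topology openin_quotient_topology)

definition sphere3 :: "(complex \<times> complex) topology" where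
  "sphere3 = top_of_set {(z1, z2). (cmod z1)\<^sup>2 + (cmod z2)\<^sup>2 = 1}"

definition lens_rotation :: "nat \<Rightarrow> int \<Rightarrow> complex \<times> complex \<Rightarrow> complex \<times> complex" where
  "lens_rotation p q =
     (\<lambda>(z1, z2). (exp (2 * of_real pi * \<i> / of_nat p) * z1,
                  exp (2 * of_real pi * \<i> * of_int q / of_nat p) * z2))"

text \<open>
  Points of \<open>L(p,q)\<close> are the orbits under the powers of the generator; natural exponents suffice
  because its \<open>p\<close>-th power is the identity.
\<close>

definition lens_space :: "nat \<Rightarrow> int \<Rightarrow> (complex \<times> complex) set topology" where
  "lens_space p q =
     quotient_topology sphere3 (\<lambda>z. {(lens_rotation p q ^^ k) z |k::nat. True})"

text \<open>The pair \<open>(a, b)\<close> of complex numbers stands for the quaternion \<open>a + b j\<close>.\<close>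

definition quat_mult :: "complex \<times> complex \<Rightarrow> complex \<times> complex \<Rightarrow> complex \<times> complex" where
  "quat_mult = (\<lambda>(a, b) (c, d). (a * c - b * cnj d, a * d + b * cnj c))"

definition quat_i :: "complex \<times> complex" where "quat_i = (\<i>, 0)"
definition quat_j :: "complex \<times> complex" where "quat_j = (0, 1)"
definition quat_k :: "complex \<times> complex" where "quat_k = (0, \<i>)"

lemma Hamilton_relations:
  "quat_mult quat_i quat_i = (-1, 0)" "quat_mult quat_j quat_j = (-1, 0)"
  "quat_mult quat_k quat_k = (-1, 0)" "quat_mult quat_i quat_j = quat_k"
  "quat_mult quat_j quat_k = quat_i" "quat_mult quat_k quat_i = quat_j"
  by (simp_all add: quat_mult_def quat_i_def quat_j_def quat_k_def)

definition Q8 :: "(complex \<times> complex) set" where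
  "Q8 = {(1, 0), (-1, 0), quat_i, - quat_i, quat_j, - quat_j, quat_k, - quat_k}"

definition sphere3_mod_Q8 :: "(complex \<times> complex) set topology" where
  "sphere3_mod_Q8 = quotient_topology sphere3 (\<lambda>x. {quat_mult g x |g. g \<in> Q8})"

definition torus3 :: "(complex \<times> complex \<times> complex) topology" where
  "torus3 = prod_topology (top_of_set (sphere 0 1))
              (prod_topology (top_of_set (sphere 0 1)) (top_of_set (sphere 0 1)))"

end

theory Submission
 imports Defs "HOL-Homology.Invariance_of_Domain" "HOL-Library.Z2"
begin

text \<open>
  Let \<open>X\<close> have four vertices, coloured \<open>0, \<dots>, 3\<close>. Every tetrahedron has one vertex of each
  colour and shares its face opposite to colour \<open>c\<close> with exactly one other tetrahedron
  \<open>sg c T\<close>. So \<open>X\<close> is recorded by its finite set \<open>TT\<close> of tetrahedra with four fixed point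
  free involutions (locale \<open>gem\<close>). Manifoldness enters through small punctured balls, which
  carry no coverings: the tetrahedra round an edge form a single orbit of the two
  involutions that fix it (\<open>edge_orbit\<close>), those round a vertex a single orbit of three
  (\<open>vertex_orbit\<close>), and a cocycle on the link of a vertex is a coboundary
  (\<open>potential_at_vertex\<close>). Hence the edges with given end points are the orbits of the other
  two involutions. As \<open>h\<^sub>2\<close> is the number of edges minus \<open>6\<close>, it has to be shown that there are
  more than \<open>6 r + 6\<close> edges, for a bound \<open>r\<close> of \<open>m(M)\<close>.

  \<^emph>\<open>The weak inequality.\<close> Let \<open>E\<close> (the sphere or real three-space) cover \<open>X\<close> with deck
  group \<open>G\<close>. Over the open star of each vertex the covering has a section; comparing the sections of
  the vertices \<open>a\<close> and \<open>b\<close> inside a tetrahedron gives an element \<open>h a b T\<close> of \<open>G\<close>, which depends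
  only on the edge of \<open>T\<close> between \<open>a\<close> and \<open>b\<close>. The labels of the edges joining one fixed pair of
  vertices already generate \<open>G\<close>, because the subgroup that they generate contains all others
  (\<open>generated_by_one_pair\<close>). One of them is trivial, so there are at least \<open>r + 1\<close> edges
  for each of the six pairs, where \<open>r\<close> is the least number of generators of \<open>G\<close> (\<open>many_edges\<close>).

  \<^emph>\<open>Equality is impossible.\<close> If every pair is joined by exactly \<open>r + 1\<close> edges, then the Euler
  characteristics of the vertex links leave at most \<open>6 r + 2\<close> tetrahedra (\<open>card_TT_bound\<close>).
  Now consider two opposite pairs of vertices and a function \<open>c\<close> of the tetrahedra that depends only
  on the edge \<open>e\<close> of the first pair in them. Moving round an edge \<open>f\<close> of the second pair one meets edges
  \<open>e\<close> alternately on two sides; if the alternating sum of the values of \<open>c\<close> vanishes round every such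
  \<open>f\<close>, then \<open>c\<close> gives rise to a cocycle on \<open>X\<close>, which becomes trivial on \<open>E\<close>
  (\<open>cocycle_on_cover\<close>). For finite \<open>G\<close> and real values averaging over \<open>G\<close> shows that \<open>c\<close> is constant
  (\<open>real_label_constant\<close>); for abelian \<open>G\<close> and values in any group all values
  commute (\<open>label_values_commute\<close>). The first is used for lens spaces and for the quaternion space,
  the second, with values in a nilpotent group, for the torus. In each case nontrivial cycles
  round the edges \<open>f\<close> are therefore needed, relations in \<open>G\<close> force these cycles to be long, and
  \<open>6 r + 2\<close> tetrahedra are not enough for them (\<open>not_extremal\<close> in \<open>lens_gem\<close>, \<open>Q8_gem\<close>, \<open>T3_gem\<close>).
\<close>

section \<open>Covering maps of abstract topological spaces\<close>

text \<open>A chart of a covering is kept as a family of local sections: \<open>s e\<close> is the section over \<open>V\<close> through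
  the point \<open>e\<close>, so that no decomposition of the preimage of \<open>V\<close> into sheets has to be chosen.\<close>

definition even_chart ::
 "'e topology => 's topology => ('e => 's) => 's set => ('e => 's => 'e) => bool" where
 "even_chart E S p V s \<longleftrightarrow> openin S V & (ALL e:topspace E. p e : V -->
    continuous_map (subtopology S V) E (s e) & s e (p e) = e & openin E (s e ` V) & (ALL y:V. p (s e y) = y)) &
   (ALL e:topspace E. ALL e':topspace E. p e : V --> p e' : V -->
    s e ` V Int s e' ` V ~= {} --> s e ` V = s e' ` V)"

definition cover_map :: "'e topology => 's topology => ('e => 's) => bool" where
 "cover_map E S p \<longleftrightarrow> continuous_map E S p & p ` topspace E = topspace S &
   (ALL x:topspace S. EX V s. x : V & even_chart E S p V s)"

lemma even_chartD:
 assumes "even_chart E S p V s" "e : topspace E" "p e : V"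
 shows "continuous_map (subtopology S V) E (s e)" "s e (p e) = e" "openin E (s e ` V)" "y : V ==> p (s e y) = y"
 using assms unfolding even_chart_def by blast+

lemma even_chart_same_sheet:
 assumes "even_chart E S p V s" "e : topspace E" "e' : topspace E" "p e : V" "p e' : V"
  "y : V" "s e y = s e' y"
 shows "s e ` V = s e' ` V" using assms unfolding even_chart_def by blast

lemma even_chart_open: "even_chart E S p V s ==> openin S V" by (simp add: even_chart_def)

lemma cover_map_continuous: "cover_map E S p ==> continuous_map E S p" by (simp add: cover_map_def)

lemma cover_map_surj: "cover_map E S p ==> p ` topspace E = topspace S" by (simp add: cover_map_def)

lemma lift_unique:
 assumes cov: "cover_map E S p" and Y: "connected_space Y"
  and f: "continuous_map Y E f" and g: "continuous_map Y E g"
  and fg: "!!y. y : topspace Y ==> p (f y) = p (g y)"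
  and y0: "y0 : topspace Y" "f y0 = g y0" and y: "y : topspace Y"
 shows "f y = g y"
proof -
 have fE: "f z : topspace E" "g z : topspace E" if "z : topspace Y" for z using f g that by (auto simp: continuous_map_def)
 have pS: "p e : topspace S" if "e : topspace E" for e
  using cover_map_continuous[OF cov] that by (auto simp: continuous_map_def)
 let ?A = "{z : topspace Y. f z = g z}" and ?B = "{z : topspace Y. f z ~= g z}"
 have loc: "EX W. openin Y W & z : W & (ALL w:W. f w = g w \<longleftrightarrow> f z = g z)" if z: "z : topspace Y" for z
 proof -
  obtain V s where ch: "even_chart E S p V s" and V: "p (f z) : V"
   using cov pS[OF fE(1)[OF z]] unfolding cover_map_def by blast
  note s = even_chartD(2,3,4)[OF ch] even_chart_same_sheet[OF ch]
  have V': "p (g z) : V" using V fg z by simp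
  let ?W = "{w : topspace Y. f w : s (f z) ` V} Int {w : topspace Y. g w : s (g z) ` V}"
  have A: "openin Y ?W" using f g s(2) fE z V V' by (intro openin_Int openin_continuous_map_preimage) auto
  have B: "z : ?W" using z V V' s(1)[OF fE(1)[OF z]] s(1)[OF fE(2)[OF z]] by force
  have C: "f w = g w \<longleftrightarrow> f z = g z" if w: "w : ?W" for w
  proof -
   have wY: "w : topspace Y" using w by auto
   have 1: "f w = s (f z) (p (f w))" "p (f w) : V" using w s(3)[OF fE(1)[OF z] V] by auto
   have 2: "g w = s (g z) (p (f w))" using w s(3)[OF fE(2)[OF z] V'] fg[OF wY] by auto
   show ?thesis
   proof
    assume "f z = g z" thus "f w = g w" using 1 2 by simp
   next
    assume "f w = g w"
    hence "f z = s (g z) (p (f z))"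
     using s(4)[OF fE[OF z] V V' 1(2)] 1 2 s(1)[OF fE(1)[OF z] V] V s(3)[OF fE(2)[OF z] V'] by force
    also have "... = g z" using s(1)[OF fE(2)[OF z] V'] fg[OF z] by simp
    finally show "f z = g z" .
   qed
  qed
  show ?thesis by (rule exI[of _ ?W], rule conjI[OF A], rule conjI[OF B], rule ballI, erule C)
 qed
 have "EX T. openin Y T & z : T & T <= ?A" if "z : ?A" for z
 proof -
  have "z : topspace Y" using that by simp
  from loc[OF this] obtain W where W: "openin Y W" "z : W" "ALL w:W. f w = g w \<longleftrightarrow> f z = g z" by auto
  have "W <= ?A"
  proof
   fix w assume "w : W"
   thus "w : ?A" using bspec[OF W(3)] that subsetD[OF openin_subset[OF W(1)]] by simp
  qed
  thus ?thesis using W(1,2) by auto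
 qed
 hence oA: "openin Y ?A" by (subst openin_subopen) blast
 have "EX T. openin Y T & z : T & T <= ?B" if "z : ?B" for z
 proof -
  have "z : topspace Y" using that by simp
  from loc[OF this] obtain W where W: "openin Y W" "z : W" "ALL w:W. f w = g w \<longleftrightarrow> f z = g z" by auto
  have "W <= ?B"
  proof
   fix w assume "w : W"
   thus "w : ?B" using bspec[OF W(3)] that subsetD[OF openin_subset[OF W(1)]] by simp
  qed
  thus ?thesis using W(1,2) by auto
 qed
 hence oB: "openin Y ?B" by (subst openin_subopen) blast
 have "topspace Y - ?A = ?B" by auto
 hence "closedin Y ?A" using oB by (simp add: closedin_def)
 with oA have "?A = {} | ?A = topspace Y" using Y unfolding connected_space_clopen_in by blast
 moreover have "y0 : ?A" using y0 by simp
 ultimately have "y : ?A" using y by blast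
 thus ?thesis by simp
qed

text \<open>For fixed \<open>y\<close> the interval is cut into pieces that \<open>H\<close> sends into evenly covered sets, and the lift
  is continued over one piece after the other on a neighbourhood of \<open>y\<close>. By uniqueness of lifts of
  paths the results for different \<open>y\<close> agree on overlaps and glue to a continuous map.\<close>

lemma homotopy_lift:
 assumes cov: "cover_map E S p"
  and H: "continuous_map (prod_topology (top_of_set {0..1::real}) Y) S H"
  and f0: "continuous_map Y E f0"
  and pf0: "!!y. y : topspace Y ==> p (f0 y) = H (0, y)"
 shows "EX G. continuous_map (prod_topology (top_of_set {0..1}) Y) E G &
  (ALL t:{0..1}. ALL y:topspace Y. p (G (t, y)) = H (t, y)) & (ALL y:topspace Y. G (0, y) = f0 y)"
proof -
 let ?X = "prod_topology euclideanreal Y"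
 have HI: "continuous_map (subtopology ?X ({0..1} \<times> topspace Y)) S H"
  using H by (simp add: prod_topology_subtopology)
 have pS: "p e : topspace S" if "e : topspace E" for e
  using cover_map_continuous[OF cov] that by (auto simp: continuous_map_def)
 define Q where "Q y a b \<longleftrightarrow> (0 <= a --> a <= b --> b <= 1 -->
   (ALL W g. openin Y W --> y : W --> continuous_map (subtopology Y W) E g --> (ALL w:W. p (g w) = H (a, w)) -->
   (EX W' G. openin Y W' & y : W' & W' <= W & continuous_map (subtopology ?X ({a..b} \<times> W')) E G &
     (ALL t:{a..b}. ALL w:W'. p (G (t, w)) = H (t, w)) & (ALL w:W'. G (a, w) = g w))))" for y a b
 have Q01: "Q y 0 1" if y: "y : topspace Y" for y
 proof (rule Bolzano[of 0 1 "Q y"])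
  show "(0::real) <= 1" by simp
 next
  fix a b c assume Qab: "Q y a b" and Qbc: "Q y b c" and abc: "a <= b" "b <= c"
  show "Q y a c"
   unfolding Q_def
  proof (intro impI allI)
   fix W g assume a: "0 <= a" "a <= c" "c <= 1"
    and W: "openin Y W" "y : W" "continuous_map (subtopology Y W) E g" "ALL w:W. p (g w) = H (a, w)"
   obtain W1 G1 where 1: "openin Y W1" "y : W1" "W1 <= W" "continuous_map (subtopology ?X ({a..b} \<times> W1)) E G1"
     "ALL t:{a..b}. ALL w:W1. p (G1 (t, w)) = H (t, w)" "ALL w:W1. G1 (a, w) = g w"
    using Qab[unfolded Q_def, rule_format, OF _ _ _ W(1,2,3)] W(4) a abc by auto
   have pair: "continuous_map (subtopology Y W1) (subtopology ?X ({a..b} \<times> W1)) (%w. (b, w))"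
    using abc by (simp add: continuous_map_in_subtopology continuous_map_pairwise o_def)
   have g1: "continuous_map (subtopology Y W1) E (%w. G1 (b, w))"
    using continuous_map_compose[OF pair 1(4)] by (simp add: o_def)
   have g1p: "ALL w:W1. p (G1 (b, w)) = H (b, w)" using 1(5) abc by auto
   obtain W2 G2 where 2: "openin Y W2" "y : W2" "W2 <= W1" "continuous_map (subtopology ?X ({b..c} \<times> W2)) E G2"
     "ALL t:{b..c}. ALL w:W2. p (G2 (t, w)) = H (t, w)" "ALL w:W2. G2 (b, w) = G1 (b, w)"
    using Qbc[unfolded Q_def, rule_format, OF _ _ _ 1(1,2) g1] g1p a abc by auto
   have W2Y: "W2 <= topspace Y" using 2 openin_subset by blast
   let ?Z = "subtopology ?X ({a..c} \<times> W2)"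
   have "continuous_map ?Z E (%z. if fst z <= b then G1 z else G2 z)"
   proof (rule continuous_map_cases_le)
    show "continuous_map ?Z euclideanreal fst" by (intro continuous_map_from_subtopology continuous_map_fst)
    have "subtopology ?Z {x : topspace ?Z. fst x <= b} = subtopology (subtopology ?X ({a..b} \<times> W1)) ({a..b} \<times> W2)"
     unfolding subtopology_subtopology by (rule arg_cong[of _ _ "subtopology ?X"]) (use W2Y abc 2 in auto)
    thus "continuous_map (subtopology ?Z {x : topspace ?Z. fst x <= b}) E G1"
     by (simp only:) (rule continuous_map_from_subtopology[OF 1(4)])
    have "subtopology ?Z {x : topspace ?Z. b <= fst x} = subtopology ?X ({b..c} \<times> W2)"
     unfolding subtopology_subtopology by (rule arg_cong[of _ _ "subtopology ?X"]) (use W2Y abc in auto)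
    thus "continuous_map (subtopology ?Z {x : topspace ?Z. b <= fst x}) E G2" by (simp only:) (rule 2(4))
    show "G1 x = G2 x" if "x : topspace ?Z" "fst x = b" for x using that 2(6) by auto
   qed auto
   thus "EX W' G. openin Y W' & y : W' & W' <= W & continuous_map (subtopology ?X ({a..c} \<times> W')) E G &
     (ALL t:{a..c}. ALL w:W'. p (G (t, w)) = H (t, w)) & (ALL w:W'. G (a, w) = g w)"
    using 1 2 abc by (intro exI[of _ W2] exI[of _ "%z. if fst z <= b then G1 z else G2 z"]) auto
  qed
 next
  fix x :: real assume x: "0 <= x" "x <= 1"
  hence xy: "(x, y) : {0..1} \<times> topspace Y" using y by simp
  hence "H (x, y) : topspace S" using H by (auto simp: continuous_map_def)
  then obtain V s where ch: "even_chart E S p V s" and HxV: "H (x, y) : V" using cov unfolding cover_map_def by blast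
  note V = even_chart_open[OF ch] HxV
  note s = even_chartD[OF ch]
  have "openin (subtopology ?X ({0..1} \<times> topspace Y)) {z : {0..1} \<times> topspace Y. H z : V}"
  proof -
   have "{z : topspace (subtopology ?X ({0..1} \<times> topspace Y)). H z : V} = {z : {0..1} \<times> topspace Y. H z : V}"
    by auto
   thus ?thesis using openin_continuous_map_preimage[OF HI V(1)] by metis
  qed
  then obtain O' where O': "openin ?X O'" "{z : {0..1} \<times> topspace Y. H z : V} = O' Int ({0..1} \<times> topspace Y)"
   by (auto simp: openin_subtopology)
  have "(x, y) : O'" using O'(2) xy V(2) by auto
  then obtain I W0 where IW: "open I" "openin Y W0" "x : I" "y : W0" "I \<times> W0 <= O'"
   using O'(1) unfolding openin_prod_topology_alt by (metis open_openin)
  then obtain d where d: "d > 0" "ball x d <= I" by (meson open_contains_ball)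
  have HV: "H (t, w) : V" if "t : {0..1}" "\<bar>t - x\<bar> < d" "w : W0" for t w
  proof -
   have "(t, w) : O'" using that IW d by (force simp: dist_real_def)
   moreover have "w : topspace Y" using that IW openin_subset by blast
   ultimately show ?thesis using O'(2) that by blast
  qed
  have "Q y a b" if ab: "a <= x" "x <= b" "b - a < d" for a b
   unfolding Q_def
  proof (intro impI allI)
   fix W g assume a: "0 <= a" "a <= b" "b <= 1"
    and W: "openin Y W" "y : W" "continuous_map (subtopology Y W) E g" "ALL w:W. p (g w) = H (a, w)"
   have WY: "W <= topspace Y" using W openin_subset by blast
   have gy: "g y : topspace E" using W WY by (auto simp: continuous_map_def)
   have pgy: "p (g y) : V" using HV[of a y] W a ab IW by auto
   define W' where "W' = {w : topspace (subtopology Y W). g w : s (g y) ` V} Int W0"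
   have W'o: "openin Y W'"
    using W(1) IW(2) openin_trans_full openin_continuous_map_preimage[OF W(3) s(3)[OF gy pgy]] by (auto simp: W'_def)
   have yW': "y : W'"
   proof -
    have "g y : s (g y) ` V" using s(2)[OF gy pgy] pgy by force
    thus ?thesis unfolding W'_def using W WY IW by auto
   qed
   have W'W: "W' <= W" "W' <= W0" unfolding W'_def by auto
   have sub: "{a..b} \<times> W' <= {0..1} \<times> topspace Y" using W'W WY a by auto
   have cH: "continuous_map (subtopology ?X ({a..b} \<times> W')) (subtopology S V) H"
   proof -
    have "continuous_map (subtopology ?X ({a..b} \<times> W')) S H" using continuous_map_from_subtopology_mono[OF HI sub] .
    moreover have "H z : V" if "z : {a..b} \<times> W'" for z using that HV[of "fst z" "snd z"] a ab W'W by (cases z) auto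
    ultimately show ?thesis by (auto simp: continuous_map_in_subtopology)
   qed
   have cG: "continuous_map (subtopology ?X ({a..b} \<times> W')) E (s (g y) o H)"
    by (rule continuous_map_compose[OF cH s(1)[OF gy pgy]])
   have "s (g y) (H (a, w)) = g w" if "w : W'" for w using that W'_def s(4)[OF gy pgy] W(4) by auto
   moreover have "p (s (g y) (H (t, w))) = H (t, w)" if "t : {a..b}" "w : W'" for t w
    using that HV[of t w] a ab W'W s(4)[OF gy pgy] by auto
   ultimately show "EX W' G. openin Y W' & y : W' & W' <= W & continuous_map (subtopology ?X ({a..b} \<times> W')) E G &
     (ALL t:{a..b}. ALL w:W'. p (G (t, w)) = H (t, w)) & (ALL w:W'. G (a, w) = g w)"
    using W'o yW' W'W cG by (intro exI[of _ W'] exI[of _ "s (g y) o H"]) auto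
  qed
  thus "EX d>0. ALL a b. a <= x & x <= b & b - a < d --> Q y a b" using d by blast
 qed
 have "EX W G. openin Y W & y : W & continuous_map (subtopology ?X ({0..1} \<times> W)) E G &
     (ALL t:{0..1}. ALL w:W. p (G (t, w)) = H (t, w)) & (ALL w:W. G (0, w) = f0 w)" if y: "y : topspace Y" for y
  using Q01[OF y, unfolded Q_def, rule_format, of "topspace Y" f0] y f0 pf0 by auto
 then obtain W G where WG: "!!y. y : topspace Y ==> openin Y (W y) & y : W y &
    continuous_map (subtopology ?X ({0..1} \<times> W y)) E (G y) &
     (ALL t:{0..1}. ALL w:W y. p (G y (t, w)) = H (t, w)) & (ALL w:W y. G y (0, w) = f0 w)" by metis
 have agree: "G y (t, w) = G y' (t, w)"
  if y: "y : topspace Y" "y' : topspace Y" and w: "w : W y" "w : W y'" and t: "t : {0..1}" for y y' t w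
 proof -
  have wY: "w : topspace Y" using WG y w openin_subset by blast
  have c: "continuous_map (top_of_set {0..1}) E (%t. G z (t, w))" if z: "z : topspace Y" "w : W z" for z
  proof -
   have "continuous_map (top_of_set {0..1}) (subtopology ?X ({0..1} \<times> W z)) (%t. (t, w))"
    using z wY by (auto simp: continuous_map_in_subtopology continuous_map_pairwise o_def)
   from continuous_map_compose[OF this] WG[OF z(1)] show ?thesis by (auto simp: o_def)
  qed
  show ?thesis by (rule lift_unique[OF cov _ c[OF y(1) w(1)] c[OF y(2) w(2)], of 0])
    (use WG y w t connected_Icc in "auto simp: connectedin_def")
 qed
 let ?G = "%z. G (snd z) z"
 have cont: "continuous_map (prod_topology (top_of_set {0..1}) Y) E ?G"
 proof (rule pasting_lemma[where I = "topspace Y" and T = "%y. {0..1} \<times> W y" and f = G])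
  show "openin (prod_topology (top_of_set {0..1}) Y) ({0..1} \<times> W y)" if "y : topspace Y" for y
   using WG[OF that] by (auto simp: openin_prod_Times_iff)
  show "continuous_map (subtopology (prod_topology (top_of_set {0..1}) Y) ({0..1} \<times> W y)) E (G y)"
   if "y : topspace Y" for y
  proof -
   have eq: "({0..1::real} \<times> topspace Y) Int ({0..1} \<times> W y) = {0..1} \<times> W y"
    using WG[OF that] openin_subset by auto
   show ?thesis using WG[OF that] by (simp add: prod_topology_subtopology subtopology_subtopology eq)
  qed
  show "G i x = G j x" if "i : topspace Y" "j : topspace Y"
    "x : topspace (prod_topology (top_of_set {0..1}) Y) Int ({0..1} \<times> W i) Int ({0..1} \<times> W j)" for i j x
   using that agree[of i j "snd x" "fst x"] by auto
  show "EX j. j : topspace Y & x : {0..1} \<times> W j & ?G x = G j x"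
   if "x : topspace (prod_topology (top_of_set {0..1}) Y)" for x using that WG by auto
 qed
 show ?thesis by (rule exI[of _ ?G]) (use cont WG in auto)
qed

lemma path_lift:
 assumes cov: "cover_map E S p" and c: "continuous_map (top_of_set {0..1::real}) S ga"
  and e: "e : topspace E" "p e = ga 0"
 shows "EX dl. continuous_map (top_of_set {0..1}) E dl & (ALL t:{0..1}. p (dl t) = ga t) & dl 0 = e"
proof -
 let ?Y = "top_of_set {0::real}"
 have "continuous_map (prod_topology (top_of_set {0..1::real}) ?Y) S (ga o fst)"
  by (rule continuous_map_compose[OF continuous_map_fst c])
 moreover have "continuous_map ?Y E (%_. e)" using e by simp
 ultimately have "EX G. continuous_map (prod_topology (top_of_set {0..1}) ?Y) E G &
   (ALL t:{0..1}. ALL y:topspace ?Y. p (G (t, y)) = (ga o fst) (t, y)) & (ALL y:topspace ?Y. G (0, y) = e)"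
  by (rule homotopy_lift[OF cov]) (use e in simp)
 then obtain G where G: "continuous_map (prod_topology (top_of_set {0..1}) ?Y) E G"
   "ALL t:{0..1}. ALL y:topspace ?Y. p (G (t, y)) = (ga o fst) (t, y)" "ALL y:topspace ?Y. G (0, y) = e" by auto
 have "continuous_map (top_of_set {0..1}) (prod_topology (top_of_set {0..1}) ?Y) (%t::real. (t, 0::real))"
  by (auto simp: o_def intro!: continuous_intros)
 from continuous_map_compose[OF this G(1)]
 have "continuous_map (top_of_set {0..1}) E (%t. G (t, 0))" by (simp add: o_def)
 thus ?thesis by (intro exI[of _ "%t. G (t, 0)"] conjI) (use G(2,3) in auto)
qed

definition section_through ::
 "'e topology => 's topology => ('e => 's) => 's set => 'e => ('s => 'e) => bool" where
 "section_through E S p A e s \<longleftrightarrow>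
   continuous_map (subtopology S A) E s & (ALL x:A. p (s x) = x) & s (p e) = e"

text \<open>A contraction of \<open>A\<close> is a homotopy from a constant map to the identity, and its lift ends in a section.\<close>

lemma section_through_contractible:
 assumes cov: "cover_map E S p" and A: "A <= topspace S" and con: "contractible_space (subtopology S A)"
  and e: "e : topspace E" "p e : A"
 obtains s where "section_through E S p A e s"
proof -
 let ?A = "subtopology S A"
 have topA: "topspace ?A = A" using A by auto
 let ?a = "p e"
 have "homotopic_with (%x. True) ?A ?A (%x. ?a) id" using con e(2) by (metis contractible_space_alt topA homotopic_with_sym)
 then obtain h where h: "continuous_map (prod_topology (top_of_set {0..1::real}) ?A) ?A h"
  and h0: "ALL x. h (0, x) = ?a" and h1: "ALL x. h (1, x) = id x"
  unfolding homotopic_with_def by (elim exE conjE)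
 have hS: "continuous_map (prod_topology (top_of_set {0..1::real}) ?A) S h" using h continuous_map_in_subtopology by blast
 \<comment> \<open>the track of the base point is a loop; lift it backwards from \<open>e\<close> to find the starting point\<close>
 have base: "continuous_map (top_of_set {0..1}) (prod_topology (top_of_set {0..1}) ?A) (%t::real. (t, ?a))"
  using e A by (auto simp: continuous_map_pairwise o_def)
 have rev: "continuous_map (top_of_set {0..1}) (prod_topology (top_of_set {0..1}) ?A) (%t::real. (1 - t, ?a))"
  using e A by (auto simp: continuous_map_pairwise o_def intro!: continuous_intros)
 have "continuous_map (top_of_set {0..1}) S (%t. h (1 - t, ?a))"
  using continuous_map_compose[OF rev hS] by (simp add: o_def)
 note rl = this
 have "p e = h (1 - 0, ?a)" using h1 by simp
 note e0 = this
 obtain dl where dl: "continuous_map (top_of_set {0..1}) E dl" "ALL t:{0..1}. p (dl t) = h (1 - t, ?a)" "dl 0 = e"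
  using path_lift[OF cov rl e(1) e0] by auto
 have "dl 1 : topspace E" using dl(1) by (auto simp: continuous_map_def)
 moreover have "p (dl 1) = h (1 - 1, ?a)" using bspec[OF dl(2), of 1] by simp
 ultimately have d1: "dl 1 : topspace E" "p (dl 1) = ?a" using h0 by auto
 have "continuous_map ?A E (%_. dl 1)" "p (dl 1) = h (0, y)" for y using d1(1) by (simp, simp only: d1(2) spec[OF h0])
 note gl = this
 obtain G where G: "continuous_map (prod_topology (top_of_set {0..1}) ?A) E G"
  "ALL t:{0..1}. ALL y:topspace ?A. p (G (t, y)) = h (t, y)" "ALL y:topspace ?A. G (0, y) = dl 1"
  using homotopy_lift[OF cov hS gl] by auto
 have G1: "G (1, ?a) = e"
 proof -
  have cG: "continuous_map (top_of_set {0..1}) E (%t. G (t, ?a))"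
   using continuous_map_compose[OF base G(1)] by (simp add: o_def)
  have "continuous_map (top_of_set {0..1}) (top_of_set {0..1}) (%t::real. 1 - t)" by (auto intro!: continuous_intros)
  from continuous_map_compose[OF this dl(1)]
  have cd: "continuous_map (top_of_set {0..1}) E (%t. dl (1 - t))" by (simp add: o_def)
  have conn: "connected_space (top_of_set {0..1::real})" by simp
  have a: "?a : topspace ?A" using e topA by simp
  have "G (1, ?a) = dl (1 - 1)"
  proof (rule lift_unique[OF cov conn cG cd, of 0 1])
   fix t :: real assume "t : topspace (top_of_set {0..1})"
   hence t: "t : {0..1}" "1 - t : {0..1}" by auto
   show "p (G (t, ?a)) = p (dl (1 - t))" using bspec[OF bspec[OF G(2) t(1)] a] bspec[OF dl(2) t(2)] by simp
  next
   show "G (0, ?a) = dl (1 - 0)" using bspec[OF G(3) a] by simp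
  qed auto
  thus ?thesis using dl(3) by simp
 qed
 have "continuous_map ?A (prod_topology (top_of_set {0..1}) ?A) (%x. (1::real, x))"
  by (auto simp: continuous_map_pairwise o_def)
 from continuous_map_compose[OF this G(1)]
 have "continuous_map ?A E (%x. G (1, x))" by (simp add: o_def)
 thus thesis
 proof (rule that[of "%x. G (1, x)", unfolded section_through_def, OF conjI], intro conjI ballI)
  fix x assume "x : A"
  hence x: "x : topspace ?A" using topA by simp
  show "p (G (1, x)) = x" using bspec[OF bspec[OF G(2), of 1] x] spec[OF h1, of x] by simp
 qed (rule G1)
qed

lemma section_through_Un:
 assumes cov: "cover_map E S p"
  and AB: "openin S A" "openin S B" "contractible_space (subtopology S A)" "contractible_space (subtopology S B)"
  and I: "connectedin S (A Int B)" "A Int B ~= {}"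
  and e: "e : topspace E" "p e : A"
 obtains s where "section_through E S p (A Un B) e s"
proof -
 obtain sA where sA: "section_through E S p A e sA"
  using section_through_contractible[OF cov openin_subset[OF AB(1)] AB(3) e] .
 obtain w where w: "w : A" "w : B" using I by blast
 have SAB: "A <= topspace S" "B <= topspace S" using AB openin_subset by auto
 have "sA w : topspace E" "p (sA w) : B" using sA w SAB by (auto simp: section_through_def continuous_map_def)
 then obtain sB where sB: "section_through E S p B (sA w) sB"
  using section_through_contractible[OF cov SAB(2) AB(4)] by metis
 have eq: "sA x = sB x" if "x : A" "x : B" for x
 proof (rule lift_unique[OF cov, of "subtopology S (A Int B)" sA sB w x])
  show "connected_space (subtopology S (A Int B))" using I(1) by (simp add: connectedin_def)
  show "continuous_map (subtopology S (A Int B)) E sA" "continuous_map (subtopology S (A Int B)) E sB"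
   using sA sB unfolding section_through_def by (meson Int_lower1 Int_lower2 continuous_map_from_subtopology_mono)+
  show "sA w = sB w" using sB sA w by (auto simp: section_through_def)
 qed (use sA sB w that SAB in "auto simp: section_through_def")
 let ?s = "%x. if x : A then sA x else sB x"
 have "continuous_map (subtopology S (A Un B)) E ?s"
 proof (rule pasting_lemma[where I = "UNIV :: bool set" and T = "%b. if b then A else B" and f = "%b. if b then sA else sB"])
  show "openin (subtopology S (A Un B)) (if i then A else B)" for i using AB(1,2) by (auto simp: openin_subtopology)
  show "continuous_map (subtopology (subtopology S (A Un B)) (if i then A else B)) E (if i then sA else sB)" for i
   using sA sB by (simp add: subtopology_subtopology section_through_def)
 qed (use eq in auto)
 thus thesis by (intro that[of ?s]) (use sA sB e in "auto simp: section_through_def")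
qed

text \<open>Spaces of this kind carry no nontrivial coverings; spheres of dimension at least two, their
  cylinders and contractible spaces are examples.\<close>

definition two_contractible_pieces :: "'a topology => bool" where
 "two_contractible_pieces S \<longleftrightarrow> (EX A B. openin S A & openin S B & A Un B = topspace S &
   contractible_space (subtopology S A) & contractible_space (subtopology S B) &
   connectedin S (A Int B) & A Int B ~= {})"

lemma two_contractible_pieces_section:
 assumes "two_contractible_pieces S" "cover_map E S p"
 obtains s where "continuous_map S E s" "!!x. x : topspace S ==> p (s x) = x"
proof -
 obtain A B where AB: "openin S A" "openin S B" "A Un B = topspace S"
   "contractible_space (subtopology S A)" "contractible_space (subtopology S B)"
   "connectedin S (A Int B)" "A Int B ~= {}" using assms(1) unfolding two_contractible_pieces_def by blast
 obtain w where w: "w : A" using AB by blast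
 hence "w : p ` topspace E" using AB cover_map_surj[OF assms(2)] by blast
 then obtain e where e: "e : topspace E" "p e : A" using w by blast
 obtain s where "section_through E S p (A Un B) e s" using section_through_Un[OF assms(2) AB(1,2,4,5,6,7) e] .
 thus thesis using that[of s] AB(3) by (auto simp: section_through_def)
qed

lemma two_contractible_pieces_contractible:
 assumes "contractible_space S" "topspace S ~= {}"
 shows "two_contractible_pieces S"
 unfolding two_contractible_pieces_def using assms contractible_imp_path_connected_space path_connected_imp_connected_space
 by (intro exI[of _ "topspace S"]) (auto simp: connectedin_topspace)

lemma two_contractible_pieces_homeomorphic:
 assumes "two_contractible_pieces S" "homeomorphic_map S T f"
 shows "two_contractible_pieces T"
proof -
 obtain A B where AB: "openin S A" "openin S B" "A Un B = topspace S"
   "contractible_space (subtopology S A)" "contractible_space (subtopology S B)"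
   "connectedin S (A Int B)" "A Int B ~= {}" using assms(1) unfolding two_contractible_pieces_def by blast
 have sub: "A <= topspace S" "B <= topspace S" using AB by auto
 have c: "contractible_space (subtopology T (f ` C))"
  if C: "C <= topspace S" "contractible_space (subtopology S C)" for C
 proof -
  have "homeomorphic_map (subtopology S C) (subtopology T (f ` C)) f" by (rule homeomorphic_map_subtopologies[OF assms(2)])
    (use C homeomorphic_imp_surjective_map[OF assms(2)] in blast)
  thus ?thesis using C homeomorphic_space_contractibility homeomorphic_map_imp_homeomorphic_space by blast
 qed
 have inj: "inj_on f (topspace S)" using assms(2) homeomorphic_imp_injective_map by blast
 have fI: "f ` A Int f ` B = f ` (A Int B)" using inj_on_image_Int[OF inj sub] by simp
 show ?thesis
  unfolding two_contractible_pieces_def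
 proof (rule exI[of _ "f ` A"], rule exI[of _ "f ` B"], intro conjI)
  show "openin T (f ` A)" "openin T (f ` B)" using AB homeomorphic_map_openness_eq[OF assms(2)] by blast+
  show "f ` A Un f ` B = topspace T" using AB(3) homeomorphic_imp_surjective_map[OF assms(2)] by blast
  show "contractible_space (subtopology T (f ` A))" "contractible_space (subtopology T (f ` B))" using c AB by blast+
  show "connectedin T (f ` A Int f ` B)"
   unfolding fI using connectedin_continuous_map_image[OF homeomorphic_imp_continuous_map[OF assms(2)] AB(6)] .
  show "f ` A Int f ` B ~= {}" using AB(7) fI by simp
 qed
qed

section \<open>Cech cocycles\<close>

definition locally_const :: "'s topology => 's set => ('s => 'c) => bool" where
 "locally_const S A f \<longleftrightarrow> (ALL x:A. EX U. openin S U & x : U & U <= A & (ALL y:U. f y = f x))"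

lemma openin_locally_const:
 assumes "locally_const S A f"
 shows "openin S {x : A. P (f x)}"
proof (subst openin_subopen, intro ballI)
 fix x assume x: "x : {x : A. P (f x)}"
 then obtain U where U: "openin S U" "x : U" "U <= A" "ALL y:U. f y = f x" using assms unfolding locally_const_def by blast
 have "P (f y)" if "y : U" for y using bspec[OF U(4) that] x by simp
 thus "EX T. openin S T & x : T & T <= {x : A. P (f x)}" using U(1,2,3) by blast
qed

lemma locally_const_connected:
 assumes f: "locally_const S A f" and C: "connectedin S C" "C <= A" and xy: "x : C" "y : C"
 shows "f x = f y"
proof (rule ccontr)
 assume ne: "f x ~= f y"
 have "openin S {z : A. f z = f x}" "openin S {z : A. f z ~= f x}" by (rule openin_locally_const[OF f])+
 thus False by (rule connectedinD[OF C(1)]) (use C xy ne in auto)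
qed

locale cech_cocycle =
 fixes S :: "'s topology" and I :: "'i set" and V :: "'i => 's set"
  and g :: "'i => 'i => 's => 'h::group_add"
 assumes V_open: "i : I ==> openin S (V i)"
  and V_cover: "topspace S = (UN i:I. V i)"
  and g_const: "i : I ==> j : I ==> locally_const S (V i Int V j) (g i j)"
  and g_cocycle: "i : I ==> j : I ==> k : I ==> x : V i ==> x : V j ==> x : V k ==> g i j x + g j k x = g i k x"
begin

definition chart :: "'s => 'i" where "chart x = (SOME i. i : I & x : V i)"

text \<open>The covering space glued from the sets \<open>V i \<times> 'h\<close> by means of the cocycle: its points are pairs of a
  base point and a value with respect to a chosen chart, \<open>sheet i\<close> translates from the chart \<open>i\<close>.\<close>

definition sheet :: "'i => 'h => 's => 's \<times> 'h" where
 "sheet i c x = (x, g (chart x) i x + c)"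

definition cover_space :: "('s \<times> 'h) topology" where
 "cover_space = topology (%W. W <= topspace S \<times> UNIV & (ALL i:I. ALL c. openin S {x : V i. sheet i c x : W}))"

lemma openin_cover_space:
 "openin cover_space W \<longleftrightarrow> W <= topspace S \<times> UNIV & (ALL i:I. ALL c. openin S {x : V i. sheet i c x : W})"
proof -
 have "istopology (%W. W <= topspace S \<times> UNIV & (ALL i:I. ALL c. openin S {x : V i. sheet i c x : W}))"
  unfolding istopology_def
 proof (intro conjI allI impI ballI)
  fix A B i c assume A: "A <= topspace S \<times> UNIV & (ALL i:I. ALL c. openin S {x : V i. sheet i c x : A})"
   and B: "B <= topspace S \<times> UNIV & (ALL i:I. ALL c. openin S {x : V i. sheet i c x : B})" and i: "i : I"
  have "{x : V i. sheet i c x : A Int B} = {x : V i. sheet i c x : A} Int {x : V i. sheet i c x : B}" by auto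
  thus "openin S {x : V i. sheet i c x : A Int B}" using A B i by auto
 next
  fix K i c assume K: "ALL A:K. A <= topspace S \<times> UNIV & (ALL i:I. ALL c. openin S {x : V i. sheet i c x : A})" and i: "i : I"
  have "openin S (UN A:K. {x : V i. sheet i c x : A})" by (rule openin_Union) (use K i in auto)
  moreover have "(UN A:K. {x : V i. sheet i c x : A}) = {x : V i. sheet i c x : \<Union>K}" by auto
  ultimately show "openin S {x : V i. sheet i c x : \<Union>K}" by simp
 qed auto
 thus ?thesis by (simp add: cover_space_def)
qed

lemma chart: "x : topspace S ==> chart x : I & x : V (chart x)"
 unfolding chart_def by (rule someI_ex) (use V_cover in auto)

lemma VS: "i : I ==> x : V i ==> x : topspace S" using V_cover by auto

lemma sheet_eq_iff:
 assumes "i : I" "j : I" "x : V i" "x : V j"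
 shows "sheet i c x = sheet j d x \<longleftrightarrow> c = g i j x + d"
proof -
 have "g (chart x) i x + g i j x = g (chart x) j x" using assms chart[OF VS[OF assms(1,3)]] by (intro g_cocycle) auto
 hence "g (chart x) j x + d = g (chart x) i x + (g i j x + d)" by (simp add: add.assoc[symmetric])
 thus ?thesis by (simp add: sheet_def)
qed

lemma topspace_cover_space: "topspace cover_space = topspace S \<times> UNIV"
proof
 show "topspace cover_space <= topspace S \<times> UNIV" using openin_cover_space[of "topspace cover_space"] by simp
 have "{x : V i. sheet i c x : topspace S \<times> UNIV} = V i" if "i : I" for i c
  using VS[OF that] by (auto simp: sheet_def)
 thus "topspace S \<times> UNIV <= topspace cover_space"
  using V_open by (auto simp: openin_cover_space intro!: openin_subset)
qed

lemma sheet_open: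
 assumes "i : I"
 shows "openin cover_space (sheet i c ` V i)"
 unfolding openin_cover_space
proof (intro conjI ballI allI)
 show "sheet i c ` V i <= topspace S \<times> UNIV" using VS assms by (auto simp: sheet_def)
 fix j d assume j: "j : I"
 have "{x : V j. sheet j d x : sheet i c ` V i} = {x : V i Int V j. c = g i j x + d}"
  using sheet_eq_iff[OF assms j] by (force simp: sheet_def)
 thus "openin S {x : V j. sheet j d x : sheet i c ` V i}"
  using openin_locally_const[OF g_const[OF assms j], of "%v. c = v + d"] by simp
qed

lemma sheet_continuous:
 assumes "i : I"
 shows "continuous_map (subtopology S (V i)) cover_space (sheet i c)"
 unfolding continuous_map_def
proof (intro conjI allI impI)
 show "sheet i c : topspace (subtopology S (V i)) \<rightarrow> topspace cover_space"
  by (auto simp: topspace_cover_space sheet_def)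
 fix W assume "openin cover_space W"
 hence "openin S {x : V i. sheet i c x : W}" using assms by (simp add: openin_cover_space)
 moreover have "{x : topspace (subtopology S (V i)). sheet i c x : W} = {x : V i. sheet i c x : W}" using VS assms by auto
 ultimately show "openin (subtopology S (V i)) {x : topspace (subtopology S (V i)). sheet i c x : W}"
  using openin_open_subtopology[OF V_open[OF assms]] by auto
qed

lemma cover_map_cover_space: "cover_map cover_space S fst"
 unfolding cover_map_def
proof (intro conjI ballI)
 show "fst ` topspace cover_space = topspace S" by (auto simp: topspace_cover_space)
 show "continuous_map cover_space S fst"
  unfolding continuous_map_def
 proof (intro conjI allI impI)
  fix U assume U: "openin S U"
  have "{x : V i. sheet i c x : {z : topspace cover_space. fst z : U}} = V i Int U" if "i : I" for i c
   using VS that by (auto simp: topspace_cover_space sheet_def)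
  thus "openin cover_space {z : topspace cover_space. fst z : U}"
   unfolding openin_cover_space using V_open U by (auto simp: topspace_cover_space)
 qed (auto simp: topspace_cover_space)
 fix x assume x: "x : topspace S"
 define i where "i = chart x"
 have i: "i : I" "x : V i" using chart[OF x] by (auto simp: i_def)
 define s where "s e = sheet i (- g (chart (fst e)) i (fst e) + snd e)" for e
 have "even_chart cover_space S fst (V i) s"
  using sheet_continuous[OF i(1)] sheet_open[OF i(1)] s_def V_open[OF i(1)] by (auto simp: even_chart_def s_def sheet_def)
 thus "EX V s. x : V & even_chart cover_space S fst V s" using i(2) by blast
qed

text \<open>A section of the covering space glued from the cocycle expresses it as a coboundary.\<close>

lemma cocycle_trivial:
 assumes "two_contractible_pieces S"
 obtains t where "!!i. i : I ==> locally_const S (V i) (t i)"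
  "!!i j x. i : I ==> j : I ==> x : V i ==> x : V j ==> g i j x = t i x - t j x"
proof -
 obtain s where s: "continuous_map S cover_space s" "!!x. x : topspace S ==> fst (s x) = x"
  using two_contractible_pieces_section[OF assms cover_map_cover_space] by metis
 define t where "t i x = - g (chart x) i x + snd (s x)" for i x
 have st: "s x = sheet i (t i x) x" if "i : I" "x : V i" for i x
  using s(2)[OF VS[OF that]] by (simp add: sheet_def t_def prod_eq_iff)
 show thesis
 proof (rule that)
  fix i assume i: "i : I"
  show "locally_const S (V i) (t i)"
   unfolding locally_const_def
  proof (intro ballI)
   fix x assume x: "x : V i"
   let ?U = "{y : topspace S. s y : sheet i (t i x) ` V i} Int V i"
   have "openin S ?U" by (intro openin_Int openin_continuous_map_preimage[OF s(1)] sheet_open V_open i)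
   moreover have "x : ?U"
   proof -
    have "s x : sheet i (t i x) ` V i" by (rule image_eqI, rule st[OF i x], rule x)
    thus ?thesis using x VS[OF i x] by blast
   qed
   moreover have "t i y = t i x" if y: "y : ?U" for y
   proof -
    have yV: "y : V i" "s y : sheet i (t i x) ` V i" using y by auto
    thus ?thesis using st[OF i yV(1)] by (auto simp: sheet_def)
   qed
   ultimately show "EX U. openin S U & x : U & U <= V i & (ALL y:U. t i y = t i x)"
    by (intro exI[of _ ?U] conjI ballI) blast+
  qed
 next
  fix i j x assume ij: "i : I" "j : I" "x : V i" "x : V j"
  have "t i x = g i j x + t j x" using st ij sheet_eq_iff[OF ij] by metis
  thus "g i j x = t i x - t j x" by simp
 qed
qed

end

section \<open>Generators of the fundamental group\<close>

lemma loop_homotopy_refl: "p : loops M x ==> (p, p) : loop_homotopy M x"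
 by (simp add: loop_homotopy_def loops_def pathin_def)

lemma loop_homotopy_sym: "(p, q) : loop_homotopy M x ==> (q, p) : loop_homotopy M x"
 by (simp add: loop_homotopy_def homotopic_with_sym)

lemma loop_homotopy_trans:
 "(p, q) : loop_homotopy M x ==> (q, r) : loop_homotopy M x ==> (p, r) : loop_homotopy M x"
 unfolding loop_homotopy_def using homotopic_with_trans by fastforce

lemma loop_homotopy_classI:
 "(p, q) : loop_homotopy M x ==> loop_homotopy M x `` {p} = loop_homotopy M x `` {q}"
 unfolding Image_singleton by (blast intro: loop_homotopy_sym loop_homotopy_trans)

lemma loop_homotopy_eqI:
 assumes "p : loops M x" "q : loops M x" "!!t. t : {0..1} ==> p t = q t"
 shows "(p, q) : loop_homotopy M x"
proof -
 have "homotopic_with (%r. r 0 = x & r 1 = x) (top_of_set {0..1}) M p p" using assms by (simp add: loops_def pathin_def)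
 hence "homotopic_with (%r. r 0 = x & r 1 = x) (top_of_set {0..1}) M p q" by (rule homotopic_with_eq) (use assms in auto)
 thus ?thesis using assms by (simp add: loop_homotopy_def)
qed

lemma loop_concat_loops:
 assumes p: "p : loops M x" and q: "q : loops M x"
 shows "loop_concat p q : loops M x"
proof -
 let ?I = "top_of_set {0..1::real}"
 have "continuous_map ?I M (%t. if t <= 1/2 then (p o (%t. 2 * t)) t else (q o (%t. 2 * t - 1)) t)"
 proof (rule continuous_map_cases_le)
  have 1: "continuous_map (subtopology ?I {t : topspace ?I. t <= 1/2}) ?I (%t. 2 * t)"
   by (auto simp: subtopology_subtopology intro!: continuous_intros)
  show "continuous_map (subtopology ?I {t : topspace ?I. t <= 1/2}) M (p o (%t. 2 * t))"
   using continuous_map_compose[OF 1, of M p] p by (simp add: loops_def pathin_def)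
  have 2: "continuous_map (subtopology ?I {t : topspace ?I. 1/2 <= t}) ?I (%t. 2 * t - 1)"
   by (auto simp: subtopology_subtopology intro!: continuous_intros)
  show "continuous_map (subtopology ?I {t : topspace ?I. 1/2 <= t}) M (q o (%t. 2 * t - 1))"
   using continuous_map_compose[OF 2, of M q] q by (simp add: loops_def pathin_def)
  show "(p o (%t. 2 * t)) t = (q o (%t. 2 * t - 1)) t" if "t = 1/2" for t using p q unfolding that by (simp add: loops_def)
 qed auto
 hence "pathin M (loop_concat p q)"
  unfolding pathin_def loop_concat_def o_def .
 thus ?thesis using p q by (simp add: loops_def loop_concat_def)
qed

lemma loop_concat_homotopic:
 assumes p: "(p, p') : loop_homotopy M x" and q: "(q, q') : loop_homotopy M x"
 shows "(loop_concat p q, loop_concat p' q') : loop_homotopy M x"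
proof -
 let ?X = "top_of_set ({0..1::real} \<times> {0..1::real})"
 obtain h where h: "continuous_map ?X M h" "ALL t. h (0, t) = p t" "ALL t. h (1, t) = p' t"
   "ALL s:{0..1}. h (s, 0) = x & h (s, 1) = x" using p by (auto simp: loop_homotopy_def homotopic_with_def)
 obtain k where k: "continuous_map ?X M k" "ALL t. k (0, t) = q t" "ALL t. k (1, t) = q' t"
   "ALL s:{0..1}. k (s, 0) = x & k (s, 1) = x" using q by (auto simp: loop_homotopy_def homotopic_with_def)
 let ?f = "%z. (fst z, 2 * snd z)" and ?g = "%z. (fst z, 2 * snd z - 1)"
 let ?H = "%z. if snd z <= 1/2 then (h o ?f) z else (k o ?g) z"
 have "continuous_map ?X M ?H"
 proof (rule continuous_map_cases_le)
  have 1: "continuous_map (subtopology ?X {z : topspace ?X. snd z <= 1/2}) ?X ?f"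
   by (auto simp: subtopology_subtopology intro!: continuous_intros)
  show "continuous_map (subtopology ?X {z : topspace ?X. snd z <= 1/2}) M (h o ?f)"
   by (rule continuous_map_compose[OF 1 h(1)])
  have 2: "continuous_map (subtopology ?X {z : topspace ?X. 1/2 <= snd z}) ?X ?g"
   by (auto simp: subtopology_subtopology intro!: continuous_intros)
  show "continuous_map (subtopology ?X {z : topspace ?X. 1/2 <= snd z}) M (k o ?g)"
   by (rule continuous_map_compose[OF 2 k(1)])
  show "(h o ?f) z = (k o ?g) z" if "z : topspace ?X" "snd z = 1/2" for z
  proof -
   show ?thesis using that h(4) k(4) by (auto simp: that(2))
  qed
  show "continuous_map ?X euclideanreal snd" by (simp add: continuous_on_snd)
 qed auto
 moreover have "?H (0, t) = loop_concat p q t" "?H (1, t) = loop_concat p' q' t" for t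
  using h k by (auto simp: loop_concat_def)
 moreover have "?H (s, 0) = x & ?H (s, 1) = x" if "s : {0..1}" for s using h(4) k(4) that by auto
 ultimately have "homotopic_with (%r. r 0 = x & r 1 = x) (top_of_set {0..1}) M (loop_concat p q) (loop_concat p' q')"
  unfolding homotopic_with_def prod_topology_subtopology_eu by (intro exI[of _ ?H]) blast
 moreover have "loop_concat p q : loops M x" "loop_concat p' q' : loops M x"
  using p q by (auto simp: loop_homotopy_def intro: loop_concat_loops)
 ultimately show ?thesis by (simp add: loop_homotopy_def)
qed

locale deck_cover =
 fixes E :: "'p topology" and M :: "'m topology" and q :: "'p => 'm"
  and G :: "('g, 'more) monoid_scheme" (structure) and act :: "'g => 'p => 'p"
 assumes cover: "cover_map E M q"
  and group_G: "group G"
  and act_cont: "g : carrier G ==> continuous_map E E (act g)"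
  and q_act: "g : carrier G ==> x : topspace E ==> q (act g x) = q x"
  and act_mult: "g : carrier G ==> h : carrier G ==> x : topspace E ==> act (g \<otimes> h) x = act g (act h x)"
  and act_one: "x : topspace E ==> act \<one> x = x"
  and act_trans: "x : topspace E ==> y : topspace E ==> q x = q y ==> EX g:carrier G. y = act g x"
  and act_free: "g : carrier G ==> x : topspace E ==> act g x = x ==> g = \<one>"

text \<open>Paths in the simply connected space \<open>P\<close> from a base point to its translates represent every class of
  loops, so sending \<open>g\<close> to the class of the image of a path to \<open>act g y0\<close> is an epimorphism from the deck
  group onto the fundamental group, and images of generators generate.\<close>

lemma min_generators_fundamental_group_le:
 fixes P :: "'p::real_normed_vector set" and G (structure)
 assumes deck: "deck_cover E M q G act" and E: "E = top_of_set P" and sc: "simply_connected P"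
  and x0: "x0 : topspace M" and K: "K <= carrier G" "finite K" "generate G K = carrier G"
 shows "min_generators (fundamental_group M x0) <= card K"
proof -
 interpret deck_cover E M q G act by (rule deck)
 interpret group G by (rule group_G)
 let ?fg = "fundamental_group M x0" and ?r = "loop_homotopy M x0"
 have topE: "topspace E = P" by (simp add: E)
 have "x0 : q ` topspace E" using x0 cover_map_surj[OF cover] by simp
 then obtain y0 where y0: "y0 : P" "q y0 = x0" using topE by auto
 have actP: "act g y : P" if "g : carrier G" "y : P" for g y
  using act_cont[OF that(1)] that(2) topE by (auto simp: continuous_map_def)
 have push: "pathin M (q o a)" if "path a" "path_image a <= P" for a
 proof -
  have "continuous_map (top_of_set {0..1}) E a" using that by (auto simp: E path_def path_image_def)
  from continuous_map_compose[OF this cover_map_continuous[OF cover]]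
  show ?thesis by (simp add: pathin_def)
 qed
 have hom: "(q o a, q o b) : ?r"
  if a: "path a" "path_image a <= P" "a 0 = y0" and b: "path b" "path_image b <= P" "b 0 = y0"
   and ab: "a 1 = b 1" and e: "q (a 1) = x0" for a b
 proof -
  have "homotopic_paths P a b"
   using sc a b ab by (simp add: simply_connected_eq_homotopic_paths pathstart_def pathfinish_def)
  hence "homotopic_with (%r. r 0 = y0 & r 1 = a 1) (top_of_set {0..1}) E a b"
   by (simp add: homotopic_paths_def E pathstart_def pathfinish_def a)
  thus ?thesis
   using y0 e push[OF a(1,2)] push[OF b(1,2)] a b ab homotopic_with_compose_continuous_map_left[OF _ cover_map_continuous[OF cover]]
   by (force simp: loop_homotopy_def loops_def)
 qed
 have "EX a. path a & path_image a <= P & a 0 = y0 & a 1 = act g y0" if "g : carrier G" for g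
  using simply_connected_imp_path_connected[OF sc] actP[OF that y0(1)] y0(1)
  unfolding path_connected_def by (metis pathfinish_def pathstart_def)
 then obtain al where al: "!!g. g : carrier G ==>
   path (al g) & path_image (al g) <= P & al g 0 = y0 & al g 1 = act g y0" by metis
 have q1: "q (al g 1) = x0" if "g : carrier G" for g using al[OF that] q_act[OF that, of y0] y0 topE by simp
 have al_loop: "q o al g : loops M x0" if "g : carrier G" for g
  using push[of "al g"] al[OF that] q1[OF that] y0 by (simp add: loops_def)
 define cls where "cls g = ?r `` {q o al g}" for g
 have surj: "EX g:carrier G. (ga, q o al g) : ?r" if ga: "ga : loops M x0" for ga
 proof -
  have c: "continuous_map (top_of_set {0..1}) M ga" and e0: "q y0 = ga 0" using ga y0 by (auto simp: loops_def pathin_def)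
  obtain dl where dl: "continuous_map (top_of_set {0..1}) E dl" "ALL t:{0..1}. q (dl t) = ga t" "dl 0 = y0"
   using path_lift[OF cover c y0(1)[folded topE] e0] by auto
  have dlP: "path dl" "path_image dl <= P" using dl(1) by (auto simp: E path_def path_image_def)
  have "dl 1 : P" using dlP by (auto simp: path_image_def)
  moreover have qd: "q (dl 1) = x0" using dl(2) ga by (auto simp: loops_def)
  ultimately obtain g where g: "g : carrier G" "dl 1 = act g y0" using act_trans[of y0 "dl 1"] y0 topE by auto
  have r1: "(ga, q o dl) : ?r" by (rule loop_homotopy_eqI[OF ga])
    (use push[OF dlP] dl(2,3) qd y0 in "auto simp: loops_def")
  have r2: "(q o dl, q o al g) : ?r" by (rule hom[OF dlP dl(3)]) (use al[OF g(1)] g(2) qd in simp_all)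
  show ?thesis by (rule bexI[where x = g], rule loop_homotopy_trans[OF r1 r2], rule g(1))
 qed
 have carr: "carrier ?fg = cls ` carrier G"
 proof -
  have "carrier ?fg = (%ga. ?r `` {ga}) ` loops M x0" by (auto simp: fundamental_group_def quotient_def)
  also have "... = cls ` carrier G"
  proof (intro equalityI subsetI)
   fix A assume "A : (%ga. ?r `` {ga}) ` loops M x0"
   then obtain ga where ga: "ga : loops M x0" "A = ?r `` {ga}" by auto
   obtain g where g: "g : carrier G" "(ga, q o al g) : ?r" using surj[OF ga(1)] by blast
   show "A : cls ` carrier G" using g(1) loop_homotopy_classI[OF g(2)] by (simp add: cls_def ga(2))
  next
   fix A assume "A : cls ` carrier G"
   thus "A : (%ga. ?r `` {ga}) ` loops M x0" using al_loop by (auto simp: cls_def)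
  qed
  finally show ?thesis .
 qed
 have one: "\<one>\<^bsub>?fg\<^esub> = cls \<one>"
 proof -
  have "(q o (%t. y0), q o al \<one>) : ?r"
   by (rule hom) (use al[of \<one>] act_one[of y0] y0 topE in "auto simp: path_def")
  moreover have "q o (%t::real. y0) = (%t. x0)" using y0 by auto
  ultimately show ?thesis using loop_homotopy_classI by (simp add: fundamental_group_def cls_def)
 qed
 have mult: "cls g \<otimes>\<^bsub>?fg\<^esub> cls h = cls (g \<otimes> h)" if g: "g : carrier G" and h: "h : carrier G" for g h
 proof -
  let ?c = "loop_concat (q o al g) (q o al h)"
  have c_loop: "?c : loops M x0" by (rule loop_concat_loops[OF al_loop[OF g] al_loop[OF h]])
  have 1: "(?c, z) : ?r" if "z : {loop_concat a b |a b. a : cls g & b : cls h}" for z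
   using that loop_concat_homotopic by (auto simp: cls_def)
  have 2: "?c : {loop_concat a b |a b. a : cls g & b : cls h}"
   using loop_homotopy_refl[OF al_loop[OF g]] loop_homotopy_refl[OF al_loop[OF h]] by (auto simp: cls_def)
  have "?r `` {loop_concat a b |a b. a : cls g & b : cls h} = ?r `` {?c}"
  proof (intro equalityI subsetI)
   fix y assume "y : ?r `` {loop_concat a b |a b. a : cls g & b : cls h}"
   then obtain z where z: "z : {loop_concat a b |a b. a : cls g & b : cls h}" "(z, y) : ?r" by auto
   show "y : ?r `` {?c}" using loop_homotopy_trans[OF 1[OF z(1)] z(2)] by simp
  next
   fix y assume "y : ?r `` {?c}"
   thus "y : ?r `` {loop_concat a b |a b. a : cls g & b : cls h}" using 2 by blast
  qed
  hence "cls g \<otimes>\<^bsub>?fg\<^esub> cls h = ?r `` {?c}" by (simp add: fundamental_group_def)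
  also have "... = cls (g \<otimes> h)"
  proof -
   let ?b = "al g +++ (act g o al h)"
   have ca: "continuous_on P (act g)" using act_cont[OF g] by (simp add: E)
   have pb: "path (act g o al h)" "path_image (act g o al h) <= P" using al[OF h] continuous_on_subset[OF ca] actP[OF g]
    by (auto intro!: path_continuous_image simp: path_image_compose)
   have st: "pathfinish (al g) = pathstart (act g o al h)"
    using al[OF g] al[OF h] by (simp add: pathfinish_def pathstart_def)
   have pg: "path (al g)" "path_image (al g) <= P" using al[OF g] by auto
   have b: "path ?b" "path_image ?b <= P"
    using path_join_imp[OF pg(1) pb(1) st] path_image_join_subset[of "al g" "act g o al h"] pg(2) pb(2) by auto
   have b': "?b 0 = y0" "?b 1 = act (g \<otimes> h) y0"
    using al[OF g] al[OF h] act_mult[OF g h, of y0] y0 topE by (auto simp: joinpaths_def)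
   note b = b b'
   have qb: "q (act (g \<otimes> h) y0) = x0" using q_act[of "g \<otimes> h" y0] g h y0 topE by simp
   have "(?c, q o ?b) : ?r"
   proof (rule loop_homotopy_eqI[OF c_loop])
    show "q o ?b : loops M x0" using push[OF b(1,2)] b(3,4) y0 qb by (simp add: loops_def)
    fix t :: real assume t: "t : {0..1}"
    have "q (act g (al h (2 * t - 1))) = q (al h (2 * t - 1))" if "~ t <= 1/2"
    proof -
     have "al h (2 * t - 1) : P" using t that al[OF h] by (auto simp: path_image_def)
     thus ?thesis using q_act[OF g] topE by simp
    qed
    thus "?c t = (q o ?b) t" by (auto simp: loop_concat_def joinpaths_def)
   qed
   moreover have "(q o ?b, q o al (g \<otimes> h)) : ?r"
    by (rule hom[OF b(1-3)]) (use b(4) al[of "g \<otimes> h"] g h qb in "simp_all add: o_def")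
   ultimately have "(?c, q o al (g \<otimes> h)) : ?r" by (rule loop_homotopy_trans)
   thus ?thesis unfolding cls_def by (rule loop_homotopy_classI)
  qed
  finally show ?thesis .
 qed
 have hm: "cls : hom G ?fg" using mult carr by (auto simp: hom_def)
 have "group (?fg\<lparr>carrier := cls ` carrier G, one := cls \<one>\<rparr>)" by (rule hom_imp_img_group[OF hm])
 moreover have "?fg\<lparr>carrier := cls ` carrier G, one := cls \<one>\<rparr> = ?fg" using carr one by simp
 ultimately have "group ?fg" by simp
 hence "generate ?fg (cls ` K) = carrier ?fg"
  using hm group_hom.generate_img[of G ?fg cls K] K carr by (simp add: group_hom_def group_hom_axioms_def)
 moreover have "cls ` K <= carrier ?fg" "finite (cls ` K)" using K carr by auto
 ultimately have "min_generators ?fg <= card (cls ` K)"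
  unfolding min_generators_def by (intro Least_le) blast
 also have "... <= card K" by (rule card_image_le[OF K(2)])
 finally show ?thesis .
qed

section \<open>Quotients by properly discontinuous group actions\<close>

text \<open>A quotient map whose fibres are the orbits of a group that acts freely and properly
  discontinuously; unlike a covering map it is visibly preserved when its target is replaced by a
  homeomorphic space.\<close>

locale orbit_map = group G for G (structure) +
 fixes E :: "'p topology" and M :: "'m topology" and q :: "'p => 'm" and act
 assumes q: "quotient_map E M q"
  and act_cont: "g : carrier G ==> continuous_map E E (act g)"
  and act_mult: "g : carrier G ==> h : carrier G ==> x : topspace E ==> act (g \<otimes> h) x = act g (act h x)"
  and act_one: "x : topspace E ==> act \<one> x = x"
  and fib: "x : topspace E ==> y : topspace E ==> q x = q y \<longleftrightarrow> (EX g:carrier G. y = act g x)"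
  and disc: "x : topspace E ==>
   EX V. openin E V & x : V & (ALL g:carrier G. g ~= \<one> --> act g ` V Int V = {})"
begin

text \<open>The sections of the quotient map over \<open>q ` V\<close>, for \<open>V\<close> disjoint from its translates, are the translates of the inverse of \<open>q\<close> on \<open>V\<close>.\<close>

lemma deck_cover: "deck_cover E M q G act"
proof -
 have actE: "act g x : topspace E" if "g : carrier G" "x : topspace E" for g x
  using act_cont[OF that(1)] that(2) by (auto simp: continuous_map_def)
 have q_act: "q (act g x) = q x" if "g : carrier G" "x : topspace E" for g x
  using fib[OF that(2) actE[OF that]] that(1) by auto
 have inv_act: "act (inv g) (act g x) = x" "act g (act (inv g) x) = x"
  if "g : carrier G" "x : topspace E" for g x using act_mult[of "inv g" g x] act_mult[of g "inv g" x] that act_one by auto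
 have act_open: "openin E (act g ` V)" if g: "g : carrier G" and V: "openin E V" for g V
 proof -
  have "act g ` V = {x : topspace E. act (inv g) x : V}" using openin_subset[OF V] g actE inv_act by (auto; metis imageI)
  thus ?thesis using openin_continuous_map_preimage[OF act_cont V, of "inv g"] g by simp
 qed
 have q_open: "openin M (q ` V)" if V: "openin E V" for V
 proof -
  have VE: "V <= topspace E" by (rule openin_subset[OF V])
  have "{x : topspace E. q x : q ` V} = (UN g:carrier G. act g ` V)" using fib VE actE by (auto; metis imageI subsetD)
  hence op: "openin E {x : topspace E. q x : q ` V}" using act_open[OF _ V] by auto
  have "q ` V <= topspace M" using quotient_imp_surjective_map[OF q] VE by blast
  thus ?thesis by (rule iffD1[OF q[unfolded quotient_map_def, THEN conjunct2, rule_format] op])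
 qed
 have ev: "EX W s. x : W & even_chart E M q W s" if x: "x : topspace M" for x
 proof -
  have "x : q ` topspace E" using quotient_imp_surjective_map[OF q] x by simp
  then obtain y where y: "y : topspace E" "q y = x" by blast
  obtain V where V: "openin E V" "y : V" and Vd: "!!g. g : carrier G ==> g ~= \<one> ==> act g ` V Int V = {}"
   using disc[OF y(1)] by blast
  have VE: "V <= topspace E" using V openin_subset by blast
  let ?W = "q ` V"
  have inj: "v = v'" if v: "v : V" "v' : V" "q v = q v'" for v v'
  proof -
   have vE: "v : topspace E" "v' : topspace E" using v VE by auto
   obtain g where g: "g : carrier G" "v' = act g v" using fib[OF vE] v(3) by blast
   thus ?thesis using Vd[OF g(1)] v act_one[OF vE(1)] by force
  qed
  define sg where "sg = inv_into V q"
  have sg: "sg w : V" "q (sg w) = w" if "w : ?W" for w using that by (auto simp: sg_def inv_into_into f_inv_into_f)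
  have sgq: "sg (q v) = v" if "v : V" for v using inj sg[of "q v"] that by blast
  have W: "openin M ?W" by (rule q_open[OF V(1)])
  have csg: "continuous_map (subtopology M ?W) E sg"
   unfolding continuous_map_def
  proof (intro conjI allI impI)
   show "sg : topspace (subtopology M ?W) \<rightarrow> topspace E" using sg VE by auto
   fix U assume U: "openin E U"
   have "{w : topspace (subtopology M ?W). sg w : U} = q ` (U Int V)" using sgq openin_subset[OF W] by auto
   thus "openin (subtopology M ?W) {w : topspace (subtopology M ?W). sg w : U}"
    using openin_open_subtopology[OF W] q_open[OF openin_Int[OF U V(1)]] by auto
  qed
  define ga where "ga e = (SOME g. g : carrier G & e = act g (sg (q e)))" for e
  have ga: "ga e : carrier G" "e = act (ga e) (sg (q e))" if e: "e : topspace E" "q e : ?W" for e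
  proof -
   have "EX g. g : carrier G & e = act g (sg (q e))" using fib[of "sg (q e)" e] sg[OF e(2)] VE e by auto
   from someI_ex[OF this] show "ga e : carrier G" "e = act (ga e) (sg (q e))" by (simp_all add: ga_def)
  qed
  define s where "s e = act (ga e) o sg" for e
  have sW: "s e ` ?W = act (ga e) ` V" for e using sgq by (auto simp: s_def image_image)
  have "even_chart E M q ?W s"
   unfolding even_chart_def
  proof (intro conjI ballI impI W)
   fix e assume e: "e : topspace E" "q e : ?W"
   note g = ga[OF e]
   show "continuous_map (subtopology M ?W) E (s e)"
    unfolding s_def by (rule continuous_map_compose[OF csg act_cont[OF g(1)]])
   show "s e (q e) = e" using g(2) by (simp add: s_def)
   show "openin E (s e ` ?W)" unfolding sW by (rule act_open[OF g(1) V(1)])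
   show "q (s e w) = w" if "w : ?W" for w using q_act[OF g(1), of "sg w"] sg[OF that] VE by (auto simp: s_def)
  next
   fix e e' assume e: "e : topspace E" "q e : ?W" and e': "e' : topspace E" "q e' : ?W"
    and ne: "s e ` ?W Int s e' ` ?W ~= {}"
   then obtain v v' where v: "v : V" "v' : V" "act (ga e) v = act (ga e') v'" unfolding sW by auto
   note g = ga(1)[OF e] ga(1)[OF e']
   let ?g = "inv (ga e') \<otimes> ga e"
   have vE: "v : topspace E" "v' : topspace E" using v VE by auto
   have "ga e = ga e'"
    using act_mult[OF _ g(1) vE(1), of "inv (ga e')"] g v(3) inv_act(1)[OF g(2) vE(2)] Vd[of ?g] v inv_equality by force
   thus "s e ` ?W = s e' ` ?W" by (simp add: s_def)
  qed
  thus ?thesis using y V by blast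
 qed
 show ?thesis
 proof
  show "cover_map E M q"
   unfolding cover_map_def using quotient_imp_continuous_map[OF q] quotient_imp_surjective_map[OF q] ev by blast
  show "g = \<one>" if g: "g : carrier G" "x : topspace E" "act g x = x" for g x
   using disc[OF g(2)] g by (metis IntI empty_iff imageI)
 qed (use act_cont q_act act_mult act_one fib in "auto simp: group_axioms")
qed

lemma deck_cover_homeomorphic:
 assumes "homeomorphic_map M N f"
 shows "deck_cover E N (f o q) G act"
proof -
 have "(f o q) x = (f o q) y \<longleftrightarrow> q x = q y" if "x : topspace E" "y : topspace E" for x y
  using inj_on_eq_iff[OF homeomorphic_imp_injective_map[OF assms]] quotient_imp_surjective_map[OF q] that by auto
 then interpret N: orbit_map G E N "f o q" act by unfold_locales
   (use quotient_map_compose[OF q conjunct1[OF assms[unfolded homeomorphic_map_def]]] act_cont act_mult act_one fib disc in auto)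
 show ?thesis by (rule N.deck_cover)
qed

end

text \<open>Each point differs from its finitely many translates, so a small neighbourhood of it is disjoint from its own translates.\<close>

lemma orbit_map_finite:
 fixes P :: "'p::metric_space set" and G (structure)
 assumes G: "group G" and fin: "finite (carrier G)"
  and cont: "!!g. g : carrier G ==> continuous_on P (act g)"
  and actP: "!!g x. g : carrier G ==> x : P ==> act g x : P"
  and mult: "!!g h x. g : carrier G ==> h : carrier G ==> x : P ==> act (g \<otimes> h) x = act g (act h x)"
  and one: "!!x. x : P ==> act \<one> x = x"
  and free: "!!g x. g : carrier G ==> x : P ==> act g x = x ==> g = \<one>"
  and q: "!!x. x : P ==> q x = (%g. act g x) ` carrier G"
 shows "orbit_map G (top_of_set P) (quotient_topology (top_of_set P) q) q act"
proof -
 interpret group G by (rule G)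
 let ?E = "top_of_set P"
 have cE: "continuous_map ?E ?E (act g)" if "g : carrier G" for g using cont[OF that] actP[OF that] by auto
 show ?thesis
 proof
  show "quotient_map ?E (quotient_topology ?E q) q" by (rule quotient_map_quotient_topology)
  fix x assume x: "x : topspace ?E"
  hence xP: "x : P" by simp
  {
   fix y assume "y : topspace ?E"
   hence yP: "y : P" by simp
   have sub: "q (act g y) <= q y" if "g : carrier G" "y : P" for g y
    unfolding q[OF that(2)] q[OF actP[OF that]] using mult[OF _ that, symmetric] that(1) by auto
   show "q x = q y \<longleftrightarrow> (EX g:carrier G. y = act g x)"
   proof
    assume "q x = q y"
    moreover have "y : q y" using q[OF yP] one[OF yP] by (metis image_eqI one_closed)
    ultimately show "EX g:carrier G. y = act g x" using q[OF xP] by auto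
   next
    assume "EX g:carrier G. y = act g x"
    then obtain g where g: "g : carrier G" "y = act g x" by blast
    show "q x = q y" using mult[of "inv g" g x] g xP one sub[OF g(1) xP] sub[OF inv_closed[OF g(1)] yP] by auto
   qed
  }
  let ?r = "%g. dist x (act g x) / 2" and ?I = "carrier G - {\<one>}"
  let ?U = "%g. {y : topspace ?E. act g y : ball (act g x) (?r g)} Int (P Int ball x (?r g))"
  define V where "V = (INT g:?I. ?U g) Int topspace ?E"
  have "openin ?E V"
   unfolding V_def
  proof (rule openin_INT)
   fix g assume "g : ?I"
   hence "continuous_map ?E euclidean (act g)" using cont by simp
   thus "openin ?E (?U g)" by (intro openin_Int openin_continuous_map_preimage[where Y = euclidean] openin_open_Int) auto
  qed (use fin in simp)
  moreover have "0 < ?r g" if "g : ?I" for g using free[of g x] that xP by auto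
  hence "x : V" using xP by (auto simp: V_def)
  moreover have "act g ` V Int V = {}" if g: "g : carrier G" "g ~= \<one>" for g
  proof (rule ccontr)
   assume "act g ` V Int V ~= {}"
   then obtain y where "y : V" "act g y : V" by blast
   thus False using g dist_triangle2[of x "act g x" "act g y"] by (force simp: V_def)
  qed
  ultimately show "EX V. openin ?E V & x : V & (ALL g:carrier G. g ~= \<one> --> act g ` V Int V = {})" by blast
 qed (use cE mult one in auto)
qed

section \<open>The three manifolds as quotients\<close>

lemma sphere3_eq: "sphere3 = top_of_set (sphere (0 :: complex \<times> complex) 1)"
proof -
 have "{(z1, z2). (cmod z1)\<^sup>2 + (cmod z2)\<^sup>2 = 1} = sphere (0 :: complex \<times> complex) 1"
  by (auto simp: norm_prod_def)
 thus ?thesis by (simp add: sphere3_def)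
qed

text \<open>The complement of a point is homeomorphic to a hyperplane, and the complement of two points to a hyperplane without a point.\<close>

lemma two_contractible_pieces_sphere:
 fixes a :: "'a::euclidean_space"
 assumes "3 <= DIM('a)" "0 < r"
 shows "two_contractible_pieces (top_of_set (sphere a r))"
proof -
 let ?S = "sphere a r"
 obtain b :: 'a where b: "b : Basis" using nonempty_Basis by blast
 define n where "n = a + r *\<^sub>R b"
 define m where "m = a - r *\<^sub>R b"
 have nm: "n : ?S" "m : ?S" "n ~= m"
 proof -
  have "n - m ~= 0" using b assms by (auto simp: n_def m_def scaleR_2[symmetric])
  thus "n ~= m" by auto
  show "n : ?S" "m : ?S" using b assms by (auto simp: n_def m_def dist_norm)
 qed
 have hom: "(?S - {x}) homeomorphic {y. b \<bullet> y = 0}" if "x : ?S" for x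
  by (rule homeomorphic_punctured_sphere_hyperplane[OF assms(2) that]) (use b in auto)
 have con: "contractible (?S - {x})" if "x : ?S" for x
  using homeomorphic_contractible_eq[OF hom[OF that]] convex_imp_contractible[OF convex_hyperplane] by blast
 obtain f g where fg: "homeomorphism (?S - {n}) {y. b \<bullet> y = 0} f g"
  using hom[OF nm(1)] by (auto simp: homeomorphic_def)
 have dim: "aff_dim {y. b \<bullet> y = 0} = int DIM('a) - 1" using b by (subst aff_dim_hyperplane) (auto)
 have "connected ({y. b \<bullet> y = 0} - {f m})"
  by (rule connected_punctured_convex[OF convex_hyperplane]) (use dim assms in auto)
 moreover have "continuous_on ({y. b \<bullet> y = 0} - {f m}) g"
 proof (rule continuous_on_subset)
  show "continuous_on {y. b \<bullet> y = 0} g" using fg by (simp add: homeomorphism_def)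
 qed auto
 ultimately have "connected (g ` ({y. b \<bullet> y = 0} - {f m}))" by (rule connected_continuous_image[rotated])
 moreover have "g ` ({y. b \<bullet> y = 0} - {f m}) = (?S - {n}) Int (?S - {m})"
 proof -
  have g: "inj_on g {y. b \<bullet> y = 0}" "g ` {y. b \<bullet> y = 0} = ?S - {n}" "g (f m) = m" "b \<bullet> f m = 0"
   using fg nm by (auto simp: homeomorphism_def inj_on_def; metis)+
  show ?thesis using g inj_on_image_set_diff[OF g(1)] by auto
 qed
 ultimately have "connected ((?S - {n}) Int (?S - {m}))" by simp
 moreover have "(?S - {n}) Int (?S - {m}) ~= {}"
 proof
  assume "(?S - {n}) Int (?S - {m}) = {}"
  hence "?S <= {n, m}" by auto
  hence "finite ?S" using finite_subset by blast
  thus False using assms connected_finite_iff_sing[OF connected_sphere[of a r]] nm by fastforce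
 qed
 moreover have "openin (top_of_set ?S) (?S - {x})" for x by (metis Diff_eq openin_open_Int open_Compl closed_singleton)
 moreover have "(?S - {n}) Un (?S - {m}) = topspace (top_of_set ?S)" using nm by auto
 moreover have "contractible_space (subtopology (top_of_set ?S) (?S - {x}))" if "x : ?S" for x
  using con[OF that] by (simp add: subtopology_subtopology Int_absorb1)
 moreover have "connectedin (top_of_set ?S) ((?S - {n}) Int (?S - {m}))"
  using calculation(1) by (auto simp: connectedin_subtopology)
 ultimately show ?thesis
  unfolding two_contractible_pieces_def using nm(1,2)
  by (rule_tac exI[of _ "?S - {n}"], rule_tac exI[of _ "?S - {m}"], intro conjI) simp_all
qed

lemma two_contractible_pieces_sphere3: "two_contractible_pieces sphere3"
 unfolding sphere3_eq by (rule two_contractible_pieces_sphere) auto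

lemma simply_connected_sphere3: "simply_connected (sphere (0 :: complex \<times> complex) 1)"
 by (rule simply_connected_sphere) simp

definition lens_action :: "nat => int => int => complex \<times> complex => complex \<times> complex" where
 "lens_action p q k = (%(z1, z2). (cis (2 * pi * (k / p)) * z1, cis (2 * pi * (k * q / p)) * z2))"

lemma lens_rotation_power: "(lens_rotation p q ^^ n) z = lens_action p q (int n) z"
proof (induction n)
 case 0
 show ?case by (simp add: lens_action_def)
next
 case (Suc n)
 have 1: "exp (2 * of_real pi * \<i> / of_nat p) = cis (2 * pi * (1 / p))" by (simp add: cis_conv_exp mult_ac)
 have 2: "exp (2 * of_real pi * \<i> * of_int q / of_nat p) = cis (2 * pi * (q / p))" by (simp add: cis_conv_exp mult_ac)
 obtain z1 z2 where z: "z = (z1, z2)" by force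
 have "(lens_rotation p q ^^ Suc n) z = lens_rotation p q (lens_action p q (int n) z)" using Suc by simp
 also have "... = (cis (2 * pi * (1 / p)) * (cis (2 * pi * (n / p)) * z1),
         cis (2 * pi * (q / p)) * (cis (2 * pi * (n * q / p)) * z2))"
  unfolding lens_rotation_def lens_action_def 1 2 z by simp
 also have "... = lens_action p q (int (Suc n)) z"
  unfolding lens_action_def z mult.assoc[symmetric] cis_mult by (simp add: distrib_left add_divide_distrib distrib_right)
 finally show ?case .
qed

lemma lens_action_mod:
 assumes "0 < p"
 shows "lens_action p q (k mod int p) = lens_action p q k"
proof -
 have k: "real_of_int k = of_int (k mod int p) + real p * of_int (k div int p)"
  by (metis add.commute mult_div_mod_eq of_int_add of_int_mult of_int_of_nat_eq)
 have 1: "cis (2 * pi * (k / p)) = cis (2 * pi * ((k mod int p) / p))"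
 proof -
  have "2 * pi * (k / p) = 2 * pi * ((k mod int p) / p) + 2 * pi * of_int (k div int p)"
   using assms by (subst k) (simp add: field_simps)
  thus ?thesis by (simp add: cis_mult[symmetric])
 qed
 have 2: "cis (2 * pi * (k * q / p)) = cis (2 * pi * ((k mod int p) * q / p))"
 proof -
  have "2 * pi * (k * q / p) = 2 * pi * ((k mod int p) * q / p) + 2 * pi * of_int (k div int p * q)"
   unfolding of_int_mult using assms by (subst k) (simp add: field_simps)
  thus ?thesis by (simp add: cis_mult[symmetric] del: of_int_mult)
 qed
 show ?thesis unfolding lens_action_def using 1 2 by simp
qed

lemma lens_action_add: "lens_action p q (k + l) z = lens_action p q k (lens_action p q l z)"
 by (cases z) (simp add: lens_action_def mult.assoc[symmetric] cis_mult distrib_left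
   distrib_right add_divide_distrib)

lemma cis_2pi_eq_1_iff: "cis (2 * pi * x) = 1 \<longleftrightarrow> x : \<int>"
proof
 assume "cis (2 * pi * x) = 1"
 hence "cos (2 * pi * x) = 1" by (simp add: complex_eq_iff)
 then obtain n :: int where "2 * pi * x = real_of_int n * 2 * pi" using cos_one_2pi_int by blast
 thus "x : \<int>" by simp
qed simp

lemma lens_orbit_map:
 assumes p: "3 <= p" and pq: "coprime (int p) q"
 shows "orbit_map (integer_mod_group p) sphere3 (lens_space p q)
   (%z. {(lens_rotation p q ^^ k) z |k::nat. True}) (lens_action p q)"
 unfolding lens_space_def sphere3_eq
proof (rule orbit_map_finite)
 have carr: "carrier (integer_mod_group p) = {0..<int p}" using p by (simp add: carrier_integer_mod_group)
 show "group (integer_mod_group p)" by simp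
 show "finite (carrier (integer_mod_group p))" by (simp add: carr)
 show "continuous_on (sphere 0 1) (lens_action p q g)" for g
  unfolding lens_action_def case_prod_beta by (intro continuous_intros)
 show "lens_action p q g x : sphere 0 1" if "x : sphere 0 1" for g x
  using that by (cases x) (simp add: lens_action_def norm_prod_def norm_mult)
 show "lens_action p q (g \<otimes>\<^bsub>integer_mod_group p\<^esub> h) x = lens_action p q g (lens_action p q h x)" for g h x
  using p by (simp add: lens_action_mod lens_action_add)
 show "lens_action p q \<one>\<^bsub>integer_mod_group p\<^esub> x = x" for x by (cases x) (simp add: lens_action_def)
 show "g = \<one>\<^bsub>integer_mod_group p\<^esub>"
  if g: "g : carrier (integer_mod_group p)" and x: "x : sphere 0 1" and fx: "lens_action p q g x = x" for g x
 proof -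
  obtain z1 z2 where z: "x = (z1, z2)" by force
  have dvd: "int p dvd m" if m: "real_of_int m / real p : \<int>" for m
  proof -
   obtain n where "real_of_int m / real p = of_int n" using m by (rule Ints_cases)
   hence "real_of_int m = of_int (n * int p)" using p by (simp add: field_simps)
   hence "m = n * int p" by (simp only: of_int_eq_iff)
   thus ?thesis by simp
  qed
  have "int p dvd g"
  proof (cases "z1 = 0")
   case False
   thus ?thesis using fx z dvd cis_2pi_eq_1_iff by (force simp: lens_action_def)
  next
   case True
   hence "int p dvd g * q" using x z fx dvd cis_2pi_eq_1_iff by (fastforce simp: lens_action_def)
   thus ?thesis using pq coprime_dvd_mult_left_iff by blast
  qed
  thus ?thesis using g carr by (auto dest: zdvd_imp_le)
 qed
 show "{(lens_rotation p q ^^ k) x |k::nat. True} = (%g. lens_action p q g x) ` carrier (integer_mod_group p)" for x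
 proof (intro equalityI subsetI)
  fix y assume "y : {(lens_rotation p q ^^ k) x |k::nat. True}"
  then obtain k :: nat where "y = lens_action p q (int k) x" by (auto simp: lens_rotation_power)
  thus "y : (%g. lens_action p q g x) ` carrier (integer_mod_group p)"
   using p by (auto simp: lens_action_mod carr intro: image_eqI[of _ _ "int k mod int p"])
 next
  fix y assume "y : (%g. lens_action p q g x) ` carrier (integer_mod_group p)"
  then obtain g where "0 <= g" "y = lens_action p q g x" by (auto simp: carr)
  hence "y = (lens_rotation p q ^^ nat g) x" by (simp add: lens_rotation_power)
  thus "y : {(lens_rotation p q ^^ k) x |k::nat. True}" by blast
 qed
qed

definition Q8_group :: "(complex \<times> complex) monoid" where
 "Q8_group = \<lparr>carrier = Q8, mult = quat_mult, one = (1, 0)\<rparr>"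

abbreviation "Q == Q8_group"

lemma quat_mult_assoc: "quat_mult (quat_mult x y) z = quat_mult x (quat_mult y z)"
 by (cases x; cases y; cases z) (simp add: quat_mult_def algebra_simps)

lemma quat_mult_one: "quat_mult (1, 0) x = x" "quat_mult x (1, 0) = x" by (cases x; simp add: quat_mult_def)+

lemma Q8_elements:
 "Q8 = {(1, 0), (-1, 0), (\<i>, 0), (-\<i>, 0), (0, 1), (0, -1), (0, \<i>), (0, -\<i>)}"
 by (simp add: Q8_def quat_i_def quat_j_def quat_k_def)

lemma Q8_mult_closed: "x : Q8 ==> y : Q8 ==> quat_mult x y : Q8"
 unfolding Q8_elements by (elim insertE emptyE) (simp_all add: quat_mult_def)

lemma group_Q8: "group Q8_group"
proof (rule groupI)
 show "EX y:carrier Q8_group. y \<otimes>\<^bsub>Q\<^esub> x = \<one>\<^bsub>Q\<^esub>" if "x : carrier Q8_group" for x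
 proof -
  have "x : Q8" using that by (simp add: Q8_group_def)
  hence "(cnj (fst x), - snd x) : Q8 & quat_mult (cnj (fst x), - snd x) x = (1, 0)"
   unfolding Q8_elements by (elim insertE emptyE) (simp_all add: quat_mult_def)
  thus ?thesis by (auto simp: Q8_group_def)
 qed
qed (auto simp: Q8_group_def Q8_mult_closed quat_mult_assoc quat_mult_one, simp add: Q8_elements)

lemma norm_quat_mult: "norm (quat_mult x y) = norm x * norm y"
proof -
 obtain a b c d where x: "x = (a, b)" "y = (c, d)" by force
 have "complex_of_real ((cmod (a * c - b * cnj d))\<^sup>2 + (cmod (a * d + b * cnj c))\<^sup>2) =
  complex_of_real (((cmod a)\<^sup>2 + (cmod b)\<^sup>2) * ((cmod c)\<^sup>2 + (cmod d)\<^sup>2))"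
  by (simp add: complex_norm_square algebra_simps del: of_real_power)
 hence "(cmod (a * c - b * cnj d))\<^sup>2 + (cmod (a * d + b * cnj c))\<^sup>2 =
  ((cmod a)\<^sup>2 + (cmod b)\<^sup>2) * ((cmod c)\<^sup>2 + (cmod d)\<^sup>2)" by (simp only: of_real_eq_iff)
 thus ?thesis by (simp add: x quat_mult_def norm_prod_def real_sqrt_mult)
qed

lemma Q8_orbit_map:
 "orbit_map Q8_group sphere3 sphere3_mod_Q8 (%x. {quat_mult g x |g. g : Q8}) quat_mult"
 unfolding sphere3_mod_Q8_def sphere3_eq
proof (rule orbit_map_finite)
 have carr: "carrier Q8_group = Q8" by (simp add: Q8_group_def)
 show "group Q8_group" by (rule group_Q8)
 show "finite (carrier Q8_group)" by (simp add: carr Q8_elements)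
 show "continuous_on (sphere 0 1) (quat_mult g)" for g
  unfolding quat_mult_def case_prod_beta by (intro continuous_intros)
 have n1: "norm g = 1" if "g : Q8" for g
  using that unfolding Q8_elements by (elim insertE emptyE) (simp_all add: norm_prod_def)
 show "quat_mult g x : sphere 0 1" if "g : carrier Q8_group" "x : sphere 0 1" for g x
  using that n1[of g] by (simp add: carr norm_quat_mult)
 show "quat_mult (g \<otimes>\<^bsub>Q\<^esub> h) x = quat_mult g (quat_mult h x)" for g h x
  by (simp add: Q8_group_def quat_mult_assoc)
 show "quat_mult \<one>\<^bsub>Q\<^esub> x = x" for x by (simp add: Q8_group_def quat_mult_one)
 show "g = \<one>\<^bsub>Q\<^esub>" if "x : sphere 0 1" "quat_mult g x = x" for g x
 proof -
  obtain a b where x: "x = (a, b)" by force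
  have "a * cnj a + b * cnj b = complex_of_real ((cmod a)\<^sup>2 + (cmod b)\<^sup>2)"
   by (simp only: of_real_add complex_norm_square)
  also have "... = 1" using that(1) x by (simp add: norm_prod_def)
  finally have "quat_mult x (cnj a, - b) = (1, 0)" by (simp add: x quat_mult_def)
  thus ?thesis using that(2) quat_mult_assoc[of g x "(cnj a, - b)"] by (simp add: quat_mult_one Q8_group_def)
 qed
 show "{quat_mult g x |g. g : Q8} = (%g. quat_mult g x) ` carrier Q8_group" for x by (auto simp: carr)
qed

definition Z3_group :: "(int \<times> int \<times> int) monoid" where
 "Z3_group = \<lparr>carrier = UNIV, mult = (+), one = 0\<rparr>"

definition Z3_action :: "int \<times> int \<times> int => real \<times> real \<times> real => real \<times> real \<times> real" where
 "Z3_action = (%(k, l, m) (a, b, c). (a + k, b + l, c + m))"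

definition torus_map :: "real \<times> real \<times> real => complex \<times> complex \<times> complex" where
 "torus_map = (%(a, b, c). (cis (2 * pi * a), cis (2 * pi * b), cis (2 * pi * c)))"

lemma group_Z3: "group Z3_group"
proof (rule groupI)
 show "EX y:carrier Z3_group. y \<otimes>\<^bsub>Z3_group\<^esub> x = \<one>\<^bsub>Z3_group\<^esub>" for x
  by (rule bexI[of _ "- x"]) (simp_all add: Z3_group_def)
qed (auto simp: Z3_group_def algebra_simps)

lemma cis_2pi_eq_iff: "cis (2 * pi * a) = cis (2 * pi * b) \<longleftrightarrow> (EX k::int. b = a + k)"
proof -
 have "cis (2 * pi * a) = cis (2 * pi * b) \<longleftrightarrow> cis (2 * pi * b) / cis (2 * pi * a) = 1" by auto
 also have "... \<longleftrightarrow> b - a : \<int>"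
  unfolding cis_divide by (simp add: right_diff_distrib[symmetric] cis_2pi_eq_1_iff)
 also have "... \<longleftrightarrow> (EX k::int. b = a + k)"
  by (metis Ints_cases Ints_of_int add.commute add_diff_cancel_right' diff_add_cancel)
 finally show ?thesis .
qed

lemma torus3_eq: "torus3 = top_of_set (sphere 0 1 \<times> sphere 0 1 \<times> sphere 0 1)" by (simp add: torus3_def)

lemma torus_orbit_map: "orbit_map Z3_group (top_of_set UNIV) torus3 torus_map Z3_action"
proof (intro orbit_map.intro orbit_map_axioms.intro group_Z3)
 have cont: "continuous_on S torus_map" for S
  unfolding torus_map_def case_prod_beta by (intro continuous_intros)
 have tm: "continuous_map (top_of_set S) torus3 torus_map" for S using cont[of S] by (auto simp: torus3_eq torus_map_def)
 have unit: "EX t. 0 <= t & t <= 1 & z = cis (2 * pi * t)" if z1: "cmod z = 1" for z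
 proof -
  obtain t where t: "0 <= t" "t < 2 * pi" "z = Complex (cos t) (sin t)" by (rule complex_unimodular_polar[OF z1])
  thus ?thesis by (intro exI[of _ "t / (2 * pi)"]) (simp add: cis.ctr)
 qed
 let ?C = "{0..1::real} \<times> {0..1::real} \<times> {0..1::real}" and ?E = "top_of_set UNIV"
 have surj: "torus_map ` ?C = topspace torus3"
 proof (intro equalityI subsetI)
  fix z assume "z : topspace torus3"
  then obtain z1 z2 z3 where z: "z = (z1, z2, z3)" "cmod z1 = 1" "cmod z2 = 1" "cmod z3 = 1" by (auto simp: torus3_eq)
  obtain a b c where "0 <= a" "a <= 1" "z1 = cis (2 * pi * a)" "0 <= b" "b <= 1" "z2 = cis (2 * pi * b)"
   "0 <= c" "c <= 1" "z3 = cis (2 * pi * c)" using unit z by metis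
  thus "z : torus_map ` ?C" by (intro image_eqI[of _ _ "(a, b, c)"]) (auto simp: torus_map_def z)
 qed (auto simp: torus3_eq torus_map_def)
 \<comment> \<open>a fundamental domain is compact, so that it suffices to look at the restriction to it\<close>
 have qC: "quotient_map (top_of_set ?C) torus3 torus_map" by (rule continuous_imp_quotient_map)
   (use surj tm in "simp_all add: torus3_eq Hausdorff_space_subtopology compact_space_subtopology compact_Times")
 show "quotient_map ?E torus3 torus_map"
  unfolding quotient_map_def
 proof (intro conjI allI impI iffI)
  show "torus_map ` topspace ?E = topspace torus3"
   using surj tm[of UNIV] continuous_map_image_subset_topspace[of ?E torus3 torus_map] by fastforce
  fix U assume U: "U <= topspace torus3"
  show "openin ?E {x : topspace ?E. torus_map x : U}" if "openin torus3 U"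
   by (rule openin_continuous_map_preimage[OF tm that])
  assume "openin ?E {x : topspace ?E. torus_map x : U}"
  hence "openin (top_of_set ?C) (?C Int {x. torus_map x : U})" by auto
  moreover have "?C Int {x. torus_map x : U} = {x : topspace (top_of_set ?C). torus_map x : U}" by auto
  ultimately show "openin torus3 U" using qC U by (simp add: quotient_map_def)
 qed
 show "torus_map x = torus_map y \<longleftrightarrow> (EX g:carrier Z3_group. y = Z3_action g x)" for x y
  by (cases x; cases y) (auto simp: torus_map_def Z3_action_def Z3_group_def cis_2pi_eq_iff)
 show "continuous_map ?E ?E (Z3_action g)" for g
  unfolding Z3_action_def case_prod_beta by (simp, intro continuous_intros)
 show "Z3_action (g \<otimes>\<^bsub>Z3_group\<^esub> h) x = Z3_action g (Z3_action h x)" for g h x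
  by (cases g; cases h; cases x) (simp add: Z3_action_def Z3_group_def)
 show "Z3_action \<one>\<^bsub>Z3_group\<^esub> x = x" for x
  by (cases x) (simp add: Z3_action_def Z3_group_def zero_prod_def)
 show "EX V. openin ?E V & x : V & (ALL g:carrier Z3_group. g ~= \<one>\<^bsub>Z3_group\<^esub> --> Z3_action g ` V Int V = {})" for x
 proof (intro exI[of _ "ball x (1/2)"] conjI ballI impI)
  fix g assume g: "g ~= \<one>\<^bsub>Z3_group\<^esub>"
  have far: "1 <= dist y (Z3_action g y)" for y
  proof -
   obtain k l m a b c where gy: "g = (k, l, m)" "y = (a, b, c)" by (cases g; cases y) auto
   have "k ~= 0 | l ~= 0 | m ~= 0" using g gy by (auto simp: Z3_group_def zero_prod_def)
   moreover have "(1::real) <= \<bar>real_of_int i\<bar>" if i: "i ~= 0" for i :: int using i by simp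
   moreover note dist_fst_le[of y "Z3_action g y"] dist_snd_le[of y "Z3_action g y"]
    dist_fst_le[of "snd y" "snd (Z3_action g y)"] dist_snd_le[of "snd y" "snd (Z3_action g y)"]
   ultimately show ?thesis by (simp add: gy Z3_action_def dist_real_def) (metis order_trans)
  qed
  show "Z3_action g ` ball x (1/2) Int ball x (1/2) = {}"
  proof (rule ccontr)
   assume "Z3_action g ` ball x (1/2) Int ball x (1/2) ~= {}"
   then obtain y where "dist x y < 1/2" "dist x (Z3_action g y) < 1/2" by auto
   thus False using dist_triangle3[of y "Z3_action g y" x] far[of y] by simp
  qed
 qed auto
qed

lemma generate_integer_mod_group:
 assumes "3 <= p"
 shows "generate (integer_mod_group p) {1} = carrier (integer_mod_group p)"
proof (intro equalityI subsetI)
 have carr: "carrier (integer_mod_group p) = {0..<int p}" using assms by (simp add: carrier_integer_mod_group)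
 fix x assume "x : generate (integer_mod_group p) {1}"
 thus "x : carrier (integer_mod_group p)" using group.generate_in_carrier[of "integer_mod_group p" "{1}"] assms by auto
next
 have carr: "carrier (integer_mod_group p) = {0..<int p}" using assms by (simp add: carrier_integer_mod_group)
 have *: "int n < int p ==> int n : generate (integer_mod_group p) {1}" for n
 proof (induction n)
  case 0
  show ?case using generate.one[of "integer_mod_group p" "{1}"] by simp
 next
  case (Suc n)
  have "int n \<otimes>\<^bsub>integer_mod_group p\<^esub> 1 : generate (integer_mod_group p) {1}"
   by (rule generate.eng) (use Suc in "auto intro: generate.incl")
  thus ?case using Suc.prems by (simp add: add.commute)
 qed
 fix x assume "x : carrier (integer_mod_group p)"
 thus "x : generate (integer_mod_group p) {1}" using *[of "nat x"] carr by auto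
qed

lemma generate_Q8: "generate Q8_group {quat_i, quat_j} = carrier Q8_group"
proof (intro equalityI subsetI)
 have K: "{quat_i, quat_j} <= carrier Q8_group" by (auto simp: Q8_group_def Q8_def)
 fix x assume "x : generate Q8_group {quat_i, quat_j}"
 thus "x : carrier Q8_group" using group.generate_in_carrier[OF group_Q8 K] by blast
next
 let ?H = "generate Q8_group {quat_i, quat_j}"
 have m: "quat_mult x y : ?H" if "x : ?H" "y : ?H" for x y using generate.eng[OF that] by (simp add: Q8_group_def)
 have i: "(\<i>, 0) : ?H" and j: "(0, 1) : ?H"
  using generate.incl[of quat_i "{quat_i, quat_j}" Q8_group] generate.incl[of quat_j "{quat_i, quat_j}" Q8_group]
  by (simp_all add: quat_i_def quat_j_def)
 have n: "(-1, 0) : ?H" using m[OF i i] by (simp add: quat_mult_def)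
 have k: "(0, \<i>) : ?H" using m[OF i j] by (simp add: quat_mult_def)
 show "x : ?H" if "x : carrier Q8_group" for x
  using m[OF n n] m[OF n i] m[OF n j] m[OF n k] i j n k that by (auto simp: quat_mult_def Q8_elements Q8_group_def)
qed

lemma generate_Z3: "generate Z3_group {(1,0,0), (0,1,0), (0,0,1)} = carrier Z3_group"
proof (intro equalityI subsetI)
 fix x assume "x : generate Z3_group {(1,0,0), (0,1,0), (0,0,1)}"
 thus "x : carrier Z3_group" by (simp add: Z3_group_def)
next
 interpret group Z3_group by (rule group_Z3)
 let ?H = "generate Z3_group {(1,0,0), (0,1,0), (0,0,1)}"
 have H: "subgroup ?H Z3_group" by (rule generate_is_subgroup) (simp add: Z3_group_def)
 have m: "x + y : ?H" if "x : ?H" "y : ?H" for x y using generate.eng[OF that] by (simp add: Z3_group_def)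
 have z: "0 : ?H" using subgroup.one_closed[OF H] by (simp add: Z3_group_def)
 have neg: "- x : ?H" if "x : ?H" for x
 proof -
  have "inv\<^bsub>Z3_group\<^esub> x = - x" by (rule inv_equality) (simp_all add: Z3_group_def)
  thus ?thesis using subgroup.m_inv_closed[OF H that] by simp
 qed
 have nat: "(of_nat n * k, of_nat n * l, of_nat n * m') : ?H" if "(k, l, m') : ?H" for n k l m'
 proof (induction n)
  case 0 show ?case using z by (simp add: zero_prod_def)
 next
  case (Suc n)
  show ?case using m[OF Suc that] by (simp add: algebra_simps)
 qed
 have mult: "(a * k, a * l, a * m') : ?H" if "(k, l, m') : ?H" for a k l m'
 proof (cases "0 <= a")
  case True thus ?thesis using nat[OF that, of "nat a"] by simp
 next
  case False thus ?thesis using neg[OF nat[OF that, of "nat (- a)"]] by simp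
 qed
 fix x assume "x : carrier Z3_group"
 obtain a b c where x: "x = (a, b, c)" by (cases x)
 have "(a * 1, a * 0, a * 0) : ?H" "(b * 0, b * 1, b * 0) : ?H" "(c * 0, c * 0, c * 1) : ?H"
  by (intro mult generate.incl; simp)+
 from m[OF m[OF this(1,2)] this(3)] show "x : ?H" by (simp add: x)
qed

section \<open>Coloured graphs of gems\<close>

text \<open>A \<open>T\<close> in \<open>TT\<close> stands for a tetrahedron with vertices coloured \<open>0\<close> to \<open>3\<close>, and \<open>sg c T\<close> for its neighbour
  across the face opposite to colour \<open>c\<close>.\<close>

locale gem =
 fixes TT :: "'t set" and sg :: "nat => 't => 't"
 assumes finite_TT: "finite TT" and nonempty_TT: "TT ~= {}"
  and sg_in: "c < 4 ==> T : TT ==> sg c T : TT"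
  and sg_sg: "c < 4 ==> sg c (sg c T) = T"
  and sg_ne: "c < 4 ==> T : TT ==> sg c T ~= T"
begin

definition adj :: "nat set => ('t \<times> 't) set" where
 "adj C = {(S, sg c S) |S c. S : TT & c : C}"

definition orb :: "nat set => 't => 't set" where
 "orb C T = {T'. (T, T') : (adj C)\<^sup>*}"

definition orbits :: "nat set => 't set set" where
 "orbits C = orb C ` TT"

lemma orb_refl: "T : orb C T" by (simp add: orb_def)

lemma orb_step: "T' : orb C T ==> T' : TT ==> c : C ==> sg c T' : orb C T"
 unfolding orb_def adj_def by (auto intro: rtrancl.rtrancl_into_rtrancl)

lemma orb_induct [consumes 3, case_names base step]:
 assumes "T' : orb C T" "T : TT" "C <= {..<4}" "P T"
  and "!!S c. S : TT ==> S : orb C T ==> c : C ==> P S ==> P (sg c S)"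
 shows "P T'"
proof -
 have "(T, T') : (adj C)\<^sup>*" using assms(1) by (simp add: orb_def)
 thus ?thesis
 proof (induction rule: rtrancl_induct)
  case (step y z)
  thus ?case using assms(5) by (auto simp: adj_def orb_def)
 qed (rule assms(4))
qed

lemma orb_subset: "T : TT ==> C <= {..<4} ==> orb C T <= TT"
proof
 fix T' assume a: "T' : orb C T" "T : TT" "C <= {..<4}"
 show "T' : TT" using a by (induction rule: orb_induct) (use a sg_in in "auto")
qed

lemma orb_sym: "T' : orb C T ==> T : TT ==> C <= {..<4} ==> T : orb C T'"
proof -
 assume a: "T' : orb C T" "T : TT" "C <= {..<4}"
 have "sym (adj C)"
 proof (rule symI)
  fix x y assume "(x, y) : adj C"
  then obtain c where c: "c : C" "x : TT" "y = sg c x" by (auto simp: adj_def)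
  hence c4: "c < 4" using a by auto
  have "x = sg c y" "y : TT" using c sg_sg[OF c4] sg_in[OF c4] by auto
  thus "(y, x) : adj C" using c(1) unfolding adj_def by blast
 qed
 thus ?thesis using a(1) sym_rtrancl by (auto simp: orb_def dest: symD)
qed

lemma orb_eq: "T' : orb C T ==> T : TT ==> C <= {..<4} ==> orb C T' = orb C T"
 using orb_sym unfolding orb_def by (blast intro: rtrancl_trans)

lemma orb_sg: "T : TT ==> C <= {..<4} ==> c : C ==> orb C (sg c T) = orb C T"
 by (rule orb_eq) (auto intro: orb_step orb_refl)

lemma orb_const:
 assumes "T' : orb C T" "T : TT" "C <= {..<4}" "!!c S. c : C ==> S : TT ==> f (sg c S) = f S"
 shows "f T' = f T" using assms(1-3) by (induction rule: orb_induct) (use assms(4) in auto)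

lemma orbits_disjoint:
 assumes "C <= {..<4}" "O1 : orbits C" "O2 : orbits C" "x : O1" "x : O2"
 shows "O1 = O2"
proof -
 obtain T1 T2 where T: "T1 : TT" "O1 = orb C T1" "T2 : TT" "O2 = orb C T2" using assms by (auto simp: orbits_def)
 have "orb C x = O1" "orb C x = O2"
  unfolding T(2,4) by (rule orb_eq; use T assms in simp)+
 thus ?thesis by simp
qed

lemma Union_orbits: "C <= {..<4} ==> \<Union> (orbits C) = TT" using orb_subset orb_refl by (auto simp: orbits_def)

lemma finite_orbits: "finite (orbits C)"
 unfolding orbits_def using finite_TT by simp

lemma orbits_subset: "C <= {..<4} ==> O' : orbits C ==> O' <= TT" using orb_subset by (auto simp: orbits_def)

lemma sum_card_orbits: "C <= {..<4} ==> (SUM O':orbits C. card O') = card TT"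
proof -
 assume C: "C <= {..<4}"
 show ?thesis using finite_subset[OF orbits_subset[OF C] finite_TT] orbits_disjoint[OF C] Union_orbits[OF C]
  by (metis card_Union_disjoint pairwise_def disjnt_def disjoint_iff)
qed

lemma sum_card_orbits_Int:
 assumes "C <= {..<4}" "S <= TT"
 shows "(SUM O':orbits C. card (O' Int S)) = card S"
proof -
 have "card (UN O':orbits C. O' Int S) = (SUM O':orbits C. card (O' Int S))" by (rule card_UN_disjoint)
   (use orbits_disjoint[OF assms(1)] finite_orbits finite_subset[OF assms(2) finite_TT] in
    \<open>simp_all add: disjoint_iff, blast\<close>)
 moreover have "(UN O':orbits C. O' Int S) = S" using Union_orbits[OF assms(1)] assms(2) by auto
 ultimately show ?thesis by simp
qed

text \<open>An orbit of two of the involutions is a cycle of even length; \<open>rot i j\<close> moves two steps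
  along it, and its orbit is one of the two colour classes of the cycle.\<close>

definition rot :: "nat => nat => 't => 't" where
 "rot i j T = sg i (sg j T)"

definition period :: "nat => nat => 't => nat" where
 "period i j T = (LEAST n. 0 < n & (rot i j ^^ n) T = T)"

definition half :: "nat => nat => 't => 't set" where
 "half i j T = (%s. (rot i j ^^ s) T) ` {..<period i j T}"

context
 fixes i j :: nat
 assumes ij: "i < 4" "j < 4"
begin

lemma rot_in: "T : TT ==> (rot i j ^^ n) T : TT" by (induction n) (use ij sg_in in "auto simp: rot_def")

lemma inj_rot: "inj (rot i j)" by (rule injI) (metis rot_def sg_sg ij)

lemma period_props:
 assumes "T : TT"
 shows "0 < period i j T" "(rot i j ^^ period i j T) T = T"
  "!!n. 0 < n ==> (rot i j ^^ n) T = T ==> period i j T <= n"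
proof -
 have "{y. EX n. y = (rot i j ^^ n) T} <= TT" using rot_in assms by auto
 hence "finite {y. EX n. y = (rot i j ^^ n) T}" using finite_TT finite_subset by blast
 then obtain n where "0 < n" "(rot i j ^^ n) T = T" using funpow_inj_finite[OF inj_rot] by blast
 hence "0 < period i j T & (rot i j ^^ period i j T) T = T"
  unfolding period_def by (rule_tac LeastI[where P = "%n. 0 < n & (rot i j ^^ n) T = T"]) simp
 thus "0 < period i j T" "(rot i j ^^ period i j T) T = T" by auto
 show "period i j T <= n" if "0 < n" "(rot i j ^^ n) T = T" for n
  unfolding period_def by (rule Least_le) (use that in simp)
qed

lemma rot_inj_on: "T : TT ==> inj_on (%s. (rot i j ^^ s) T) {..<period i j T}"
proof (rule linorder_inj_onI')
 fix s s' assume T: "T : TT" and s: "s : {..<period i j T}" "s' : {..<period i j T}" "s < s'"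
 show "(rot i j ^^ s) T ~= (rot i j ^^ s') T"
 proof
  assume "(rot i j ^^ s) T = (rot i j ^^ s') T"
  moreover have "(rot i j ^^ s') T = (rot i j ^^ s) ((rot i j ^^ (s' - s)) T)"
   using s(3) by (simp add: funpow_add[symmetric] flip: o_apply[where f = "rot i j ^^ s"])
  ultimately have "(rot i j ^^ (s' - s)) T = T" using inj_fn[OF inj_rot] by (metis injD)
  thus False using period_props(3)[OF T, of "s' - s"] s by auto
 qed
qed

lemma card_half: "T : TT ==> card (half i j T) = period i j T"
 unfolding half_def by (simp add: card_image rot_inj_on)

lemma half_subset: "T : TT ==> half i j T <= TT"
 unfolding half_def using rot_in by auto

lemma rot_half: "T : TT ==> (rot i j ^^ n) T : half i j T"
proof (induction n)
 case 0
 thus ?case using period_props(1)[OF 0] by (auto simp: half_def intro: image_eqI[of _ _ 0])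
next
 case (Suc n)
 then obtain s where s: "s < period i j T" "(rot i j ^^ n) T = (rot i j ^^ s) T" by (auto simp: half_def)
 show ?case
 proof (cases "Suc s < period i j T")
  case True thus ?thesis using s by (auto simp: half_def intro: image_eqI[of _ _ "Suc s"])
 next
  case False
  hence "Suc s = period i j T" using s by simp
  hence "(rot i j ^^ Suc n) T = T" using s period_props(2)[OF Suc.prems] by (metis comp_apply funpow.simps(2))
  thus ?thesis using period_props(1)[OF Suc.prems] by (auto simp: half_def intro: image_eqI[of _ _ 0])
 qed
qed

lemma sg_rot: "sg j ((rot i j ^^ n) (sg j ((rot i j ^^ n) T))) = T"
proof (induction n arbitrary: T)
 case 0 show ?case by (simp add: sg_sg ij)
next
 case (Suc n)
 have "sg j ((rot i j ^^ Suc n) (sg j ((rot i j ^^ Suc n) T)))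
   = sg j ((rot i j ^^ n) (rot i j (sg j (rot i j ((rot i j ^^ n) T)))))" by (simp add: funpow_swap1)
 also have "rot i j (sg j (rot i j ((rot i j ^^ n) T))) = sg j ((rot i j ^^ n) T)" by (simp add: rot_def sg_sg ij)
 finally show ?case using Suc by simp
qed

text \<open>On a cycle of an even number of edges of two alternating colours every reflection of this kind is
  conjugate to one of the two involutions, which have no fixed points.\<close>

lemma reflection_no_fixed_point:
 assumes "T : TT"
 shows "sg j ((rot i j ^^ n) T) ~= T"
proof
 assume fx: "sg j ((rot i j ^^ n) T) = T"
 define m where "m = n div 2"
 have s: "(rot i j ^^ m) (sg j ((rot i j ^^ m) X)) = sg j X" for X using sg_rot[of m X] sg_sg[OF ij(2)] by metis
 show False
 proof (cases "even n")
  case True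
  hence n: "n = m + m" by (auto simp: m_def)
  have "sg j T = (rot i j ^^ n) T" using fx sg_sg[OF ij(2)] by metis
  hence "sg j T = (rot i j ^^ m) ((rot i j ^^ m) T)" by (simp add: n funpow_add)
  thus False using s inj_fn[OF inj_rot] injD sg_ne[OF ij(2) rot_in[OF assms]] by metis
 next
  case False
  hence n: "n = Suc (m + m)" unfolding m_def by presburger
  have "sg j T = (rot i j ^^ n) T" using fx sg_sg[OF ij(2)] by metis
  hence "sg j T = (rot i j ^^ m) (rot i j ((rot i j ^^ m) T))" by (simp add: n funpow_add funpow_swap1)
  thus False using s inj_fn[OF inj_rot] injD sg_ne[OF ij(1) sg_in[OF ij(2) rot_in[OF assms]]] by (metis rot_def)
 qed
qed

lemma half_disjoint:
 assumes "T : TT"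
 shows "half i j T Int sg j ` half i j T = {}"
proof (rule ccontr)
 assume "half i j T Int sg j ` half i j T ~= {}"
 then obtain s s' where e: "(rot i j ^^ s) T = sg j ((rot i j ^^ s') T)" by (auto simp: half_def)
 have "sg j ((rot i j ^^ (s + s')) T) = sg j ((rot i j ^^ s') (sg j ((rot i j ^^ s') T)))"
  using e by (simp add: add.commute[of s] funpow_add)
 also have "... = T" by (rule sg_rot)
 finally show False using reflection_no_fixed_point[OF assms] by blast
qed

lemma sg_half: "T : TT ==> sg i ` sg j ` half i j T = half i j T"
proof -
 assume T: "T : TT"
 have sub: "rot i j ` half i j T <= half i j T"
 proof
  fix x assume "x : rot i j ` half i j T"
  then obtain s where "x = (rot i j ^^ Suc s) T" by (auto simp: half_def)
  thus "x : half i j T" using rot_half[OF T, of "Suc s"] by simp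
 qed
 have "finite (half i j T)" by (simp add: half_def)
 hence "rot i j ` half i j T = half i j T" using sub inj_rot by (metis card_image card_subset_eq inj_on_subset subset_UNIV)
 thus ?thesis by (simp add: image_comp rot_def)
qed

lemma orb_eq_halves:
 assumes T: "T : TT"
 shows "orb {i, j} T = half i j T Un sg j ` half i j T"
proof (intro equalityI subsetI)
 have C: "{i, j} <= {..<4}" using ij by auto
 fix T' assume "T' : orb {i, j} T"
 thus "T' : half i j T Un sg j ` half i j T" using T C
 proof (induction rule: orb_induct)
  case base show ?case using rot_half[OF T, of 0] by simp
 next
  case (step S c)
  have h: "sg i X : sg j ` half i j T" if "X : half i j T" for X using that sg_half[OF T] by (force simp: sg_sg[OF ij(1)])
  have h': "sg i X : half i j T" if "X : sg j ` half i j T" for X by (subst sg_half[OF T, symmetric]) (rule imageI[OF that])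
  have "sg j X : half i j T" if "X : sg j ` half i j T" for X using that sg_sg[OF ij(2)] by auto
  thus ?case using step h h' by auto
 qed
next
 fix T' assume "T' : half i j T Un sg j ` half i j T"
 moreover have r: "(rot i j ^^ n) T : orb {i, j} T" for n
 proof (induction n)
  case (Suc n)
  show ?case
   using orb_step[OF Suc rot_in[OF T]] orb_step[OF _ sg_in[OF ij(2) rot_in[OF T]]]
   by (simp add: rot_def[of i j "(rot i j ^^ n) T"])
 qed (simp add: orb_refl)
 ultimately show "T' : orb {i, j} T" using orb_step[OF r rot_in[OF T], of j] by (auto simp: half_def)
qed

lemma card_sg_half: "card (sg j ` half i j T) = card (half i j T)" by (rule card_image) (metis inj_onI sg_sg ij(2))

lemma finite_half: "finite (half i j T)" by (simp add: half_def)

lemma card_orb: "T : TT ==> card (orb {i, j} T) = 2 * period i j T"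
 using card_Un_disjoint[OF finite_half finite_imageI[OF finite_half] half_disjoint, of T]
 by (simp add: orb_eq_halves card_sg_half card_half)

lemma sum_half_sg_j:
 assumes "T : TT" "!!X. X : TT ==> f (sg j X) = f X"
 shows "sum f (sg j ` half i j T) = sum f (half i j T)"
proof -
 have "sum f (sg j ` half i j T) = sum (f o sg j) (half i j T)" by (rule sum.reindex) (metis inj_onI sg_sg ij(2))
 also have "... = sum f (half i j T)" by (rule sum.cong) (use assms half_subset in auto)
 finally show ?thesis .
qed

lemma sum_half_sg_i:
 assumes "T : TT" "!!X. X : TT ==> f (sg i X) = f X"
 shows "sum f (sg j ` half i j T) = sum f (half i j T)"
proof -
 have "sum f (half i j T) = sum f (sg i ` sg j ` half i j T)" by (simp add: sg_half assms(1))
 also have "... = sum (f o sg i) (sg j ` half i j T)" by (rule sum.reindex) (metis inj_onI sg_sg ij(1))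
 also have "... = sum f (sg j ` half i j T)"
  by (rule sum.cong) (use assms(2) sg_in[OF ij(2)] subsetD[OF half_subset[OF assms(1)]] in auto)
 finally show ?thesis by simp
qed

text \<open>The increment of a potential along the first \<open>n\<close> double steps of the cycle, when it
  changes by \<open>zi\<close> and \<open>zj\<close> across the two kinds of edges.\<close>

primrec transport :: "('t => 'h::group_add) => ('t => 'h) => 't => nat => 'h" where "transport zi zj T 0 = 0"
| "transport zi zj T (Suc n) = zi (sg j ((rot i j ^^ n) T)) + (zj ((rot i j ^^ n) T) + transport zi zj T n)"

text \<open>Going once round a cycle of involutions \<open>i\<close> and \<open>j\<close> the prescribed increments must add up to zero; this
  condition is also sufficient, and it suffices to test it for one starting point of each cycle.\<close>

lemma potential_exists:
 fixes zi zj :: "'t => 'h::group_add"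
 assumes zi: "!!T. T : TT ==> zi (sg i T) = - zi T" and zj: "!!T. T : TT ==> zj (sg j T) = - zj T"
  and hol: "!!T. T : TT ==> EX R:orb {i, j} T. transport zi zj R (period i j R) = 0"
 shows "EX w. ALL T:TT. w (sg j T) = zj T + w T & w (sg i T) = zi T + w T"
proof -
 have C: "{i, j} <= {..<4}" using ij by auto
 define rep where "rep X = (SOME R. R : orb {i, j} X & transport zi zj R (period i j R) = 0)" for X
 have rep0: "rep X : orb {i, j} X & transport zi zj (rep X) (period i j (rep X)) = 0" if X: "X : TT" for X
  unfolding rep_def by (rule someI_ex) (use hol[OF X] in blast)
 have rep: "rep X : TT" "X : orb {i, j} (rep X)" if X: "X : TT" for X
  using rep0[OF X] orb_subset[OF X C] orb_sym[OF _ X C] by auto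
 have rep_sg: "rep (sg d X) = rep X" if "X : TT" "d : {i, j}" for X d
  unfolding rep_def using orb_sg[OF that(1) C that(2)] by simp
 let ?W = "transport zi zj"
 \<comment> \<open>position on the cycle of the representative: index and colour class\<close>
 have in_half: "(rot i j ^^ s) R : half i j R" if "R : TT" for R s using rot_half[OF that] .
 have idx: "s = s'" if R: "R : TT" and a: "s < period i j R" "s' < period i j R" "(rot i j ^^ s) R = (rot i j ^^ s') R" for R s s'
  using rot_inj_on[OF R] a unfolding inj_on_def by blast
 define w where "w X = (let R = rep X in if X : half i j R then ?W R (THE s. s < period i j R & X = (rot i j ^^ s) R)
   else zj (sg j X) + ?W R (THE s. s < period i j R & sg j X = (rot i j ^^ s) R))" for X
 have w1: "w ((rot i j ^^ s) R) = ?W R s"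
  if "rep ((rot i j ^^ s) R) = R" "s < period i j R" "R : TT" for R s
 proof -
  have "(THE s'. s' < period i j R & (rot i j ^^ s) R = (rot i j ^^ s') R) = s" using idx[OF that(3)] that(2) by auto
  thus ?thesis using in_half[OF that(3)] that(1) by (simp add: w_def)
 qed
 have w2: "w (sg j ((rot i j ^^ s) R)) = zj ((rot i j ^^ s) R) + ?W R s"
  if "rep (sg j ((rot i j ^^ s) R)) = R" "s < period i j R" "R : TT" for R s
 proof -
  have "sg j ((rot i j ^^ s) R) ~: half i j R" using half_disjoint[OF that(3)] in_half[OF that(3)] by blast
  moreover have "(THE s'. s' < period i j R & (rot i j ^^ s) R = (rot i j ^^ s') R) = s"
   using idx[OF that(3)] that(2) by auto
  ultimately show ?thesis using that(1) by (simp add: w_def sg_sg[OF ij(2)])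
 qed
 have "w (sg j X) = zj X + w X & w (sg i X) = zi X + w X" if X: "X : TT" for X
 proof -
  define R where "R = rep X"
  have R: "R : TT" using rep(1)[OF X] by (simp add: R_def)
  let ?a = "period i j R"
  have Wa: "?W R ?a = 0" using rep0[OF X] by (simp add: R_def)
  have a0: "0 < ?a" "(rot i j ^^ ?a) R = R" using period_props[OF R] by auto
  have repj: "rep (sg j X) = R" and repi: "rep (sg i X) = R" using rep_sg[OF X] by (auto simp: R_def)
  \<comment> \<open>the potential is also given by the formula one full turn later\<close>
  have w1': "w ((rot i j ^^ s) R) = ?W R s" if "rep ((rot i j ^^ s) R) = R" "s <= ?a" for s
  proof (cases "s = ?a")
   case True
   hence "w ((rot i j ^^ s) R) = w ((rot i j ^^ 0) R)" using a0 by simp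
   also have "... = ?W R 0" by (rule w1) (use that True a0 R in simp_all)
   finally show ?thesis using Wa True by simp
  qed (use w1 that R in simp)
  have "X : half i j R Un sg j ` half i j R" using rep(2)[OF X] orb_eq_halves[OF R] by (simp add: R_def)
  then consider s where "s < ?a" "X = (rot i j ^^ s) R" | s where "s < ?a" "X = sg j ((rot i j ^^ s) R)"
   by (auto simp: half_def)
  thus ?thesis
  proof cases
   case 1
   have repX: "rep ((rot i j ^^ s) R) = R" unfolding 1(2)[symmetric] by (simp add: R_def)
   have wX: "w X = ?W R s" using w1[OF repX 1(1) R] 1(2) by simp
   have "w (sg j X) = zj X + w X" using w2[of s R] repj 1 wX R by simp
   moreover have "w (sg i X) = zi X + w X"
   proof -
    obtain m where m: "m < ?a" "X = (rot i j ^^ Suc m) R"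
    proof (cases s)
     case 0
     thus thesis using 1(2) a0 that[of "?a - 1"] by simp
    next
     case (Suc m) thus thesis using that[of m] 1 by simp
    qed
    let ?Y = "sg j ((rot i j ^^ m) R)"
    have sX: "sg i X = ?Y" using m(2) sg_sg[OF ij(1)] by (simp add: rot_def)
    have YT: "?Y : TT" using sg_in[OF ij(2) rot_in[OF R]] .
    have Yi: "sg i ?Y = X" unfolding sX[symmetric] by (rule sg_sg[OF ij(1)])
    have wY: "w ?Y = zj ((rot i j ^^ m) R) + ?W R m" by (rule w2[OF _ m(1) R]) (use repi sX in simp)
    have "w X = ?W R (Suc m)" unfolding m(2)
     by (rule w1') (simp_all only: m(2)[symmetric] R_def[symmetric], use m(1) in simp)
    hence "w X = zi ?Y + w ?Y" by (simp add: wY)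
    moreover have "zi X = - zi ?Y" using zi[OF YT] Yi by simp
    ultimately show ?thesis by (simp add: sX)
   qed
   ultimately show ?thesis by simp
  next
   case 2
   let ?Y = "(rot i j ^^ s) R"
   have jX: "sg j X = ?Y" using 2(2) sg_sg[OF ij(2)] by simp
   have repY: "rep ?Y = R" using repj jX by simp
   have wX: "w X = zj ?Y + ?W R s" unfolding 2(2) by (rule w2[OF _ 2(1) R]) (simp only: 2(2)[symmetric] R_def[symmetric])
   have wY: "w ?Y = ?W R s" by (rule w1[OF repY 2(1) R])
   have "zj X = - zj ?Y" unfolding 2(2) by (rule zj[OF rot_in[OF R]])
   hence "w (sg j X) = zj X + w X" by (simp add: jX wX wY)
   moreover have "w (sg i X) = zi X + w X"
   proof -
    have iX: "sg i X = (rot i j ^^ Suc s) R" using 2(2) by (simp add: rot_def)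
    have "w (sg i X) = ?W R (Suc s)" unfolding iX by (rule w1') (use repi iX 2(1) in simp_all)
    thus ?thesis by (simp add: wX 2(2)[symmetric])
   qed
   ultimately show ?thesis by simp
  qed
 qed
 thus ?thesis by blast
qed

text \<open>The special case of a labelling \<open>c\<close> that has to be integrated across one kind of edges.\<close>

definition holonomy :: "('t => 'h::group_add) => 't => 'h" where
 "holonomy c T = transport (%X. c (sg i X) - c X) (%X. 0) T (period i j T)"

lemma transport_label:
 "transport (%X. c (sg i X) - c X) (%X. 0) T (Suc n) =
   c ((rot i j ^^ Suc n) T) - c (sg j ((rot i j ^^ n) T)) + transport (%X. c (sg i X) - c X) (%X. 0) T n"
 by (simp add: rot_def)

lemma label_potential_exists:
 fixes c :: "'t => 'h::group_add"
 assumes "!!T. T : TT ==> EX R:orb {i, j} T. holonomy c R = 0"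
 shows "EX w. ALL T:TT. w (sg j T) = w T & w (sg i T) = c (sg i T) - c T + w T"
 using potential_exists[of "%X. c (sg i X) - c X" "%X. 0"] assms by (simp add: holonomy_def sg_sg[OF ij(1)])

lemma holonomy_abelian:
 fixes c :: "'t => 'h::ab_group_add"
 assumes T: "T : TT"
 shows "holonomy c T = sum c (half i j T) - sum c (sg j ` half i j T)"
proof -
 have "transport (%X. c (sg i X) - c X) (%X. 0) T n =
   (SUM s<n. c ((rot i j ^^ Suc s) T)) - (SUM s<n. c (sg j ((rot i j ^^ s) T)))" for n
  by (induction n) (simp_all only: transport_label, auto)
 hence "holonomy c T = (SUM s<period i j T. c ((rot i j ^^ Suc s) T))
   - (SUM s<period i j T. c (sg j ((rot i j ^^ s) T)))" by (simp add: holonomy_def)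
 moreover have "(SUM s<period i j T. c ((rot i j ^^ s) T)) = sum c (half i j T)"
  unfolding half_def by (subst sum.reindex[OF rot_inj_on[OF T]]) simp
 moreover have "(SUM s<period i j T. c ((rot i j ^^ Suc s) T)) = (SUM s<period i j T. c ((rot i j ^^ s) T))"
 proof -
  have "(SUM s<n. c ((rot i j ^^ Suc s) T)) + c T = (SUM s<n. c ((rot i j ^^ s) T)) + c ((rot i j ^^ n) T)" for n
   by (induction n) (auto)
  from this[of "period i j T"] show ?thesis using period_props(2)[OF T] by simp
 qed
 moreover have "(SUM s<period i j T. c (sg j ((rot i j ^^ s) T))) = sum c (sg j ` half i j T)"
 proof -
  have "inj_on (%s. sg j ((rot i j ^^ s) T)) {..<period i j T}"
   using rot_inj_on[OF T] sg_sg[OF ij(2)] unfolding inj_on_def by metis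
  thus ?thesis unfolding half_def image_image by (subst sum.reindex) auto
 qed
 ultimately show ?thesis by simp
qed

end

end

section \<open>Counting at a vertex\<close>

lemma sum_over_pairs:
 fixes f :: "'a => 'b::comm_monoid_add"
 assumes "i ~= j" "i ~= l" "j ~= l"
 shows "(SUM P:{{i, j}, {i, l}, {j, l}}. SUM c:P. f c) = (f i + f i) + (f j + f j) + (f l + f l)"
proof -
 show ?thesis using assms by (simp add: doubleton_eq_iff ac_simps)
qed

text \<open>A subset of even size is determined by its part outside \<open>v\<close>.\<close>

lemma card_even_subsets_le:
 assumes "finite V" "v : V"
 shows "card {X. X <= V & even (card X)} <= 2 ^ (card V - 1)"
proof -
 have "inj_on (%X. X - {v}) {X. X <= V & even (card X)}"
 proof (rule inj_onI)
  fix X Y assume X: "X : {X. X <= V & even (card X)}" and Y: "Y : {X. X <= V & even (card X)}"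
   and e: "X - {v} = Y - {v}"
  have fin: "finite X" "finite Y" using X Y assms(1) finite_subset by auto
  have "v : X \<longleftrightarrow> v : Y"
  proof -
   have c: "card Z = card (Z - {v}) + (if v : Z then 1 else 0)" if "finite Z" for Z using card.remove[OF that, of v] by simp
   have "even (card (X - {v}) + (if v : X then 1 else 0))" "even (card (X - {v}) + (if v : Y then 1 else 0))"
    using X Y c[OF fin(1)] c[OF fin(2)] e by auto
   thus ?thesis by (auto split: if_splits)
  qed
  thus "X = Y" using e by blast
 qed
 moreover have "(%X. X - {v}) ` {X. X <= V & even (card X)} <= Pow (V - {v})" by auto
 ultimately have "card {X. X <= V & even (card X)} <= card (Pow (V - {v}))" by (rule card_inj_on_le) (use assms(1) in simp)
 thus ?thesis using assms by (simp add: card_Pow)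
qed

context gem
begin

lemma orb_single: "c < 4 ==> T : TT ==> orb {c} T = {T, sg c T}"
proof (intro equalityI subsetI)
 fix x assume c: "c < 4" and T: "T : TT" and x: "x : orb {c} T"
 have "{c} <= {..<4}" using c by simp
 with x T have "x : {T, sg c T}" by (induction rule: orb_induct) (use c sg_sg in auto)
 thus "x : {T, sg c T}" .
next
 fix x assume "c < 4" "T : TT" "x : {T, sg c T}"
 thus "x : orb {c} T" using orb_refl[of T "{c}"] orb_step[of T "{c}" T c] by auto
qed

lemma card_orbits_single: "c < 4 ==> 2 * card (orbits {c}) = card TT"
proof -
 assume c: "c < 4"
 have "card TT = (SUM O':orbits {c}. card O')" using sum_card_orbits[of "{c}"] c by simp
 also have "... = (SUM O':orbits {c}. 2)"
 proof (rule sum.cong[OF refl])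
  fix O' assume "O' : orbits {c}"
  then obtain T where "T : TT" "O' = {T, sg c T}" using orb_single[OF c] by (auto simp: orbits_def)
  thus "card O' = 2" using sg_ne[OF c, of T] by auto
 qed
 finally show ?thesis by simp
qed

lemma orb_mono: "C <= D ==> orb C T <= orb D T"
 unfolding orb_def adj_def using rtrancl_mono[of "{(S, sg c S) |S c. S : TT & c : C}" "{(S, sg c S) |S c. S : TT & c : D}"]
 by blast

lemma sum_triangles_j:
 assumes ij: "i < 4" "j < 4" and R: "R : TT"
 shows "(SUM t | t : orbits {j} & t <= orb {i, j} R. f t) = (SUM X:half i j R. f (orb {j} X))"
proof (rule sum.reindex_cong[of "orb {j}"])
 have sub: "half i j R <= TT" by (rule half_subset[OF ij R])
 show "inj_on (orb {j}) (half i j R)"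
 proof (rule inj_onI)
  fix X Y assume X: "X : half i j R" and Y: "Y : half i j R" and e: "orb {j} X = orb {j} Y"
  have "X : {Y, sg j Y}" using e orb_refl[of X "{j}"] orb_single[OF ij(2)] Y sub by auto
  moreover have "X ~= sg j Y" using half_disjoint[OF ij R] X Y by auto
  ultimately show "X = Y" by simp
 qed
 show "{t : orbits {j}. t <= orb {i, j} R} = orb {j} ` half i j R"
 proof (intro equalityI subsetI)
  fix t assume "t : {t : orbits {j}. t <= orb {i, j} R}"
  then obtain X where X: "X : TT" "t = orb {j} X" "X : orb {i, j} R" using orb_refl by (auto simp: orbits_def)
  consider "X : half i j R" | Y where "Y : half i j R" "X = sg j Y" using X(3) orb_eq_halves[OF ij R] by auto
  thus "t : orb {j} ` half i j R"
  proof cases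
   case 2
   thus ?thesis using X(2) orb_sg[of Y "{j}" j] sub ij by auto
  qed (use X in blast)
 next
  fix t assume "t : orb {j} ` half i j R"
  then obtain X where X: "X : half i j R" "t = orb {j} X" by blast
  have "orb {i, j} X = orb {i, j} R" by (rule orb_eq) (use X ij R orb_eq_halves[OF ij R] in auto)
  thus "t : {t : orbits {j}. t <= orb {i, j} R}" using X sub orb_mono[of "{j}" "{i, j}" X] by (auto simp: orbits_def)
 qed
qed simp

lemma sum_triangles_i:
 assumes ij: "i < 4" "j < 4" and R: "R : TT"
 shows "(SUM t | t : orbits {i} & t <= orb {i, j} R. f t) = (SUM X:sg j ` half i j R. f (orb {i} X))"
proof (rule sum.reindex_cong[of "orb {i}"])
 have sub: "half i j R <= TT" by (rule half_subset[OF ij R])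
 hence sub': "sg j ` half i j R <= TT" using sg_in[OF ij(2)] by auto
 have h: "sg i Y : half i j R" if "Y : sg j ` half i j R" for Y
  by (subst sg_half[OF ij R, symmetric]) (rule imageI[OF that])
 show "inj_on (orb {i}) (sg j ` half i j R)"
 proof (rule inj_onI)
  fix X Y assume X: "X : sg j ` half i j R" and Y: "Y : sg j ` half i j R" and e: "orb {i} X = orb {i} Y"
  have "X : {Y, sg i Y}" using e orb_refl[of X "{i}"] orb_single[OF ij(1)] Y sub' by auto
  moreover have "X ~= sg i Y" using half_disjoint[OF ij R] X h[OF Y] by (metis IntI emptyE)
  ultimately show "X = Y" by simp
 qed
 show "{t : orbits {i}. t <= orb {i, j} R} = orb {i} ` sg j ` half i j R"
 proof (intro equalityI subsetI)
  fix t assume "t : {t : orbits {i}. t <= orb {i, j} R}"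
  then obtain X where X: "X : TT" "t = orb {i} X" "X : orb {i, j} R" using orb_refl by (auto simp: orbits_def)
  consider "X : sg j ` half i j R" | "X : half i j R" using X(3) orb_eq_halves[OF ij R] by auto
  thus "t : orb {i} ` sg j ` half i j R"
  proof cases
   case 2
   hence "X : sg i ` sg j ` half i j R" using sg_half[OF ij R] by simp
   then obtain Y where Y: "Y : sg j ` half i j R" "X = sg i Y" by blast
   thus ?thesis using X(2) orb_sg[of Y "{i}" i] sub' ij by auto
  qed (use X in blast)
 next
  fix t assume "t : orb {i} ` sg j ` half i j R"
  then obtain X where X: "X : sg j ` half i j R" "t = orb {i} X" by blast
  have "orb {i, j} X = orb {i, j} R" by (rule orb_eq) (use X ij R orb_eq_halves[OF ij R] in auto)
  thus "t : {t : orbits {i}. t <= orb {i, j} R}" using X sub' orb_mono[of "{i}" "{i, j}" X] by (auto simp: orbits_def)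
 qed
qed simp

lemma sum_triangles:
 assumes P: "P <= {..<4}" and c: "c : P"
 shows "(SUM O':orbits P. SUM t | t : orbits {c} & t <= O'. f t) = (SUM t:orbits {c}. f t)"
proof -
 have un: "(UN O':orbits P. {t. t : orbits {c} & t <= O'}) = orbits {c}"
 proof (intro equalityI subsetI)
  fix t assume "t : orbits {c}"
  then obtain X where X: "X : TT" "t = orb {c} X" by (auto simp: orbits_def)
  thus "t : (UN O':orbits P. {t. t : orbits {c} & t <= O'})" using orb_mono[of "{c}" P X] c X by (auto simp: orbits_def)
 qed auto
 have ne: "t ~= {}" if "t : orbits {c}" for t using that orb_refl by (auto simp: orbits_def)
 have "(SUM t:(UN O':orbits P. {t. t : orbits {c} & t <= O'}). f t) =
   (SUM O':orbits P. SUM t | t : orbits {c} & t <= O'. f t)"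
 proof (rule sum.UNION_disjoint)
  show "ALL O1:orbits P. ALL O2:orbits P. O1 ~= O2 -->
    {t. t : orbits {c} & t <= O1} Int {t. t : orbits {c} & t <= O2} = {}"
  proof (intro ballI impI, rule ccontr)
   fix O1 O2 assume O12: "O1 : orbits P" "O2 : orbits P" "O1 ~= O2"
    and "{t. t : orbits {c} & t <= O1} Int {t. t : orbits {c} & t <= O2} ~= {}"
   then obtain t where "t : orbits {c}" "t <= O1" "t <= O2" by blast
   then obtain x where "x : O1" "x : O2" using ne by blast
   thus False using orbits_disjoint[OF P O12(1,2)] O12(3) by blast
  qed
 qed (use finite_orbits in auto)
 thus ?thesis unfolding un by simp
qed

lemma transport_triangles:
 fixes zi zj :: "'t set => 'h::ab_group_add"
 assumes ij: "i < 4" "j < 4" and R: "R : TT"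
 shows "transport i j (%X. zi (orb {i} X)) (%X. zj (orb {j} X)) R (period i j R) =
  (SUM t | t : orbits {i} & t <= orb {i, j} R. zi t) + (SUM t | t : orbits {j} & t <= orb {i, j} R. zj t)"
proof -
 let ?f = "%X. zi (orb {i} X)" and ?g = "%X. zj (orb {j} X)"
 have t: "transport i j ?f ?g R n = (SUM s<n. ?f (sg j ((rot i j ^^ s) R))) + (SUM s<n. ?g ((rot i j ^^ s) R))" for n
  by (induction n) (simp_all add: transport.simps[OF ij] ac_simps)
 have "(SUM s<period i j R. ?g ((rot i j ^^ s) R)) = (SUM X:half i j R. ?g X)"
  unfolding half_def by (subst sum.reindex[OF rot_inj_on[OF ij R]]) simp
 moreover have "(SUM s<period i j R. ?f (sg j ((rot i j ^^ s) R))) = (SUM X:sg j ` half i j R. ?f X)"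
 proof -
  have "inj_on (%s. sg j ((rot i j ^^ s) R)) {..<period i j R}"
   using rot_inj_on[OF ij R] sg_sg[OF ij(2)] unfolding inj_on_def by metis
  thus ?thesis unfolding half_def image_image by (subst sum.reindex) auto
 qed
 ultimately show ?thesis
  unfolding t sum_triangles_i[OF ij R] sum_triangles_j[OF ij R] by simp
qed

text \<open>The link of a vertex is a closed surface without nontrivial double covering, so its Euler
  characteristic is at least two. In terms of cochains with two values on the dual graph, whose
  nodes are the tetrahedra: a cocycle is a coboundary, which leaves at most \<open>2 ^ (card TT - 1)\<close>
 cocycles, and the values of the differential add up to zero.\<close>

lemma euler_vertex:
 assumes i: "i < 4" "j < 4" "l < 4" and dist: "i ~= j" "i ~= l" "j ~= l"
  and V: "!!z :: nat => 't => bit. (!!c d. c : {i, j, l} ==> d : {i, j, l} ==> c ~= d ==>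
     EX w. ALL T:TT. w (sg c T) = z c T + w T & w (sg d T) = z d T + w T) ==>
   EX u. ALL T:TT. ALL c:{i, j, l}. u (sg c T) = z c T + u T"
 shows "card TT + 4 <= 2 * (card (orbits {i, j}) + card (orbits {i, l}) + card (orbits {j, l}))"
proof -
 define C where "C = {i, j, l}"
 have C4: "c < 4" if "c : C" for c using that i by (auto simp: C_def)
 define PP where "PP = {{i, j}, {i, l}, {j, l}}"
 have PPC: "P <= {..<4}" if "P : PP" for P using that i by (auto simp: PP_def)
 define EE where "EE = (SIGMA c:C. orbits {c})"
 define VV where "VV = (SIGMA P:PP. orbits P)"
 have finE: "finite EE" and finV: "finite VV" using finite_orbits by (auto simp: EE_def VV_def C_def PP_def)
 have "2 * card EE = (SUM c:C. 2 * card (orbits {c}))" by (simp add: EE_def C_def finite_orbits sum_distrib_left)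
 also have "... = (SUM c:C. card TT)" by (rule sum.cong) (use C4 card_orbits_single in auto)
 also have "... = 3 * card TT" using dist by (simp add: C_def)
 finally have cardE: "2 * card EE = 3 * card TT" .
 have PPd: "{i, j} ~= {i, l}" "{i, j} ~= {j, l}" "{i, l} ~= {j, l}" using dist by auto
 have cardV: "card VV = card (orbits {i, j}) + card (orbits {i, l}) + card (orbits {j, l})"
  using PPd by (simp add: VV_def PP_def finite_orbits)
 obtain T0 where T0: "T0 : TT" using nonempty_TT by blast
 have V0: "EX v. v : VV" using T0 by (auto simp: VV_def PP_def orbits_def)
 define zz :: "(nat \<times> 't set) set => nat => 't set => bit" where "zz S c t = of_bool ((c, t) : S)" for S c t
 define hol where "hol S x = (SUM c:fst x. SUM t | t : orbits {c} & t <= snd x. zz S c t)" for S x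
 define D where "D S = {x : VV. hol S x = 1}" for S
 define dl where "dl U = {(c, orb {c} T) |c T. c : C & T : TT & (T : U) ~= (sg c T : U)}" for U
 have even_D: "even (card (D S))" for S
 proof -
  have "(SUM x:VV. hol S x) = (SUM P:PP. SUM O':orbits P. hol S (P, O'))"
   unfolding VV_def by (subst sum.Sigma) (auto simp: PP_def finite_orbits)
  also have "... = (SUM P:PP. SUM c:P. SUM t:orbits {c}. zz S c t)"
  proof (rule sum.cong[OF refl])
   fix P assume P: "P : PP"
   have "(SUM O':orbits P. hol S (P, O')) = (SUM c:P. SUM O':orbits P. SUM t | t : orbits {c} & t <= O'. zz S c t)"
    unfolding hol_def fst_conv snd_conv by (rule sum.swap)
   also have "... = (SUM c:P. SUM t:orbits {c}. zz S c t)" by (rule sum.cong[OF refl]) (rule sum_triangles[OF PPC[OF P]])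
   finally show "(SUM O':orbits P. hol S (P, O')) = (SUM c:P. SUM t:orbits {c}. zz S c t)" .
  qed
  also have "... = 0" unfolding PP_def sum_over_pairs[OF dist] by simp
  finally have "(SUM x:VV. hol S x) = 0" .
  moreover have "(SUM x:VV. hol S x) = of_nat (card (D S))"
  proof -
   have "(SUM x:VV. hol S x) = (SUM x:VV. if hol S x = 1 then 1 else 0)" by (rule sum.cong) (auto)
   also have "... = (SUM x:D S. 1)" unfolding D_def by (rule sum.inter_filter[symmetric, OF finV])
   finally show ?thesis by simp
  qed
  moreover have "(of_nat n :: bit) = of_bool (odd n)" for n by (induction n) auto
  ultimately show ?thesis by auto
 qed
 have zz_sym: "zz (sym_diff S S') c t = zz S c t + zz S' c t" for S S' c t by (auto simp: zz_def)
 have hol_sym: "hol (sym_diff S S') x = hol S x + hol S' x" for S S' x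
  unfolding hol_def zz_sym by (simp only: sum.distrib)
 have ker: "EX U. U <= TT & S = dl U" if S: "S <= EE" and DS: "D S = {}" for S
 proof -
  have h0: "hol S x = 0" if "x : VV" for x using that DS by (fastforce simp: D_def)
  define z where "z c T = zz S c (orb {c} T)" for c T
  have "EX w. ALL T:TT. w (sg c T) = z c T + w T & w (sg d T) = z d T + w T"
   if c: "c : {i, j, l}" and d: "d : {i, j, l}" and cd: "c ~= d" for c d
  proof -
   have c4: "c < 4" "d < 4" using c d C4 by (auto simp: C_def)
   have P: "{c, d} : PP" using c d cd by (auto simp: PP_def)
   have zs: "z e (sg e T) = - z e T" if "e < 4" "T : TT" for e T
    unfolding z_def using orb_sg[of T "{e}" e] that by simp
   have "EX w. ALL T:TT. w (sg d T) = z d T + w T & w (sg c T) = z c T + w T"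
   proof (rule potential_exists[OF c4])
    fix T assume T: "T : TT"
    show "z c (sg c T) = - z c T" "z d (sg d T) = - z d T" using zs c4 T by auto
    have "transport c d (z c) (z d) T (period c d T) = hol S ({c, d}, orb {c, d} T)"
     unfolding z_def transport_triangles[OF c4 T] hol_def using cd by simp
    also have "... = 0" by (rule h0) (use P T in "auto simp: VV_def orbits_def")
    finally show "EX R:orb {c, d} T. transport c d (z c) (z d) R (period c d R) = 0" using orb_refl by blast
   qed
   thus ?thesis by blast
  qed
  then obtain u where u: "ALL T:TT. ALL c:C. u (sg c T) = z c T + u T" using V[of z] unfolding C_def by blast
  have "S = dl {T : TT. u T = 1}"
  proof -
   have iff: "(c, orb {c} T) : S \<longleftrightarrow> (T : {T : TT. u T = 1}) ~= (sg c T : {T : TT. u T = 1})"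
    if "c : C" "T : TT" for c T
   proof -
    show ?thesis using u that sg_in[OF C4[OF that(1)] that(2)] by (auto simp: z_def zz_def)
   qed
   show ?thesis using S iff by (fastforce simp: EE_def orbits_def dl_def)
  qed
  thus ?thesis by (intro exI[of _ "{T : TT. u T = 1}"]) auto
 qed
 have img: "EX U'. U' <= TT - {T0} & dl U = dl U'" if U: "U <= TT" for U
 proof (cases "T0 : U")
  case True
  have "dl U = dl (TT - U)"
  proof -
   have "(T : U) ~= (sg c T : U) \<longleftrightarrow> (T : TT - U) ~= (sg c T : TT - U)" if "c : C" "T : TT" for c T
    using sg_in[OF C4[OF that(1)] that(2)] that(2) by blast
   thus ?thesis unfolding dl_def by blast
  qed
  thus ?thesis using True by auto
 qed (use U in blast)
 define r where "r X = (SOME S. S <= EE & D S = X)" for X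
 have r: "r (D S) <= EE & D (r (D S)) = D S" if "S <= EE" for S
  unfolding r_def by (rule someI_ex) (use that in blast)
 let ?F = "%S. (D S, sym_diff S (r (D S)))"
 let ?even = "{X. X <= VV & even (card X)}"
 have inj: "inj_on ?F (Pow EE)" by (auto intro!: inj_onI)
 have ran: "?F ` Pow EE <= ?even \<times> dl ` Pow (TT - {T0})"
 proof
  fix y assume "y : ?F ` Pow EE"
  then obtain S where S: "S <= EE" "y = ?F S" by blast
  have "D (sym_diff S (r (D S))) = {}" using r[OF S(1)] by (auto simp: D_def hol_sym)
  moreover have "sym_diff S (r (D S)) <= EE" using S r[OF S(1)] by blast
  ultimately obtain U where "U <= TT" "sym_diff S (r (D S)) = dl U" using ker by metis
  then obtain U' where "U' <= TT - {T0}" "sym_diff S (r (D S)) = dl U'" using img by metis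
  hence "sym_diff S (r (D S)) : dl ` Pow (TT - {T0})" by blast
  moreover have "D S : ?even" using even_D by (auto simp: D_def)
  ultimately show "y : ?even \<times> dl ` Pow (TT - {T0})" using S(2) by blast
 qed
 have fin: "finite (?even \<times> dl ` Pow (TT - {T0}))" using finV finite_TT by auto
 have "card (Pow EE) <= card (?even \<times> dl ` Pow (TT - {T0}))" by (rule card_inj_on_le[OF inj ran fin])
 also have "... = card ?even * card (dl ` Pow (TT - {T0}))" by (rule card_cartesian_product)
 also have "... <= 2 ^ (card VV - 1) * 2 ^ (card TT - 1)"
 proof (rule mult_mono)
  show "card ?even <= 2 ^ (card VV - 1)" using V0 card_even_subsets_le[OF finV] by blast
  have "card (dl ` Pow (TT - {T0})) <= card (Pow (TT - {T0}))" by (rule card_image_le) (use finite_TT in simp)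
  thus "card (dl ` Pow (TT - {T0})) <= 2 ^ (card TT - 1)" using finite_TT T0 by (simp add: card_Pow)
 qed auto
 finally have "(2::nat) ^ card EE <= 2 ^ (card VV - 1 + (card TT - 1))" using finE by (simp add: card_Pow power_add)
 hence "card EE <= card VV - 1 + (card TT - 1)" by simp
 moreover have "0 < card VV" "0 < card TT" using V0 finV T0 finite_TT card_gt_0_iff by blast+
 ultimately show ?thesis using cardE cardV by arith
qed

end

section \<open>Gems with a cocycle in the fundamental group\<close>

text \<open>The elements \<open>h a b T\<close> of the deck group compare the sections over the stars of the vertices \<open>a\<close> and \<open>b\<close>
  in the tetrahedron \<open>T\<close>; \<open>h_inv\<close> says that they depend only on the edge from \<open>a\<close> to \<open>b\<close>.\<close>

locale gem_cocycle = gem TT sg + G: group G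
 for TT :: "'t set" and sg and G :: "('g, 'more) monoid_scheme" (structure) +
 fixes h :: "nat => nat => 't => 'g" and T0 :: 't
 assumes T0: "T0 : TT"
  and h_in: "a < 4 ==> b < 4 ==> T : TT ==> h a b T : carrier G"
  and h_comp: "a < 4 ==> b < 4 ==> c < 4 ==> T : TT ==> h b c T \<otimes> h a b T = h a c T"
  and h_inv: "a < 4 ==> b < 4 ==> c < 4 ==> c ~= a ==> c ~= b ==> T : TT ==> h a b (sg c T) = h a b T"
  and h_T0: "a < 4 ==> b < 4 ==> h a b T0 = \<one>"
  and one_vertex: "c < 4 ==> T : TT ==> orb ({..<4} - {c}) T = TT"
  and h_generates: "subgroup H G ==> (!!a b T. a < 4 ==> b < 4 ==> T : TT ==> h a b T : H) ==> H = carrier G"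
  and card_TT: "card TT + 4 <= card (orbits {0,1}) + card (orbits {0,2}) + card (orbits {0,3})
    + card (orbits {1,2}) + card (orbits {1,3}) + card (orbits {2,3})"
begin

lemma h_self: "a < 4 ==> T : TT ==> h a a T = \<one>" using h_comp[of a a a T] h_in[of a a T] by (simp add: G.l_cancel_one)

lemma h_swap: "a < 4 ==> b < 4 ==> T : TT ==> h b a T = inv (h a b T)"
 using h_comp[of a b a T] h_self h_in G.inv_equality[of "h b a T" "h a b T"] by simp

text \<open>For a third colour \<open>k\<close> move \<open>T\<close> by the three involutions other than that of \<open>k\<close>, which act transitively. They preserve \<open>h i k\<close>
  except for \<open>sg i\<close>, which preserves \<open>h j k\<close> and so changes \<open>h i k\<close> by elements of \<open>H\<close>. As \<open>h i k T0\<close> is trivial, \<open>H\<close> contains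
  all \<open>h i k T\<close>, and with them all labels.\<close>

lemma generated_by_one_pair:
 assumes ij: "i < 4" "j < 4" "i ~= j" and H: "subgroup H G" and hH: "!!T. T : TT ==> h i j T : H"
 shows "H = carrier G"
proof (rule h_generates[OF H])
 have ik: "h i k T : H" if k: "k < 4" and T: "T : TT" for k T
 proof -
  consider "k = j" | "k = i" | "k ~= i" "k ~= j" by blast
  thus ?thesis
  proof cases
   case 1 thus ?thesis using hH T by simp
  next
   case 2 thus ?thesis using h_self[OF ij(1) T] subgroup.one_closed[OF H] by simp
  next
   case 3
   have "T : orb ({..<4} - {k}) T0" using one_vertex[OF k T0] T by simp
   have "{..<4} - {k} <= {..<4}" by auto
   with `T : orb ({..<4} - {k}) T0` T0 show ?thesis
   proof (induction rule: orb_induct)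
    case base show ?case using h_T0[OF ij(1) k] subgroup.one_closed[OF H] by simp
   next
    case (step S c)
    have c: "c < 4" "c ~= k" using step by auto
    show ?case
    proof (cases "c = i")
     case False thus ?thesis using h_inv[of i k c S] ij k step by simp
    next
     case True
     have S': "sg i S : TT" using sg_in ij step by simp
     have "h j k (sg i S) = h j k S" using h_inv[of j k i S] ij k 3 step by simp
     also have "... = h i k S \<otimes> inv (h i j S)"
      using h_comp[of i j k S, symmetric] h_in[of j k S] h_in[of i j S] ij k step(1) by (simp add: G.m_assoc)
     finally have "h i k (sg i S) = h i k S \<otimes> inv (h i j S) \<otimes> h i j (sg i S)"
      using h_comp[of i j k "sg i S"] ij k S' by simp
     moreover have "h i k S \<otimes> inv (h i j S) \<otimes> h i j (sg i S) : H"
      using H step hH[OF S'] hH[of S] by (simp add: subgroup.m_closed subgroup.m_inv_closed)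
     ultimately show ?thesis using True by simp
    qed
   qed
  qed
 qed
 fix a b :: nat and T assume a: "a < 4" "b < 4" "T : TT"
 show "h a b T : H" using h_comp[of a i b T] h_swap[of i a T] ij a H ik by (metis subgroup.m_closed subgroup.m_inv_closed)
qed

end

text \<open>A quadruple of distinct colours; \<open>{i, j}\<close>-orbits are the edges of the triangulation with
  end points \<open>k\<close> and \<open>l\<close>.\<close>

definition colours :: "nat => nat => nat => nat => bool" where
 "colours i j k l \<longleftrightarrow> i < 4 & j < 4 & k < 4 & l < 4 & distinct [i, j, k, l]"

lemma colours_swap: "colours i j k l ==> colours k l i j" by (auto simp: colours_def)

context gem
begin

text \<open>Walking round the edge \<open>orb {i, j} T\<close> one meets the edges opposite to it alternately on two sides;
  \<open>sides i j T e\<close> counts how often \<open>e\<close> occurs, with a sign for the side.\<close>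

definition sides :: "nat => nat => 't => 't set => int" where
 "sides i j T e = int (card (half i j T Int e)) - int (card (sg j ` half i j T Int e))"

lemma sum_by_orbit:
 fixes f :: "'t => 'b::comm_ring_1"
 assumes C: "C <= {..<4}" and A: "A <= TT" and f: "!!e X. e : orbits C ==> X : e ==> f X = F e"
 shows "sum f A = (SUM e:orbits C. of_nat (card (A Int e)) * F e)"
proof -
 have "A = (UN e:orbits C. A Int e)" using Union_orbits[OF C] A by auto
 hence "sum f A = sum f (UN e:orbits C. A Int e)" by simp
 also have "... = (SUM e:orbits C. sum f (A Int e))" by (rule sum.UNION_disjoint)
   (use finite_orbits finite_subset[OF A finite_TT] orbits_disjoint[OF C] in "simp_all add: disjoint_iff, blast")
 also have "... = (SUM e:orbits C. of_nat (card (A Int e)) * F e)" by (rule sum.cong[OF refl]) (use f in simp)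
 finally show ?thesis .
qed

lemma sum_halves_by_orbit:
 fixes f :: "'t => 'b::comm_ring_1"
 assumes ij: "i < 4" "j < 4" and C: "C <= {..<4}" and T: "T : TT"
  and f: "!!e X. e : orbits C ==> X : e ==> f X = F e"
 shows "sum f (half i j T) - sum f (sg j ` half i j T) = (SUM e:orbits C. of_int (sides i j T e) * F e)"
proof -
 have A: "half i j T <= TT" "sg j ` half i j T <= TT" using half_subset[OF ij T] sg_in[OF ij(2)] by auto
 have "sum f (half i j T) = (SUM e:orbits C. of_nat (card (half i j T Int e)) * F e)" by (rule sum_by_orbit[OF C A(1) f])
 moreover have "sum f (sg j ` half i j T) = (SUM e:orbits C. of_nat (card (sg j ` half i j T Int e)) * F e)"
  by (rule sum_by_orbit[OF C A(2) f])
 ultimately show ?thesis by (simp only: sum_subtractf[symmetric] sides_def left_diff_distrib of_int_diff of_int_of_nat_eq)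
qed

lemma sum_sides:
 assumes ij: "i < 4" "j < 4" and C: "C <= {..<4}" and T: "T : TT"
 shows "(SUM e:orbits C. sides i j T e) = 0"
proof -
 have "sum (%X. 1) (half i j T) - sum (%X. 1::int) (sg j ` half i j T) = (SUM e:orbits C. of_int (sides i j T e) * 1)"
  by (rule sum_halves_by_orbit[OF ij C T]) simp
 thus ?thesis by (simp add: card_sg_half[OF ij])
qed

lemma card_orb_Int:
 assumes ij: "i < 4" "j < 4" and T: "T : TT"
 shows "card (orb {i, j} T Int e) = card (half i j T Int e) + card (sg j ` half i j T Int e)"
proof -
 have "orb {i, j} T Int e = (half i j T Int e) Un (sg j ` half i j T Int e)" using orb_eq_halves[OF ij T] by auto
 thus ?thesis using half_disjoint[OF ij T] finite_half[OF ij, of T] by (simp add: card_Un_disjoint disjoint_iff)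
qed

lemma card_half_Int_le:
 assumes ij: "i < 4" "j < 4" and T: "T : TT"
 shows "card (half i j T Int e) <= period i j T" "card (sg j ` half i j T Int e) <= period i j T"
 using card_mono[OF finite_half[OF ij], of "half i j T Int e" T]
  card_mono[OF finite_imageI[OF finite_half[OF ij]], of "sg j ` half i j T Int e" "sg j" T]
  card_half[OF ij T] card_sg_half[OF ij, of T] by auto

lemma mem_orbit_iff:
 assumes "C <= {..<4}" "e' : orbits C" "e : orbits C" "X : e'"
 shows "X : e \<longleftrightarrow> e' = e" using orbits_disjoint[OF assms(1-3,4)] assms(4) by blast

lemma orbits_label:
 assumes "C <= {..<4}" "e : orbits C" "X : e"
 shows "X : TT" "orb C X = e"
proof -
 obtain Y where Y: "Y : TT" "e = orb C Y" using assms(2) by (auto simp: orbits_def)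
 show "X : TT" using orb_subset[OF Y(1) assms(1)] assms(3) Y by auto
 show "orb C X = e" using orb_eq[OF _ Y(1) assms(1)] assms(3) Y(2) by simp
qed

end

context gem_cocycle
begin

lemma h_orbit:
 assumes c: "colours i j k l" and e: "e : orbits {k, l}" and X: "X : e" "Y : e"
 shows "h i j X = h i j Y"
proof -
 have C: "{k, l} <= {..<4}" using c by (auto simp: colours_def)
 note l = orbits_label[OF C e]
 have "X : orb {k, l} Y" using l[OF X(2)] X by simp
 from orb_const[OF this l(1)[OF X(2)] C, of "h i j"] show ?thesis using c h_inv by (auto simp: colours_def)
qed

text \<open>Round an edge from \<open>k\<close> to \<open>l\<close> the labels \<open>h i k\<close> and \<open>h j k\<close> are alternately constant, and the quotient of two successive
  ones is a label of an opposite edge. This yields a relation between the labels of the opposite edges.\<close>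

lemma h_around:
 assumes c: "colours i j k l"
 shows "!!T. T : TT ==> h i k (sg j T) = h i k T" "!!T. T : TT ==> h j k (sg i T) = h j k T"
  "!!T. T : TT ==> h i k T = h j k T \<otimes> h i j T" using c h_inv h_comp by (auto simp: colours_def)

end

text \<open>The numerical extremal case: every pair of vertices is joined by \<open>r + 1\<close> edges.\<close>

locale extremal_gem = gem_cocycle +
 fixes r :: nat
 assumes edges: "colours i j k l ==> card (orbits {i, j}) = r + 1"
begin

lemma card_TT_le: "card TT <= 6 * r + 2"
proof -
 show ?thesis
  using edges[of 0 1 2 3] edges[of 0 2 1 3] edges[of 0 3 1 2] edges[of 1 2 0 3] edges[of 1 3 0 2] edges[of 2 3 0 1] card_TT
  by (simp add: colours_def)
qed

lemma sum_card_edges: "colours i j k l ==> (SUM e:orbits {i, j}. card e) <= 6 * r + 2"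
 using sum_card_orbits[of "{i, j}"] card_TT_le by (auto simp: colours_def)

lemma card_edge_even:
 assumes "colours i j k l" "e : orbits {i, j}"
 shows "even (card e)" "2 <= card e"
proof -
 obtain T where T: "T : TT" "e = orb {i, j} T" using assms by (auto simp: orbits_def)
 have ij: "i < 4" "j < 4" using assms by (auto simp: colours_def)
 show "even (card e)" "2 <= card e" using card_orb[OF ij T(1)] T period_props(1)[OF ij T(1)] by auto
qed

end

section \<open>Lens spaces\<close>

text \<open>The hypothesis \<open>real_label\<close> is what the covering by the sphere contributes: a real function of the edges from \<open>i\<close> to \<open>j\<close>
  that can be integrated round the opposite edges is constant.\<close>

locale lens_gem = extremal_gem TT sg "integer_mod_group p" h T0 1 for TT :: "'t set" and sg and p :: nat and h T0 +
 assumes p: "3 <= p"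
  and real_label: "colours i j k l ==> (!!T. T : TT ==> c (sg k T) = c T & c (sg l T) = c T) ==>
   (EX w. ALL T:TT. w (sg j T) = w T & w (sg i T) = c (sg i T) - c T + w T) ==>
   T : TT ==> T' : TT ==> (c :: 't => real) T = c T'"
begin

text \<open>Here \<open>r = 1\<close>: there are at most \<open>8\<close> tetrahedra, and between any two vertices there are two edges, whose labels differ
  by a generator of the cyclic group. The relation round an opposite edge therefore makes the signed multiplicity \<open>sides\<close>
 divisible by \<open>p\<close>. If it were always zero, the indicator function of one of the two edges could be integrated without being
 constant. So on one of the two cycles it is at least \<open>3\<close> in absolute value; this leaves only two tetrahedra for the other
 cycle, and the number of tetrahedra round \<open>e1\<close> would be odd.\<close>

lemma not_extremal: False
proof -
 have co: "colours 0 1 2 3" "colours 2 3 0 1" by (simp_all add: colours_def)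
 have ij: "(0::nat) < 4" "(1::nat) < 4" by simp_all
 have C: "{2, 3} <= {..<4::nat}" "{0, 1} <= {..<4::nat}" by auto
 have carr: "carrier (integer_mod_group p) = {0..<int p}" using p by (simp add: carrier_integer_mod_group)
 let ?h = "h 0 1"
 obtain e1 e2 where e: "orbits {2, 3} = {e1, e2}" "e1 ~= e2"
 proof -
  have "card (orbits {2, 3}) = 2" using edges[OF co(2)] by simp
  thus thesis using that unfolding card_2_iff by blast
 qed
 have e1: "e1 : orbits {2, 3}" and e2: "e2 : orbits {2, 3}" using e by auto
 obtain Y1 Y2 where Y: "Y1 : e1" "Y2 : e2" using e1 e2 orb_refl by (auto simp: orbits_def)
 have YT: "Y1 : TT" "Y2 : TT" using orbits_label(1)[OF C(1)] e1 e2 Y by auto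
 have Y1n: "Y1 ~: e2" using orbits_disjoint[OF C(1) e1 e2 Y(1)] e(2) by blast
 define x where "x = ?h Y1 - ?h Y2"
 \<comment> \<open>the two labels differ by a generator\<close>
 have "coprime x (int p)"
 proof -
  define d where "d = gcd x (int p)"
  have d0: "d dvd int p" by (simp add: d_def)
  have lab: "?h T = ?h Y1 | ?h T = ?h Y2" if T: "T : TT" for T
   using T Union_orbits[OF C(1)] e(1) h_orbit[OF co(1) e1 _ Y(1)] h_orbit[OF co(1) e2 _ Y(2)] by auto
  have dh: "d dvd ?h T" if T: "T : TT" for T using h_T0[of 0 1] T lab[OF T] lab[OF T0] by (auto simp: d_def x_def)
  have sub: "subgroup {y : {0..<int p}. d dvd y} (integer_mod_group p)"
   using p carr d0 by (auto simp: mod_simps dvd_mod carr intro!: G.subgroupI)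
  have "{y : {0..<int p}. d dvd y} = carrier (integer_mod_group p)"
   by (rule generated_by_one_pair[OF _ _ _ sub, of 0 1]) (use dh h_in[of 0 1] carr in auto)
  moreover have "1 : carrier (integer_mod_group p)" using p by simp
  ultimately have "1 : {y : {0..<int p}. d dvd y}" by simp
  thus ?thesis by (simp add: d_def coprime_iff_gcd_eq_1)
 qed
 have sides2: "sides 0 1 T e2 = - sides 0 1 T e1" if "T : TT" for T using sum_sides[OF ij C(1) that] e by simp
 have dvd: "int p dvd sides 0 1 T e1" if T: "T : TT" for T
 proof -
  have A: "half 0 1 T <= TT" "sg 1 ` half 0 1 T <= TT" using half_subset[OF ij T] sg_in[OF ij(2)] by auto
  define f where "f X = h 0 2 X - h 1 2 X - ?h X" for X
  have "int p dvd f X" if "X : TT" for X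
  proof -
   have "h 0 2 X = (h 1 2 X + ?h X) mod int p" using h_around(3)[OF co(1) that] by simp
   thus ?thesis unfolding f_def by (metis diff_diff_eq dvd_minus_mod dvd_diff_commute)
  qed
  hence "int p dvd sum f (half 0 1 T) - sum f (sg 1 ` half 0 1 T)" using A by (intro dvd_diff dvd_sum) auto
  also have "sum f (half 0 1 T) - sum f (sg 1 ` half 0 1 T) = - (sum ?h (half 0 1 T) - sum ?h (sg 1 ` half 0 1 T))"
   unfolding f_def sum_subtractf
   using sum_half_sg_j[OF ij T, of "h 0 2"] sum_half_sg_i[OF ij T, of "h 1 2"] h_around[OF co(1)] by simp
  also have "sum ?h (half 0 1 T) - sum ?h (sg 1 ` half 0 1 T) =
    (SUM e:orbits {2, 3}. of_int (sides 0 1 T e) * (if e = e1 then ?h Y1 else ?h Y2))"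
   by (rule sum_halves_by_orbit[OF ij C(1) T])
    (use e h_orbit[OF co(1) e1 _ Y(1)] h_orbit[OF co(1) e2 _ Y(2)] in auto)
  also have "... = sides 0 1 T e1 * x" using e sides2[OF T] by (simp add: x_def algebra_simps)
  finally have "int p dvd sides 0 1 T e1 * x" by simp
  thus ?thesis using \<open>coprime x (int p)\<close> by (simp add: coprime_commute coprime_dvd_mult_left_iff)
 qed
 have "EX T:TT. sides 0 1 T e1 ~= 0"
 proof (rule ccontr)
  assume "~ (EX T:TT. sides 0 1 T e1 ~= 0)"
  hence s0: "sides 0 1 T e1 = 0" if "T : TT" for T using that by blast
  define c :: "'t => real" where "c X = of_bool (X : e1)" for X
  have hol: "holonomy 0 1 c T = 0" if T: "T : TT" for T
  proof -
   have "holonomy 0 1 c T = (SUM e:orbits {2, 3}. of_int (sides 0 1 T e) * of_bool (e = e1))"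
    unfolding holonomy_abelian[OF ij T]
    by (rule sum_halves_by_orbit[OF ij C(1) T]) (simp add: c_def mem_orbit_iff[OF C(1) _ e1])
   thus ?thesis using e s0[OF T] by simp
  qed
  have "c Y1 = c Y2"
  proof (rule real_label[OF co(1) _ _ YT])
   show "c (sg 2 T) = c T & c (sg 3 T) = c T" if T: "T : TT" for T
   proof -
    have "sg d T : e1 \<longleftrightarrow> T : e1" if d: "d : {2, 3}" for d
     using orbits_label(2)[OF C(1) e1] orb_refl orb_sg[OF T C(1) d] by blast
    thus ?thesis by (simp add: c_def)
   qed
   show "EX w. ALL T:TT. w (sg 1 T) = w T & w (sg 0 T) = c (sg 0 T) - c T + w T"
    by (rule label_potential_exists[OF ij]) (use hol orb_refl in blast)
  qed
  moreover have "Y2 ~: e1" using orbits_disjoint[OF C(1) e2 e1 Y(2)] e(2) by blast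
  ultimately show False using Y by (simp add: c_def)
 qed
 then obtain T where T: "T : TT" "sides 0 1 T e1 ~= 0" by blast
 let ?O = "orb {0, 1} T"
 have O: "?O : orbits {0, 1}" using T by (auto simp: orbits_def)
 obtain O' where O': "orbits {0, 1} = {?O, O'}" "?O ~= O'"
 proof -
  have "card (orbits {0, 1} - {?O}) = 1" using edges[OF co(1)] O by simp
  then obtain O' where "orbits {0, 1} - {?O} = {O'}" by (rule card_1_singletonE)
  hence "orbits {0, 1} = {?O, O'}" "?O ~= O'" using O by auto
  thus thesis by (rule that)
 qed
 hence O'in: "O' : orbits {0, 1}" by auto
 then obtain T' where T': "T' : TT" "O' = orb {0, 1} T'" by (auto simp: orbits_def)
 have pp: "period 0 1 T + period 0 1 T' <= 4"
  using sum_card_edges[OF co(1)] O' card_orb[OF ij T(1)] card_orb[OF ij T'(1)] T' by simp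
 have pos: "0 < period 0 1 T'" using period_props(1)[OF ij T'(1)] .
 note le = card_half_Int_le[OF ij T(1), of e1] and le' = card_half_Int_le[OF ij T'(1), of e1]
 have "card (half 0 1 T Int e1) + card (sg 1 ` half 0 1 T Int e1) = 3" and p1: "period 0 1 T' = 1"
  using dvd_imp_le_int[OF T(2) dvd[OF T(1)]] le pp pos p by (auto simp: sides_def)
 hence odd: "card (?O Int e1) = 3" using card_orb_Int[OF ij T(1)] by simp
 have "\<bar>sides 0 1 T' e1\<bar> <= 1" using le' p1 unfolding sides_def by linarith
 moreover have "int p <= \<bar>sides 0 1 T' e1\<bar>" if "sides 0 1 T' e1 ~= 0"
  using dvd_imp_le_int[OF that dvd[OF T'(1)]] by simp
 ultimately have "sides 0 1 T' e1 = 0" using p by auto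
 hence "card (O' Int e1) = 2 * card (half 0 1 T' Int e1)"
  using card_orb_Int[OF ij T'(1), of e1] T'(2) unfolding sides_def by simp
 moreover have "card e1 = card (?O Int e1) + card (O' Int e1)"
  using sum_card_orbits_Int[OF C(2) orbits_subset[OF C(1) e1]] O' by simp
 ultimately have "odd (card e1)" using odd by simp
 thus False using card_edge_even(1)[OF co(2) e1] by simp
qed

end

section \<open>The quaternion space\<close>

text \<open>Together \<open>chi1\<close> and \<open>chi2\<close> describe the quotient of \<open>Q8\<close> by its centre, which is the four-group.\<close>

definition chi1 :: "complex \<times> complex => int" where "chi1 q = of_bool (fst q = 0)"
definition chi2 :: "complex \<times> complex => int" where "chi2 q = of_bool (fst q : {\<i>, -\<i>} | snd q : {\<i>, -\<i>})"

lemma i_neq: "\<i> ~= 1" "\<i> ~= -1" "- \<i> ~= 1" "- \<i> ~= -1" "1 ~= \<i>" "-1 ~= \<i>" "1 ~= - \<i>" "-\<i> ~= \<i>" "\<i> ~= -\<i>" "(-1::complex) ~= 1"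
 by (auto simp: complex_eq_iff)

lemma chi_hom:
 assumes "x : Q8" "y : Q8"
 shows "even (chi1 (quat_mult x y) - chi1 x - chi1 y)" "even (chi2 (quat_mult x y) - chi2 x - chi2 y)"
 using assms unfolding Q8_elements by (elim insertE emptyE; simp add: quat_mult_def chi1_def chi2_def i_neq)+

lemma chi_range: "chi1 x : {0, 1}" "chi2 x : {0, 1}" by (auto simp: chi1_def chi2_def)

lemma square_noncentral:
 assumes "x : Q8" "chi1 x ~= 0 | chi2 x ~= 0"
 shows "quat_mult x x = (-1, 0)" using assms unfolding Q8_elements
 by (elim insertE emptyE; simp add: quat_mult_def chi1_def chi2_def i_neq)

lemma Q8_proper_kernel:
 fixes ps :: "complex \<times> complex => int"
 assumes hom: "!!x y. x : Q8 ==> y : Q8 ==> even (ps (quat_mult x y) - ps x - ps y)"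
 shows "subgroup {q : Q8. even (ps q)} Q8_group"
proof -
 interpret group Q8_group by (rule group_Q8)
 have one: "(1, 0) : Q8" by (simp add: Q8_elements)
 have e1: "even (ps (1, 0))" using hom[OF one one] by (simp add: quat_mult_one)
 show ?thesis
 proof (rule subgroupI)
  fix a assume a: "a : {q : Q8. even (ps q)}"
  let ?b = "inv\<^bsub>Q\<^esub> a"
  have ac: "a : carrier Q8_group" using a by (simp add: Q8_group_def)
  have b: "?b : Q8" "quat_mult ?b a = (1, 0)" using inv_closed[OF ac] l_inv[OF ac] by (simp_all add: Q8_group_def)
  show "?b : {q : Q8. even (ps q)}" using hom[OF b(1), of a] a b(2) b(1) e1 by simp
  fix c assume c: "c : {q : Q8. even (ps q)}"
  show "a \<otimes>\<^bsub>Q\<^esub> c : {q : Q8. even (ps q)}"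
   using hom[of a c] a c Q8_mult_closed by (simp add: Q8_group_def)
 qed (use one e1 in "auto simp: Q8_group_def")
qed

lemma parity_system:
 fixes a b :: "'e => int" and s :: "'e => int"
 assumes r: "!!e. a e : {0, 1}" "!!e. b e : {0, 1}"
  and d: "(a e1, b e1) ~= (a e2, b e2)" "(a e1, b e1) ~= (a e3, b e3)" "(a e2, b e2) ~= (a e3, b e3)"
  and s: "s e1 + s e2 + s e3 = 0"
  and p: "even (s e1 * a e1 + s e2 * a e2 + s e3 * a e3)" "even (s e1 * b e1 + s e2 * b e2 + s e3 * b e3)"
 shows "even (s e1)" "even (s e2)" "even (s e3)"
proof -
 have s3: "s e3 = - s e1 - s e2" using s by simp
 have "even (s e1) & even (s e2)"
  using r(1)[of e1] r(1)[of e2] r(1)[of e3] r(2)[of e1] r(2)[of e2] r(2)[of e3] d p unfolding s3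
  by (elim insertE emptyE) auto
 thus "even (s e1)" "even (s e2)" "even (s e3)" unfolding s3 by auto
qed

lemma sum_zero_signs:
 fixes a b c :: int
 assumes "a + b + c = 0" "a ~= 0 | b ~= 0 | c ~= 0"
 shows "(a > 0 & b < 0) | (a > 0 & c < 0) | (b > 0 & a < 0) | (b > 0 & c < 0) | (c > 0 & a < 0) | (c > 0 & b < 0)"
 using assms by presburger

locale Q8_gem = extremal_gem TT sg Q8_group h T0 2 for TT :: "'t set" and sg and h T0 +
 assumes real_label: "colours i j k l ==> (!!T. T : TT ==> c (sg k T) = c T & c (sg l T) = c T) ==>
   (EX w. ALL T:TT. w (sg j T) = w T & w (sg i T) = c (sg i T) - c T + w T) ==>
   T : TT ==> T' : TT ==> (c :: 't => real) T = c T'"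
begin

lemma carrier_Q8: "carrier Q8_group = Q8" and mult_Q8: "mult Q8_group = quat_mult" and one_Q8: "one Q8_group = (1, 0)"
 by (simp_all add: Q8_group_def)

context
 fixes i j k l
 assumes co: "colours i j k l"
begin

lemma ij: "i < 4" "j < 4" and kl: "k < 4" and C: "{k, l} <= {..<4}" "{i, j} <= {..<4}" and ij_ne: "i ~= j"
 using co by (auto simp: colours_def)

lemma h_Q8: "T : TT ==> h i j T : Q8" "T : TT ==> h i k T : Q8" "T : TT ==> h j k T : Q8"
 using h_in ij kl carrier_Q8 by auto

lemma odd_character:
 fixes ps :: "complex \<times> complex => int"
 assumes hom: "!!x y. x : Q8 ==> y : Q8 ==> even (ps (quat_mult x y) - ps x - ps y)"
  and q: "q : Q8" "odd (ps q)"
 shows "EX T:TT. odd (ps (h i j T))"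
proof (rule ccontr)
 assume "~ (EX T:TT. odd (ps (h i j T)))"
 hence "h i j T : {q : Q8. even (ps q)}" if "T : TT" for T using that h_Q8 by blast
 note hk = this
 show False using q carrier_Q8 generated_by_one_pair[OF ij ij_ne Q8_proper_kernel[OF hom] hk] by auto
qed

text \<open>The three labels generate \<open>Q8\<close> and one of them is trivial, so no two can be congruent modulo the centre.\<close>

lemma classes_distinct:
 assumes e: "e1 : orbits {k, l}" "e2 : orbits {k, l}" "e1 ~= e2" and X: "X1 : e1" "X2 : e2"
 shows "(chi1 (h i j X1), chi2 (h i j X1)) ~= (chi1 (h i j X2), chi2 (h i j X2))"
proof
 assume eq: "(chi1 (h i j X1), chi2 (h i j X1)) = (chi1 (h i j X2), chi2 (h i j X2))"
 have "card (orbits {k, l} - {e1, e2}) = 1" using edges[OF colours_swap[OF co]] e finite_orbits by simp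
 then obtain e3 where e3: "orbits {k, l} - {e1, e2} = {e3}" by (auto simp: card_1_singleton_iff)
 hence orb: "orbits {k, l} = {e1, e2, e3}" using e by auto
 hence "e3 : orbits {k, l}" by simp
 then obtain X3 where X3: "X3 : e3" "e3 : orbits {k, l}" using orb_refl by (auto simp: orbits_def)
 have lab: "h i j T = h i j X1 | h i j T = h i j X2 | h i j T = h i j X3" if "T : TT" for T
  using that Union_orbits[OF C(1)] orb h_orbit[OF co e(1) _ X(1)] h_orbit[OF co e(2) _ X(2)] h_orbit[OF co X3(2) _ X3(1)]
  by auto
 \<comment> \<open>only two classes occur, one of them trivial: some nonzero character vanishes on both\<close>
 let ?c = "%T. (chi1 (h i j T), chi2 (h i j T))"
 have "?c T0 = (0, 0)" using h_T0[OF ij] one_Q8 by (simp add: chi1_def chi2_def i_neq)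
 then obtain v where v: "!!T. T : TT ==> ?c T = (0, 0) | ?c T = v" using lab[OF T0] lab eq by metis
 have v01: "v = (0,0) | v = (0,1) | v = (1,0) | v = (1,1) | (ALL T:TT. ?c T = (0, 0))"
 proof (cases "EX T:TT. ?c T = v")
  case True
  then obtain T where "?c T = v" by blast
  thus ?thesis using chi_range[of "h i j T"] by auto
 qed (use v in blast)
 have q: "(0, 1) : Q8" "(\<i>, 0) : Q8" by (auto simp: Q8_elements)
 have o1: "EX T:TT. odd (chi1 (h i j T))" by (rule odd_character[OF chi_hom(1) q(1)]) (simp_all add: chi1_def)
 have o2: "EX T:TT. odd (chi2 (h i j T))" by (rule odd_character[OF chi_hom(2) q(2)]) (simp_all add: chi2_def)
 have o3: "EX T:TT. odd (chi1 (h i j T) + chi2 (h i j T))"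
 proof (rule odd_character[of "%q. chi1 q + chi2 q", OF _ q(1)])
  fix x y assume "x : Q8" "y : Q8"
  hence "even ((chi1 (quat_mult x y) - chi1 x - chi1 y) + (chi2 (quat_mult x y) - chi2 x - chi2 y))" using chi_hom by simp
  thus "even (chi1 (quat_mult x y) + chi2 (quat_mult x y) - (chi1 x + chi2 x) - (chi1 y + chi2 y))" by auto
 qed (simp add: chi1_def chi2_def i_neq)
 show False using v01 o1 o2 o3 v by (elim disjE) fastforce+
qed

text \<open>Modulo the centre, the relation round an opposite edge is a linear system for the multiplicities over the field with two elements,
  and the three classes are in general position.\<close>

lemma sides_even:
 assumes T: "T : TT" and e: "e : orbits {k, l}"
 shows "even (sides i j T e)"
proof -
 have "card (orbits {k, l}) = 3" using edges[OF colours_swap[OF co]] by simp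
 then obtain e1 e2 e3 where E: "orbits {k, l} = {e1, e2, e3}" "e1 ~= e2" "e1 ~= e3" "e2 ~= e3" by (auto simp: card_3_iff)
 define X where "X e = (SOME X. X : e)" for e :: "'t set"
 have X: "X e : e" if "e : orbits {k, l}" for e
  unfolding X_def by (rule someI_ex) (use that orb_refl in "auto simp: orbits_def")
 have par: "even (SUM e:orbits {k, l}. sides i j T e * ps (h i j (X e)))"
  if hom: "!!x y. x : Q8 ==> y : Q8 ==> even (ps (quat_mult x y) - ps x - ps y)" for ps :: "complex \<times> complex => int"
 proof -
  have A: "half i j T <= TT" "sg j ` half i j T <= TT" using half_subset[OF ij T] sg_in[OF ij(2)] by auto
  define f where "f X = ps (h i k X) - ps (h j k X) - ps (h i j X)" for X
  have "2 dvd f X" if "X : TT" for X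
   unfolding f_def h_around(3)[OF co that] mult_Q8 using hom h_Q8 that by simp
  hence "2 dvd sum f (half i j T) - sum f (sg j ` half i j T)" using A by (intro dvd_diff dvd_sum) auto
  also have "sum f (half i j T) - sum f (sg j ` half i j T) =
    - (sum (%X. ps (h i j X)) (half i j T) - sum (%X. ps (h i j X)) (sg j ` half i j T))"
   unfolding f_def sum_subtractf
   using sum_half_sg_j[OF ij T, of "%X. ps (h i k X)"] sum_half_sg_i[OF ij T, of "%X. ps (h j k X)"]
    h_around[OF co] by simp
  also have "sum (%X. ps (h i j X)) (half i j T) - sum (%X. ps (h i j X)) (sg j ` half i j T) =
    (SUM e:orbits {k, l}. of_int (sides i j T e) * ps (h i j (X e)))"
  proof (rule sum_halves_by_orbit[OF ij C(1) T])
   fix e Y assume "e : orbits {k, l}" "Y : e"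
   thus "ps (h i j Y) = ps (h i j (X e))" using h_orbit[OF co _ _ X] by metis
  qed
  finally show ?thesis by simp
 qed
 have E': "e1 : orbits {k, l}" "e2 : orbits {k, l}" "e3 : orbits {k, l}" using E by auto
 note cd = classes_distinct[OF _ _ _ X X]
 have "even (sides i j T e1)" "even (sides i j T e2)" "even (sides i j T e3)"
  by (rule parity_system[of "%e. chi1 (h i j (X e))" "%e. chi2 (h i j (X e))" e1 e2 e3 "sides i j T"];
    use chi_range cd E E' sum_sides[OF ij C(1) T] par[OF chi_hom(1)] par[OF chi_hom(2)] in
    \<open>simp add: add.assoc\<close>)+
 thus ?thesis using e E by auto
qed

text \<open>After one turn round a cycle that carries only the labels \<open>x\<close> and \<open>x'\<close>, the label from \<open>i\<close> to \<open>k\<close> is multiplied by a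
  power of \<open>y = x'\<^sup>-\<^sup>1 x\<close> whose exponent is \<open>sides i j T e\<close> up to sign. It cannot be \<open>2\<close>, because \<open>y\<close> is noncentral and has square \<open>-1\<close>.\<close>

lemma two_labels:
 assumes T: "T : TT" and e: "e : orbits {k, l}" "e' : orbits {k, l}" "e ~= e'"
  and sub: "orb {i, j} T <= e Un e'"
 shows "\<bar>sides i j T e\<bar> ~= 2"
proof
 assume s2: "\<bar>sides i j T e\<bar> = 2"
 obtain X X' where X: "X : e" "X' : e'" using e orb_refl by (auto simp: orbits_def)
 have XT: "X : TT" "X' : TT" using orbits_label(1)[OF C(1)] e X by auto
 let ?x = "h i j X" and ?x' = "h i j X'"
 have xc: "?x : carrier Q8_group" "?x' : carrier Q8_group" using h_Q8 XT carrier_Q8 by auto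
 define y where "y = inv\<^bsub>Q\<^esub> ?x' \<otimes>\<^bsub>Q\<^esub> ?x"
 have yc: "y : carrier Q8_group" unfolding y_def using xc by simp
 have xy: "?x' \<otimes>\<^bsub>Q\<^esub> y = ?x" unfolding y_def using xc by (simp add: G.m_assoc[symmetric])
 have yy: "y \<otimes>\<^bsub>Q\<^esub> y = (-1, 0)"
 proof -
  have "chi1 y ~= 0 | chi2 y ~= 0"
  proof (rule ccontr)
   assume "~ ?thesis"
   hence "even (chi1 ?x - chi1 ?x')" "even (chi2 ?x - chi2 ?x')" using chi_hom[of ?x' y] xy xc yc carrier_Q8 mult_Q8 by auto
   thus False using chi_range[of ?x] chi_range[of ?x'] classes_distinct[OF e X] by fastforce
  qed
  thus ?thesis using square_noncentral[of y] yc carrier_Q8 mult_Q8 by simp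
 qed
 define m :: "'t => int" where "m Y = of_bool (Y : e)" for Y
 have g: "h i j Y = ?x' \<otimes>\<^bsub>Q\<^esub> y [^]\<^bsub>Q\<^esub> m Y" if Y: "Y : orb {i, j} T" for Y
  using Y h_orbit[OF co e(1) _ X(1)] xy yc sub h_orbit[OF co e(2) _ X(2)] xc by (auto simp: m_def)
 let ?tr = "transport i j (%X. m (sg i X) - m X) (%X. 0) T"
 have orbT: "orb {i, j} T <= TT" using orb_subset[OF T C(2)] .
 have rot_orb: "(rot i j ^^ n) T : orb {i, j} T" for n using rot_half[OF ij T] orb_eq_halves[OF ij T] by auto
 have walk: "h i k ((rot i j ^^ n) T) = h i k T \<otimes>\<^bsub>Q\<^esub> y [^]\<^bsub>Q\<^esub> ?tr n" for n
 proof (induction n)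
  case 0 show ?case using h_in[OF ij(1) kl T] by (simp add: transport.simps(1)[OF ij])
 next
  case (Suc n)
  let ?S = "(rot i j ^^ n) T"
  let ?S1 = "sg j ?S" and ?S2 = "(rot i j ^^ Suc n) T"
  have S: "?S : TT" "?S1 : TT" "?S2 : TT" using rot_in[OF ij T, of n] rot_in[OF ij T, of "Suc n"] sg_in[OF ij(2)] by auto
  have So: "?S1 : orb {i, j} T" "?S2 : orb {i, j} T" using orb_step[OF rot_orb[of n] S(1), of j] rot_orb[of "Suc n"] by auto
  have S2: "?S2 = sg i ?S1" by (simp add: rot_def)
  have hc: "h i j ?S1 : carrier Q8_group" "h j k ?S1 : carrier Q8_group" "h i k ?S : carrier Q8_group"
   "h i k T : carrier Q8_group" using h_in ij kl S T by auto
  have "h i k ?S = h j k ?S1 \<otimes>\<^bsub>Q\<^esub> h i j ?S1"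
   using h_around(1)[OF co S(1)] h_around(3)[OF co S(2)] by simp
  hence 1: "h j k ?S1 = h i k ?S \<otimes>\<^bsub>Q\<^esub> inv\<^bsub>Q\<^esub> (h i j ?S1)"
   using hc by (simp add: G.m_assoc)
  have "h i k ?S2 = h j k ?S2 \<otimes>\<^bsub>Q\<^esub> h i j ?S2" by (rule h_around(3)[OF co S(3)])
  also have "h j k ?S2 = h j k ?S1" unfolding S2 by (rule h_around(2)[OF co S(2)])
  also have "... \<otimes>\<^bsub>Q\<^esub> h i j ?S2 =
    h i k ?S \<otimes>\<^bsub>Q\<^esub> (inv\<^bsub>Q\<^esub> (h i j ?S1) \<otimes>\<^bsub>Q\<^esub> h i j ?S2)"
   unfolding 1 using hc h_in[OF ij S(3)] by (simp add: G.m_assoc)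
  also have "inv\<^bsub>Q\<^esub> (h i j ?S1) \<otimes>\<^bsub>Q\<^esub> h i j ?S2 = y [^]\<^bsub>Q\<^esub> (m ?S2 - m ?S1)"
  proof -
   let ?p = "y [^]\<^bsub>Q\<^esub> m ?S1" and ?p' = "y [^]\<^bsub>Q\<^esub> m ?S2"
   have pc: "?p : carrier Q8_group" "?p' : carrier Q8_group" using yc by auto
   have "inv\<^bsub>Q\<^esub> (?x' \<otimes>\<^bsub>Q\<^esub> ?p) \<otimes>\<^bsub>Q\<^esub> (?x' \<otimes>\<^bsub>Q\<^esub> ?p') =
     inv\<^bsub>Q\<^esub> ?p \<otimes>\<^bsub>Q\<^esub> (inv\<^bsub>Q\<^esub> ?x' \<otimes>\<^bsub>Q\<^esub> ?x') \<otimes>\<^bsub>Q\<^esub> ?p'"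
    using pc xc(2) by (simp only: G.inv_mult_group G.m_assoc G.inv_closed G.m_closed)
   also have "... = inv\<^bsub>Q\<^esub> ?p \<otimes>\<^bsub>Q\<^esub> ?p'" using pc xc(2) by simp
   also have "... = y [^]\<^bsub>Q\<^esub> (- m ?S1 + m ?S2)"
    by (simp only: G.int_pow_mult[OF yc] G.int_pow_neg[OF yc])
   finally show ?thesis unfolding g[OF So(1)] g[OF So(2)] by simp
  qed
  finally have "h i k ?S2 = h i k T \<otimes>\<^bsub>Q\<^esub> y [^]\<^bsub>Q\<^esub> (?tr n + (m ?S2 - m ?S1))"
   unfolding Suc.IH using hc yc by (simp add: G.m_assoc G.int_pow_mult[symmetric])
  thus ?case unfolding transport_label[OF ij] by (simp add: add.commute)
 qed
 have "?tr (period i j T) = sides i j T e"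
 proof -
  have "?tr (period i j T) = holonomy i j m T" by (simp add: holonomy_def[OF ij])
  also have "... = (SUM e'':orbits {k, l}. of_int (sides i j T e'') * of_bool (e'' = e))"
   unfolding holonomy_abelian[OF ij T]
   by (rule sum_halves_by_orbit[OF ij C(1) T]) (simp add: m_def mem_orbit_iff[OF C(1) _ e(1)])
  also have "... = sides i j T e" using e(1) finite_orbits[of "{k, l}"] by simp
  finally show ?thesis .
 qed
 hence hy: "h i k T = h i k T \<otimes>\<^bsub>Q\<^esub> y [^]\<^bsub>Q\<^esub> sides i j T e"
  using walk[of "period i j T"] period_props(2)[OF ij T] by simp
 have y1: "y [^]\<^bsub>Q\<^esub> sides i j T e = \<one>\<^bsub>Q\<^esub>"
  by (rule iffD1[OF G.l_cancel_one'[OF h_in[OF ij(1) kl T] G.int_pow_closed[OF yc]] hy])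
 have y2: "y [^]\<^bsub>Q\<^esub> (2::int) = (-1, 0)" using G.int_pow_mult[OF yc, of 1 1] yc yy by simp
 have "y [^]\<^bsub>Q\<^esub> (2::int) = \<one>\<^bsub>Q\<^esub>"
 proof (cases "sides i j T e = 2")
  case True thus ?thesis using y1 by simp
 next
  case False
  hence "sides i j T e = - 2" using s2 by simp
  thus ?thesis using y1 G.int_pow_neg[OF yc, of 2] yc by simp
 qed
 thus False using y2 one_Q8 by simp
qed

lemma sum_card_half:
 assumes T: "T : TT"
 shows "(SUM e:orbits {k, l}. card (half i j T Int e)) = period i j T"
  "(SUM e:orbits {k, l}. card (sg j ` half i j T Int e)) = period i j T"
proof -
 have A: "half i j T <= TT" "sg j ` half i j T <= TT" using half_subset[OF ij T] sg_in[OF ij(2)] by auto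
 show "(SUM e:orbits {k, l}. card (half i j T Int e)) = period i j T"
  using sum_card_orbits_Int[OF C(1) A(1)] card_half[OF ij T] by (simp add: Int_commute)
 show "(SUM e:orbits {k, l}. card (sg j ` half i j T Int e)) = period i j T"
  using sum_card_orbits_Int[OF C(1) A(2)] card_half[OF ij T] card_sg_half[OF ij, of T] by (simp add: Int_commute)
qed

text \<open>The multiplicities are even. If they are not all zero, then on a cycle of at most six tetrahedra two of them are \<open>2\<close> and
  \<open>-2\<close>, and by \<open>two_labels\<close> the third label occurs as well.\<close>

lemma long_cycles:
 assumes T: "T : TT" and ne: "EX e:orbits {k, l}. sides i j T e ~= 0"
 shows "3 <= period i j T" "period i j T = 3 ==> e : orbits {k, l} ==> card (orb {i, j} T Int e) = 2"
proof -
 have "card (orbits {k, l}) = 3" using edges[OF colours_swap[OF co]] by simp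
 then obtain a b c where E: "orbits {k, l} = {a, b, c}" "a ~= b" "a ~= c" "b ~= c" by (auto simp: card_3_iff)
 define p where "p = period i j T"
 let ?A = "%e. int (card (half i j T Int e))" and ?B = "%e. int (card (sg j ` half i j T Int e))"
 let ?s = "sides i j T"
 have s: "?s e = ?A e - ?B e" for e by (simp add: sides_def)
 have tot: "?A x + ?A y + ?A z = int p" "?B x + ?B y + ?B z = int p"
  if "orbits {k, l} = {x, y, z}" "x ~= y" "x ~= z" "y ~= z" for x y z
  using sum_card_half[OF T] that by (simp_all add: p_def)
 have ev: "even (?s e)" if "e : orbits {k, l}" for e using sides_even[OF T that] .
 have sub: "orb {i, j} T <= x Un y"
  if xyz: "orbits {k, l} = {x, y, z}" and z: "?A z = 0" "?B z = 0" for x y z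
 proof -
  have "card (orb {i, j} T Int z) = 0" using z card_orb_Int[OF ij T] by simp
  moreover have "finite (orb {i, j} T)" using orb_subset[OF T C(2)] finite_TT finite_subset by blast
  ultimately have "orb {i, j} T Int z = {}" by simp
  thus ?thesis using orb_subset[OF T C(2)] Union_orbits[OF C(1)] xyz by auto
 qed
 have two: "\<bar>?s x\<bar> ~= 2" if "orbits {k, l} = {x, y, z}" "x ~= y" "?A z = 0" "?B z = 0" for x y z
  by (rule two_labels[OF T, of x y]) (use that sub in auto)
 \<comment> \<open>in a short cycle one label occurs with multiplicity 2 and another one with multiplicity -2\<close>
 have key: "3 <= p & (p = 3 --> ?A x + ?B x = 2 & ?A y + ?B y = 2 & ?A z + ?B z = 2)"
  if xyz: "orbits {k, l} = {x, y, z}" "x ~= y" "x ~= z" "y ~= z"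
   and "?s x > 0" "?s y < 0" for x y z
 proof (cases "p <= 3")
  case True
  have "even (?s x)" "even (?s y)" "even (?s z)" using ev xyz by auto
  then obtain x' y' z' where ev': "?s x = 2 * x'" "?s y = 2 * y'" "?s z = 2 * z'" by (auto elim!: evenE)
  have nn: "0 <= ?A x" "0 <= ?A y" "0 <= ?A z" "0 <= ?B x" "0 <= ?B y" "0 <= ?B z" by simp_all
  note t = tot[OF xyz]
  have x1: "x' = 1" using ev' t True that(5) by (simp add: s)
  have y1: "y' = - 1" using ev' t True that(6) by (simp add: s)
  have x2: "?s x = 2" "?s y = -2" "?s z = 0" using ev' x1 y1 t unfolding s by linarith+
  show ?thesis
  proof (cases "?A z = 0")
   case z0: True
   hence "?B z = 0" using x2(3) unfolding s by linarith
   thus ?thesis using two[OF xyz(1,2) z0] x2(1) by simp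
  next
   case False
   thus ?thesis using nn x2 t by (simp add: s)
  qed
 qed simp
 have "?s a + ?s b + ?s c = 0" using tot[OF E] unfolding s by linarith
 moreover have "?s a ~= 0 | ?s b ~= 0 | ?s c ~= 0" using ne E by auto
 ultimately have "(?s a > 0 & ?s b < 0) | (?s a > 0 & ?s c < 0) | (?s b > 0 & ?s a < 0) |
   (?s b > 0 & ?s c < 0) | (?s c > 0 & ?s a < 0) | (?s c > 0 & ?s b < 0)" by (rule sum_zero_signs)
 moreover have perm: "orbits {k, l} = {a, c, b}" "orbits {k, l} = {b, a, c}" "orbits {k, l} = {b, c, a}"
  "orbits {k, l} = {c, a, b}" "orbits {k, l} = {c, b, a}" using E(1) by auto
 ultimately consider "?s a > 0" "?s b < 0" | "?s a > 0" "?s c < 0" | "?s b > 0" "?s a < 0" | "?s b > 0" "?s c < 0"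
  | "?s c > 0" "?s a < 0" | "?s c > 0" "?s b < 0" by (elim disjE conjE)
 hence "3 <= p & (p = 3 --> ?A a + ?B a = 2 & ?A b + ?B b = 2 & ?A c + ?B c = 2)"
 proof cases
  case 1 show ?thesis by (rule key[OF E(1) E(2) E(3) E(4) 1])
 next
  case 2 show ?thesis using key[OF perm(1) E(3) E(2) E(4)[symmetric] 2] by blast
 next
  case 3 show ?thesis using key[OF perm(2) E(2)[symmetric] E(4) E(3) 3] by blast
 next
  case 4 show ?thesis using key[OF perm(3) E(4) E(2)[symmetric] E(3)[symmetric] 4] by blast
 next
  case 5 show ?thesis using key[OF perm(4) E(3)[symmetric] E(4)[symmetric] E(2) 5] by blast
 next
  case 6 show ?thesis using key[OF perm(5) E(4)[symmetric] E(3)[symmetric] E(2)[symmetric] 6] by blast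
 qed
 note fin = this
 show "3 <= period i j T" using fin unfolding p_def by blast
 show "card (orb {i, j} T Int e) = 2" if p3: "period i j T = 3" and e: "e : orbits {k, l}"
  using p3 e fin by (auto simp: p_def E(1) card_orb_Int[OF ij T])
qed

text \<open>If the multiplicities vanished on all cycles but one, then there would be a nonconstant real solution of the single remaining
  linear equation, in contradiction to \<open>real_label\<close>.\<close>

lemma another_nonzero:
 assumes T: "T : TT"
 shows "EX T':TT. T' ~: orb {i, j} T & (EX e:orbits {k, l}. sides i j T' e ~= 0)"
proof (rule ccontr)
 assume "~ ?thesis"
 hence z: "sides i j T' e = 0" if "T' : TT" "T' ~: orb {i, j} T" "e : orbits {k, l}" for T' e using that by blast
 have "card (orbits {k, l}) = 3" using edges[OF colours_swap[OF co]] by simp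
 then obtain e1 e2 e3 where E: "orbits {k, l} = {e1, e2, e3}" "e1 ~= e2" "e1 ~= e3" "e2 ~= e3" by (auto simp: card_3_iff)
 define s1 s2 s3 where "s1 = sides i j T e1" and "s2 = sides i j T e2" and "s3 = sides i j T e3"
 have sum0: "s1 + s2 + s3 = 0" using sum_sides[OF ij C(1) T] E by (simp add: s1_def s2_def s3_def)
 obtain x1 x2 x3 :: int where x: "s1 * x1 + s2 * x2 + s3 * x3 = 0" "~ (x1 = x2 & x2 = x3)"
 proof (cases "s1 = 0 & s2 = 0 & s3 = 0")
  case True thus thesis using that[of 1 0 0] by simp
 next
  case False
  have "~ (s2 - s3 = s3 - s1 & s3 - s1 = s1 - s2)" using False sum0 by auto
  moreover have "s1 * (s2 - s3) + s2 * (s3 - s1) + s3 * (s1 - s2) = 0" by (simp add: algebra_simps)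
  ultimately show thesis using that by blast
 qed
 define F :: "'t set => real" where "F e = of_int (if e = e1 then x1 else if e = e2 then x2 else x3)" for e
 define c :: "'t => real" where "c X = F (orb {k, l} X)" for X
 have cF: "c X = F e" if "e : orbits {k, l}" "X : e" for X e using orbits_label(2)[OF C(1) that] by (simp add: c_def)
 have hol: "holonomy i j c S = (SUM e:orbits {k, l}. of_int (sides i j S e) * F e)" if "S : TT" for S
  unfolding holonomy_abelian[OF ij that] by (rule sum_halves_by_orbit[OF ij C(1) that cF])
 have const: "c Y = c Y'" if "Y : TT" "Y' : TT" for Y Y'
 proof (rule real_label[OF co _ _ that])
  show "c (sg k S) = c S & c (sg l S) = c S" if "S : TT" for S using orb_sg[OF that C(1)] by (simp add: c_def)
  show "EX w. ALL T:TT. w (sg j T) = w T & w (sg i T) = c (sg i T) - c T + w T"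
  proof (rule label_potential_exists[OF ij])
   fix S assume S: "S : TT"
   show "EX R:orb {i, j} S. holonomy i j c R = 0"
   proof (cases "S : orb {i, j} T")
    case True
    have "holonomy i j c T = of_int (s1 * x1 + s2 * x2 + s3 * x3)"
     unfolding hol[OF T] using E by (simp add: F_def s1_def s2_def s3_def)
    thus ?thesis using x(1) orb_sym[OF True T C(2)] by auto
   next
    case False
    thus ?thesis using hol[OF S] z[OF S False] orb_refl by auto
   qed
  qed
 qed
 have "EX Y:TT. c Y = F e" if e: "e : orbits {k, l}" for e
 proof -
  obtain Y where Y: "Y : e" using e orb_refl by (auto simp: orbits_def)
  show ?thesis using orbits_label(1)[OF C(1) e Y] cF[OF e Y] by blast
 qed
 hence "F e = F e'" if "e : orbits {k, l}" "e' : orbits {k, l}" for e e' using const that by metis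
 hence "F e1 = F e2" "F e2 = F e3" using E by auto
 thus False using x(2) E by (simp add: F_def)
qed

text \<open>There are three cycles with at most \<open>14\<close> tetrahedra altogether, and two of them have at least six; so the third one has two.
  On the two long cycles every label occurs twice.\<close>

lemma shape: "(EX O':orbits {i, j}. card O' = 2) & (ALL e:orbits {k, l}. 4 <= card e)"
proof -
 obtain T1 where T1: "T1 : TT" "EX e:orbits {k, l}. sides i j T1 e ~= 0" using another_nonzero[OF T0] by blast
 obtain T2 where T2: "T2 : TT" "T2 ~: orb {i, j} T1" "EX e:orbits {k, l}. sides i j T2 e ~= 0"
  using another_nonzero[OF T1(1)] by blast
 let ?O1 = "orb {i, j} T1" and ?O2 = "orb {i, j} T2"
 have O: "?O1 : orbits {i, j}" "?O2 : orbits {i, j}" "?O1 ~= ?O2" using T1 T2 orb_refl by (auto simp: orbits_def)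
 have "card (orbits {i, j} - {?O1, ?O2}) = 1" using edges[OF co] O finite_orbits by simp
 then obtain O3 where O3: "orbits {i, j} - {?O1, ?O2} = {O3}" by (auto simp: card_1_singleton_iff)
 hence orbs: "orbits {i, j} = {?O1, ?O2, O3}" "O3 ~= ?O1" "O3 ~= ?O2" using O by auto
 hence "O3 : orbits {i, j}" by auto
 then obtain T3 where T3: "T3 : TT" "O3 = orb {i, j} T3" by (auto simp: orbits_def)
 have le: "period i j T1 + period i j T2 + period i j T3 <= 7"
  using sum_card_edges[OF co] orbs O card_orb[OF ij] T1 T2 T3 by simp
 have "3 <= period i j T1" "3 <= period i j T2" "0 < period i j T3"
  using long_cycles(1) T1 T2 period_props(1)[OF ij T3(1)] by auto
 hence p: "period i j T1 = 3" "period i j T2 = 3" "period i j T3 = 1" using le by auto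
 have "card O3 = 2" using card_orb[OF ij T3(1)] p T3 by simp
 moreover have "4 <= card e" if e: "e : orbits {k, l}" for e
 proof -
  have "card e = (SUM O':orbits {i, j}. card (O' Int e))"
   using sum_card_orbits_Int[OF C(2) orbits_subset[OF C(1) e]] by simp
  also have "... = card (?O1 Int e) + card (?O2 Int e) + card (O3 Int e)" using orbs O by simp
  finally show ?thesis using long_cycles(2)[OF T1 p(1) e] long_cycles(2)[OF T2(1,3) p(2) e] by simp
 qed
 ultimately show ?thesis using orbs by blast
qed

end

text \<open>By \<open>shape\<close> some edge from \<open>2\<close> to \<open>3\<close> has two tetrahedra round it, and by \<open>shape\<close> for the opposite pair it has four.\<close>

lemma not_extremal: False
proof -
 have co: "colours 0 1 2 3" "colours 2 3 0 1" by (simp_all add: colours_def)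
 from shape[OF co(2)] obtain e where "e : orbits {2, 3}" "card e = 2" by blast
 moreover have "4 <= card e" using shape[OF co(1)] calculation(1) by blast
 ultimately show False by simp
qed

end

section \<open>The three-dimensional torus\<close>

text \<open>The free real nilpotent group of class two on three generators. A closed path of labels that traverses each label equally often
  in both directions is trivial in every abelian group; here the centre still records the area that it encloses.\<close>

datatype nil3 = Nil3 (vec_part: "real ^ 3") (centre_part: "real ^ 3")

instantiation nil3 :: group_add
begin

definition zero_nil3 :: nil3 where "0 = Nil3 0 0"
definition plus_nil3 :: "nil3 => nil3 => nil3" where
 "x + y = Nil3 (vec_part x + vec_part y) (centre_part x + centre_part y + cross3 (vec_part x) (vec_part y))"
definition uminus_nil3 :: "nil3 => nil3" where "- x = Nil3 (- vec_part x) (- centre_part x)"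
definition minus_nil3 :: "nil3 => nil3 => nil3" where "x - y = x + - (y :: nil3)"

instance by standard (auto simp: zero_nil3_def plus_nil3_def uminus_nil3_def minus_nil3_def
   cross_add_left cross_add_right algebra_simps)

end

lemma nil3_parts:
 "vec_part (x + y) = vec_part x + vec_part y" "vec_part (x - y) = vec_part x - vec_part y" "vec_part 0 = 0"
 "centre_part 0 = 0" by (simp_all add: zero_nil3_def plus_nil3_def uminus_nil3_def minus_nil3_def)

lemma nil3_eqI: "vec_part x = vec_part y ==> centre_part x = centre_part y ==> x = y" by (cases x; cases y) simp

text \<open>Quotients of \<open>nil3\<close>: only the component of the centre in the direction of \<open>cross3 p q\<close> is kept.\<close>

definition nil3_proj :: "real ^ 3 => real ^ 3 => nil3 => nil3" where
 "nil3_proj p q x = Nil3 (vector [p \<bullet> vec_part x, q \<bullet> vec_part x, 0])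
   (vector [0, 0, cross3 p q \<bullet> centre_part x])"

lemma vector_3_add: "vector [a, b, c] + vector [a', b', c'] = (vector [a + a', b + b', c + c'] :: real ^ 3)"
 by (simp add: vec_eq_iff forall_3)

lemma nil3_proj_add: "nil3_proj p q (x + y) = nil3_proj p q x + nil3_proj p q y"
 unfolding nil3_proj_def plus_nil3_def nil3.sel vector_3_add
 by (simp add: vec_eq_iff forall_3 cross_components inner_add_right dot_cross algebra_simps)

lemma nil3_proj_zero: "nil3_proj p q 0 = 0" by (simp add: nil3_proj_def zero_nil3_def vec_eq_iff forall_3)

lemma perpendicular_to_two: "EX a :: real ^ 3. a ~= 0 & a \<bullet> x = 0 & a \<bullet> y = 0"
proof -
 have "dim {x, y} <= card {x, y}" by (rule dim_le_card') simp
 also have "... <= 2" by (simp add: card_insert_if)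
 finally have "dim {x, y} < DIM(real ^ 3)" by simp
 hence "EX a. a ~= 0 & (ALL z:span {x, y}. orthogonal a z)" by (rule orthogonal_to_subspace_exists) blast
 then obtain a where a: "a ~= 0" "ALL z:span {x, y}. orthogonal a z" by blast
 show ?thesis using a by (auto simp: span_base orthogonal_def)
qed

definition triple_area :: "real ^ 3 => real ^ 3 => real ^ 3 => real ^ 3" where
 "triple_area x y z = cross3 x y + cross3 y z + cross3 z x"

lemma triple_area_perm:
 "triple_area y z x = triple_area x y z" "triple_area z x y = triple_area x y z"
 "triple_area y x z = - triple_area x y z" "triple_area x z y = - triple_area x y z"
 "triple_area z y x = - triple_area x y z"
 unfolding triple_area_def by (simp_all add: vec_eq_iff forall_3 cross_components algebra_simps)

lemma hexagon_nil3:
 "Nil3 x 0 - Nil3 y 0 + (Nil3 z 0 - Nil3 x 0 + (Nil3 y 0 - Nil3 z 0)) = Nil3 0 (- 2 *\<^sub>R triple_area x y z)"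
 by (simp add: minus_nil3_def plus_nil3_def uminus_nil3_def triple_area_def vec_eq_iff forall_3 cross_components algebra_simps)

lemma two_cases:
 assumes "!!e. (of_bool (a0 = e) :: nat) + of_bool (a1 = e) = of_bool (b0 = e) + of_bool (b1 = e)"
 shows "(b0 = a0 & b1 = a1) | (b0 = a1 & b1 = a0)"
proof (cases "b0 = a0")
 case True thus ?thesis using assms[of b1] by auto
next
 case False thus ?thesis using assms[of b0] assms[of b1] by (cases "b0 = a1"; cases "b1 = a0") auto
qed

lemma three_cases:
 assumes "!!e. (of_bool (a0 = e) :: nat) + of_bool (a1 = e) + of_bool (a2 = e)
   = of_bool (b0 = e) + of_bool (b1 = e) + of_bool (b2 = e)"
 shows "(b0 = a0 & b1 = a1 & b2 = a2) | (b0 = a0 & b1 = a2 & b2 = a1) | (b0 = a1 & b1 = a0 & b2 = a2)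
  | (b0 = a2 & b1 = a1 & b2 = a0) | (b0 = a1 & b1 = a2 & b2 = a0) | (b0 = a2 & b1 = a0 & b2 = a1)"
proof -
 consider "b0 = a0" | "b0 = a1" | "b0 = a2" using assms[of b0] by (cases "b0 = a0"; cases "b0 = a1"; cases "b0 = a2") auto
 thus ?thesis
 proof cases
  case 1
  have "(b1 = a1 & b2 = a2) | (b1 = a2 & b2 = a1)" by (rule two_cases) (use assms 1 in simp)
  thus ?thesis using 1 by blast
 next
  case 2
  have "(b1 = a0 & b2 = a2) | (b1 = a2 & b2 = a0)" by (rule two_cases) (use assms 2 in "simp")
  thus ?thesis using 2 by blast
 next
  case 3
  have "(b1 = a0 & b2 = a1) | (b1 = a1 & b2 = a0)" by (rule two_cases) (use assms 3 in "simp")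
  thus ?thesis using 3 by blast
 qed
qed

lemma rearranged_triple:
 assumes "{a', b', c'} = {a, b, c}" and "distinct [a', b', c']"
 shows "(a' = a & b' = b & c' = c) | (a' = a & b' = c & c' = b) | (a' = b & b' = a & c' = c) |
  (a' = b & b' = c & c' = a) | (a' = c & b' = a & c' = b) | (a' = c & b' = b & c' = a)"
proof -
 have "a' : {a, b, c}" "b' : {a, b, c}" "c' : {a, b, c}" using assms(1) by auto
 moreover have "a' ~= b'" "a' ~= c'" "b' ~= c'" using assms(2) by auto
 ultimately show ?thesis by auto
qed

context gem
begin

lemma holonomy_hom:
 assumes ij: "i < 4" "j < 4" and f: "!!x y. f (x + y) = f x + f y" "f (0 :: 'h::group_add) = (0 :: 'k::group_add)"
 shows "f (holonomy i j c T) = holonomy i j (%X. f (c X)) T"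
proof -
 have fm: "f (x - y) = f x - f y" for x y using f(1)[of "x - y" y] by simp
 have "f (transport i j (%X. c (sg i X) - c X) (%X. 0) T n) =
   transport i j (%X. f (c (sg i X)) - f (c X)) (%X. 0) T n" for n
  by (induction n) (simp_all only: transport.simps[OF ij] f fm)
 thus ?thesis by (simp only: holonomy_def[OF ij])
qed

lemma card_half_eq_sum:
 assumes ij: "i < 4" "j < 4" and T: "T : TT"
 shows "card (half i j T Int e) = (SUM s<period i j T. of_bool ((rot i j ^^ s) T : e))"
  "card (sg j ` half i j T Int e) = (SUM s<period i j T. of_bool (sg j ((rot i j ^^ s) T) : e))"
proof -
 have "card (half i j T Int e) = (SUM X:half i j T. of_bool (X : e))" using finite_half[OF ij, of T] by simp
 also have "... = (SUM s<period i j T. of_bool ((rot i j ^^ s) T : e))"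
  unfolding half_def by (subst sum.reindex[OF rot_inj_on[OF ij T]]) simp
 finally show "card (half i j T Int e) = (SUM s<period i j T. of_bool ((rot i j ^^ s) T : e))" .
 have inj: "inj_on (%s. sg j ((rot i j ^^ s) T)) {..<period i j T}"
  using rot_inj_on[OF ij T] sg_sg[OF ij(2)] unfolding inj_on_def by metis
 have "card (sg j ` half i j T Int e) = (SUM X:sg j ` half i j T. of_bool (X : e))" using finite_half[OF ij, of T] by simp
 also have "... = (SUM s<period i j T. of_bool (sg j ((rot i j ^^ s) T) : e))"
  unfolding half_def image_image by (subst sum.reindex[OF inj]) simp
 finally show "card (sg j ` half i j T Int e) = (SUM s<period i j T. of_bool (sg j ((rot i j ^^ s) T) : e))" .
qed

end

definition real_vec :: "int \<times> int \<times> int => real ^ 3" where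
 "real_vec q = vector [of_int (fst q), of_int (fst (snd q)), of_int (snd (snd q))]"

lemma real_vec_add: "real_vec (x + y) = real_vec x + real_vec y" by (simp add: real_vec_def vector_3_add)

lemma subgroup_kernel_real_vec: "subgroup {q. a \<bullet> real_vec q = 0} Z3_group"
proof -
 interpret G: group Z3_group by (rule group_Z3)
 show ?thesis
 proof (rule G.subgroupI)
  fix q assume q: "q : {q. a \<bullet> real_vec q = 0}"
  have "inv\<^bsub>Z3_group\<^esub> q = - q" by (rule G.inv_equality) (simp_all add: Z3_group_def)
  moreover have "real_vec (- q) = - real_vec q" by (simp add: real_vec_def vec_eq_iff forall_3)
  ultimately show "inv\<^bsub>Z3_group\<^esub> q : {q. a \<bullet> real_vec q = 0}" using q by simp
  fix q' assume "q' : {q. a \<bullet> real_vec q = 0}"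
  thus "q \<otimes>\<^bsub>Z3_group\<^esub> q' : {q. a \<bullet> real_vec q = 0}"
   using q by (simp add: Z3_group_def real_vec_add inner_add_right)
 next
  have "real_vec 0 = 0" by (simp add: real_vec_def vec_eq_iff forall_3)
  thus "{q. a \<bullet> real_vec q = 0} ~= {}" by (metis (mono_tags) emptyE inner_zero_right mem_Collect_eq)
 qed (simp add: Z3_group_def)
qed

lemma real_vec_orthogonal_all:
 assumes "!!q. a \<bullet> real_vec q = 0"
 shows "a = 0" using assms[of "(1,0,0)"] assms[of "(0,1,0)"] assms[of "(0,0,1)"]
 by (simp add: real_vec_def inner_vec_def sum_3 vec_eq_iff forall_3)

locale T3_gem = extremal_gem TT sg Z3_group h T0 3 for TT :: "'t set" and sg and h T0 +
 assumes nil_label: "colours i j k l ==> (!!T. T : TT ==> c (sg k T) = c T & c (sg l T) = c T) ==>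
   (EX w. ALL T:TT. w (sg j T) = w T & w (sg i T) = c (sg i T) - c T + w T) ==> c T0 = 0 ==>
   T : TT ==> T' : TT ==> (c :: 't => nil3) T + c T' = c T' + c T"
begin

context
 fixes i j k l
 assumes co: "colours i j k l"
begin

lemma ij: "i < 4" "j < 4" and kl: "k < 4" and C: "{k, l} <= {..<4}" "{i, j} <= {..<4}" and ij_ne: "i ~= j"
 using co by (auto simp: colours_def)

lemma four_labels:
 obtains e1 e2 e3 where "orbits {k, l} = {orb {k, l} T0, e1, e2, e3}" "distinct [orb {k, l} T0, e1, e2, e3]"
proof -
 let ?e0 = "orb {k, l} T0"
 have e0: "?e0 : orbits {k, l}" using T0 by (auto simp: orbits_def)
 have "card (orbits {k, l} - {?e0}) = 3" using edges[OF colours_swap[OF co]] e0 by simp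
 then obtain e1 e2 e3 where e: "orbits {k, l} - {?e0} = {e1, e2, e3}" "e1 ~= e2" "e1 ~= e3" "e2 ~= e3"
  by (auto simp: card_3_iff)
 have "orbits {k, l} = {?e0, e1, e2, e3}" using e(1) e0 by blast
 moreover have "distinct [?e0, e1, e2, e3]" using e by auto
 ultimately show thesis by (rule that)
qed

text \<open>The labels of the four edges span a three-dimensional space and one of them is zero, so they are affinely
  independent. Hence the relation round an opposite edge forces all multiplicities to vanish.\<close>

lemma sides_zero:
 assumes T: "T : TT" and e: "e : orbits {k, l}"
 shows "sides i j T e = 0"
proof -
 define X where "X e = (SOME X. X : e)" for e :: "'t set"
 have X: "X e : e" if "e : orbits {k, l}" for e
  unfolding X_def by (rule someI_ex) (use that orb_refl in "auto simp: orbits_def")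
 define v where "v e = real_vec (h i j (X e))" for e
 have v: "real_vec (h i j Y) = v e" if "e : orbits {k, l}" "Y : e" for Y e
  using h_orbit[OF co that X[OF that(1)]] by (simp add: v_def)
 let ?e0 = "orb {k, l} T0"
 have e0: "?e0 : orbits {k, l}" using T0 by (auto simp: orbits_def)
 have v0: "v ?e0 = 0" using h_T0[OF ij] v[OF e0 orb_refl] by (simp add: Z3_group_def real_vec_def vec_eq_iff forall_3)
 \<comment> \<open>every linear functional annihilates the combination of the labels given by the multiplicities\<close>
 have rel: "(SUM e:orbits {k, l}. of_int (sides i j T e) * (a \<bullet> v e)) = 0" for a
 proof -
  have A: "half i j T <= TT" "sg j ` half i j T <= TT" using half_subset[OF ij T] sg_in[OF ij(2)] by auto
  let ?f = "%Y. a \<bullet> real_vec (h i k Y)" and ?g = "%Y. a \<bullet> real_vec (h j k Y)" and ?h = "%Y. a \<bullet> real_vec (h i j Y)"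
  have eq: "?h Y = ?f Y - ?g Y" if "Y : TT" for Y
   using h_around(3)[OF co that] by (simp add: Z3_group_def real_vec_add inner_add_right)
  have "sum ?h S = sum ?f S - sum ?g S" if "S <= TT" for S
   unfolding sum_subtractf[symmetric] by (rule sum.cong) (use eq that in auto)
  hence "sum ?h (half i j T) - sum ?h (sg j ` half i j T) = 0"
   using A sum_half_sg_j[OF ij T, of ?f] sum_half_sg_i[OF ij T, of ?g] h_around[OF co] by simp
  moreover have "sum ?h (half i j T) - sum ?h (sg j ` half i j T) =
    (SUM e:orbits {k, l}. of_int (sides i j T e) * (a \<bullet> v e))"
   by (rule sum_halves_by_orbit[OF ij C(1) T]) (use v in simp)
  ultimately show ?thesis by simp
 qed
 \<comment> \<open>no functional annihilates all labels, because they generate the group\<close>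
 have gen: "a = 0" if a: "!!e. e : orbits {k, l} ==> a \<bullet> v e = 0" for a
 proof -
  have "h i j S : {q. a \<bullet> real_vec q = 0}" if S: "S : TT" for S
   using S v[OF _ orb_refl] a by (force simp: orbits_def)
  hence "a \<bullet> real_vec q = 0" for q
   using generated_by_one_pair[OF ij ij_ne subgroup_kernel_real_vec] by (auto simp: Z3_group_def)
  thus "a = 0" by (rule real_vec_orthogonal_all)
 qed
 obtain e1 e2 e3 where E: "orbits {k, l} = {?e0, e1, e2, e3}" "distinct [?e0, e1, e2, e3]" by (rule four_labels)
 have z: "sides i j T x = 0" if xyz: "orbits {k, l} = {?e0, x, y, z}" "distinct [?e0, x, y, z]" for x y z
 proof -
  obtain a :: "real ^ 3" where a: "a ~= 0" "a \<bullet> v y = 0" "a \<bullet> v z = 0" using perpendicular_to_two by blast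
  have "a \<bullet> v x ~= 0" using a(1) gen by (force simp: xyz(1) a(2,3) v0)
  moreover have "of_int (sides i j T x) * (a \<bullet> v x) = 0" using rel[of a] xyz a v0 by simp
  ultimately show ?thesis by simp
 qed
 have "orbits {k, l} = {?e0, e2, e1, e3}" "orbits {k, l} = {?e0, e3, e1, e2}" using E(1) by auto
 hence s: "sides i j T e1 = 0" "sides i j T e2 = 0" "sides i j T e3 = 0"
  using z[OF E] z[of e2 e1 e3] z[of e3 e1 e2] E(2) by auto
 thus ?thesis using sum_sides[OF ij C(1) T] E s e by auto
qed

text \<open>The four edges receive the vertices of a tetrahedron in space as labels, the edge of \<open>T0\<close> the origin.\<close>

definition label_vec :: "'t set => real ^ 3" where
 "label_vec = (SOME u. u (orb {k, l} T0) = 0 & (EX e1 e2 e3. orbits {k, l} = {orb {k, l} T0, e1, e2, e3} &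
   u e1 = axis 1 1 & u e2 = axis 2 1 & u e3 = axis 3 1))"

lemma label_vec: "label_vec (orb {k, l} T0) = 0 & (EX e1 e2 e3. orbits {k, l} = {orb {k, l} T0, e1, e2, e3} &
   label_vec e1 = axis 1 1 & label_vec e2 = axis 2 1 & label_vec e3 = axis 3 1)"
proof -
 let ?P = "%u :: 't set => real ^ 3. u (orb {k, l} T0) = 0 & (EX e1 e2 e3. orbits {k, l} = {orb {k, l} T0, e1, e2, e3} &
   u e1 = axis 1 1 & u e2 = axis 2 1 & u e3 = axis 3 1)"
 obtain e1 e2 e3 where E: "orbits {k, l} = {orb {k, l} T0, e1, e2, e3}" "distinct [orb {k, l} T0, e1, e2, e3]"
  by (rule four_labels)
 let ?u = "%e. if e = e1 then axis 1 1 else if e = e2 then axis 2 1 else if e = e3 then axis 3 1 else (0 :: real ^ 3)"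
 have u: "?u e1 = axis 1 1" "?u e2 = axis 2 1" "?u e3 = axis 3 1" "?u (orb {k, l} T0) = 0" using E(2) by auto
 have "EX u. ?P u"
 proof (rule exI[of _ ?u], rule conjI)
  show "?u (orb {k, l} T0) = 0" by (rule u(4))
  show "EX e1 e2 e3. orbits {k, l} = {orb {k, l} T0, e1, e2, e3} & ?u e1 = axis 1 1 & ?u e2 = axis 2 1 & ?u e3 = axis 3 1"
   by (rule exI[of _ e1], rule exI[of _ e2], rule exI[of _ e3]) (intro conjI E u(1,2,3))
 qed
 hence "?P (SOME u. ?P u)" by (rule someI_ex)
 thus ?thesis unfolding label_vec_def .
qed

definition lab :: "'t => nil3" where "lab X = Nil3 (label_vec (orb {k, l} X)) 0"

definition area :: "'t => real ^ 3" where "area T = centre_part (holonomy i j lab T)"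

lemma holonomy_lab: "T : TT ==> holonomy i j lab T = Nil3 0 (area T)"
proof (rule nil3_eqI)
 assume T: "T : TT"
 have A: "half i j T <= TT" "sg j ` half i j T <= TT" using half_subset[OF ij T] sg_in[OF ij(2)] by auto
 let ?u = "%X. label_vec (orb {k, l} X)"
 have comp: "holonomy i j (%X. a \<bullet> ?u X) T = 0" for a
 proof -
  have "sum (%X. a \<bullet> ?u X) (half i j T) - sum (%X. a \<bullet> ?u X) (sg j ` half i j T) =
    (SUM e:orbits {k, l}. of_int (sides i j T e) * (a \<bullet> label_vec e))"
   by (rule sum_halves_by_orbit[OF ij C(1) T]) (simp add: orbits_label(2)[OF C(1)])
  thus ?thesis using sides_zero[OF T] by (simp add: holonomy_abelian[OF ij T])
 qed
 have "a \<bullet> vec_part (holonomy i j lab T) = holonomy i j (%X. a \<bullet> vec_part (lab X)) T" for a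
  by (rule holonomy_hom[OF ij]) (simp_all add: nil3_parts inner_add_right)
 hence "a \<bullet> vec_part (holonomy i j lab T) = 0" for a using comp by (simp add: lab_def)
 thus "vec_part (holonomy i j lab T) = vec_part (Nil3 0 (area T))" using inner_eq_zero_iff by fastforce
qed (simp add: area_def)

text \<open>If all areas were orthogonal to \<open>w\<close>, projecting the centre of \<open>nil3\<close> to the line of \<open>w\<close> would produce labels in a
  Heisenberg group that can be integrated but do not commute.\<close>

lemma areas_span:
 fixes w :: "real ^ 3"
 assumes w: "!!T. T : TT ==> EX R:orb {i, j} T. w \<bullet> area R = 0"
 shows "w = 0"
proof (rule ccontr)
 assume w0: "w ~= 0"
 obtain p :: "real ^ 3" where p: "p ~= 0" "p \<bullet> w = 0" using perpendicular_to_two[of w w] by blast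
 define q where "q = cross3 w p"
 have pq: "cross3 p q = (p \<bullet> p) *\<^sub>R w" using p(2) by (simp add: q_def Lagrange)
 define c where "c X = nil3_proj p q (lab X)" for X
 have com: "c Y + c Y' = c Y' + c Y" if Y: "Y : TT" "Y' : TT" for Y Y'
 proof (rule nil_label[OF co _ _ _ Y])
  show "c (sg k S) = c S & c (sg l S) = c S" if "S : TT" for S using orb_sg[OF that C(1)] by (simp add: c_def lab_def)
  show "c T0 = 0" using label_vec nil3_proj_zero by (simp add: c_def lab_def zero_nil3_def)
  show "EX w. ALL T:TT. w (sg j T) = w T & w (sg i T) = c (sg i T) - c T + w T"
  proof (rule label_potential_exists[OF ij])
   fix S assume S: "S : TT"
   obtain R where R: "R : orb {i, j} S" "w \<bullet> area R = 0" using w[OF S] by blast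
   have "R : TT" using R orb_subset[OF S C(2)] by auto
   have "holonomy i j c R = nil3_proj p q (holonomy i j lab R)"
    unfolding c_def by (rule holonomy_hom[OF ij nil3_proj_add nil3_proj_zero, symmetric])
   also have "... = 0"
    unfolding holonomy_lab[OF `R : TT`]
    using R(2) by (simp add: nil3_proj_def pq zero_nil3_def vec_eq_iff forall_3)
   finally show "EX R:orb {i, j} S. holonomy i j c R = 0" using R(1) by blast
  qed
 qed
 have cr: "w \<bullet> cross3 (label_vec e) (label_vec e') = 0" if e: "e : orbits {k, l}" "e' : orbits {k, l}" for e e'
 proof -
  obtain Y Y' where Y: "Y : TT" "e = orb {k, l} Y" "Y' : TT" "e' = orb {k, l} Y'" using e by (auto simp: orbits_def)
  have "centre_part (c Y + c Y') $ 3 = centre_part (c Y' + c Y) $ 3" using com[OF Y(1,3)] by simp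
  hence "cross3 p q \<bullet> cross3 (label_vec e) (label_vec e') = 0"
   by (simp add: c_def lab_def nil3_proj_def plus_nil3_def cross_components Y dot_cross)
  thus ?thesis using p(1) by (simp add: pq)
 qed
 obtain e1 e2 e3 where E: "orbits {k, l} = {orb {k, l} T0, e1, e2, e3}"
   "label_vec e1 = axis 1 1" "label_vec e2 = axis 2 1" "label_vec e3 = axis 3 1" using label_vec by blast
 show False
  using cr[of e1 e2] cr[of e2 e3] cr[of e3 e1] E w0 by (simp add: cross_basis inner_axis vec_eq_iff forall_3)
qed

lemma label_count:
 assumes T: "T : TT"
 shows "(SUM s<period i j T. of_bool (orb {k, l} ((rot i j ^^ s) T) = e) :: nat) =
   (SUM s<period i j T. of_bool (orb {k, l} (sg j ((rot i j ^^ s) T)) = e))"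
proof (cases "e : orbits {k, l}")
 case True
 have mem: "X : e \<longleftrightarrow> orb {k, l} X = e" for X using orbits_label(2)[OF C(1) True] orb_refl by metis
 have "card (half i j T Int e) = card (sg j ` half i j T Int e)" using sides_zero[OF T True] by (simp add: sides_def)
 thus ?thesis unfolding card_half_eq_sum[OF ij T] mem .
next
 case False
 have "orb {k, l} X ~= e" if "X : TT" for X using False that by (auto simp: orbits_def)
 thus ?thesis using rot_in[OF ij T] sg_in[OF ij(2) rot_in[OF ij T]] by simp
qed

text \<open>All labels occur equally often on both sides. On a cycle with at most four tetrahedra this makes the area vanish, and on a
  cycle with six the only order of the labels with nonzero area is \<open>a, b, c\<close> on one side and a rotation of it on the other.\<close>

lemma short_cycles:
 assumes T: "T : TT" and ne: "area T ~= 0"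
 shows "3 <= period i j T"
  "period i j T = 3 ==> EX a b c. distinct [a, b, c] & {a, b, c} <= orbits {k, l} & orb {i, j} T <= a Un b Un c &
   (ALL e:{a, b, c}. card (orb {i, j} T Int e) = 2) &
   area T = - 2 *\<^sub>R triple_area (label_vec a) (label_vec b) (label_vec c)"
proof -
 let ?r = "%s. (rot i j ^^ s) T"
 let ?a = "%s. orb {k, l} (?r s)" and ?b = "%s. orb {k, l} (sg j (?r s))"
 let ?c = "%e. Nil3 (label_vec e) 0"
 have hol: "holonomy i j lab T ~= 0" using ne holonomy_lab[OF T] by (simp add: zero_nil3_def)
 note tl = transport_label[OF ij, of lab T] and t0 = transport.simps(1)[OF ij, of "%X. lab (sg i X) - lab X" "%X. 0" T]
 have lab: "lab X = ?c (orb {k, l} X)" for X by (simp add: lab_def)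
 have la: "lab (?r s) = ?c (?a s)" "lab (sg j (?r s)) = ?c (?b s)" for s by (rule lab)+
 have p0: "0 < period i j T" and pT: "?r (period i j T) = T" using period_props[OF ij T] by auto
 have not1: "period i j T ~= 1"
 proof
  assume p: "period i j T = 1"
  have "holonomy i j lab T = lab (?r 1) - lab (sg j (?r 0)) + 0"
   unfolding holonomy_def[OF ij] p One_nat_def tl t0 ..
  also have "?r 1 = T" using pT p by simp
  finally have "holonomy i j lab T = lab (?r 0) - lab (sg j (?r 0))" by simp
  hence "holonomy i j lab T = ?c (?a 0) - ?c (?b 0)" using lab[of "?r 0"] lab[of "sg j (?r 0)"] by metis
  moreover have "?a 0 = ?b 0" using label_count[OF T, of "?a 0"] unfolding p by (simp add: of_bool_def split: if_splits)
  ultimately show False using hol by simp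
 qed
 have not2: "period i j T ~= 2"
 proof
  assume p: "period i j T = 2"
  have "holonomy i j lab T = lab (?r 2) - lab (sg j (?r 1)) + (lab (?r 1) - lab (sg j (?r 0)) + 0)"
   unfolding holonomy_def[OF ij] p numeral_2_eq_2 One_nat_def tl t0 ..
  also have "?r 2 = ?r 0" using pT p by simp
  finally have "holonomy i j lab T = ?c (?a 0) - ?c (?b 1) + (?c (?a 1) - ?c (?b 0))" by (simp only: la add_0_right)
  moreover have "(?b 0 = ?a 0 & ?b 1 = ?a 1) | (?b 0 = ?a 1 & ?b 1 = ?a 0)"
  proof (rule two_cases)
   fix e
   show "(of_bool (?a 0 = e) :: nat) + of_bool (?a 1 = e) = of_bool (?b 0 = e) + of_bool (?b 1 = e)"
    using label_count[OF T, of e] unfolding p by (simp add: numeral_2_eq_2)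
  qed
  moreover have "x - y + (y - x) = 0" for x y :: nil3 by (metis diff_add_cancel add.assoc eq_diff_eq diff_self)
  ultimately show False using hol by auto
 qed
 show "3 <= period i j T" using p0 not1 not2 by simp
 assume p: "period i j T = 3"
 have "holonomy i j lab T = lab (?r 3) - lab (sg j (?r 2)) + (lab (?r 2) - lab (sg j (?r 1)) + (lab (?r 1) - lab (sg j (?r 0)) + 0))"
  unfolding holonomy_def[OF ij] p numeral_3_eq_3 numeral_2_eq_2 One_nat_def tl t0 ..
 also have "?r 3 = ?r 0" using pT p by simp
 finally have hol3: "holonomy i j lab T = ?c (?a 0) - ?c (?b 2) + (?c (?a 2) - ?c (?b 1) + (?c (?a 1) - ?c (?b 0)))"
  by (simp only: la add_0_right)
 have cancel: "x - y + (y - z) = x - z" for x y z :: nil3 by (metis diff_add_cancel add.assoc add_diff_eq)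
 have "(?b 0 = ?a 0 & ?b 1 = ?a 1 & ?b 2 = ?a 2) | (?b 0 = ?a 0 & ?b 1 = ?a 2 & ?b 2 = ?a 1) | (?b 0 = ?a 1 & ?b 1 = ?a 0 & ?b 2 = ?a 2)
  | (?b 0 = ?a 2 & ?b 1 = ?a 1 & ?b 2 = ?a 0) | (?b 0 = ?a 1 & ?b 1 = ?a 2 & ?b 2 = ?a 0) | (?b 0 = ?a 2 & ?b 1 = ?a 0 & ?b 2 = ?a 1)"
 proof (rule three_cases)
  fix e
  show "(of_bool (?a 0 = e) :: nat) + of_bool (?a 1 = e) + of_bool (?a 2 = e) = of_bool (?b 0 = e) + of_bool (?b 1 = e) + of_bool (?b 2 = e)"
   using label_count[OF T, of e] unfolding p by (simp add: numeral_3_eq_3 numeral_2_eq_2)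
 qed
 hence b: "?b 0 = ?a 2 & ?b 1 = ?a 0 & ?b 2 = ?a 1" using hol hol3 by (elim disjE) (simp_all add: cancel)
 have hex: "holonomy i j lab T = ?c (?a 0) - ?c (?a 1) + (?c (?a 2) - ?c (?a 0) + (?c (?a 1) - ?c (?a 2)))"
  using hol3 b by simp
 have d: "distinct [?a 0, ?a 1, ?a 2]" using hol hex by (auto simp: cancel)
 have inE: "?a s : orbits {k, l}" for s using rot_in[OF ij T] by (auto simp: orbits_def)
 have area: "area T = - 2 *\<^sub>R triple_area (label_vec (?a 0)) (label_vec (?a 1)) (label_vec (?a 2))"
  unfolding area_def hex hexagon_nil3 by simp
 have count: "card (orb {i, j} T Int e) = 2" if e: "e : {?a 0, ?a 1, ?a 2}" for e
 proof -
  have eE: "e : orbits {k, l}" using e inE[of 0] inE[of 1] inE[of 2] by blast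
  have mem: "X : e \<longleftrightarrow> orb {k, l} X = e" for X using orbits_label(2)[OF C(1) eE] orb_refl by metis
  have "card (half i j T Int e) = 1"
   using e d by (auto simp: card_half_eq_sum(1)[OF ij T] mem p numeral_3_eq_3 numeral_2_eq_2)
  moreover have "card (sg j ` half i j T Int e) = card (half i j T Int e)"
   using sides_zero[OF T eE] by (simp add: sides_def)
  ultimately show ?thesis using card_orb_Int[OF ij T, of e] by simp
 qed
 have sub: "orb {i, j} T <= ?a 0 Un ?a 1 Un ?a 2"
 proof
  fix X assume "X : orb {i, j} T"
  hence "X : half i j T Un sg j ` half i j T" using orb_eq_halves[OF ij T] by simp
  then obtain s where s: "s < 3" "X = ?r s | X = sg j (?r s)" unfolding half_def p by auto
  have "s = 0 | s = 1 | s = 2" using s(1) by auto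
  moreover have "X : orb {k, l} X" by (rule orb_refl)
  ultimately show "X : ?a 0 Un ?a 1 Un ?a 2" using s(2) b by auto
 qed
 show "EX a b c. distinct [a, b, c] & {a, b, c} <= orbits {k, l} & orb {i, j} T <= a Un b Un c &
   (ALL e:{a, b, c}. card (orb {i, j} T Int e) = 2) &
   area T = - 2 *\<^sub>R triple_area (label_vec a) (label_vec b) (label_vec c)"
  using inE d sub area count by blast
qed

text \<open>There are four cycles with at most \<open>20\<close> tetrahedra altogether. By \<open>areas_span\<close> three of them have nonzero area, hence at
  least six tetrahedra each.\<close>

lemma four_cycles:
 obtains R1 R2 R3 R4 where "R1 : TT" "R2 : TT" "R3 : TT" "R4 : TT"
  "orbits {i, j} = {orb {i, j} R1, orb {i, j} R2, orb {i, j} R3, orb {i, j} R4}"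
  "distinct [orb {i, j} R1, orb {i, j} R2, orb {i, j} R3, orb {i, j} R4]"
  "period i j R1 = 3" "period i j R2 = 3" "period i j R3 = 3" "period i j R4 = 1"
  "area R1 ~= 0" "area R2 ~= 0" "area R3 ~= 0" "area R4 = 0"
proof -
 \<comment> \<open>outside any two cycles there is one whose area does not vanish\<close>
 have ex: "EX T:TT. T ~: orb {i, j} S & T ~: orb {i, j} S' & area T ~= 0" if S: "S : TT" "S' : TT" for S S'
 proof (rule ccontr)
  assume neg: "~ ?thesis"
  obtain w :: "real ^ 3" where w: "w ~= 0" "w \<bullet> area S = 0" "w \<bullet> area S' = 0" using perpendicular_to_two by blast
  have "w = 0"
  proof (rule areas_span)
   fix T assume T: "T : TT"
   consider "T : orb {i, j} S" | "T : orb {i, j} S'" | "area T = 0" using neg T by blast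
   thus "EX R:orb {i, j} T. w \<bullet> area R = 0"
   proof cases
    case 1 thus ?thesis using w orb_sym[OF 1 S(1) C(2)] by blast
   next
    case 2 thus ?thesis using w orb_sym[OF 2 S(2) C(2)] by blast
   next
    case 3 thus ?thesis using orb_refl by (intro bexI[of _ T]) auto
   qed
  qed
  thus False using w(1) by simp
 qed
 obtain R1 where R1: "R1 : TT" "area R1 ~= 0" using ex[OF T0 T0] by blast
 obtain R2 where R2: "R2 : TT" "R2 ~: orb {i, j} R1" "area R2 ~= 0" using ex[OF R1(1) R1(1)] by blast
 obtain R3 where R3: "R3 : TT" "R3 ~: orb {i, j} R1" "R3 ~: orb {i, j} R2" "area R3 ~= 0" using ex[OF R1(1) R2(1)] by blast
 let ?O1 = "orb {i, j} R1" and ?O2 = "orb {i, j} R2" and ?O3 = "orb {i, j} R3"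
 have O: "?O1 : orbits {i, j}" "?O2 : orbits {i, j}" "?O3 : orbits {i, j}" "distinct [?O1, ?O2, ?O3]"
  using R1 R2 R3 orb_refl by (auto simp: orbits_def)
 have "card (orbits {i, j} - {?O1, ?O2, ?O3}) = 1" using edges[OF co] O finite_orbits by simp
 then obtain O4 where O4: "orbits {i, j} - {?O1, ?O2, ?O3} = {O4}" by (rule card_1_singletonE)
 hence "O4 : orbits {i, j}" by auto
 then obtain R4 where R4: "R4 : TT" "O4 = orb {i, j} R4" by (auto simp: orbits_def)
 have orbs: "orbits {i, j} = {?O1, ?O2, ?O3, orb {i, j} R4}" "distinct [?O1, ?O2, ?O3, orb {i, j} R4]"
 proof -
  show "distinct [?O1, ?O2, ?O3, orb {i, j} R4]" using O4 R4(2) O(4) by auto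
  have "orbits {i, j} = {?O1, ?O2, ?O3} Un {O4}" using O4 O(1-3) by blast
  thus "orbits {i, j} = {?O1, ?O2, ?O3, orb {i, j} R4}" unfolding R4(2) by auto
 qed
 have le: "period i j R1 + period i j R2 + period i j R3 + period i j R4 <= 10"
  using sum_card_edges[OF co] orbs card_orb[OF ij] R1 R2 R3 R4 by simp
 have "3 <= period i j R1" "3 <= period i j R2" "3 <= period i j R3" "0 < period i j R4"
  using short_cycles(1) R1 R2 R3 period_props(1)[OF ij R4(1)] by auto
 hence p: "period i j R1 = 3" "period i j R2 = 3" "period i j R3 = 3" "period i j R4 = 1" using le by auto
 show thesis using short_cycles(1)[OF R4(1)] p that[OF R1(1) R2(1) R3(1) R4(1) orbs p] R1 R2 R3 by auto
qed

lemma small_edge: "EX O':orbits {i, j}. card O' = 2"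
proof -
 obtain R1 R2 R3 R4 where "R4 : TT" "period i j R4 = 1" by (rule four_cycles) blast
 thus ?thesis using card_orb[OF ij, of R4] by (auto simp: orbits_def)
qed

lemma same_labels_same_area:
 assumes e: "e : orbits {k, l}" and R: "R : TT" "period i j R = 3" "area R ~= 0" "card (orb {i, j} R Int e) ~= 2"
  and R': "R' : TT" "period i j R' = 3" "area R' ~= 0" "card (orb {i, j} R' Int e) ~= 2"
 shows "area R' = area R | area R' = - area R"
proof -
 obtain a b c where abc: "distinct [a, b, c]" "{a, b, c} <= orbits {k, l}"
  "ALL e:{a, b, c}. card (orb {i, j} R Int e) = 2" "area R = - 2 *\<^sub>R triple_area (label_vec a) (label_vec b) (label_vec c)"
  using short_cycles(2)[OF R(1,3,2)] by blast
 obtain a' b' c' where abc': "distinct [a', b', c']" "{a', b', c'} <= orbits {k, l}"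
  "ALL e:{a', b', c'}. card (orb {i, j} R' Int e) = 2" "area R' = - 2 *\<^sub>R triple_area (label_vec a') (label_vec b') (label_vec c')"
  using short_cycles(2)[OF R'(1,3,2)] by blast
 have four: "card (orbits {k, l} - {e}) = 3" using edges[OF colours_swap[OF co]] e by simp
 have rest: "{x, y, z} = orbits {k, l} - {e}"
  if "distinct [x, y, z]" "{x, y, z} <= orbits {k, l}" "e ~: {x, y, z}" for x y z
  using that four by (intro card_subset_eq) auto
 have "{a', b', c'} = {a, b, c}" using abc(3) R(4) abc'(3) R'(4) rest[OF abc(1,2)] rest[OF abc'(1,2)] by metis
 hence "(a' = a & b' = b & c' = c) | (a' = a & b' = c & c' = b) | (a' = b & b' = a & c' = c) |
  (a' = b & b' = c & c' = a) | (a' = c & b' = a & c' = b) | (a' = c & b' = b & c' = a)"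
  using abc'(1) by (rule rearranged_triple)
 thus ?thesis
  unfolding abc(4) abc'(4) by (elim disjE) (simp_all add:
    triple_area_perm[where x = "label_vec a" and y = "label_vec b" and z = "label_vec c"])
qed

text \<open>The areas of two cycles that miss the same label agree up to sign, so the areas would span at most a plane.\<close>

lemma no_small_label:
 assumes e: "e : orbits {k, l}" and e2: "card e = 2"
 shows False
proof -
 obtain R1 R2 R3 R4 where R: "R1 : TT" "R2 : TT" "R3 : TT" "R4 : TT"
  and orbs: "orbits {i, j} = {orb {i, j} R1, orb {i, j} R2, orb {i, j} R3, orb {i, j} R4}"
  "distinct [orb {i, j} R1, orb {i, j} R2, orb {i, j} R3, orb {i, j} R4]"
  and p: "period i j R1 = 3" "period i j R2 = 3" "period i j R3 = 3" "period i j R4 = 1"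
  and area: "area R1 ~= 0" "area R2 ~= 0" "area R3 ~= 0" "area R4 = 0" by (rule four_cycles)
 have "card e = (SUM O':orbits {i, j}. card (O' Int e))" using sum_card_orbits_Int[OF C(2) orbits_subset[OF C(1) e]] by simp
 also have "... = card (orb {i, j} R1 Int e) + card (orb {i, j} R2 Int e) + card (orb {i, j} R3 Int e) + card (orb {i, j} R4 Int e)"
  using orbs by simp
 finally have sum2: "card (orb {i, j} R1 Int e) + card (orb {i, j} R2 Int e) + card (orb {i, j} R3 Int e) <= 2"
  using e2 by simp
 \<comment> \<open>two of the three long cycles avoid \<open>e\<close>, hence have the same labels and the same area up to sign\<close>
 have key: False if "card (orb {i, j} P Int e) ~= 2" "card (orb {i, j} P' Int e) ~= 2"
  and P: "P : TT" "P' : TT" "P'' : TT" "period i j P = 3" "period i j P' = 3" "area P ~= 0" "area P' ~= 0"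
  and all: "orbits {i, j} = {orb {i, j} P, orb {i, j} P', orb {i, j} P'', orb {i, j} R4}" for P P' P''
 proof -
  have pm: "area P' = area P | area P' = - area P" by (rule same_labels_same_area[OF e P(1,4,6) that(1) P(2,5,7) that(2)])
  obtain w :: "real ^ 3" where w: "w ~= 0" "w \<bullet> area P = 0" "w \<bullet> area P'' = 0" using perpendicular_to_two by blast
  have w': "w \<bullet> area P' = 0" using pm w by auto
  have "w = 0"
  proof (rule areas_span)
   fix T assume T: "T : TT"
   hence "EX S:{P, P', P'', R4}. orb {i, j} T = orb {i, j} S" using all by (auto simp: orbits_def)
   then obtain S where S: "S : {P, P', P'', R4}" "orb {i, j} T = orb {i, j} S" by blast
   have "w \<bullet> area S = 0" using S(1) w w' area(4) by auto
   moreover have "S : orb {i, j} T" using S(2) orb_refl by simp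
   ultimately show "EX R:orb {i, j} T. w \<bullet> area R = 0" by blast
  qed
  thus False using w(1) by simp
 qed
 have all: "orbits {i, j} = {orb {i, j} R1, orb {i, j} R3, orb {i, j} R2, orb {i, j} R4}"
  "orbits {i, j} = {orb {i, j} R2, orb {i, j} R3, orb {i, j} R1, orb {i, j} R4}" using orbs(1) by auto
 consider "card (orb {i, j} R1 Int e) ~= 2" "card (orb {i, j} R2 Int e) ~= 2"
  | "card (orb {i, j} R1 Int e) ~= 2" "card (orb {i, j} R3 Int e) ~= 2"
  | "card (orb {i, j} R2 Int e) ~= 2" "card (orb {i, j} R3 Int e) ~= 2" using sum2 by linarith
 thus False
 proof cases
  case 1 show False by (rule key[OF 1 R(1,2,3) p(1,2) area(1,2) orbs(1)])
 next
  case 2 show False by (rule key[OF 2 R(1,3,2) p(1,3) area(1,3) all(1)])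
 next
  case 3 show False by (rule key[OF 3 R(2,3,1) p(2,3) area(2,3) all(2)])
 qed
qed

end

text \<open>The short cycle among the four cycles is an edge with only two tetrahedra round it, which \<open>no_small_label\<close> excludes.\<close>

lemma not_extremal: False
proof -
 have co: "colours 0 1 2 3" "colours 2 3 0 1" by (simp_all add: colours_def)
 from small_edge[OF co(2)] obtain e where "e : orbits {2, 3}" "card e = 2" by blast
 thus False using no_small_label[OF co(1)] by blast
qed

end

section \<open>Simplices and balls as cones\<close>

text \<open>The simplex with vertex set \<open>S\<close>, in barycentric coordinates.\<close>

definition bary_simplex :: "nat set => (nat => real) set" where
 "bary_simplex S = {x. (ALL a. 0 <= x a) & (ALL a. a ~: S --> x a = 0) & sum x S = 1}"

definition bary_boundary :: "nat set => (nat => real) set" where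
 "bary_boundary S = {x : bary_simplex S. EX a:S. x a = 0}"

definition ball_norm :: "nat => (nat => real) => real" where
 "ball_norm n x = sqrt (SUM i<n. (x i)\<^sup>2)"

lemma ball_norm_nonneg [simp]: "0 <= ball_norm n x" by (simp add: ball_norm_def sum_nonneg)

lemma ball_norm_scale: "ball_norm n (%i. r * x i) = \<bar>r\<bar> * ball_norm n x"
 by (simp add: ball_norm_def power_mult_distrib sum_distrib_left[symmetric] real_sqrt_mult)

lemma ball_norm_coordinate: "i < n ==> \<bar>x i\<bar> <= ball_norm n x"
 unfolding ball_norm_def by (rule real_le_rsqrt) (simp add: member_le_sum[of i "{..<n}" "%i. (x i)\<^sup>2"])

lemma ball_norm_eq_0_iff: "ball_norm n x = 0 \<longleftrightarrow> (ALL i<n. x i = 0)"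
 by (auto simp: ball_norm_def sum_nonneg_eq_0_iff)

lemma nball_sets:
 "topspace (nball n) = {x. (ALL i>=n. x i = 0) & ball_norm n x <= 1}"
 "nball_interior n = {x. (ALL i>=n. x i = 0) & ball_norm n x < 1}"
 "nball_boundary n = {x. (ALL i>=n. x i = 0) & ball_norm n x = 1}"
 by (auto simp: nball_interior_def nball_boundary_def nball_def topspace_Euclidean_space ball_norm_def)

lemma nball_eq: "nball n = top_of_set (topspace (nball n))"
 by (simp add: nball_def Euclidean_space_def subtopology_subtopology euclidean_product_topology
   topspace_Euclidean_space)

lemma Euclidean_space_eq: "Euclidean_space n = top_of_set {x. ALL i>=n. x i = 0}"
 by (simp add: Euclidean_space_def euclidean_product_topology)

lemma continuous_on_coordinate [continuous_intros]: "continuous_on X (%x. x (i :: nat) :: real)"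
 by (rule continuous_on_subset[OF continuous_on_product_coordinates subset_UNIV])

lemma continuous_on_ball_norm: "continuous_on X (ball_norm n)"
 unfolding ball_norm_def by (intro continuous_on_real_sqrt continuous_on_sum continuous_on_power continuous_on_coordinate)

lemma compact_nball: "compact (topspace (nball n))"
proof -
 have "compactin (product_topology (%i. euclideanreal) UNIV) (PiE UNIV (%i :: nat. {-1..1}))" by (simp add: compactin_PiE)
 hence "compact (PiE UNIV (%i :: nat. {-1..1 :: real}))" by (simp add: euclidean_product_topology)
 moreover have "closed (topspace (nball n))"
 proof -
  have "topspace (nball n) = (INT i:{n..}. {x. x i = 0}) Int {x. ball_norm n x <= 1}" by (auto simp: nball_sets)
  moreover have "closed {x :: nat => real. x i = 0}" for i by (intro closed_Collect_eq continuous_intros)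
  moreover have "closed {x. ball_norm n x <= 1}" by (intro closed_Collect_le continuous_on_ball_norm continuous_intros)
  ultimately show ?thesis by (simp only:) (intro closed_Int closed_INT ballI)
 qed
 moreover have "topspace (nball n) <= PiE UNIV (%i :: nat. {-1..1})"
 proof
  fix x assume x: "x : topspace (nball n)"
  have "\<bar>x i\<bar> <= 1" for i
  proof (cases "i < n")
   case True
   thus ?thesis using ball_norm_coordinate[OF True, of x] x by (simp add: nball_sets)
  qed (use x in "simp add: nball_sets")
  thus "x : PiE UNIV (%i :: nat. {-1..1})" by (auto simp: abs_le_iff)
 qed
 ultimately show ?thesis by (metis compact_Int_closed Int_absorb1)
qed

lemma continuous_on_Min:
 assumes "finite A" "A ~= {}" "!!a. a : A ==> continuous_on X (f a :: _ => real)"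
 shows "continuous_on X (%x. Min ((%a. f a x) ` A))" using assms
proof (induction A rule: finite_ne_induct)
 case (insert a A)
 show ?case using insert by (auto intro: continuous_intros)
qed simp

lemma continuous_on_radial:
 fixes N g :: "'a :: topological_space => real"
 assumes N: "continuous_on E N" "!!x. x : E ==> 0 <= N x"
  and g: "continuous_on {x : E. N x ~= 0} g" "!!x. x : E ==> N x ~= 0 ==> \<bar>g x\<bar> <= 1"
 shows "continuous_on E (%x. if N x = 0 then 0 else N x * g x)"
 unfolding continuous_on_def
proof
 let ?f = "%x. if N x = 0 then 0 else N x * g x"
 fix x assume x: "x : E"
 show "(?f \<longlongrightarrow> ?f x) (at x within E)"
 proof (cases "N x = 0")
  case True
  have "eventually (%y. norm (?f y) <= N y) (at x within E)"
   unfolding eventually_at_filter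
  proof (rule always_eventually, intro allI impI)
   fix y assume "y : E"
   thus "norm (?f y) <= N y" using N(2)[of y] g(2)[of y] by (auto simp: abs_mult)
  qed
  moreover have "(N \<longlongrightarrow> 0) (at x within E)" using N(1) x True unfolding continuous_on_def by metis
  ultimately have "(?f \<longlongrightarrow> 0) (at x within E)" by (rule Lim_null_comparison)
  thus ?thesis using True by simp
 next
  case False
  let ?E = "{x : E. N x ~= 0}"
  obtain U where U: "open U" "U Int E = N -` (- {0}) Int E"
   using N(1) unfolding continuous_on_open_invariant by (metis open_Compl closed_singleton)
  have eq: "at x within E = at x within ?E" by (rule at_within_nhd[of x U]) (use U x False in auto)
  have "continuous_on ?E (%x. N x * g x)" by (intro continuous_intros g continuous_on_subset[OF N(1)]) auto
  hence "(?f \<longlongrightarrow> N x * g x) (at x within ?E)"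
   using x False Lim_transform_eventually by (fastforce simp: continuous_on_def)
  thus ?thesis using False eq by simp
 qed
qed

text \<open>Coning off the map gives a continuous injection \<open>H\<close> of Euclidean space into itself, where a point is first written as a multiple
  \<open>N x\<close> of a boundary point of the simplex by subtracting the least of its coordinates \<open>mu\<close>. By invariance of domain the image of \<open>H\<close> is
  a neighbourhood of the origin, so it meets every ray.\<close>

lemma inj_simplex_boundary_onto_sphere:
 assumes S: "finite S" "card S = Suc n" and n: "0 < n"
  and ps: "continuous_on (bary_boundary S) ps" "ps ` bary_boundary S <= nball_boundary n" "inj_on ps (bary_boundary S)"
 shows "ps ` bary_boundary S = nball_boundary n"
proof
 obtain d where d: "d : S" using S by force
 have "card (S - {d}) = n" using S d by simp
 then obtain b where b: "bij_betw b (S - {d}) {..<n}"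
  using S ex_bij_betw_finite_nat[of "S - {d}"] by (auto simp: atLeast0LessThan)
 define mu where "mu x a = (if a : S - {d} then x (b a) else 0)" for x :: "nat => real" and a
 define mn where "mn x = Min ((%a. mu x a) ` S)" for x
 define bar where "bar x a = (if a : S then mu x a - mn x else 0)" for x a
 define N where "N x = (SUM a:S. bar x a)" for x
 define H where "H x i = (if N x = 0 then 0 else N x * ps (%a. bar x a / N x) i)" for x i
 let ?E = "{x :: nat => real. ALL i>=n. x i = 0}"
 have mn_le: "mn x <= mu x a" if "a : S" for x a unfolding mn_def using S that by simp
 have mn_ex: "EX a:S. mn x = mu x a" for x
 proof -
  have "mn x : (%a. mu x a) ` S" unfolding mn_def by (rule Min_in) (use S d in auto)
  thus ?thesis by auto
 qed
 have bar0: "0 <= bar x a" for x a using mn_le by (simp add: bar_def)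
 have N0: "0 <= N x" for x unfolding N_def by (rule sum_nonneg) (rule bar0)
 have bd: "(%a. bar x a / N x) : bary_boundary S" if "N x ~= 0" for x using that mn_ex[of x] bar0 N0
  by (auto simp: sum_divide_distrib[symmetric] N_def bar_def bary_boundary_def bary_simplex_def)
 have cont: "continuous_on X (%x. mu x a)" for X a
  unfolding mu_def by (cases "a : S - {d}") (simp_all only: if_True if_False continuous_on_coordinate continuous_on_const)
 have cmn: "continuous_on X mn" for X unfolding mn_def by (rule continuous_on_Min) (use S d cont in auto)
 have cbar: "continuous_on X (%x. bar x a)" for X a
  unfolding bar_def using cont cmn by (cases "a : S") (auto intro!: continuous_on_diff)
 have cN: "continuous_on X N" for X unfolding N_def by (intro continuous_intros cbar)
 have nrm: "ball_norm n (H x) = N x" for x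
 proof (cases "N x = 0")
  case False
  have "ball_norm n (ps (%a. bar x a / N x)) = 1" using ps(2) bd[OF False] by (auto simp: nball_sets)
  moreover have "H x = (%i. N x * ps (%a. bar x a / N x) i)" by (simp add: H_def fun_eq_iff)
  ultimately show ?thesis using N0[of x] by (simp add: ball_norm_scale)
 qed (simp add: H_def ball_norm_def)
 have cH: "continuous_on ?E H"
 proof (rule continuous_on_coordinatewise_then_product)
  fix i
  show "continuous_on ?E (%x. H x i)"
   unfolding H_def
  proof (rule continuous_on_radial[OF cN N0])
   have "continuous_on {x : ?E. N x ~= 0} (%x. ps (%a. bar x a / N x))"
   proof (rule continuous_on_compose2[OF ps(1)])
    show "continuous_on {x : ?E. N x ~= 0} (%x a. bar x a / N x)"
     by (rule continuous_on_coordinatewise_then_product) (auto intro!: continuous_intros cbar cN)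
   qed (use bd in auto)
   thus "continuous_on {x : ?E. N x ~= 0} (%x. ps (%a. bar x a / N x) i)"
    by (rule continuous_on_product_then_coordinatewise)
   fix x assume "N x ~= 0"
   hence u: "ps (%a. bar x a / N x) : nball_boundary n" using ps(2) bd by blast
   show "\<bar>ps (%a. bar x a / N x) i\<bar> <= 1"
    using u ball_norm_coordinate[of i n "ps (%a. bar x a / N x)"] by (cases "i < n") (simp_all add: nball_sets)
  qed
 qed
 have HE: "H ` ?E <= ?E"
 proof (rule image_subsetI)
  fix x
  show "H x : ?E" using ps(2) bd[of x] by (cases "N x = 0") (auto simp: H_def nball_sets)
 qed
 have injH: "inj_on H ?E"
 proof (rule inj_onI)
  fix x y assume x: "x : ?E" and y: "y : ?E" and eq: "H x = H y"
  have Neq: "N x = N y" using eq nrm by metis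
  have bareq: "bar x = bar y"
  proof (cases "N x = 0")
   case True
   have "bar z a = 0" if "N z = 0" for z a using that bar0 by (metis sum_nonneg_eq_0_iff[OF S(1)] N_def bar_def)
   hence "bar x a = 0" "bar y a = 0" for a using True Neq by auto
   thus ?thesis by auto
  next
   case False
   have "ps (%a. bar x a / N x) = ps (%a. bar y a / N y)"
   proof
    fix i show "ps (%a. bar x a / N x) i = ps (%a. bar y a / N y) i"
     using fun_cong[OF eq, of i] False Neq by (simp add: H_def)
   qed
   thus ?thesis using bd[of x] bd[of y] False Neq ps(3) by (auto simp: fun_eq_iff dest: inj_onD)
  qed
  have mueq: "mu x a = mu y a" if "a : S" for a
   using fun_cong[OF bareq, of d] d fun_cong[OF bareq, of a] that by (simp add: bar_def mu_def)
  show "x = y"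
  proof
   fix i
   show "x i = y i"
   proof (cases "i < n")
    case True
    hence "i : b ` (S - {d})" using bij_betw_imp_surj_on[OF b] by simp
    then obtain a where a: "a : S - {d}" "b a = i" by blast
    thus ?thesis using mueq[of a] by (simp add: mu_def)
   qed (use x y in simp)
  qed
 qed
 have "openin (Euclidean_space n) (H ` ?E)" using cH HE injH invariance_of_domain_Euclidean_space
  by (simp add: Euclidean_space_eq subtopology_subtopology image_subset_iff_funcset)
 then obtain U where U: "open U" "H ` ?E = U Int ?E"
  unfolding Euclidean_space_eq openin_open by blast
 show "nball_boundary n <= ps ` bary_boundary S"
 proof
  fix u assume u: "u : nball_boundary n"
  have u1: "ball_norm n u = 1" "u : ?E" using u by (auto simp: nball_sets)
  have "H (%i. 0) = (%i. 0)" using mn_ex[of "%i. 0"] by (simp add: N_def bar_def mu_def H_def fun_eq_iff)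
  moreover have "(%i. 0) : ?E" by simp
  ultimately have "(%i. 0) : H ` ?E" by (rule image_eqI[OF sym])
  hence 0: "(%i. 0) : U" using U(2) by blast
  have "continuous_on UNIV (%t :: real. %i. t * u i)"
   by (rule continuous_on_coordinatewise_then_product) (intro continuous_intros)
  hence "open ((%t :: real. %i. t * u i) -` U)" using U(1) by (rule open_vimage[rotated])
  moreover have "(0 :: real) : (%t :: real. %i. t * u i) -` U" using 0 by simp
  ultimately obtain e where e: "e > 0" "ball 0 e <= (%t :: real. %i. t * u i) -` U" by (meson open_contains_ball)
  let ?t = "e / 2"
  have "?t : ball 0 e" using e(1) by simp
  hence "(%i. ?t * u i) : U" using e(2) by blast
  hence "(%i. ?t * u i) : H ` ?E" using u1(2) U(2) by simp
  then obtain x where x: "(%i. ?t * u i) = H x" by blast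
  have "N x = ?t" using nrm[of x] unfolding x[symmetric] ball_norm_scale u1(1) using e(1) by simp
  hence N: "N x = ?t" "N x ~= 0" using e(1) by auto
  show "u : ps ` bary_boundary S" using N(2) fun_cong[OF x] bd[OF N(2)] by (auto simp: N(1) H_def)
 qed
qed (rule ps(2))

text \<open>The point \<open>r w\<close> with \<open>w\<close> on the sphere goes to the convex combination of the barycentre and \<open>be w\<close> with weights \<open>1 - r\<close> and \<open>r\<close>;
  the inverse subtracts the least barycentric coordinate.\<close>

lemma cone_extension:
 assumes S: "finite S" "card S = Suc n" and n: "0 < n"
  and be: "continuous_on (nball_boundary n) be" "bij_betw be (nball_boundary n) (bary_boundary S)"
 shows "EX B. continuous_on (topspace (nball n)) B & bij_betw B (topspace (nball n)) (bary_simplex S) &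
  (ALL w:nball_boundary n. B w = be w) & (ALL w:nball_interior n. ALL a:S. 0 < B w a)"
proof -
 let ?r = "ball_norm n" and ?D = "topspace (nball n)"
 define u where "u w = (%i. w i / ?r w)" for w
 define B where "B w a = (if a : S then (1 - ?r w) / (1 + real n) else 0) + (if ?r w = 0 then 0 else ?r w * be (u w) a)" for w a
 have r: "0 <= ?r w" "w : ?D ==> ?r w <= 1" for w by (auto simp: nball_sets)
 have u: "u w : nball_boundary n" if "w : ?D" "?r w ~= 0" for w
 proof -
  have "u w = (%i. (1 / ?r w) * w i)" by (simp add: u_def)
  hence "ball_norm n (u w) = 1" using that(2) by (simp only: ball_norm_scale) simp
  thus ?thesis using that by (simp add: nball_sets u_def)
 qed
 have bd: "be (u w) : bary_boundary S" if "w : ?D" "?r w ~= 0" for w using be(2) u[OF that] by (auto simp: bij_betw_def)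
 have bdD: "0 <= x a" "x a <= 1" "a ~: S ==> x a = 0" "sum x S = 1" "EX a:S. x a = 0" if "x : bary_boundary S" for x a
 proof -
  show x: "0 <= x a" "a ~: S ==> x a = 0" "sum x S = 1" "EX a:S. x a = 0" for a
   using that by (auto simp: bary_boundary_def bary_simplex_def)
  show "x a <= 1" using x member_le_sum[of a S x] S by (cases "a : S") auto
 qed
 have cont: "continuous_on ?D B"
 proof (rule continuous_on_coordinatewise_then_product)
  fix a
  have "continuous_on ?D (%w. if ?r w = 0 then 0 else ?r w * be (u w) a)"
  proof (rule continuous_on_radial[OF continuous_on_ball_norm r(1)])
   have "continuous_on {w : ?D. ?r w ~= 0} (%w. be (u w))"
   proof (rule continuous_on_compose2[OF be(1)])
    show "continuous_on {w : ?D. ?r w ~= 0} u"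
     unfolding u_def by (rule continuous_on_coordinatewise_then_product) (auto intro!: continuous_intros continuous_on_ball_norm)
   qed (use u in auto)
   thus "continuous_on {w : ?D. ?r w ~= 0} (%w. be (u w) a)" by (rule continuous_on_product_then_coordinatewise)
   fix w assume "w : ?D" "?r w ~= 0"
   thus "\<bar>be (u w) a\<bar> <= 1" using bdD(1,2)[OF bd] by simp
  qed
  moreover have "continuous_on ?D (%w. if a : S then (1 - ?r w) / (1 + real n) else 0)"
   by (cases "a : S") (auto intro!: continuous_intros continuous_on_ball_norm)
  ultimately show "continuous_on ?D (%w. B w a)" unfolding B_def by (rule continuous_on_add[rotated])
 qed
 have lower: "(1 - ?r w) / (1 + real n) <= B w a" if "w : ?D" "a : S" for w a
  using bdD(1)[OF bd[OF that(1)]] that by (simp add: B_def)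
 have attained: "EX a:S. B w a = (1 - ?r w) / (1 + real n)" if w: "w : ?D" for w
 proof (cases "?r w = 0")
  case True
  obtain a where "a : S" using S by force
  thus ?thesis using True by (auto simp: B_def)
 next
  case False
  obtain a where "a : S" "be (u w) a = 0" using bdD(5)[OF bd[OF w False]] by blast
  thus ?thesis by (auto simp: B_def)
 qed
 have maps: "B w : bary_simplex S" if w: "w : ?D" for w
 proof -
  have "sum (B w) S = (SUM a:S. (1 - ?r w) / (1 + real n)) + (SUM a:S. if ?r w = 0 then 0 else ?r w * be (u w) a)"
   unfolding B_def by (simp add: sum.distrib)
  also have "(SUM a:S. (1 - ?r w) / (1 + real n)) = 1 - ?r w" using S by simp
  also have "(SUM a:S. if ?r w = 0 then 0 else ?r w * be (u w) a) = ?r w"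
   using bdD(4)[OF bd[OF w]] by (cases "?r w = 0") (simp_all add: sum_distrib_left[symmetric])
  finally have "sum (B w) S = 1" by simp
  moreover have "0 <= B w a" for a using lower[OF w, of a] r[of w] w bdD(3)[OF bd[OF w], of a] by (cases "a : S") (auto simp: B_def)
  moreover have "B w a = 0" if "a ~: S" for a using that bdD(3)[OF bd[OF w] that] by (simp add: B_def)
  ultimately show ?thesis by (simp add: bary_simplex_def)
 qed
 have inj: "inj_on B ?D"
 proof (rule inj_onI)
  fix w v assume w: "w : ?D" and v: "v : ?D" and eq: "B w = B v"
  have req: "?r w = ?r v" using attained[OF v] lower[OF w] eq attained[OF w] lower[OF v] by force
  show "w = v"
  proof (cases "?r w = 0")
   case True
   have "w i = 0" "v i = 0" for i
    using True req w v ball_norm_eq_0_iff[of n w] ball_norm_eq_0_iff[of n v] by (cases "i < n"; simp add: nball_sets)+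
   thus ?thesis by auto
  next
   case False
   have "be (u w) = be (u v)"
   proof
    fix a show "be (u w) a = be (u v) a"
     using fun_cong[OF eq, of a] False unfolding B_def req by (simp only: if_False add_left_cancel mult_cancel_left)
      simp
   qed
   thus ?thesis using be(2) u[OF w] u[OF v] False req by (auto simp: bij_betw_def u_def fun_eq_iff dest: inj_onD)
  qed
 qed
 have surj: "x : B ` ?D" if x: "x : bary_simplex S" for x
 proof -
  have xD: "0 <= x a" "a ~: S ==> x a = 0" "sum x S = 1" for a using x by (auto simp: bary_simplex_def)
  define m where "m = Min (x ` S)"
  have mS: "finite (x ` S)" "x ` S ~= {}" using S by auto
  have m_le: "m <= x a" if "a : S" for a unfolding m_def using mS that by simp
  obtain c where c: "c : S" "m = x c" using Min_in[OF mS] unfolding m_def by auto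
  have m0: "0 <= m" using c xD(1) by simp
  define q where "q = 1 - (1 + real n) * m"
  have sumq: "(SUM a:S. x a - m) = q" using S xD(3) by (simp add: sum_subtractf q_def)
  have q0: "0 <= q" unfolding sumq[symmetric] by (rule sum_nonneg) (use m_le in auto)
  have q1: "q <= 1" using m0 by (simp add: q_def)
  have mq: "(1 - q) / (1 + real n) = m" by (simp add: q_def)
  show ?thesis
  proof (cases "q = 0")
   case True
   have "x a = m" if "a : S" for a using True sumq sum_nonneg_eq_0_iff[OF S(1), of "%a. x a - m"] m_le that by auto
   moreover have "?r (%i. 0) = 0" by (simp add: ball_norm_def)
   ultimately have "x = B (%i. 0)" using xD(2) mq True by (auto simp: B_def)
   thus ?thesis using `?r (%i. 0) = 0` by (auto simp: nball_sets)
  next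
   case False
   hence qpos: "0 < q" using q0 by simp
   define y where "y a = (if a : S then (x a - m) / q else 0)" for a
   have "sum y S = 1" using sumq False by (simp add: y_def sum_divide_distrib[symmetric])
   moreover have "y c = 0" using c by (simp add: y_def)
   ultimately have "y : bary_boundary S" using c m_le qpos by (auto simp: bary_boundary_def bary_simplex_def y_def)
   hence "y : be ` nball_boundary n" using bij_betw_imp_surj_on[OF be(2)] by simp
   then obtain v where v: "v : nball_boundary n" "be v = y" by blast
   let ?w = "%i. q * v i"
   have rw: "?r ?w = q" using v(1) qpos by (simp add: ball_norm_scale nball_sets)
   have "B ?w a = x a" for a using rw qpos False xD(2)[of a] by (simp add: u_def B_def rw v(2) mq y_def)
   hence "B ?w = x" by auto
   moreover have "?w : ?D" using rw q1 v(1) by (auto simp: nball_sets)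
   ultimately show ?thesis by blast
  qed
 qed
 have "bij_betw B ?D (bary_simplex S)" unfolding bij_betw_def using inj maps surj by blast
 moreover have "ALL w:nball_boundary n. B w = be w" by (auto simp: nball_sets B_def u_def)
 moreover have "ALL w:nball_interior n. ALL a:S. 0 < B w a"
 proof (intro ballI)
  fix w a assume w: "w : nball_interior n" and a: "a : S"
  have "w : ?D" "?r w < 1" using w by (auto simp: nball_sets)
  moreover have "0 < (1 - ?r w) / (1 + real n)" using `?r w < 1` by simp
  ultimately show "0 < B w a" using lower[of w a] a by linarith
 qed
 ultimately show ?thesis using cont by blast
qed

section \<open>Barycentric coordinates on a simplicial cell complex\<close>

lemma bary_simplex_mono: "S <= T ==> finite T ==> bary_simplex S <= bary_simplex T"
proof
 fix x assume S: "S <= T" "finite T" and x: "x : bary_simplex S"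
 have "sum x S = sum x T" by (rule sum.mono_neutral_left) (use S x in "auto simp: bary_simplex_def")
 thus "x : bary_simplex T" using S x by (auto simp: bary_simplex_def)
qed

lemma bary_simplex_restrict:
 assumes "x : bary_simplex T" "finite T" "{a. 0 < x a} <= S" "S <= T"
 shows "x : bary_simplex S"
proof -
 have x: "0 <= x a" "sum x T = 1" for a using assms(1) by (auto simp: bary_simplex_def)
 have 0: "x a = 0" if "a ~: S" for a using that assms(3) x(1)[of a] by force
 have "sum x S = sum x T" by (rule sum.mono_neutral_left) (use assms 0 in auto)
 thus ?thesis using x 0 by (simp add: bary_simplex_def)
qed

lemma bary_simplex_support_subset: "x : bary_simplex S ==> {a. 0 < x a} <= S"
 unfolding bary_simplex_def by force

lemma bary_simplex_support_nonempty: "x : bary_simplex S ==> {a. 0 < x a} ~= {}"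
proof
 assume x: "x : bary_simplex S" and e: "{a. 0 < x a} = {}"
 have "x a = 0" for a
 proof -
  have "~ 0 < x a" using e by blast
  moreover have "0 <= x a" using x by (simp add: bary_simplex_def)
  ultimately show ?thesis by simp
 qed
 thus False using x by (simp add: bary_simplex_def)
qed

locale contracted_complex =
 fixes K :: "'a cell_complex"
 assumes simplicial: "simplicial_cell_complex 3 K"
  and four_vertices: "f_number K 0 = 4"
  and compact: "compact_space (realization K)"
begin

abbreviation "R \<equiv> realization K"

lemma CW: "regular_CW_complex K" using simplicial by (simp add: simplicial_cell_complex_def)

lemma Hausdorff: "Hausdorff_space R" using CW by (simp add: regular_CW_complex_def)

lemma characteristic:
 assumes "c : cells K"
 shows "embedding_map (nball (cell_dim K c)) R (char_map K c)" "char_map K c ` topspace (nball (cell_dim K c)) = c"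
 using CW assms by (auto simp: regular_CW_complex_def)

lemma open_cells_disjoint:
 "c : cells K ==> c' : cells K ==> y : open_cell K c ==> y : open_cell K c' ==> c = c'"
 using CW unfolding regular_CW_complex_def by blast

lemma open_cells_cover: "(UN c:cells K. open_cell K c) = topspace R" using CW by (simp add: regular_CW_complex_def)

lemma carrier_exists: "y : topspace R ==> EX c:cells K. y : open_cell K c" using open_cells_cover by blast

lemma homeomorphic_cell:
 assumes "c : cells K"
 obtains th where "homeomorphic_maps (nball (cell_dim K c)) (subtopology R c) (char_map K c) th"
 using characteristic[OF assms] unfolding embedding_map_def homeomorphic_map_maps by auto

lemma weak_topology:
 "A <= topspace R ==> closedin R A \<longleftrightarrow> (ALL c:cells K. closedin (subtopology R c) (A Int c))"
 using CW unfolding regular_CW_complex_def by (elim conjE) (rule mp, erule spec)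

lemma continuous_characteristic:
 assumes "c : cells K"
 shows "continuous_map (nball (cell_dim K c)) R (char_map K c)"
 using characteristic(1)[OF assms] unfolding embedding_map_def
 by (meson homeomorphic_imp_continuous_map continuous_map_in_subtopology)

lemma cell_subset: "c : cells K ==> c <= topspace R"
 using continuous_map_image_subset_topspace[OF continuous_characteristic] characteristic(2) by metis

lemma cell_split:
 assumes c: "c : cells K"
 shows "open_cell K c Un cell_boundary K c = c" "open_cell K c Int cell_boundary K c = {}" "open_cell K c ~= {}"
proof -
 let ?n = "cell_dim K c"
 have s: "nball_interior ?n Un nball_boundary ?n = topspace (nball ?n)" "nball_interior ?n Int nball_boundary ?n = {}"
  by (auto simp: nball_sets)
 show "open_cell K c Un cell_boundary K c = c"
  using characteristic(2)[OF c] s unfolding open_cell_def cell_boundary_def by (simp add: image_Un[symmetric])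
 have "inj_on (char_map K c) (topspace (nball ?n))"
  using characteristic(1)[OF c] by (simp add: embedding_map_def homeomorphic_map_def)
 hence "char_map K c ` (nball_interior ?n Int nball_boundary ?n) = char_map K c ` nball_interior ?n Int char_map K c ` nball_boundary ?n"
  by (rule inj_on_image_Int) (use s(1) in auto)
 thus "open_cell K c Int cell_boundary K c = {}" using s(2) by (simp add: open_cell_def cell_boundary_def)
 show "open_cell K c ~= {}" by (auto simp: nball_sets ball_norm_def open_cell_def)
qed

lemma cell_nonempty: "c : cells K ==> c ~= {}" using cell_split(1,3) by fastforce

lemma compact_cell:
 assumes c: "c : cells K"
 shows "compactin R c" "closedin R c"
proof -
 have "compact_space (nball (cell_dim K c))" by (subst nball_eq) (simp add: compact_space_subtopology compact_nball)
 hence "compactin R (char_map K c ` topspace (nball (cell_dim K c)))"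
  by (intro image_compactin[OF _ continuous_characteristic[OF c]]) (simp add: compact_space_def)
 thus "compactin R c" using characteristic(2)[OF c] by simp
 thus "closedin R c" by (rule compactin_imp_closedin[OF Hausdorff])
qed

lemma finite_cells: "finite (cells K)"
proof -
 define p where "p c = (SOME y. y : open_cell K c)" for c
 have p: "p c : open_cell K c" if "c : cells K" for c
  unfolding p_def by (rule someI_ex) (use cell_split(3)[OF that] in auto)
 have pR: "p ` cells K <= topspace R" using p open_cells_cover by blast
 have p_eq: "c = c'" if "c : cells K" "c' : cells K" "p c : open_cell K c'" for c c'
  by (rule open_cells_disjoint[OF that(1,2) p[OF that(1)] that(3)])
 have meets: "finite (p ` cells K Int c)" if c: "c : cells K" for c
 proof -
  obtain F where F: "F <= cells K" "finite F" "cell_boundary K c <= (UN e:F. open_cell K e)"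
   using CW c unfolding regular_CW_complex_def by meson
  have "p ` cells K Int c <= p ` insert c F"
  proof
   fix y assume y: "y : p ` cells K Int c"
   then obtain c' where c': "c' : cells K" "y = p c'" by blast
   have "c' = c | (EX e:F. c' = e)" using y F(3) cell_split(1)[OF c] p_eq[OF c'(1)] c F(1) c'(2) by auto
   thus "y : p ` insert c F" using c'(2) by blast
  qed
  thus ?thesis using F(2) finite_subset by blast
 qed
 have closed: "closedin R Q" if Q: "Q <= p ` cells K" for Q
 proof -
  have "closedin (subtopology R c) (Q Int c)" if c: "c : cells K" for c
  proof (rule closedin_subset_topspace)
   have "finite (Q Int c)" using meets[OF c] Q by (meson Int_mono finite_subset subset_refl)
   thus "closedin R (Q Int c)" using Hausdorff_imp_t1_space[OF Hausdorff] Q pR unfolding t1_space_closedin_finite by blast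
  qed simp
  moreover have "Q <= topspace R" using Q pR by simp
  ultimately show ?thesis using weak_topology by blast
 qed
 have "finite (p ` cells K)"
 proof (rule ccontr)
  assume inf: "infinite (p ` cells K)"
  have "topspace R Int R derived_set_of (p ` cells K) ~= {}"
   using compact inf pR by (metis compactin_imp_Bolzano_Weierstrass compact_space_def)
  then obtain x where x: "x : R derived_set_of (p ` cells K)" by blast
  let ?Q = "p ` cells K - {x}"
  have "openin R (topspace R - ?Q)" using closed[of ?Q] by auto
  moreover have "x : topspace R - ?Q" using x by (auto simp: in_derived_set_of)
  moreover have "ALL T. x : T & openin R T --> (EX y. y ~= x & y : p ` cells K & y : T)"
   using x unfolding in_derived_set_of by (rule conjunct2)
  ultimately have "EX y. y ~= x & y : p ` cells K & y : topspace R - ?Q" by (elim allE[of _ "topspace R - ?Q"] impE conjI)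
  thus False by auto
 qed
 moreover have "inj_on p (cells K)" by (rule inj_onI) (use p p_eq in metis)
 ultimately show ?thesis by (rule finite_imageD)
qed

lemma zero_cell:
 assumes "c : cells K" "cell_dim K c = 0"
 shows "cell_boundary K c = {}" "open_cell K c = c" "EX y. c = {y}"
proof -
 show b: "cell_boundary K c = {}" using assms(2) by (simp add: cell_boundary_def nball_sets ball_norm_def)
 thus "open_cell K c = c" using cell_split(1)[OF assms(1)] by simp
 have "topspace (nball 0) = {%i. 0}" by (auto simp: nball_sets ball_norm_def)
 thus "EX y. c = {y}" using characteristic(2)[OF assms(1)] assms(2) by auto
qed

definition faces :: "'a set => 'a set set" where
 "faces c = insert c {e : cells K. e <= cell_boundary K c}"

definition verts :: "'a set => 'a set set" where
 "verts c = {v : cells K. cell_dim K v = 0 & v <= c}"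

text \<open>The poset isomorphism sends the empty set to itself, because both posets have it as their least element.\<close>

lemma boundary_poset:
 assumes c: "c : cells K" and n: "0 < cell_dim K c"
 shows "EX f p. bij_betw f {e : cells K. e <= cell_boundary K c} {A. A \<subset> {..cell_dim K c} & A ~= {}} &
  (ALL e:{e : cells K. e <= cell_boundary K c}. ALL e':{e : cells K. e <= cell_boundary K c}. e <= e' \<longleftrightarrow> f e <= f e') &
  (ALL a<=cell_dim K c. p a : cells K & p a <= cell_boundary K c & f (p a) = {a})"
proof -
 let ?n = "cell_dim K c" and ?P = "boundary_complex K c" and ?Q = "{e : cells K. e <= cell_boundary K c}"
 have P: "?P = insert {} ?Q" by (auto simp: boundary_complex_def face_poset_def)
 have nonempty: "{} ~: ?Q" using cell_nonempty by auto
 obtain f where f: "bij_betw f ?P (simplex_boundary_complex ?n)" "ALL x:?P. ALL y:?P. x <= y \<longleftrightarrow> f x <= f y"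
  using simplicial c unfolding simplicial_cell_complex_def isomorphic_set_posets_def by meson
 have surj: "A \<subset> {..?n} ==> EX e:?P. f e = A" for A
  using bij_betw_imp_surj_on[OF f(1)] unfolding simplex_boundary_complex_def by (metis imageE mem_Collect_eq)
 have "{} \<subset> {..?n}" by auto
 then obtain e where e: "e : ?P" "f e = {}" using surj by blast
 have f0: "f {} = {}" using P f(2) e by auto
 have "bij_betw f (?P - {{}}) (simplex_boundary_complex ?n - {{}})"
  using f0 P bij_betw_DiffI[OF f(1)] by (fastforce simp: simplex_boundary_complex_def)
 moreover have "?P - {{}} = ?Q" using P nonempty by simp
 moreover have "simplex_boundary_complex ?n - {{}} = {A. A \<subset> {..?n} & A ~= {}}" by (auto simp: simplex_boundary_complex_def)
 ultimately have b: "bij_betw f ?Q {A. A \<subset> {..?n} & A ~= {}}" by simp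
 have "EX e. e : cells K & e <= cell_boundary K c & f e = {a}" if "a <= ?n" for a
 proof -
  have "{a} ~= {..?n}"
  proof
   assume e: "{a} = {..?n}"
   have "0 : {..?n}" "?n : {..?n}" by auto
   thus False using n unfolding e[symmetric] by simp
  qed
  hence "{a} \<subset> {..?n}" using that by auto
  then obtain e where "e : ?P" "f e = {a}" using surj by blast
  thus ?thesis using P f0 by auto
 qed
 then obtain p where p: "a <= ?n ==> p a : cells K & p a <= cell_boundary K c & f (p a) = {a}" for a by metis
 show ?thesis
 proof (rule exI[of _ f], rule exI[of _ p], intro conjI b)
  show "ALL e:?Q. ALL e':?Q. e <= e' \<longleftrightarrow> f e <= f e'" using f(2) P by simp
  show "ALL a<=?n. p a : cells K & p a <= cell_boundary K c & f (p a) = {a}" using p by blast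
 qed
qed

lemma boundary_face_exists:
 assumes "c : cells K" "0 < cell_dim K c"
 shows "EX e:cells K. e <= cell_boundary K c"
proof -
 let ?C = "%f p. ALL a<=cell_dim K c. p a : cells K & p a <= cell_boundary K c & f (p a) = {a :: nat}"
 have "EX f p. ?C f p" using boundary_poset[OF assms] by auto
 thus ?thesis by auto
qed

text \<open>In the poset of nonempty subsets of a set, the elements are the sets of minimal elements below them.\<close>

lemma faces_verts:
 assumes c: "c : cells K"
 shows "card (verts c) = Suc (cell_dim K c)" "bij_betw verts (faces c) {S. S <= verts c & S ~= {}}"
proof -
 have "card (verts c) = Suc (cell_dim K c) & bij_betw verts (faces c) {S. S <= verts c & S ~= {}}"
 proof (cases "cell_dim K c = 0")
  case True
  obtain y where y: "c = {y}" using zero_cell[OF c True] by blast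
  have "v = c" if "v : cells K" "v <= c" for v using that(2) cell_nonempty[OF that(1)] y subset_singletonD by metis
  hence v: "verts c = {c}" using c True by (auto simp: verts_def)
  have "faces c = {c}" using zero_cell(1)[OF c True] cell_nonempty by (auto simp: faces_def)
  moreover have "{S. S <= {c} & S ~= {}} = {{c}}" by auto
  ultimately show ?thesis using v True by simp
 next
  case False
  let ?n = "cell_dim K c" and ?Q = "{e : cells K. e <= cell_boundary K c}"
  have n0: "0 < ?n" using False by simp
  obtain f p where f: "bij_betw f ?Q {A. A \<subset> {..?n} & A ~= {}}"
   and mono': "ALL e:?Q. ALL e':?Q. e <= e' \<longleftrightarrow> f e <= f e'"
   and p': "ALL a<=?n. p a : cells K & p a <= cell_boundary K c & f (p a) = {a}"
   using boundary_poset[OF c n0] by (elim exE conjE)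
  have mono: "e <= e' \<longleftrightarrow> f e <= f e'"
   if "e : cells K" "e <= cell_boundary K c" "e' : cells K" "e' <= cell_boundary K c" for e e' using mono' that by simp
  have p: "p a : cells K & p a <= cell_boundary K c & f (p a) = {a}" if "a <= ?n" for a using p' that by simp
  have fne: "f e ~= {}" "f e \<subset> {..?n}" if "e : ?Q" for e using bij_betwE[OF f] that by auto
  have sub: "cell_boundary K c <= c" using cell_split(1)[OF c] by blast
  have cQ: "c ~: ?Q" using cell_split[OF c] by blast
  have dimp: "cell_dim K (p a) = 0" if a: "a <= ?n" for a
  proof (rule ccontr)
   assume d: "cell_dim K (p a) ~= 0"
   have pa: "p a : cells K" "p a <= cell_boundary K c" "f (p a) = {a}" using p[OF a] by auto
   have d0: "0 < cell_dim K (p a)" using d by simp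
   obtain e' where e': "e' : cells K" "e' <= cell_boundary K (p a)" using boundary_face_exists[OF pa(1) d0] by blast
   have e'': "e' <= p a" "e' <= cell_boundary K c" using cell_split(1)[OF pa(1)] e' pa by auto
   hence "f e' <= {a}" using mono[of e' "p a"] e' pa by simp
   moreover have "f e' ~= {}" by (rule fne(1)) (use e'(1) e''(2) in simp)
   ultimately have "f e' = f (p a)" unfolding pa(3) by (simp add: subset_singleton_iff)
   thus False using e'(1) e''(2) pa e'(2) cell_split[OF pa(1)] inj_onD[OF bij_betw_imp_inj_on[OF f]] by blast
  qed
  have vert_p: "EX a<=?n. v = p a" if v: "v : verts c" for v
  proof -
   have v': "v : cells K" "cell_dim K v = 0" "v <= c" using v by (auto simp: verts_def)
   obtain y where y: "v = {y}" using zero_cell[OF v'(1,2)] by blast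
   have vb: "v <= cell_boundary K c"
    using y zero_cell(2)[OF v'(1,2)] open_cells_disjoint[OF v'(1) c] v'(2) False v'(3) cell_split(1)[OF c] by force
   then obtain a where a: "a : f v" using fne(1)[of v] v' by blast
   hence an: "a <= ?n" using fne(2)[of v] v' vb by blast
   hence "p a <= v" using mono[of "p a" v] p[OF an] v'(1) vb a by simp
   moreover have "p a ~= {}" using cell_nonempty p[OF an] by simp
   ultimately show ?thesis using y an by blast
  qed
  have pv: "p a : verts c" if "a <= ?n" for a using p[OF that] dimp[OF that] sub by (auto simp: verts_def)
  have vc: "verts c = p ` {..?n}" using vert_p pv by auto
  have inj: "inj_on p {..?n}"
  proof (rule inj_onI)
   fix a b assume ab: "a : {..?n}" "b : {..?n}" and eq: "p a = p b"
   have "f (p a) = {a}" "f (p b) = {b}" using p[of a] p[of b] ab by auto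
   thus "a = b" by (metis trans[OF sym] singleton_inject eq)
  qed
  define F where "F e = (if e = c then {..?n} else f e)" for e
  have F: "bij_betw F (faces c) {A. A <= {..?n} & A ~= {}}"
  proof -
   have b1: "bij_betw F ?Q {A. A \<subset> {..?n} & A ~= {}}"
    by (rule bij_betw_cong[THEN iffD1, OF _ f]) (use cQ in "auto simp: F_def")
   have b2: "bij_betw F {c} {{..?n}}" by (simp add: F_def)
   have "bij_betw F ({c} Un ?Q) ({{..?n}} Un {A. A \<subset> {..?n} & A ~= {}})" by (rule bij_betw_combine[OF b2 b1]) auto
   moreover have "{{..?n}} Un {A. A \<subset> {..?n} & A ~= {}} = {A. A <= {..?n} & A ~= {}}" by auto
   ultimately show ?thesis by (simp add: faces_def)
  qed
  have vF: "verts e = p ` F e" if e: "e : faces c" for e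
  proof (cases "e = c")
   case True thus ?thesis using vc by (simp add: F_def)
  next
   case False
   hence e': "e : cells K" "e <= cell_boundary K c" using e by (auto simp: faces_def)
   have "p a <= e \<longleftrightarrow> a : f e" if "a <= ?n" for a using mono[of "p a" e] p[OF that] e' by simp
   moreover have "verts e = {v : verts c. v <= e}" using e' sub by (auto simp: verts_def)
   moreover have "f e <= {..?n}" using fne(2)[of e] e' by blast
   ultimately show ?thesis unfolding vc using False by (auto simp: F_def)
  qed
  have "bij_betw (image p) {A. A <= {..?n} & A ~= {}} {S. S <= verts c & S ~= {}}"
   by (auto simp: bij_betw_def vc subset_image_iff intro!: inj_on_subset[OF inj_on_image_Pow[OF inj]])
  hence "bij_betw (image p o F) (faces c) {S. S <= verts c & S ~= {}}" by (rule bij_betw_trans[OF F])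
  hence "bij_betw verts (faces c) {S. S <= verts c & S ~= {}}" by (rule bij_betw_cong[THEN iffD1, rotated]) (simp add: vF)
  moreover have "card (verts c) = Suc ?n" unfolding vc using card_image[OF inj] by simp
  ultimately show ?thesis by simp
 qed
 thus "card (verts c) = Suc (cell_dim K c)" "bij_betw verts (faces c) {S. S <= verts c & S ~= {}}" by auto
qed

definition vertex :: "nat => 'a set" where
 "vertex = (SOME f. bij_betw f {..<4} {v : cells K. cell_dim K v = 0})"

lemma vertex: "bij_betw vertex {..<4} {v : cells K. cell_dim K v = 0}"
proof -
 have "card {v : cells K. cell_dim K v = 0} = 4" using four_vertices by (simp add: f_number_def)
 moreover have "finite {v : cells K. cell_dim K v = 0}" using finite_cells by simp
 ultimately have "EX f. bij_betw f {..<4 :: nat} {v : cells K. cell_dim K v = 0}" by (intro finite_same_card_bij) auto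
 thus ?thesis unfolding vertex_def by (rule someI_ex)
qed

definition col :: "'a set => nat set" where
 "col c = {a. a < 4 & vertex a <= c}"

lemma col_subset: "col c <= {..<4}" and finite_col: "finite (col c)"
 by (auto simp: col_def intro: finite_subset[of _ "{..<4}"])

lemma verts_col: "verts c = vertex ` col c"
proof
 show "verts c <= vertex ` col c"
 proof
  fix v assume v: "v : verts c"
  hence "v : vertex ` {..<4}" using bij_betw_imp_surj_on[OF vertex] by (simp add: verts_def)
  then obtain a where a: "a < 4" "v = vertex a" by auto
  thus "v : vertex ` col c" using v by (auto simp: verts_def col_def)
 qed
 show "vertex ` col c <= verts c" using bij_betwE[OF vertex] by (auto simp: verts_def col_def)
qed

lemma card_col: "c : cells K ==> card (col c) = Suc (cell_dim K c)"
 using faces_verts(1)[of c] card_image[OF inj_on_subset[OF bij_betw_imp_inj_on[OF vertex] col_subset[of c]]]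
 by (simp add: verts_col)

lemma bij_faces: "c : cells K ==> bij_betw col (faces c) {S. S <= col c & S ~= {}}"
proof -
 assume c: "c : cells K"
 have inj: "inj_on vertex {..<4}" by (rule bij_betw_imp_inj_on[OF vertex])
 have b: "bij_betw (image vertex) {S. S <= col c & S ~= {}} {S. S <= verts c & S ~= {}}" using col_subset
  by (auto simp: bij_betw_def verts_col subset_image_iff intro!: inj_on_subset[OF inj_on_image_Pow[OF inj]])
 have v: "bij_betw (image vertex o col) (faces c) {S. S <= verts c & S ~= {}}"
  by (rule bij_betw_cong[THEN iffD1, OF _ faces_verts(2)[OF c]]) (simp add: verts_col)
 have "col ` faces c <= {S. S <= col c & S ~= {}}"
  using bij_betwE[OF faces_verts(2)[OF c]] cell_split(1)[OF c] by (auto simp: faces_def verts_col col_def)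
 thus ?thesis using bij_betw_comp_iff2[OF b] v by blast
qed

lemma face:
 assumes c: "c : cells K" and e: "e : faces c"
 shows "e : cells K" "e <= c" "col e <= col c" "col e ~= {}" "e = c | (e <= cell_boundary K c & col e \<subset> col c & cell_dim K e < cell_dim K c)"
proof -
 show e': "e : cells K" using c e by (auto simp: faces_def)
 show "e <= c" using e cell_split(1)[OF c] by (auto simp: faces_def)
 show sub: "col e <= col c" "col e ~= {}" using bij_betwE[OF bij_faces[OF c]] e by auto
 show "e = c | (e <= cell_boundary K c & col e \<subset> col c & cell_dim K e < cell_dim K c)"
 proof (cases "e = c")
  case False
  hence "e <= cell_boundary K c" using e by (simp add: faces_def)
  moreover have "c : faces c" by (simp add: faces_def)
  hence "col e ~= col c" using inj_onD[OF bij_betw_imp_inj_on[OF bij_faces[OF c]]] e False by metis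
  moreover from this have "col e \<subset> col c" using sub by blast
  moreover from this have "card (col e) < card (col c)" by (rule psubset_card_mono[OF finite_col])
  ultimately show ?thesis using card_col[OF c] card_col[OF e'] by simp
 qed simp
qed

lemma faces_trans:
 assumes c: "c : cells K" "e : faces c" "e' : faces e"
 shows "e' : faces c"
proof (cases "e = c")
 case False
 hence "e <= cell_boundary K c" using assms(2) by (simp add: faces_def)
 moreover have "e' <= e" "e' : cells K" using face[OF face(1)[OF c(1,2)] c(3)] by auto
 ultimately show ?thesis by (auto simp: faces_def)
qed (use assms in simp)

lemma faces_col_inj: "c : cells K ==> e : faces c ==> e' : faces c ==> col e = col e' ==> e = e'"
 using inj_onD[OF bij_betw_imp_inj_on[OF bij_faces]] by blast

text \<open>Barycentric coordinates on the closed cell \<open>c\<close>. The last conjunct says that the faces cover \<open>c\<close>; for a regular complex this does not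
  hold by definition, and it is established along with the coordinates.\<close>

definition good :: "('a => nat => real) => 'a set => bool" where
 "good La c \<longleftrightarrow> continuous_map (subtopology R c) euclidean La & bij_betw La c (bary_simplex (col c)) &
   (ALL y:open_cell K c. ALL a:col c. 0 < La y a) & (ALL y:c. EX e:faces c. y : open_cell K e)"

lemma good_cong:
 assumes c: "c : cells K" and eq: "!!y. y : c ==> La y = La' y" and g: "good La c"
 shows "good La' c"
proof -
 have "continuous_map (subtopology R c) euclidean La'"
  by (rule continuous_map_eq[of _ _ La]) (use g eq in "auto simp: good_def")
 moreover have "bij_betw La' c (bary_simplex (col c))" using g eq unfolding good_def by (metis bij_betw_cong)
 moreover have "y : c" if "y : open_cell K c" for y using that cell_split(1)[OF c] by blast
 ultimately show ?thesis using g eq unfolding good_def by metis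
qed

lemma good_support:
 assumes c: "c : cells K" and g: "good La c" and y: "y : open_cell K c"
 shows "{a. 0 < La y a} = col c"
proof
 show "{a. 0 < La y a} <= col c"
  using y cell_split(1)[OF c] g bij_betwE bary_simplex_support_subset good_def by fastforce
 show "col c <= {a. 0 < La y a}" using g y unfolding good_def by blast
qed

lemma good_vertex:
 assumes c: "c : cells K" "cell_dim K c = 0"
 shows "EX La. good La c"
proof -
 obtain y where y: "c = {y}" using zero_cell[OF c] by blast
 obtain a where a: "col c = {a}" using card_col[OF c(1)] c(2) by (metis One_nat_def card_1_singletonE)
 let ?x = "%b. if b = a then 1 else 0 :: real"
 have "bary_simplex {a} = {?x}" by (auto simp: bary_simplex_def)
 moreover have "c : faces c" by (simp add: faces_def)
 ultimately have "good (%_. ?x) c"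
  unfolding good_def a using zero_cell(2)[OF c] by (auto simp: bij_betw_def y intro!: bexI[of _ c])
 thus ?thesis by blast
qed

text \<open>The coordinates on the proper faces identify their union with the boundary of a simplex. That this union is the whole boundary
  sphere of \<open>c\<close> is \<open>inj_simplex_boundary_onto_sphere\<close>; then the coordinates extend by \<open>cone_extension\<close>.\<close>

lemma good_extend:
 assumes c: "c : cells K" and n: "0 < cell_dim K c"
  and good: "!!e. e : cells K ==> cell_dim K e < cell_dim K c ==> good La e"
 shows "EX La'. good La' c & (ALL y:cell_boundary K c. La' y = La y)"
proof -
 let ?n = "cell_dim K c" and ?S = "col c" and ?Q = "{e : cells K. e <= cell_boundary K c}"
 define L where "L = \<Union>?Q"
 have S: "finite ?S" "card ?S = Suc ?n" using finite_col card_col[OF c] by auto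
 have Qf: "e : faces c" "e ~= c" if "e : ?Q" for e using that cell_split[OF c] by (auto simp: faces_def)
 have Qg: "good La e" if "e : ?Q" for e using good face(5)[OF c Qf(1)[OF that]] Qf(2)[OF that] that by blast
 have Lb: "L <= cell_boundary K c" unfolding L_def by blast
 have bc: "cell_boundary K c <= c" using cell_split(1)[OF c] by blast
 have LR: "L <= topspace R" using Lb bc cell_subset[OF c] by blast
 have carrier: "EX e:?Q. y : open_cell K e & {a. 0 < La y a} = col e" if y: "y : L" for y
 proof -
  obtain e where e: "e : ?Q" "y : e" using y unfolding L_def by blast
  then obtain e' where e': "e' : faces e" "y : open_cell K e'" using Qg unfolding good_def by meson
  show ?thesis using face[of e e'] e e' e'(2) good_support[of e' La y] Qg by fastforce
 qed
 have inj: "inj_on La L"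
 proof (rule inj_onI)
  fix y y' assume y: "y : L" "y' : L" and eq: "La y = La y'"
  obtain e where e: "e : ?Q" "y : open_cell K e" "{a. 0 < La y a} = col e" using carrier[OF y(1)] by blast
  obtain e' where e': "e' : ?Q" "y' : open_cell K e'" "{a. 0 < La y' a} = col e'" using carrier[OF y(2)] by blast
  have "y : e" "y' : e" using e(3) eq e e' cell_split(1) faces_col_inj[OF c Qf(1)[OF e(1)] Qf(1)[OF e'(1)]] by auto
  moreover have "inj_on La e" using Qg[OF e(1)] by (simp add: good_def bij_betw_def)
  ultimately show "y = y'" using eq by (meson inj_onD)
 qed
 have image: "La ` L = bary_boundary ?S"
 proof (intro equalityI subsetI)
  fix x assume "x : La ` L"
  then obtain y where y: "y : L" "x = La y" by blast
  obtain e where e: "e : ?Q" "y : open_cell K e" "{a. 0 < La y a} = col e" using carrier[OF y(1)] by blast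
  have "x : bary_simplex (col e)" using e cell_split(1) Qg[OF e(1)] y(2) bij_betwE by (fastforce simp: good_def)
  moreover have sub: "col e \<subset> ?S" using face(5)[OF c Qf(1)[OF e(1)]] Qf(2)[OF e(1)] by blast
  ultimately have x: "x : bary_simplex ?S" using bary_simplex_mono[OF _ S(1), of "col e"] by blast
  obtain a where a: "a : ?S" "a ~: col e" using sub by blast
  show "x : bary_boundary ?S"
   using a(2) e(3) y(2) x a by (auto simp: bary_simplex_def order_less_le bary_boundary_def)
 next
  fix x assume "x : bary_boundary ?S"
  hence x: "x : bary_simplex ?S" "EX a:?S. x a = 0" by (auto simp: bary_boundary_def)
  let ?T = "{a. 0 < x a}"
  have T: "?T <= ?S" "?T ~= {}" using bary_simplex_support_subset[OF x(1)] bary_simplex_support_nonempty[OF x(1)] .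
  obtain a where a: "a : ?S" "x a = 0" using x(2) by blast
  have T3: "?T ~= ?S" using a(2) a(1) by force
  have "?T : col ` faces c" using T by (simp add: bij_betw_imp_surj_on[OF bij_faces[OF c]])
  then obtain e where e: "e : faces c" "col e = ?T" by blast
  hence eQ: "e : ?Q" using T3 face[OF c e(1)] by auto
  have "x : La ` e"
   using e(2) T Qg[OF eQ] bary_simplex_restrict[OF x(1) S(1)] bij_betw_imp_surj_on by (force simp: good_def)
  thus "x : La ` L" using eQ unfolding L_def by blast
 qed
 have closed: "closedin R e" if "e : ?Q" for e using that compact_cell(2) by blast
 have cont: "continuous_map (subtopology R L) euclidean La"
 proof (rule pasting_lemma_closed[where I = ?Q and T = "%e. e" and f = "%_. La"])
  show "finite ?Q" using finite_cells by simp
  show "closedin (subtopology R L) e" if "e : ?Q" for e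
   by (rule closedin_subset_topspace[OF closed[OF that]]) (use that in "auto simp: L_def")
  show "continuous_map (subtopology (subtopology R L) e) euclidean La" if e: "e : ?Q" for e
  proof -
   have "L Int e = e" using e unfolding L_def by blast
   thus ?thesis using Qg[OF e] by (simp add: subtopology_subtopology good_def)
  qed
  show "EX e. e : ?Q & y : e & La y = La y" if "y : topspace (subtopology R L)" for y using that unfolding L_def by auto
 qed simp
 have compL: "compact_space (subtopology R L)"
  using closed finite_cells compact
  by (auto simp: L_def intro!: closedin_Union closedin_compact_space compact_space_subtopology)
 have topL: "topspace (subtopology R L) = L" using LR by auto
 have "homeomorphic_map (subtopology R L) (top_of_set (bary_boundary ?S)) La"
 proof (rule continuous_imp_homeomorphic_map[OF _ compL])
  show "continuous_map (subtopology R L) (top_of_set (bary_boundary ?S)) La"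
   using cont image by (auto simp: continuous_map_in_subtopology)
  show "Hausdorff_space (top_of_set (bary_boundary ?S))" by (simp add: Hausdorff_space_subtopology)
  show "La ` topspace (subtopology R L) = topspace (top_of_set (bary_boundary ?S))" using image topL by simp
  show "inj_on La (topspace (subtopology R L))" using inj topL by simp
 qed
 then obtain ph where ph: "homeomorphic_maps (subtopology R L) (top_of_set (bary_boundary ?S)) La ph"
  unfolding homeomorphic_map_maps by blast
 have phL: "ph x : L" "La (ph x) = x" if "x : bary_boundary ?S" for x
  using ph that topL unfolding homeomorphic_maps_def by (auto dest!: continuous_map_funspace)
 obtain th where th: "homeomorphic_maps (nball ?n) (subtopology R c) (char_map K c) th"
  using homeomorphic_cell[OF c] by blast
 have topc: "topspace (subtopology R c) = c" using cell_subset[OF c] by auto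
 have thc: "th y : topspace (nball ?n)" "char_map K c (th y) = y" if "y : c" for y
  using th that topc unfolding homeomorphic_maps_def by (auto dest!: continuous_map_funspace)
 have thch: "th (char_map K c w) = w" "char_map K c w : c" if "w : topspace (nball ?n)" for w
  using th that topc unfolding homeomorphic_maps_def by (auto dest!: continuous_map_funspace)
 have bd: "nball_boundary ?n <= topspace (nball ?n)" "nball_interior ?n <= topspace (nball ?n)" by (auto simp: nball_sets)
 have thb: "th y : nball_boundary ?n" if y: "y : cell_boundary K c" for y
 proof -
  obtain w where "w : nball_boundary ?n" "y = char_map K c w" using y unfolding cell_boundary_def by blast
  thus ?thesis using thch(1)[of w] bd(1) by auto
 qed
 have tho: "th y : nball_interior ?n" if y: "y : open_cell K c" for y
 proof -
  obtain w where "w : nball_interior ?n" "y = char_map K c w" using y unfolding open_cell_def by blast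
  thus ?thesis using thch(1)[of w] bd(2) by auto
 qed
 define ps where "ps = th o ph"
 have Lc: "L <= c" using Lb bc by blast
 have ps1: "continuous_on (bary_boundary ?S) ps"
 proof -
  have "continuous_map (top_of_set (bary_boundary ?S)) (subtopology R c) ph"
   using ph Lc unfolding homeomorphic_maps_def continuous_map_in_subtopology by blast
  moreover have "continuous_map (subtopology R c) (nball ?n) th" using th by (simp add: homeomorphic_maps_def)
  ultimately have "continuous_map (top_of_set (bary_boundary ?S)) (nball ?n) ps"
   unfolding ps_def by (rule continuous_map_compose)
  thus ?thesis by (subst (asm) nball_eq) (simp)
 qed
 have ps2: "ps ` bary_boundary ?S <= nball_boundary ?n" using phL(1) Lb thb unfolding ps_def by auto
 have ps3: "inj_on ps (bary_boundary ?S)"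
 proof (rule inj_onI)
  fix x x' assume x: "x : bary_boundary ?S" "x' : bary_boundary ?S" and "ps x = ps x'"
  hence "char_map K c (th (ph x)) = char_map K c (th (ph x'))" by (simp add: ps_def)
  moreover have "ph x : c" "ph x' : c" using phL(1) x Lc by auto
  ultimately have "ph x = ph x'" using thc(2) by simp
  thus "x = x'" using phL(2) x by metis
 qed
 have onto: "ps ` bary_boundary ?S = nball_boundary ?n" by (rule inj_simplex_boundary_onto_sphere[OF S n ps1 ps2 ps3])
 have L: "L = cell_boundary K c"
 proof
  show "cell_boundary K c <= L"
  proof
   fix y assume y: "y : cell_boundary K c"
   hence "th y : ps ` bary_boundary ?S" using thb onto by simp
   then obtain x where x: "x : bary_boundary ?S" "th y = th (ph x)" by (auto simp: ps_def)
   have "ph x : L" by (rule phL(1)[OF x(1)])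
   moreover have "y = ph x" using thc(2)[of y] thc(2)[of "ph x"] y bc calculation Lc x(2) by (metis subsetD)
   ultimately show "y : L" by simp
  qed
 qed (rule Lb)
 let ?be = "%w. La (char_map K c w)"
 have "continuous_on (nball_boundary ?n) ?be"
 proof -
  have "continuous_map (subtopology (nball ?n) (nball_boundary ?n)) (subtopology R L) (char_map K c)"
   unfolding continuous_map_in_subtopology L cell_boundary_def
   using continuous_map_from_subtopology[OF continuous_characteristic[OF c]] by auto
  hence "continuous_map (subtopology (nball ?n) (nball_boundary ?n)) euclidean (La o char_map K c)"
   using cont by (rule continuous_map_compose)
  moreover have "subtopology (nball ?n) (nball_boundary ?n) = top_of_set (nball_boundary ?n)"
   by (subst nball_eq) (simp only: subtopology_subtopology Int_absorb1[OF bd(1)])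
  ultimately show ?thesis by simp
 qed
 moreover have "bij_betw ?be (nball_boundary ?n) (bary_boundary ?S)"
 proof -
  have "bij_betw La L (bary_boundary ?S)" using inj image by (simp add: bij_betw_def)
  moreover have "bij_betw (char_map K c) (nball_boundary ?n) L"
   unfolding bij_betw_def L cell_boundary_def
  proof
   show "inj_on (char_map K c) (nball_boundary ?n)" by (rule inj_on_inverseI[where g = th]) (use thch(1) bd(1) in blast)
  qed simp
  ultimately have "bij_betw (La o char_map K c) (nball_boundary ?n) (bary_boundary ?S)" by (rule bij_betw_trans[rotated])
  thus ?thesis by (simp add: o_def)
 qed
 ultimately obtain B where B: "continuous_on (topspace (nball ?n)) B" "bij_betw B (topspace (nball ?n)) (bary_simplex ?S)"
  "ALL w:nball_boundary ?n. B w = ?be w" "ALL w:nball_interior ?n. ALL a:?S. 0 < B w a"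
  using cone_extension[OF S n, of ?be] by blast
 have bdry: "ALL y:cell_boundary K c. (B o th) y = La y"
 proof
  fix y assume y: "y : cell_boundary K c"
  have "B (th y) = La (char_map K c (th y))" using B(3) thb[OF y] by blast
  also have "char_map K c (th y) = y" using thc(2) y bc by blast
  finally show "(B o th) y = La y" by simp
 qed
 have "good (B o th) c"
  unfolding good_def
 proof (intro conjI ballI)
  have "continuous_map (nball ?n) euclidean B" using B(1) by (subst nball_eq) simp
  thus "continuous_map (subtopology R c) euclidean (B o th)"
   using th unfolding homeomorphic_maps_def by (meson continuous_map_compose)
  have "bij_betw th c (topspace (nball ?n))" by (rule bij_betw_byWitness[where f' = "char_map K c"]) (use thc thch in auto)
  thus "bij_betw (B o th) c (bary_simplex ?S)" using B(2) by (rule bij_betw_trans)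
  show "0 < (B o th) y a" if "y : open_cell K c" "a : ?S" for y a using B(4) tho[OF that(1)] that(2) by simp
  fix y assume y: "y : c"
  show "EX e:faces c. y : open_cell K e" using y cell_split(1)[OF c] L carrier Qf(1) by (fastforce simp: faces_def)
 qed
 thus ?thesis using bdry by blast
qed

lemma good_exists: "EX La. ALL c:cells K. cell_dim K c < n --> good La c"
proof (induction n)
 case (Suc n)
 then obtain La where La: "!!c. c : cells K ==> cell_dim K c < n ==> good La c" by blast
 have "EX La'. good La' c & (ALL y:cell_boundary K c. La' y = La y)" if c: "c : cells K" "cell_dim K c = n" for c
  using c good_vertex[OF c(1)] zero_cell(1)[OF c(1)] good_extend[OF c(1), of La] La by auto
 then obtain Ph where Ph: "!!c. c : cells K ==> cell_dim K c = n ==> good (Ph c) c & (ALL y:cell_boundary K c. Ph c y = La y)"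
  by metis
 define carr where "carr y = (THE c. c : cells K & y : open_cell K c)" for y
 have carr: "carr y = c" if "c : cells K" "y : open_cell K c" for y c
  unfolding carr_def by (rule the_equality) (use that open_cells_disjoint in blast)+
 define La' where "La' y = (if cell_dim K (carr y) = n then Ph (carr y) y else La y)" for y
 have low: "good La' c" if c: "c : cells K" "cell_dim K c < n" for c
 proof (rule good_cong[OF c(1) _ La[OF c]])
  fix y assume "y : c"
  then obtain e where e: "e : faces c" "y : open_cell K e" using La[OF c] unfolding good_def by blast
  show "La y = La' y" using face(1,5)[OF c(1) e(1)] c(2) carr[OF _ e(2)] by (auto simp: La'_def)
 qed
 have "good La' c" if c: "c : cells K" "cell_dim K c = n" for c
 proof (rule good_cong[OF c(1), of "Ph c"])
  show "good (Ph c) c" using Ph[OF c] by blast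
  fix y assume "y : c"
  then obtain e where e: "e : faces c" "y : open_cell K e" using Ph[OF c] unfolding good_def by blast
  have e': "e : cells K" by (rule face(1)[OF c(1) e(1)])
  show "Ph c y = La' y"
  proof (cases "e = c")
   case True thus ?thesis using carr[OF c(1), of y] e(2) c(2) by (simp add: La'_def)
  next
   case False
   hence "cell_dim K e < n" "e <= cell_boundary K c" using face(5)[OF c(1) e(1)] c(2) by auto
   moreover have "y : e" using e(2) cell_split(1)[OF e'] by blast
   ultimately have "Ph c y = La y" using Ph[OF c] by blast
   thus ?thesis using carr[OF e' e(2)] `cell_dim K e < n` by (simp add: La'_def)
  qed
 qed
 thus ?case using low by (metis less_SucE)
qed simp

definition coord :: "'a => nat => real" where
 "coord = (SOME La. ALL c:cells K. good La c)"

lemma good_coord: "c : cells K ==> good coord c"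
proof -
 obtain La where La: "ALL c:cells K. cell_dim K c < 4 --> good La c" using good_exists by blast
 have "cell_dim K c < 4" if "c : cells K" for c using simplicial that unfolding simplicial_cell_complex_def by fastforce
 hence "EX La. ALL c:cells K. good La c" using La by blast
 hence "ALL c:cells K. good coord c" unfolding coord_def by (rule someI_ex)
 thus "c : cells K ==> good coord c" by blast
qed

end

section \<open>Local topology of three-manifolds\<close>

type_synonym space3 = "(real \<times> real) \<times> real"

definition three_manifold :: "'a topology => bool" where
 "three_manifold R \<longleftrightarrow> (ALL x:topspace R. EX U. openin R U & x : U &
   subtopology R U homeomorphic_space (euclidean :: space3 topology))"

lemma three_manifoldI:
 assumes "!!x. x : topspace R ==> EX U. openin R U & x : U & subtopology R U homeomorphic_space Euclidean_space 3"
 shows "three_manifold R"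
proof -
 obtain f :: "(nat => real) => space3" and g where "homeomorphic_maps (Euclidean_space (DIM(space3))) euclidean f g"
  by (rule homeomorphic_maps_Euclidean_space_euclidean)
 moreover have "DIM(space3) = 3" by simp
 ultimately have "homeomorphic_maps (Euclidean_space 3) euclidean f g" by metis
 thus ?thesis using assms homeomorphic_space_trans by (metis homeomorphic_space_def three_manifold_def)
qed

lemma three_manifold_chart:
 assumes "three_manifold R" "x : topspace R"
 obtains U f and f' :: "space3 => 'a" where "openin R U" "x : U" "homeomorphic_maps (subtopology R U) euclidean f f'"
 using assms unfolding three_manifold_def homeomorphic_space_def by blast

lemma chart_maps:
 fixes f' :: "space3 => 'a"
 assumes U: "openin R U" and f: "homeomorphic_maps (subtopology R U) euclidean f f'"
 shows "!!y. y : U ==> f' (f y) = y" "!!z. f' z : U" "!!z. f (f' z) = z"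
  "continuous_map (subtopology R U) euclidean f" "continuous_map euclidean R f'"
  "!!V. openin R V ==> V <= U ==> open (f ` V)" "!!C. open C ==> openin R (f' ` C)"
proof -
 have top: "topspace (subtopology R U) = U" using openin_subset[OF U] by auto
 show fU: "f' (f y) = y" if "y : U" for y using f that top by (auto simp: homeomorphic_maps_def)
 show "f (f' z) = z" for z using f unfolding homeomorphic_maps_def by (metis UNIV_I topspace_euclidean)
 show "f' z : U" for z using f by (auto simp: homeomorphic_maps_def continuous_map_def)
 show "continuous_map (subtopology R U) euclidean f" using f by (simp add: homeomorphic_maps_def)
 show "continuous_map euclidean R f'" using f by (simp add: homeomorphic_maps_def continuous_map_in_subtopology)
 show "open (f ` V)" if "openin R V" "V <= U" for V
 proof -
  have "openin euclidean (f ` V)"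
   using that f homeomorphic_map_maps homeomorphic_imp_open_map open_map_def Int_absorb2 openin_subtopology_Int by metis
  thus ?thesis by simp
 qed
 show "openin R (f' ` C)" if "open C" for C
 proof -
  have "homeomorphic_maps euclidean (subtopology R U) f' f" by (rule homeomorphic_maps_sym[THEN iffD1, OF f])
  thus ?thesis using that homeomorphic_map_maps homeomorphic_imp_open_map open_map_def open_openin openin_trans_full[OF _ U]
   by blast
 qed
qed

lemma injective_from_three_manifold_open:
 fixes g :: "'a => space3"
 assumes R: "three_manifold R" and W: "openin R W"
  and g: "continuous_map (subtopology R W) euclidean g" "inj_on g W"
 shows "open (g ` W)"
proof -
 have "EX T. open T & y : T & T <= g ` W" if y: "y : g ` W" for y
 proof -
  obtain x where x: "x : W" "y = g x" using y by blast
  hence "x : topspace R" using openin_subset[OF W] by blast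
  then obtain U f f' where U: "openin R U" "x : U" and f: "homeomorphic_maps (subtopology R U) euclidean f (f' :: space3 => 'a)"
   by (rule three_manifold_chart[OF R])
  note fm = chart_maps[OF U(1) f]
  have UW: "openin R (U Int W)" using U(1) W by blast
  have op: "open (f ` (U Int W))" by (rule fm(6)[OF UW]) simp
  have img: "(g o f') ` f ` (U Int W) = g ` (U Int W)" using fm(1) by (auto simp: image_image)
  have "f' ` f ` (U Int W) <= W" using fm(1) by auto
  hence "continuous_map (top_of_set (f ` (U Int W))) (subtopology R W) f'"
   using continuous_map_from_subtopology[OF fm(5)] by (auto simp: continuous_map_in_subtopology)
  hence c: "continuous_on (f ` (U Int W)) (g o f')" using g(1) continuous_map_compose by force
  have "inj_on (g o f') (f ` (U Int W))"
  proof (rule comp_inj_on)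
   show "inj_on f' (f ` (U Int W))" using fm(3) by (rule inj_on_inverseI)
   show "inj_on g (f' ` f ` (U Int W))" by (rule inj_on_subset[OF g(2)]) fact
  qed
  hence "open (g ` (U Int W))" by (metis invariance_of_domain[OF c op] img)
  thus ?thesis using U(2) x by auto
 qed
 thus ?thesis by (subst open_subopen) blast
qed

lemma injective_into_three_manifold_open:
 fixes h :: "space3 => 'a"
 assumes R: "three_manifold R" and A: "open A"
  and h: "continuous_map (top_of_set A) R h" "inj_on h A"
 shows "openin R (h ` A)"
proof -
 have "EX T. openin R T & y : T & T <= h ` A" if y: "y : h ` A" for y
 proof -
  obtain x where x: "x : A" "y = h x" using y by blast
  hence "y : topspace R" using h(1) by (auto simp: continuous_map_def)
  then obtain U f f' where U: "openin R U" "y : U" and f: "homeomorphic_maps (subtopology R U) euclidean f (f' :: space3 => 'a)"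
   by (rule three_manifold_chart[OF R])
  note fm = chart_maps[OF U(1) f]
  define A' where "A' = {z : A. h z : U}"
  have op: "open A'" using openin_continuous_map_preimage[OF h(1) U(1)] A by (simp add: A'_def openin_open_eq)
  have AA: "A' <= A" by (auto simp: A'_def)
  have "continuous_map (top_of_set A') (subtopology R U) h"
   using h(1) continuous_map_from_subtopology_mono by (force simp: continuous_map_in_subtopology A'_def)
  hence c: "continuous_on A' (f o h)" using fm(4) continuous_map_compose by force
  have "inj_on (f o h) A'"
  proof (rule comp_inj_on)
   show "inj_on h A'" by (rule inj_on_subset[OF h(2) AA])
   show "inj_on f (h ` A')" by (rule inj_on_inverseI[where g = f']) (auto simp: A'_def fm(1))
  qed
  hence "openin R (f' ` (f o h) ` A')" by (metis invariance_of_domain[OF c op] fm(7))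
  moreover have "f' ` (f o h) ` A' = h ` A'"
   unfolding image_image by (rule image_cong) (auto simp: A'_def fm(1))
  ultimately have "openin R (h ` A')" by simp
  thus ?thesis using x U(2) by (intro exI[of _ "h ` A'"]) (auto simp: A'_def)
 qed
 thus ?thesis by (subst openin_subopen) blast
qed

lemma two_contractible_pieces_connected:
 assumes "two_contractible_pieces S"
 shows "connected_space S"
proof -
 obtain A B where AB: "A Un B = topspace S" "contractible_space (subtopology S A)" "contractible_space (subtopology S B)" "A Int B ~= {}"
  using assms unfolding two_contractible_pieces_def by blast
 have "connectedin S A" "connectedin S B"
  using AB contractible_imp_path_connected_space path_connected_imp_connected_space by (auto simp: connectedin_def)
 thus ?thesis using AB(4) AB(1) by (metis connectedin_Un connectedin_topspace)
qed

text \<open>The cylinder without the lower half, and without the upper half, of the vertical line through \<open>p\<close> is starlike.\<close>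

lemma two_contractible_pieces_punctured_cylinder:
 fixes p :: space3
 assumes r: "0 < r"
 shows "two_contractible_pieces (top_of_set (ball (fst p) r \<times> ball (snd p) r - {p}))"
proof -
 let ?C = "ball (fst p) r \<times> ball (snd p) r"
 let ?A = "?C - {fst p} \<times> {..snd p}" and ?B = "?C - {fst p} \<times> {snd p..}"
 have opC: "open ?C" by (intro open_Times open_ball)
 have cl: "closed ({fst p} \<times> {..snd p})" "closed ({fst p} \<times> {snd p..})"
  by (intro closed_Times closed_singleton closed_atMost closed_atLeast)+
 have star: "starlike (?C - {fst p} \<times> T)" if w: "snd w : ball (snd p) r" "fst w = fst p" "snd w ~: T"
   and T: "!!x u. 0 <= u ==> u <= 1 ==> x ~: T ==> (1 - u) * snd w + u * x ~: T" for T and w :: space3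
 proof -
  have wC: "w : ?C" using w(1,2) r by (cases w) auto
  have "convex ?C" by (intro convex_Times convex_ball)
  have "closed_segment w x <= ?C - {fst p} \<times> T" if x: "x : ?C - {fst p} \<times> T" for x
  proof
   fix y assume "y : closed_segment w x"
   then obtain u where u: "0 <= u" "u <= 1" "y = (1 - u) *\<^sub>R w + u *\<^sub>R x" by (auto simp: in_segment)
   have "y : ?C" using u x wC \<open>convex ?C\<close> by (metis DiffD1 convexD_alt)
   moreover have "y ~: {fst p} \<times> T"
   proof
    assume "y : {fst p} \<times> T"
    hence y: "fst y = fst p" "snd y : T" by auto
    have "u = 0 | fst x = fst p" using y(1) by (auto simp: u(3) fst_add w(2) algebra_simps)
    thus False using u(3) y(2) w(3) x T[OF u(1,2)] by force
   qed
   ultimately show "y : ?C - {fst p} \<times> T" by blast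
  qed
  moreover have "w : ?C - {fst p} \<times> T" using wC w(3) by auto
  ultimately show ?thesis unfolding starlike_def by blast
 qed
 have sA: "starlike ?A"
 proof (rule star[of "(fst p, snd p + r / 2)"])
  fix x u :: real assume u: "0 <= u" "u <= 1" and x: "x ~: {..snd p}"
  have "snd p < (1 - u) * (snd p + r / 2) + u * x"
  proof -
   have "(1 - u) * (snd p + r / 2) + u * x - snd p = (1 - u) * (r / 2) + u * (x - snd p)" by (simp add: algebra_simps)
   moreover have "0 < (1 - u) * (r / 2) + u * (x - snd p)" using u x r by (cases "u = 0") (auto intro!: add_nonneg_pos)
   ultimately show ?thesis by linarith
  qed
  thus "(1 - u) * snd (fst p, snd p + r / 2) + u * x ~: {..snd p}" by simp
 qed (use r in "auto simp: dist_norm")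
 have sB: "starlike ?B"
 proof (rule star[of "(fst p, snd p - r / 2)"])
  fix x u :: real assume u: "0 <= u" "u <= 1" and x: "x ~: {snd p..}"
  have "(1 - u) * (snd p - r / 2) + u * x < snd p"
  proof -
   have "snd p - ((1 - u) * (snd p - r / 2) + u * x) = (1 - u) * (r / 2) + u * (snd p - x)" by (simp add: algebra_simps)
   moreover have "0 < (1 - u) * (r / 2) + u * (snd p - x)" using u x r by (cases "u = 0") (auto intro!: add_nonneg_pos)
   ultimately show ?thesis by linarith
  qed
  thus "(1 - u) * snd (fst p, snd p - r / 2) + u * x ~: {snd p..}" by simp
 qed (use r in "auto simp: dist_norm")
 have AB: "?A Int ?B = (ball (fst p) r - {fst p}) \<times> ball (snd p) r" by auto
 have un: "?A Un ?B = ?C - {p}" by auto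
 have sub: "?A <= ?C - {p}" "?B <= ?C - {p}" by auto
 have conn: "connected (?A Int ?B)"
  unfolding AB by (intro connected_Times connected_punctured_ball connected_ball) simp
 have ne: "?A Int ?B ~= {}"
 proof -
  have "fst p + (r / 2, 0) : ball (fst p) r - {fst p}" using r by (auto simp: dist_norm prod_eq_iff)
  moreover have "snd p : ball (snd p) r" using r by simp
  ultimately show ?thesis unfolding AB by blast
 qed
 show ?thesis
  unfolding two_contractible_pieces_def
 proof (rule exI[of _ ?A], rule exI[of _ ?B], intro conjI)
  show "openin (top_of_set (?C - {p})) ?A" "openin (top_of_set (?C - {p})) ?B"
   using sub opC cl by (auto intro!: open_subset)
  show "?A Un ?B = topspace (top_of_set (?C - {p}))" by auto
  show "contractible_space (subtopology (top_of_set (?C - {p})) ?A)"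
   using starlike_imp_contractible[OF sA] sub by (simp add: subtopology_subtopology Int_absorb1)
  show "contractible_space (subtopology (top_of_set (?C - {p})) ?B)"
   using starlike_imp_contractible[OF sB] sub by (simp add: subtopology_subtopology Int_absorb1)
  show "connectedin (top_of_set (?C - {p})) (?A Int ?B)" using conn by (auto simp: connectedin_subtopology)
  show "?A Int ?B ~= {}" by (rule ne)
 qed
qed

lemma punctured_neighbourhood:
 assumes R: "three_manifold R" and U: "openin R U" "x : U"
 obtains B where "openin R B" "x : B" "B <= U" "two_contractible_pieces (subtopology R (B - {x}))"
proof -
 have xR: "x : topspace R" using U openin_subset by blast
 obtain V f and f' :: "space3 => 'a" where V: "openin R V" "x : V" and f: "homeomorphic_maps (subtopology R V) euclidean f f'"
  by (rule three_manifold_chart[OF R xR])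
 note fm = chart_maps[OF V(1) f]
 let ?p = "f x"
 have "open (f ` (U Int V))" using U V fm(6) by auto
 moreover have "?p : f ` (U Int V)" using U V by blast
 ultimately obtain A D where AD: "open A" "open D" "?p : A \<times> D" "A \<times> D <= f ` (U Int V)" by (rule open_prod_elim)
 have AD': "fst ?p : A" "snd ?p : D" using AD(3) by auto
 obtain r1 where r1: "0 < r1" "ball (fst ?p) r1 <= A" using AD(1) AD'(1) by (meson open_contains_ball)
 obtain r2 where r2: "0 < r2" "ball (snd ?p) r2 <= D" using AD(2) AD'(2) by (meson open_contains_ball)
 let ?r = "min r1 r2"
 let ?C = "ball (fst ?p) ?r \<times> ball (snd ?p) ?r"
 have r: "0 < ?r" using r1 r2 by simp
 have C: "?C <= f ` (U Int V)" using AD(4) r1(2) r2(2) by fastforce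
 have pC: "?p : ?C" using r by (cases ?p) auto
 have opC: "open ?C" by (intro open_Times open_ball)
 let ?B = "f' ` ?C"
 have B: "openin R ?B" by (rule fm(7)[OF opC])
 have "homeomorphic_maps euclidean (subtopology R V) f' f" by (rule homeomorphic_maps_sym[THEN iffD1, OF f])
 hence hm: "homeomorphic_map euclidean (subtopology R V) f'" using homeomorphic_map_maps by blast
 have px: "f' ?p = x" using fm(1) V by simp
 have img: "f' ` (?C - {?p}) = ?B - {x}" using fm(3) px by auto
 have "homeomorphic_map (top_of_set (?C - {?p})) (subtopology (subtopology R V) (?B - {x})) f'"
  by (rule homeomorphic_map_subtopologies[OF hm]) (use img fm(2) openin_subset[OF V(1)] in auto)
 moreover have "subtopology (subtopology R V) (?B - {x}) = subtopology R (?B - {x})"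
 proof -
  have "V Int (?B - {x}) = ?B - {x}" using fm(2) by blast
  thus ?thesis by (simp only: subtopology_subtopology)
 qed
 ultimately have "two_contractible_pieces (subtopology R (?B - {x}))"
  using two_contractible_pieces_homeomorphic[OF two_contractible_pieces_punctured_cylinder[OF r]] by metis
 moreover have "x : ?B" using pC px by auto
 moreover have "?B <= U"
 proof
  fix y assume "y : ?B"
  then obtain c where c: "c : ?C" "y = f' c" by blast
  obtain z where z: "z : U Int V" "c = f z" using C c(1) by blast
  thus "y : U" using c(2) fm(1)[of z] by simp
 qed
 ultimately show thesis using B by (intro that)
qed

section \<open>The coloured graph of a contracted pseudotriangulation\<close>

lemma space3_connected_line:
 "continuous_on X (%s. %a :: nat. (1 - s) * x a + s * y a :: real)" for X :: "real set"
 by (rule continuous_on_coordinatewise_then_product) (intro continuous_intros)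

lemma bary_simplex_segment:
 assumes "x : bary_simplex S" "y : bary_simplex S" "0 <= s" "s <= 1"
 shows "(%a. (1 - s) * x a + s * y a) : bary_simplex S"
 using assms by (auto simp: bary_simplex_def sum.distrib sum_distrib_left[symmetric])

lemma bary_simplex_neighbourhood:
 assumes A: "openin (top_of_set (bary_simplex {..<n})) A" and x: "x : A"
 shows "EX dl>0. ALL y:bary_simplex {..<n}. (ALL a<n. \<bar>y a - x a\<bar> < dl) --> y : A"
proof -
 obtain U where U: "open U" "A = bary_simplex {..<n} Int U" using A by (auto simp: openin_open)
 have "EX X. x : (\<Pi>\<^sub>E i\<in>UNIV. X i) & (ALL i. openin euclidean (X i)) & finite {i. X i ~= topspace euclidean} & (\<Pi>\<^sub>E i\<in>UNIV. X i) <= U"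
  using U(1) product_topology_open_contains_basis[of "%i. euclidean" UNIV U x] x U(2)
  by (simp add: euclidean_product_topology)
 then obtain X where X: "x : (\<Pi>\<^sub>E i\<in>UNIV. X i)" "(\<Pi>\<^sub>E i\<in>UNIV. X i) <= U" and X': "ALL i. openin euclidean (X i)"
  by auto
 have opX: "open (X i)" for i using X' open_openin by blast
 have xX: "x i : X i" for i using X(1) by auto
 have "EX e>0. ball (x i) e <= X i" for i using opX[of i] xX[of i] by (meson open_contains_ball)
 then obtain e where e: "!!i. 0 < e i" "!!i. ball (x i) (e i) <= X i" by metis
 let ?dl = "Min (insert 1 (e ` {..<n}))"
 have dl: "0 < ?dl" using e(1) by simp
 have "y : A" if y: "y : bary_simplex {..<n}" "ALL a<n. \<bar>y a - x a\<bar> < ?dl" for y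
 proof -
  have "y i : X i" for i
  proof (cases "i < n")
   case True
   hence "?dl <= e i" by simp
   thus ?thesis using y(2) True e(2)[of i] by (auto simp: dist_real_def abs_minus_commute)
  next
   case False
   have "y i = x i" using x U(2) y(1) False by (simp add: bary_simplex_def)
   thus ?thesis using xX by simp
  qed
  thus ?thesis using X(2) y(1) U(2) by auto
 qed
 thus ?thesis using dl by blast
qed

lemma four_colours:
 assumes "(d :: nat) < 4" "b < 4" "d ~= b"
 obtains a1 a2 where "{..<4} = {d, b, a1, a2}" "distinct [d, b, a1, a2]"
proof -
 have "card ({..<4} - {d, b}) = 2" using assms by simp
 then obtain a1 a2 where a: "{..<4} - {d, b} = {a1, a2}" "a1 ~= a2" by (auto simp: card_2_iff)
 have "{..<4} = {d, b, a1, a2}" using a(1) assms by auto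
 moreover have "distinct [d, b, a1, a2]" using a assms(3) by auto
 ultimately show thesis by (rule that)
qed

locale contracted_manifold = contracted_complex K for K :: "'a cell_complex" +
 assumes manifold: "three_manifold (realization K)"
begin

definition TT :: "'a set set" where "TT = {c : cells K. cell_dim K c = 3}"

abbreviation Dl :: "(nat => real) set" where "Dl \<equiv> bary_simplex {..<4}"

definition star :: "'a set => 'a set" where
 "star e = \<Union> (open_cell K ` {c : cells K. e : faces c})"

lemma finite_TT': "finite TT" using finite_cells by (simp add: TT_def)

lemma face_refl: "c : faces c" by (simp add: faces_def)

lemma col_T: "T : TT ==> col T = {..<4}"
 by (rule card_subset_eq) (use card_col[of T] col_subset in "auto simp: TT_def")

lemma T_col: "c : cells K ==> col c = {..<4} ==> c : TT" using card_col[of c] by (simp add: TT_def)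

lemma open_star: "e : cells K ==> openin R (star e)"
proof -
 assume e: "e : cells K"
 let ?F = "{c : cells K. e ~: faces c}"
 have "topspace R - star e = \<Union>?F"
 proof (intro equalityI subsetI)
  fix y assume y: "y : topspace R - star e"
  then obtain c where c: "c : cells K" "y : open_cell K c" using carrier_exists by blast
  thus "y : \<Union>?F" using y cell_split(1)[OF c(1)] by (auto simp: star_def)
 next
  fix y assume "y : \<Union>?F"
  then obtain c where c: "c : cells K" "e ~: faces c" "y : c" by blast
  obtain f where f: "f : faces c" "y : open_cell K f" using good_coord[OF c(1)] c(3) unfolding good_def by blast
  have fK: "f : cells K" by (rule face(1)[OF c(1) f(1)])
  have "y ~: star e"
  proof
   assume "y : star e"
   then obtain c' where c': "c' : cells K" "e : faces c'" "y : open_cell K c'" by (auto simp: star_def)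
   have "c' = f" by (rule open_cells_disjoint[OF c'(1) fK c'(3) f(2)])
   thus False using faces_trans[OF c(1) f(1)] c'(2) c(2) by simp
  qed
  thus "y : topspace R - star e" using cell_subset[OF c(1)] c(3) by blast
 qed
 moreover have "closedin R (\<Union>?F)" by (rule closedin_Union) (use compact_cell(2) finite_cells in auto)
 ultimately have "closedin R (topspace R - star e)" by simp
 moreover have "star e <= topspace R" using open_cells_cover by (auto simp: star_def)
 ultimately show ?thesis by (simp add: openin_closedin_eq)
qed

lemma continuous_coord: "continuous_map R euclidean coord"
proof (rule pasting_lemma_closed[where I = "cells K" and T = "%c. c" and f = "%_. coord"])
 show "closedin R c" if "c : cells K" for c using compact_cell(2)[OF that] .
 show "continuous_map (subtopology R c) euclidean coord" if "c : cells K" for c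
  using good_coord[OF that] by (simp add: good_def)
 show "EX c. c : cells K & y : c & coord y = coord y" if "y : topspace R" for y
  using carrier_exists[OF that] cell_split(1) by blast
qed (use finite_cells in auto)

lemma continuous_coordinate: "continuous_map R euclideanreal (%y. coord y a)"
 using continuous_coord continuous_map_componentwise_UNIV[of R "%_. euclideanreal" coord]
 by (simp add: euclidean_product_topology)

lemma coord_support: "c : cells K ==> y : open_cell K c ==> {a. 0 < coord y a} = col c"
 by (rule good_support[OF _ good_coord])

lemma coord_simplex: "y : topspace R ==> coord y : Dl"
proof -
 assume "y : topspace R"
 then obtain c where c: "c : cells K" "y : open_cell K c" using carrier_exists by blast
 hence "y : c" using cell_split(1) by blast
 thus ?thesis using good_coord[OF c(1)] bij_betwE bary_simplex_mono[OF col_subset] by (force simp: good_def)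
qed

lemma coord_inj:
 assumes c: "c : cells K" and "y : c" "y' : c" "coord y = coord y'"
 shows "y = y'" using good_coord[OF c] assms unfolding good_def bij_betw_def inj_on_def by blast

text \<open>If no two cells containing \<open>e\<close> had the same colours, then barycentric coordinates would be injective near a point of \<open>e\<close>, hence
  open by invariance of domain. But one of them vanishes on \<open>e\<close> and is nowhere negative.\<close>

lemma not_thin:
 assumes e: "e : cells K" "cell_dim K e < 3"
  and thin: "!!c c'. c : cells K ==> c' : cells K ==> e : faces c ==> e : faces c' ==> col c = col c' ==> c = c'"
 shows False
proof -
 have "col e ~= {..<4}" using card_col[OF e(1)] e(2) by force
 then obtain b where b: "b < 4" "b ~: col e" using col_subset[of e] by blast
 have "col e ~= {}" using face(4)[OF e(1) face_refl] .
 then obtain d where d: "d : col e" by blast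
 hence "d < 4" "d ~= b" using col_subset[of e] b by auto
 then obtain a1 a2 where a: "{..<4} = {d, b, a1, a2}" "distinct [d, b, a1, a2]" using four_colours b(1) by blast
 define g where "g y = ((coord y b, coord y a1), coord y a2)" for y
 have sR: "star e <= topspace R" by (rule openin_subset[OF open_star[OF e(1)]])
 have cont: "continuous_map (subtopology R (star e)) euclidean g"
 proof -
  have "continuous_map R euclidean g"
   unfolding g_def prod_topology_euclidean[symmetric] by (intro continuous_map_pairedI continuous_coordinate)
  thus ?thesis by (rule continuous_map_from_subtopology)
 qed
 have inj: "inj_on g (star e)"
 proof (rule inj_onI)
  fix y y' assume y: "y : star e" and y': "y' : star e" and eq: "g y = g y'"
  have s: "coord z d = 1 - coord z b - coord z a1 - coord z a2" if "z : star e" for z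
   using that coord_simplex sR a by (force simp: bary_simplex_def a(1))
  have "coord y i = coord y' i" for i
  proof (cases "i < 4")
   case True
   hence "i : {d, b, a1, a2}" using a(1) by auto
   thus ?thesis using eq s[OF y] s[OF y'] by (auto simp: g_def)
  next
   case False
   thus ?thesis using coord_simplex y y' sR unfolding bary_simplex_def by (metis (mono_tags, lifting) lessThan_iff mem_Collect_eq subsetD)
  qed
  hence co: "coord y = coord y'" by auto
  obtain c where c: "c : cells K" "e : faces c" "y : open_cell K c" using y by (auto simp: star_def)
  obtain c' where c': "c' : cells K" "e : faces c'" "y' : open_cell K c'" using y' by (auto simp: star_def)
  have "c = c'" using coord_support[OF c(1,3)] coord_support[OF c'(1,3)] co thin[OF c(1) c'(1) c(2) c'(2)] by simp
  thus "y = y'" using coord_inj[OF c(1) _ _ co] c c' cell_split(1)[OF c(1)] by blast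
 qed
 have "open (g ` star e)" by (rule injective_from_three_manifold_open[OF manifold open_star[OF e(1)] cont inj])
 moreover obtain y where y: "y : open_cell K e" using cell_split(3)[OF e(1)] by blast
 hence "y : star e" using e(1) face_refl by (auto simp: star_def)
 hence "g y : g ` star e" by blast
 ultimately obtain r where r: "0 < r" "ball (g y) r <= g ` star e" by (meson open_contains_ball)
 have "coord y b = 0"
 proof -
  have "~ 0 < coord y b" using coord_support[OF e(1) y] b(2) by blast
  moreover have "0 <= coord y b" using coord_simplex `y : star e` sR unfolding bary_simplex_def by blast
  ultimately show ?thesis by simp
 qed
 define z where "z = ((- (r / 2), coord y a1), coord y a2)"
 have "z : ball (g y) r" using r(1) `coord y b = 0` by (simp add: z_def g_def dist_Pair_Pair)
 hence "z : g ` star e" using r(2) by blast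
 then obtain y' where y': "y' : star e" "z = g y'" by auto
 have "coord y' b = - (r / 2)" using y'(2) by (simp add: g_def z_def)
 moreover have "0 <= coord y' b" using coord_simplex y'(1) sR unfolding bary_simplex_def by blast
 ultimately show False using r(1) by simp
qed

lemma in_tetrahedron: "e : cells K ==> EX T:TT. e : faces T"
proof -
 assume e: "e : cells K"
 let ?C = "{c : cells K. e : faces c}"
 obtain m where m: "m : ?C" "ALL c:?C. cell_dim K c <= cell_dim K m"
 proof -
  assume h: "!!m. m : ?C ==> ALL c:?C. cell_dim K c <= cell_dim K m ==> thesis"
  have fin: "finite (cell_dim K ` ?C)" using finite_cells by simp
  moreover have "cell_dim K ` ?C ~= {}" using e face_refl by auto
  ultimately have "Max (cell_dim K ` ?C) : cell_dim K ` ?C" by simp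
  then obtain m where m: "m : ?C" "Max (cell_dim K ` ?C) = cell_dim K m" by blast
  have "cell_dim K c <= cell_dim K m" if "c : ?C" for c
   unfolding m(2)[symmetric] by (rule Max_ge[OF fin imageI[OF that]])
  thus thesis using h[OF m(1)] by blast
 qed
 have only: "c = m" if "c : cells K" "m : faces c" for c
 proof -
  have "c : ?C" using faces_trans[OF that, of e] that m(1) by simp
  thus ?thesis using m(2) face(5)[OF that] by auto
 qed
 have "~ cell_dim K m < 3" using m(1) not_thin[of m] only by auto
 moreover have "cell_dim K m <= 3" using simplicial m(1) by (simp add: simplicial_cell_complex_def)
 ultimately have "m : TT" using m(1) by (simp add: TT_def)
 thus ?thesis using m(1) by blast
qed

definition cell_face :: "'a set => nat set => 'a set" where
 "cell_face T S = (THE e. e : faces T & col e = S)"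

lemma cell_face_eq: "T : TT ==> e : faces T ==> cell_face T (col e) = e"
 unfolding cell_face_def by (rule the_equality) (use faces_col_inj[of T] in "auto simp: TT_def")

lemma cell_face:
 assumes T: "T : TT" and S: "S <= {..<4}" "S ~= {}"
 shows "cell_face T S : faces T" "col (cell_face T S) = S" "cell_face T S : cells K"
proof -
 have TK: "T : cells K" using T by (simp add: TT_def)
 have "S : col ` faces T" using S col_T[OF T] by (simp add: bij_betw_imp_surj_on[OF bij_faces[OF TK]])
 then obtain e where e: "e : faces T" "col e = S" by blast
 thus "cell_face T S : faces T" "col (cell_face T S) = S" "cell_face T S : cells K"
  using cell_face_eq[OF T e(1)] face(1)[OF TK] by auto
qed

lemma cell_face_UNIV: "T : TT ==> cell_face T {..<4} = T" using cell_face_eq[of T T] face_refl col_T by simp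

lemma cell_face_mono:
 assumes T: "T : TT" "T' : TT" and S: "S <= S'" "S' <= {..<4}" "S ~= {}" and eq: "cell_face T S' = cell_face T' S'"
 shows "cell_face T S = cell_face T' S"
proof -
 have S'0: "S' ~= {}" using S by blast
 let ?e = "cell_face T S'"
 have e: "?e : faces T" "?e : faces T'" "col ?e = S'" "?e : cells K"
  using cell_face[OF T(1) S(2) S'0] cell_face[OF T(2) S(2) S'0] eq by auto
 have "S : col ` faces ?e" using S e(3) by (simp add: bij_betw_imp_surj_on[OF bij_faces[OF e(4)]])
 then obtain f where f: "f : faces ?e" "col f = S" by blast
 show ?thesis
  using faces_trans[OF _ e(1) f(1)] faces_trans[OF _ e(2) f(1)] T cell_face_eq[OF T(1), of f] cell_face_eq[OF T(2), of f] f(2)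
  by (simp add: TT_def)
qed

definition pt :: "'a set => (nat => real) => 'a" where "pt T = inv_into T coord"

lemma pt:
 assumes T: "T : TT" and x: "x : Dl"
 shows "pt T x : T" "coord (pt T x) = x" "pt T x : topspace R"
proof -
 have TK: "T : cells K" using T by (simp add: TT_def)
 have "x : coord ` T" using good_coord[OF TK] col_T[OF T] x by (metis good_def bij_betw_def)
 thus p: "pt T x : T" "coord (pt T x) = x" unfolding pt_def by (auto intro: inv_into_into f_inv_into_f)
 thus "pt T x : topspace R" using cell_subset[OF TK] by blast
qed

lemma pt_coord: "T : TT ==> y : T ==> pt T (coord y) = y"
 using good_coord[of T] unfolding pt_def good_def TT_def bij_betw_def by (auto intro: inv_into_f_f)

lemma continuous_pt:
 assumes T: "T : TT"
 shows "continuous_map (top_of_set Dl) R (pt T)"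
proof -
 have TK: "T : cells K" using T by (simp add: TT_def)
 have top: "topspace (subtopology R T) = T" using cell_subset[OF TK] by auto
 have b: "bij_betw coord T Dl" using good_coord[OF TK] col_T[OF T] by (simp add: good_def)
 have "homeomorphic_map (subtopology R T) (top_of_set Dl) coord"
 proof (rule continuous_imp_homeomorphic_map)
  show "continuous_map (subtopology R T) (top_of_set Dl) coord"
   using continuous_map_from_subtopology[OF continuous_coord] b by (auto simp: continuous_map_in_subtopology bij_betw_def)
  show "compact_space (subtopology R T)" by (rule compact_space_subtopology[OF compact_cell(1)[OF TK]])
 qed (use b top in "auto simp: bij_betw_def Hausdorff_space_subtopology")
 then obtain p where p: "homeomorphic_maps (subtopology R T) (top_of_set Dl) coord p"
  unfolding homeomorphic_map_maps by blast
 have "continuous_map (top_of_set Dl) R p" using p by (simp add: homeomorphic_maps_def continuous_map_in_subtopology)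
 moreover have "p x = pt T x" if x: "x : Dl" for x
 proof (rule coord_inj[OF TK _ pt(1)[OF T x]])
  show "p x : T" "coord (p x) = coord (pt T x)"
   using p x pt(2)[OF T x] by (auto simp: homeomorphic_maps_def continuous_map_def)
 qed
 ultimately show ?thesis by (rule continuous_map_eq) simp
qed

lemma pt_carrier:
 assumes T: "T : TT" and x: "x : Dl"
 shows "pt T x : open_cell K (cell_face T {a. 0 < x a})"
proof -
 have TK: "T : cells K" using T by (simp add: TT_def)
 obtain e where e: "e : faces T" "pt T x : open_cell K e" using good_coord[OF TK] pt(1)[OF T x] unfolding good_def by blast
 show ?thesis using coord_support[OF face(1)[OF TK e(1)] e(2)] pt(2)[OF T x] cell_face_eq[OF T e(1)] e(2) by simp
qed

lemma support: "x : Dl ==> {a. 0 < x a} <= {..<4}" "x : Dl ==> {a. 0 < x a} ~= {}"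
 by (rule bary_simplex_support_subset, assumption, rule bary_simplex_support_nonempty, assumption)

lemma pt_eq_face:
 assumes T: "T : TT" "T' : TT" and x: "x : Dl" "x' : Dl"
 shows "pt T x = pt T' x' \<longleftrightarrow> x = x' & cell_face T {a. 0 < x a} = cell_face T' {a. 0 < x a}"
proof
 assume eq: "pt T x = pt T' x'"
 hence "x = x'" using pt(2)[OF T(1) x(1)] pt(2)[OF T(2) x(2)] by simp
 moreover have "cell_face T {a. 0 < x a} = cell_face T' {a. 0 < x' a}"
  by (rule open_cells_disjoint[OF cell_face(3)[OF T(1) support[OF x(1)]] cell_face(3)[OF T(2) support[OF x(2)]]
     pt_carrier[OF T(1) x(1)]]) (use pt_carrier[OF T(2) x(2)] eq in simp)
 ultimately show "x = x' & cell_face T {a. 0 < x a} = cell_face T' {a. 0 < x a}" by simp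
next
 assume eq: "x = x' & cell_face T {a. 0 < x a} = cell_face T' {a. 0 < x a}"
 let ?e = "cell_face T {a. 0 < x a}"
 have eK: "?e : cells K" by (rule cell_face(3)[OF T(1) support[OF x(1)]])
 have "pt T x : ?e" using pt_carrier[OF T(1) x(1)] cell_split(1)[OF eK] by blast
 moreover have "pt T' x' : ?e" using pt_carrier[OF T(2) x(2)] eq cell_split(1)[OF eK] by auto
 ultimately show "pt T x = pt T' x'" using pt(2)[OF T(1) x(1)] pt(2)[OF T(2) x(2)] eq coord_inj[OF eK] by simp
qed

lemma pt_onto: "y : topspace R ==> EX T:TT. y : T & y = pt T (coord y) & coord y : Dl"
proof -
 assume y: "y : topspace R"
 obtain c where c: "c : cells K" "y : open_cell K c" using carrier_exists[OF y] by blast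
 obtain T where T: "T : TT" "c : faces T" using in_tetrahedron[OF c(1)] by blast
 have "y : c" using c cell_split(1) by blast
 thus ?thesis using face(2)[OF _ T(2)] T(1) pt_coord[OF T(1)] coord_simplex[OF y] by (force simp: TT_def)
qed

lemma openin_iff:
 assumes A: "A <= topspace R"
 shows "openin R A \<longleftrightarrow> (ALL T:TT. openin (top_of_set Dl) {x : Dl. pt T x : A})"
proof
 assume "openin R A"
 thus "ALL T:TT. openin (top_of_set Dl) {x : Dl. pt T x : A}" using openin_continuous_map_preimage[OF continuous_pt] by simp
next
 assume op: "ALL T:TT. openin (top_of_set Dl) {x : Dl. pt T x : A}"
 have clT: "closedin R (T - A)" if T: "T : TT" for T
 proof -
  have TK: "T : cells K" using T by (simp add: TT_def)
  have "openin (subtopology R T) {y : topspace (subtopology R T). coord y : {x : Dl. pt T x : A}}"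
  proof (rule openin_continuous_map_preimage)
   show "continuous_map (subtopology R T) (top_of_set Dl) coord"
    using continuous_map_from_subtopology[OF continuous_coord] coord_simplex by (auto simp: continuous_map_in_subtopology)
  qed (use op T in blast)
  moreover have "{y : topspace (subtopology R T). coord y : {x : Dl. pt T x : A}} = T Int A"
   using cell_subset[OF TK] pt_coord[OF T] coord_simplex by auto
  ultimately have "openin (subtopology R T) (T Int A)" by simp
  hence "closedin (subtopology R T) (topspace (subtopology R T) - (T Int A))" by (rule closedin_diff[OF closedin_topspace])
  moreover have "topspace (subtopology R T) - (T Int A) = T - A" using cell_subset[OF TK] by auto
  ultimately show ?thesis using closedin_trans_full compact_cell(2)[OF TK] by metis
 qed
 have "topspace R - A = (UN T:TT. T - A)"
 proof (intro equalityI subsetI)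
  fix y assume y: "y : topspace R - A"
  then obtain T where "T : TT" "y : T" using pt_onto by blast
  thus "y : (UN T:TT. T - A)" using y by blast
 qed (use cell_subset in "auto simp: TT_def")
 moreover have "closedin R (UN T:TT. T - A)" by (rule closedin_Union) (use clT finite_TT' in auto)
 ultimately show "openin R A" using A by (simp add: openin_closedin_eq)
qed

end

lemma cross_points:
 fixes s u v :: real
 assumes c: "{..<4} = {c, b, a1, a2}" "distinct [c, b, a1, a2 :: nat]" and "0 < u" "0 < v" "\<bar>s\<bar> + u + v < 1"
 defines "x \<equiv> (%a. if a = c then \<bar>s\<bar> else if a = b then 1 - \<bar>s\<bar> - u - v else if a = a1 then u else if a = a2 then v else 0)"
 shows "x : bary_simplex {..<4}" "s = 0 ==> {a. 0 < x a} = {..<4} - {c}" "s ~= 0 ==> {a. 0 < x a} = {..<4}"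
proof -
 have v: "x c = \<bar>s\<bar>" "x b = 1 - \<bar>s\<bar> - u - v" "x a1 = u" "x a2 = v" using c(2) by (auto simp: x_def)
 have z: "x a = 0" if "a ~: {..<4}" for a using that unfolding c(1) by (simp add: x_def)
 have "sum x {..<4} = 1" using c(2) v unfolding c(1) by simp
 moreover have "0 <= x a" for a using assms(3-5) by (simp add: x_def)
 ultimately show "x : bary_simplex {..<4}" using z by (simp add: bary_simplex_def)
 have pos: "0 < x b" "0 < x a1" "0 < x a2" "0 < x c \<longleftrightarrow> s ~= 0" using assms(3-5) unfolding v by auto
 have mem: "0 < x a \<longleftrightarrow> a : {..<4} & (a = c --> s ~= 0)" for a
 proof (cases "a : {..<4}")
  case True
  then consider "a = c" | "a = b" | "a = a1" | "a = a2" using c(1) by blast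
  thus ?thesis using pos(4) True pos(1) pos(2) pos(3) by auto
 qed (use z in simp)
 show "s = 0 ==> {a. 0 < x a} = {..<4} - {c}" using mem by auto
 show "s ~= 0 ==> {a. 0 < x a} = {..<4}" using mem by auto
qed

context contracted_manifold
begin

lemma second_tetrahedron:
 assumes c: "c < 4" and T: "T : TT"
 shows "EX T':TT. T' ~= T & cell_face T' ({..<4} - {c}) = cell_face T ({..<4} - {c})"
proof (rule ccontr)
 let ?C = "{..<4} - {c}"
 let ?e = "cell_face T ?C"
 have "(if c = 0 then 1 else 0) : ?C" by simp
 hence C: "?C <= {..<4}" "?C ~= {}" by blast+
 note e = cell_face[OF T C]
 assume neg: "~ ?thesis"
 have "cell_dim K ?e < 3" using c card_col[OF e(3)] e(2) by simp
 thus False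
 proof (rule not_thin[OF e(3)])
  have only: "c' = ?e | c' = T" if c': "c' : cells K" "?e : faces c'" for c'
  proof (cases "col c' = {..<4}")
   case True
   hence "c' : TT" by (rule T_col[OF c'(1)])
   moreover from this have "cell_face c' ?C = ?e" using cell_face_eq[OF _ c'(2)] e(2) by simp
   ultimately show ?thesis using neg by blast
  next
   case False
   have "?C <= col c'" using face(3)[OF c'] e(2) by simp
   moreover have "c ~: col c'"
   proof
    assume "c : col c'"
    thus False using calculation False col_subset[of c'] by auto
   qed
   ultimately have "col c' = ?C" using col_subset[of c'] by blast
   thus ?thesis using faces_col_inj[OF c'(1) c'(2) face_refl] e(2) by simp
  qed
  fix c1 c2 assume c12: "c1 : cells K" "c2 : cells K" "?e : faces c1" "?e : faces c2" "col c1 = col c2"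
  show "c1 = c2" using e(2) col_T[OF T] c only[OF c12(1,3)] only[OF c12(2,4)] c12(5) by auto
 qed
qed

text \<open>Two tetrahedra glued along a triangle contain an open ball of the manifold by invariance of domain, which leaves no room for a third one.\<close>

lemma no_third_tetrahedron:
 assumes c: "c < 4" and T: "T1 : TT" "T2 : TT" "T3 : TT" "T1 ~= T2" "T1 ~= T3" "T2 ~= T3"
  and e: "cell_face T1 ({..<4} - {c}) = e" "cell_face T2 ({..<4} - {c}) = e" "cell_face T3 ({..<4} - {c}) = e"
 shows False
proof -
 obtain b where b: "b < 4" "c ~= b" by (metis less_numeral_extra(1) zero_less_numeral zero_neq_one numeral_less_iff one_less_numeral_iff semiring_norm(76) order_less_trans)
 obtain a1 a2 where a: "{..<4} = {c, b, a1, a2}" "distinct [c, b, a1, a2]" using four_colours[OF c b] by blast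
 define A :: "space3 set" where "A = {z. 0 < snd (fst z) & 0 < snd z & \<bar>fst (fst z)\<bar> + snd (fst z) + snd z < 1}"
 define lam :: "space3 => nat => real" where "lam z = (%a. if a = c then \<bar>fst (fst z)\<bar>
   else if a = b then 1 - \<bar>fst (fst z)\<bar> - snd (fst z) - snd z
   else if a = a1 then snd (fst z) else if a = a2 then snd z else 0)" for z
 have lam: "lam z : Dl" "fst (fst z) = 0 ==> {a. 0 < lam z a} = {..<4} - {c}"
   "fst (fst z) ~= 0 ==> {a. 0 < lam z a} = {..<4}" if "z : A" for z
  using cross_points[OF a, of "snd (fst z)" "snd z" "fst (fst z)"] that unfolding A_def lam_def by auto
 have clam: "continuous_on X lam" for X
 proof (rule continuous_on_coordinatewise_then_product)
  fix i
  consider "i = c" | "i = b" | "i = a1" | "i = a2" | "i ~= c" "i ~= b" "i ~= a1" "i ~= a2" by blast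
  thus "continuous_on X (%z. lam z i)" by cases (use a(2) in "auto simp: lam_def intro!: continuous_intros")
 qed
 have opA: "open A"
 proof -
  have "A = {z. 0 < snd (fst z)} Int {z. 0 < snd z} Int {z. \<bar>fst (fst z)\<bar> + snd (fst z) + snd z < 1}" by (auto simp: A_def)
  thus ?thesis by (simp only:) (intro open_Int open_Collect_less continuous_intros)
 qed
 define h where "h z = (if 0 <= fst (fst z) then pt T1 (lam z) else pt T2 (lam z))" for z
 have cpt: "continuous_map (subtopology (top_of_set A) B) R (%z. pt T (lam z))" if "T : TT" for T B
 proof -
  have "continuous_map (top_of_set A) (top_of_set Dl) lam" using clam lam(1) by auto
  hence "continuous_map (top_of_set A) R (pt T o lam)" using continuous_pt[OF that] by (rule continuous_map_compose)
  thus ?thesis by (simp add: o_def continuous_map_from_subtopology)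
 qed
 have "continuous_map (top_of_set A) R h"
  unfolding h_def
 proof (rule continuous_map_cases_le)
  show "continuous_map (top_of_set A) euclideanreal (%z. 0)" "continuous_map (top_of_set A) euclideanreal (%z. fst (fst z))"
   by (auto intro!: continuous_intros)
  fix z assume z: "z : topspace (top_of_set A)" "0 = fst (fst z)"
  thus "pt T1 (lam z) = pt T2 (lam z)" using pt_eq_face[OF T(1,2) lam(1) lam(1)] lam(2)[of z] e by simp
 qed (rule cpt, rule T)+
 moreover have "inj_on h A"
 proof (rule inj_onI)
  fix z z' assume z: "z : A" "z' : A" and eq: "h z = h z'"
  have co: "coord (h y) = lam y" if "y : A" for y using pt(2)[OF _ lam(1)[OF that]] T by (simp add: h_def)
  have l: "lam z = lam z'" using co z eq by metis
  have sn: "snd (fst z) = snd (fst z')" "snd z = snd z'" "\<bar>fst (fst z)\<bar> = \<bar>fst (fst z')\<bar>"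
   using fun_cong[OF l, of a1] fun_cong[OF l, of a2] fun_cong[OF l, of c] a(2) by (simp_all add: lam_def)
  have "fst (fst z) = fst (fst z')"
  proof (rule ccontr)
   assume ne: "fst (fst z) ~= fst (fst z')"
   hence nz: "fst (fst z) ~= 0" and sg: "0 <= fst (fst z) \<longleftrightarrow> ~ 0 <= fst (fst z')" using sn(3) by auto
   have "pt T1 (lam z) = pt T2 (lam z)" using eq sg by (metis sym h_def l)
   thus False using pt_eq_face[OF T(1,2) lam(1)[OF z(1)] lam(1)[OF z(1)]] lam(3)[OF z(1) nz] cell_face_UNIV T by simp
  qed
  thus "z = z'" using sn by (simp add: prod_eq_iff)
 qed
 ultimately have op: "openin R (h ` A)" by (rule injective_into_three_manifold_open[OF manifold opA])
 define p :: "real => nat => real" where "p s = lam ((s, 1/4), 1/4)" for s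
 have pA: "((s, 1/4), 1/4) : A" if "\<bar>s\<bar> < 1/2" for s :: real using that by (simp add: A_def)
 have p: "p s : Dl" if "\<bar>s\<bar> < 1/2" for s using lam(1)[OF pA[OF that]] by (simp add: p_def)
 have "pt T3 (p 0) = h ((0, 1/4), 1/4)"
  using pt_eq_face[OF T(3,1) p p, of 0 0] lam(2)[OF pA, of 0] e by (simp add: h_def p_def)
 hence "p 0 : {x : Dl. pt T3 x : h ` A}" using p[of 0] pA[of 0] by auto
 moreover have "openin (top_of_set Dl) {x : Dl. pt T3 x : h ` A}"
  using openin_continuous_map_preimage[OF continuous_pt[OF T(3)] op] by simp
 ultimately obtain dl where dl: "0 < dl" "ALL y:Dl. (ALL a<4. \<bar>y a - p 0 a\<bar> < dl) --> y : {x : Dl. pt T3 x : h ` A}"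
  using bary_simplex_neighbourhood by meson
 define s where "s = min (1/4) (dl / 2)"
 have s: "0 < s" "\<bar>s\<bar> < 1/2" "s < dl" using dl(1) by (auto simp: s_def)
 have "\<bar>p s a - p 0 a\<bar> < dl" for a
  using s by (cases "a = c"; cases "a = b"; cases "a = a1"; cases "a = a2") (simp_all add: p_def lam_def)
 hence "pt T3 (p s) : h ` A" using dl(2) p[OF s(2)] by blast
 then obtain z where z: "z : A" "pt T3 (p s) = h z" by blast
 have "EX T:{T1, T2}. h z = pt T (lam z)" by (simp add: h_def)
 then obtain T where TT: "T : {T1, T2}" "h z = pt T (lam z)" by blast
 have TTT: "T : TT" using TT(1) T by auto
 have "cell_face T3 {a. 0 < p s a} = cell_face T {a. 0 < p s a}"
  by (rule conjunct2[OF iffD1[OF pt_eq_face[OF T(3) TTT p[OF s(2)] lam(1)[OF z(1)]] trans[OF z(2) TT(2)]]])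
 moreover have "{a. 0 < p s a} = {..<4}" using lam(3)[OF pA[OF s(2)]] s(1) by (simp add: p_def)
 ultimately have "T3 = T" using cell_face_UNIV[OF T(3)] cell_face_UNIV[OF TTT] by simp
 thus False using TT(1) T by auto
qed

definition sg :: "nat => 'a set => 'a set" where
 "sg c T = (if c < 4 & T : TT then SOME T'. T' : TT & T' ~= T & cell_face T' ({..<4} - {c}) = cell_face T ({..<4} - {c}) else T)"

lemma sg:
 assumes "c < 4" "T : TT"
 shows "sg c T : TT" "sg c T ~= T" "cell_face (sg c T) ({..<4} - {c}) = cell_face T ({..<4} - {c})"
proof -
 have "EX T'. T' : TT & T' ~= T & cell_face T' ({..<4} - {c}) = cell_face T ({..<4} - {c})"
  using second_tetrahedron[OF assms] by blast
 from someI_ex[OF this] assms show "sg c T : TT" "sg c T ~= T" "cell_face (sg c T) ({..<4} - {c}) = cell_face T ({..<4} - {c})"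
  by (simp_all add: sg_def)
qed

lemma triangle_neighbour:
 assumes "c < 4" "T : TT" "T' : TT" "cell_face T' ({..<4} - {c}) = cell_face T ({..<4} - {c})"
 shows "T' = T | T' = sg c T"
 using no_third_tetrahedron[OF assms(1,2,3) sg(1)[OF assms(1,2)]] sg(2,3)[OF assms(1,2)] assms(4) by metis

end

sublocale contracted_manifold \<subseteq> gem TT sg
proof
 show "finite TT" by (rule finite_TT')
 show "TT ~= {}" using simplicial by (auto simp: TT_def simplicial_cell_complex_def)
 fix c :: nat and T assume c: "c < 4"
 show "T : TT ==> sg c T : TT" "T : TT ==> sg c T ~= T" using sg[OF c] by auto
 show "sg c (sg c T) = T"
 proof (cases "T : TT")
  case True
  thus ?thesis
   using triangle_neighbour[OF c True sg(1)[OF c sg(1)[OF c True]]] sg[OF c True] sg[OF c sg(1)[OF c True]] by simp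
 qed (simp add: sg_def)
qed

context contracted_manifold
begin

lemma cell_face_orb:
 assumes T: "T : TT" "T' : orb ({..<4} - S) T" and S: "S <= {..<4}" "S ~= {}"
 shows "cell_face T' S = cell_face T S" using T(2,1) Diff_subset
proof (induction rule: orb_induct)
 case (step T'' c)
 have c: "c < 4" "S <= {..<4} - {c}" using step(3) S by auto
 show ?case using step(4) cell_face_mono[OF sg(1)[OF c(1) step(1)] step(1) c(2) _ S(2) sg(3)[OF c(1) step(1)]] by simp
qed simp

definition tet :: "'a => 'a set" where
 "tet y = (SOME T. T : TT & y = pt T (coord y))"

lemma tet: "y : topspace R ==> tet y : TT & y = pt (tet y) (coord y)"
 unfolding tet_def by (rule someI_ex) (use pt_onto in blast)

text \<open>A label of the tetrahedra that agrees on any two of them meeting at a point which satisfies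
  the open condition \<open>P\<close> is a locally constant function of the point.\<close>

lemma tet_value:
 assumes f: "!!T T' x. T : TT ==> T' : TT ==> x : Dl ==> P x ==>
   cell_face T {a. 0 < x a} = cell_face T' {a. 0 < x a} ==> f T = f T'"
 shows "T : TT ==> x : Dl ==> P x ==> f (tet (pt T x)) = f T"
  "openin (top_of_set Dl) {x : Dl. P x} ==> openin R {y : topspace R. P (coord y) & f (tet y) = v}"
proof -
 have val: "f (tet (pt T x)) = f T" if T: "T : TT" "x : Dl" "P x" for T x
 proof -
  have t: "tet (pt T x) : TT" "pt T x = pt (tet (pt T x)) x" using tet[OF pt(3)[OF T(1,2)]] pt(2)[OF T(1,2)] by auto
  thus ?thesis using pt_eq_face[OF T(1) t(1) T(2,2)] f[OF T(1) t(1) T(2,3)] by simp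
 qed
 thus "T : TT ==> x : Dl ==> P x ==> f (tet (pt T x)) = f T" .
 let ?A = "{y : topspace R. P (coord y) & f (tet y) = v}"
 assume P: "openin (top_of_set Dl) {x : Dl. P x}"
 have "openin (top_of_set Dl) {x : Dl. pt T x : ?A}" if T: "T : TT" for T
 proof -
  have e: "{x : Dl. pt T x : ?A} = (if f T = v then {x : Dl. P x} else {})" using pt(2,3)[OF T] val[OF T] by auto
  show ?thesis unfolding e using P by simp
 qed
 thus "openin R ?A" using openin_iff[of ?A] by blast
qed

lemma connectedin_pt_curve:
 assumes T: "T : TT" and X: "connected (X :: real set)" "continuous_on X ga" "ga ` X <= Dl"
 shows "connectedin R ((%r. pt T (ga r)) ` X)"
proof -
 have "continuous_map (top_of_set X) (top_of_set Dl) ga" using X by auto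
 hence "continuous_map (top_of_set X) R (pt T o ga)" using continuous_pt[OF T] by (rule continuous_map_compose)
 thus ?thesis using X(1) connectedin_continuous_map_image by (force simp: image_comp[symmetric] image_image)
qed

lemma openin_simplex_condition:
 assumes "!!X. continuous_on X f" "!!X. continuous_on X g"
 shows "openin (top_of_set Dl) {x : Dl. f x < (g x :: real)}"
proof -
 have "open {x. f x < g x}" by (rule open_Collect_less) (rule assms)+
 moreover have "{x : Dl. f x < g x} = Dl Int {x. f x < g x}" by auto
 ultimately show ?thesis by auto
qed

lemma pt_neighbourhood:
 assumes B: "openin R B" and T: "T : TT" and x: "x : Dl" "pt T x : B"
 shows "EX dl>0. ALL y:Dl. (ALL a<4. \<bar>y a - x a\<bar> < dl) --> pt T y : B"
proof -
 have "openin (top_of_set Dl) {x : Dl. pt T x : B}" using openin_continuous_map_preimage[OF continuous_pt[OF T] B] by simp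
 moreover have "x : {x : Dl. pt T x : B}" using x by simp
 ultimately obtain dl where "0 < dl" "ALL y:Dl. (ALL a<4. \<bar>y a - x a\<bar> < dl) --> y : {x : Dl. pt T x : B}"
  using bary_simplex_neighbourhood by meson
 thus ?thesis by blast
qed

lemma star_coord:
 assumes e: "e : cells K" and y: "y : star e"
 shows "col e <= {a. 0 < coord y a}" "{a. 0 < coord y a} = col e ==> y : e"
proof -
 obtain c where c: "c : cells K" "e : faces c" "y : open_cell K c" using y by (auto simp: star_def)
 have s: "{a. 0 < coord y a} = col c" by (rule coord_support[OF c(1,3)])
 thus "col e <= {a. 0 < coord y a}" using face(3)[OF c(1,2)] by simp
 assume "{a. 0 < coord y a} = col e"
 thus "y : e" using s faces_col_inj[OF c(1) face_refl c(2)] c(3) cell_split(1)[OF e] by auto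
qed

text \<open>Let \<open>f\<close> be the indicator function of one class of tetrahedra round the edge. A point \<open>x\<close> of the edge has a punctured neighbourhood
  without nontrivial coverings; it is covered by two open sets \<open>V 0\<close>, \<open>V 1\<close> which omit one half of the edge each. On their
  intersection, the part off the edge, \<open>f\<close> is locally constant and defines a cocycle. Writing it as \<open>t 1 - t 0\<close> and moving
  inside a tetrahedron to the two halves of the edge shows that \<open>f\<close> has the same value on \<open>T1\<close> and \<open>T2\<close>.\<close>

lemma edge_orbit:
 assumes co: "colours i j k l" and T: "T1 : TT" "T2 : TT" and eq: "cell_face T1 {k, l} = cell_face T2 {k, l}"
 shows "T2 : orb {i, j} T1"
proof (rule ccontr)
 assume notin: "T2 ~: orb {i, j} T1"
 have d: "i < 4" "j < 4" "k < 4" "l < 4" "distinct [i, j, k, l]" using co by (auto simp: colours_def)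
 have four: "{..<4} = {i, j, k, l}"
 proof (rule card_subset_eq[symmetric])
  show "card {i, j, k, l} = card {..<4 :: nat}" using d(5) by simp
 qed (use d in auto)
 let ?Ob = "orb {i, j} T1" and ?e = "cell_face T1 {k, l}"
 have S: "{k, l} <= {..<4}" "{k, l} ~= {}" using d by auto
 note e1 = cell_face[OF T(1) S]
 have Ob: "?Ob <= TT" by (rule orb_subset[OF T(1)]) (use d in auto)
 \<comment> \<open>the tetrahedra of one orbit fill an open set off the edge\<close>
 define P where "P x \<longleftrightarrow> 0 < min (min (x k) (x l)) (x i + x j)" for x :: "nat => real"
 have P: "openin (top_of_set Dl) {x : Dl. P x}"
  unfolding P_def by (rule openin_simplex_condition) (intro continuous_intros continuous_on_min)+
 have sat: "T' : ?Ob" if T: "T : TT" and h: "T : ?Ob" "T' : TT" "x : Dl" "P x" "cell_face T {a. 0 < x a} = cell_face T' {a. 0 < x a}" for T T' x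
 proof -
  have x: "0 < x k" "0 < x l" "0 < x i | 0 < x j" using h(4) by (auto simp: P_def)
  have "EX c:{i, j}. {..<4} - {c} <= {a. 0 < x a}" using x by (auto simp: four)
  then obtain c where c: "c : {i, j}" "{..<4} - {c} <= {a. 0 < x a}" by blast
  have c4: "c < 4" using c d by auto
  have "k : {..<4} - {c}" using c(1) d by auto
  hence "cell_face T' ({..<4} - {c}) = cell_face T ({..<4} - {c})"
   by (intro cell_face_mono[OF h(2) T c(2) support(1)[OF h(3)] _ h(5)[symmetric]]) blast
  thus ?thesis using h(1) orb_step[OF h(1) T c(1)] triangle_neighbour[OF c4 T h(2)] by auto
 qed
 define F :: "'a set => int" where "F T = (if T : ?Ob then 1 else 0)" for T
 have "F T = F T'" if h: "T : TT" "T' : TT" "x : Dl" "P x" "cell_face T {a. 0 < x a} = cell_face T' {a. 0 < x a}" for T T' x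
  using sat[OF h(1) _ h(2-5)] sat[OF h(2) _ h(1,3,4) h(5)[symmetric]] by (auto simp: F_def)
 note val = tet_value[of P F, OF this]
 define mk :: "real => real => nat => real" where
  "mk s ep = (%a. if a = k then 1/2 - ep + s else if a = l then 1/2 - ep - s else if a = i then 2 * ep else 0)" for s ep
 have mk: "mk s ep : Dl" if "0 <= ep" "\<bar>s\<bar> + ep <= 1/2" for s ep
 proof -
  have "sum (mk s ep) {..<4} = 1" using d(5) unfolding four by (simp add: mk_def)
  moreover have "mk s ep a = 0" if "a ~: {..<4}" for a using that unfolding four by (simp add: mk_def)
  ultimately show ?thesis using that by (auto simp: bary_simplex_def mk_def)
 qed
 have mkv: "mk s ep k = 1/2 - ep + s" "mk s ep l = 1/2 - ep - s" "mk s ep i = 2 * ep" "mk s ep j = 0" for s ep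
  using d(5) by (auto simp: mk_def)
 define x where "x = pt T1 (mk 0 0)"
 have edge_pt: "pt T2 (mk s 0) = pt T1 (mk s 0)" if "\<bar>s\<bar> < 1/2" for s
 proof -
  have "{a. 0 < mk s 0 a} = {k, l}" using that d(5) by (auto simp: mk_def)
  thus ?thesis using pt_eq_face[OF T(2,1) mk mk, of 0 s 0 s] that eq by simp
 qed
 have xe: "x : open_cell K ?e"
 proof -
  have "{a. 0 < mk 0 0 a} = {k, l}" by (auto simp: mk_def)
  thus ?thesis using pt_carrier[OF T(1) mk, of 0 0] by (simp add: x_def)
 qed
 hence x_star: "x : star ?e" using e1(3) face_refl by (auto simp: star_def)
 have cx: "coord x = mk 0 0" unfolding x_def by (rule pt(2)[OF T(1) mk]) simp_all
 obtain B where B: "openin R B" "x : B" "B <= star ?e" "two_contractible_pieces (subtopology R (B - {x}))"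
  by (rule punctured_neighbourhood[OF manifold open_star[OF e1(3)] x_star])
 let ?S = "subtopology R (B - {x})"
 have BR: "B <= topspace R" by (rule openin_subset[OF B(1)])
 have topS: "topspace ?S = B - {x}" using BR by auto
 have pos: "0 < coord y k" "0 < coord y l" "0 <= coord y i" "0 <= coord y j" if "y : B" for y
  using star_coord(1)[OF e1(3), of y] B(3) that e1(2) coord_simplex[of y] BR by (auto simp: bary_simplex_def)
 define W where "W y \<longleftrightarrow> 0 < coord y i + coord y j" for y
 have edge_y: "coord y k ~= 1/2" if y: "y : B - {x}" "~ W y" for y
 proof
  assume half: "coord y k = 1/2"
  have yB: "y : B" using y by blast
  have z: "coord y i = 0" "coord y j = 0" using y(2) pos[OF yB] by (auto simp: W_def)
  have sm: "coord y : Dl" using coord_simplex yB BR by blast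
  hence "coord y l = 1/2" using z half d(5) by (simp add: bary_simplex_def four)
  have "coord y a = mk 0 0 a" for a
  proof (cases "a < 4")
   case True
   hence "a : {i, j, k, l}" using four by auto
   thus ?thesis using z half `coord y l = 1/2` mkv by auto
  next
   case False
   thus ?thesis using sm mk[of 0 0] by (simp add: bary_simplex_def)
  qed
  hence c: "coord y = coord x" using cx by auto
  have "{a. 0 < coord y a} = {k, l}" unfolding c cx using d(5) by (auto simp: mk_def split: if_splits)
  hence "y : ?e" using star_coord(2)[OF e1(3), of y] B(3) yB e1(2) by auto
  moreover have "x : ?e" using xe cell_split(1)[OF e1(3)] by blast
  ultimately have "y = x" using coord_inj[OF e1(3)] c by blast
  thus False using y(1) by blast
 qed
 define V :: "nat => 'a set" where "V m = {y : B - {x}. W y | (if m = 0 then 1/2 < coord y k else coord y k < 1/2)}" for m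
 define f :: "'a => int" where "f y = F (tet y)" for y
 define g :: "nat => nat => 'a => int" where "g m n y = (int m - int n) * f y" for m n y
 have ccoord: "continuous_map ?S euclideanreal (%y. coord y a)" for a
  by (rule continuous_map_from_subtopology[OF continuous_coordinate])
 have opW: "openin ?S {y : topspace ?S. coord y i + coord y j : {0<..}}"
  by (rule openin_continuous_map_preimage) (use ccoord in "auto intro!: continuous_intros")
 have opgt: "openin ?S {y : topspace ?S. coord y k : {1/2<..}}" "openin ?S {y : topspace ?S. coord y k : {..<1/2}}"
  by (rule openin_continuous_map_preimage[OF ccoord], simp)+
 have VW: "V 0 Int V 1 = {y : B - {x}. W y}" by (auto simp: V_def)
 have fconst: "locally_const ?S {y : B - {x}. W y} f"
  unfolding locally_const_def
 proof (intro ballI)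
  fix y assume y: "y : {y : B - {x}. W y}"
  let ?U = "{z : topspace R. P (coord z) & F (tet z) = f y} Int (B - {x})"
  have "openin ?S ?U" by (rule openin_subtopology_Int[OF val(2)[OF _ _ _ _ _ P]])
  moreover have "P (coord z) \<longleftrightarrow> W z" if "z : B" for z using pos[OF that] by (auto simp: P_def W_def)
  ultimately show "EX U. openin ?S U & y : U & U <= {y : B - {x}. W y} & (ALL z:U. f z = f y)"
   using y BR by (intro exI[of _ ?U]) (auto simp: f_def)
 qed
 interpret cech_cocycle ?S "{0, 1 :: nat}" V g
 proof
  fix m :: nat assume "m : {0, 1}"
  have "V m = {y : topspace ?S. coord y i + coord y j : {0<..}} Un
   (if m = 0 then {y : topspace ?S. coord y k : {1/2<..}} else {y : topspace ?S. coord y k : {..<1/2}})"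
   unfolding topS V_def W_def by auto
  thus "openin ?S (V m)" using opW opgt by auto
 next
  have "y : V 0 Un V 1" if "y : B - {x}" for y using edge_y[OF that] that by (auto simp: V_def)
  thus "topspace ?S = (UN m:{0, 1}. V m)" unfolding topS by (auto simp: V_def)
 next
  fix m n :: nat assume mn: "m : {0, 1}" "n : {0, 1}"
  show "locally_const ?S (V m Int V n) (g m n)"
  proof (cases "m = n")
   case True
   have "openin ?S (V m)"
   proof -
    have "V m = {y : topspace ?S. coord y i + coord y j : {0<..}} Un
     (if m = 0 then {y : topspace ?S. coord y k : {1/2<..}} else {y : topspace ?S. coord y k : {..<1/2}})"
     unfolding topS V_def W_def by auto
    thus ?thesis using opW opgt by auto
   qed
   thus ?thesis using True unfolding locally_const_def g_def by auto
  next
   case False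
   thus ?thesis using VW mn fconst by (fastforce simp: Int_commute locally_const_def g_def)
  qed
 next
  fix m n q :: nat and y
  show "g m n y + g n q y = g m q y" by (simp add: g_def algebra_simps)
 qed
 obtain t where t: "!!m. m : {0, 1} ==> locally_const ?S (V m) (t m)"
  "!!m n y. m : {0, 1} ==> n : {0, 1} ==> y : V m ==> y : V n ==> g m n y = t m y - t n y"
  using cocycle_trivial[OF B(4)] by blast
 obtain dl1 where dl1: "0 < dl1" "ALL y:Dl. (ALL a<4. \<bar>y a - mk 0 0 a\<bar> < dl1) --> pt T1 y : B"
  using pt_neighbourhood[OF B(1) T(1) mk[of 0 0]] B(2) by (auto simp: x_def)
 have "pt T2 (mk 0 0) : B" using edge_pt[of 0] B(2) by (simp add: x_def)
 then obtain dl2 where dl2: "0 < dl2" "ALL y:Dl. (ALL a<4. \<bar>y a - mk 0 0 a\<bar> < dl2) --> pt T2 y : B"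
  using pt_neighbourhood[OF B(1) T(2) mk[of 0 0]] by auto
 define et where "et = min 1 (min dl1 dl2) / 8"
 have et: "0 < et" "et <= 1/8" "8 * et <= dl1" "8 * et <= dl2" using dl1(1) dl2(1) by (auto simp: et_def)
 have inB: "pt T (mk s ep) : B" "mk s ep : Dl" if h: "T : {T1, T2}" "0 <= ep" "ep <= et" "\<bar>s\<bar> <= et" for T s ep
 proof -
  show D: "mk s ep : Dl" by (rule mk) (use h et in auto)
  have "\<bar>mk s ep a - mk 0 0 a\<bar> < 8 * et" for a using h et(1) by (auto simp: mk_def)
  thus "pt T (mk s ep) : B" using et(3,4) dl1(2) dl2(2) D h(1) order_less_le_trans by blast
 qed
 have diff: "f (pt T (mk et et)) = t 1 (pt T1 (mk (- et) 0)) - t 0 (pt T1 (mk et 0))" if h: "T : {T1, T2}" for T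
 proof -
  have TT: "T : TT" using h T by auto
  have co: "coord (pt T (mk s ep)) = mk s ep" if "0 <= ep" "ep <= et" "\<bar>s\<bar> <= et" for s ep
   by (rule pt(2)[OF TT inB(2)[OF h that]])
  have nx: "pt T (mk s ep) : B - {x}" if "0 <= ep" "ep <= et" "\<bar>s\<bar> <= et" "s ~= 0 | ep ~= 0" for s ep
  proof -
   have "mk s ep ~= mk 0 0"
   proof
    assume "mk s ep = mk 0 0"
    from fun_cong[OF this, of k] fun_cong[OF this, of i] show False using mkv that(4) by auto
   qed
   thus ?thesis using co[OF that(1-3)] cx inB(1)[OF h that(1-3)] by auto
  qed
  have cont: "continuous_on X (%r. mk (p r) (q r))" if "continuous_on X p" "continuous_on X q" for X :: "real set" and p q
  proof (rule continuous_on_coordinatewise_then_product)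
   fix a show "continuous_on X (%r. mk (p r) (q r) a)"
    using that by (cases "a = k"; cases "a = l"; cases "a = i") (auto simp: mk_def intro!: continuous_intros)
  qed
  have conn: "connectedin ?S ((%r. pt T (mk (p r) (q r))) ` X)"
   if "connected X" "continuous_on X p" "continuous_on X q" "!!r. r : X ==> 0 <= q r & q r <= et & \<bar>p r\<bar> <= et & (p r ~= 0 | q r ~= 0)" for X :: "real set" and p q
  proof -
   have "connectedin R ((%r. pt T (mk (p r) (q r))) ` X)"
    by (rule connectedin_pt_curve[OF TT that(1) cont[OF that(2,3)]]) (use inB(2)[OF h] that(4) in blast)
   thus ?thesis using nx that(4) by (auto simp: connectedin_subtopology)
  qed
  have inV0: "pt T (mk et r) : V 0" if "r : {0..et}" for r
   using nx[of r et] co[of r et] that et(1) mkv by (cases "r = 0") (auto simp: V_def W_def)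
  have inV1: "pt T (mk (- et) r) : V 1" if "r : {0..et}" for r
   using nx[of r "- et"] co[of r "- et"] that et(1) mkv by (cases "r = 0") (auto simp: V_def W_def)
  have inW: "pt T (mk r et) : V 0" "pt T (mk r et) : V 1" if "r : {- et..et}" for r
  proof -
   have r: "\<bar>r\<bar> <= et" using that by (simp add: abs_le_iff minus_le_iff)
   hence "pt T (mk r et) : B - {x}" using nx[of et r] et(1) by simp
   moreover have "W (pt T (mk r et))" using co[of et r] r et(1) mkv by (simp add: W_def)
   ultimately show "pt T (mk r et) : V 0" "pt T (mk r et) : V 1" by (auto simp: V_def)
  qed
  have "t 0 (pt T (mk et 0)) = t 0 (pt T (mk et et))"
   by (rule locally_const_connected[OF t(1) conn[of "{0..et}" "%r. et" "%r. r"]])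
    (use et(1) inV0 in "auto intro!: continuous_intros")
  moreover have "t 1 (pt T (mk (- et) 0)) = t 1 (pt T (mk (- et) et))"
   by (rule locally_const_connected[OF t(1) conn[of "{0..et}" "%r. - et" "%r. r"]])
    (use et(1) inV1 in "auto intro!: continuous_intros")
  moreover have "t 1 (pt T (mk et et)) = t 1 (pt T (mk (- et) et))"
   by (rule locally_const_connected[OF t(1) conn[of "{- et..et}" "%r. r" "%r. et"]])
    (use et(1) inW in "auto intro!: continuous_intros")
  moreover have "f (pt T (mk et et)) = t 1 (pt T (mk et et)) - t 0 (pt T (mk et et))"
   using t(2)[of 1 0 "pt T (mk et et)"] inW[of et] et(1) by (simp add: g_def)
  moreover have "pt T (mk et 0) = pt T1 (mk et 0)" "pt T (mk (- et) 0) = pt T1 (mk (- et) 0)"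
   using h edge_pt[of et] edge_pt[of "- et"] et by auto
  ultimately show ?thesis by simp
 qed
 have Pm: "P (mk et et)" using et(1,2) mkv by (simp add: P_def)
 have "f (pt T (mk et et)) = F T" if "T : {T1, T2}" for T
  unfolding f_def by (rule val(1)) (use T Pm inB(2)[of T et et] et(1) that in auto)
 hence "f (pt T1 (mk et et)) = 1" "f (pt T2 (mk et et)) = 0" using notin orb_refl by (auto simp: F_def)
 thus False using diff[of T1] diff[of T2] by simp
qed

lemma colours_four: "colours i j k l ==> {..<4} = {i, j, k, l}"
proof (rule card_subset_eq[symmetric])
 assume "colours i j k l"
 thus "{i, j, k, l} <= {..<4}" "card {i, j, k, l} = card {..<4 :: nat}" by (auto simp: colours_def)
qed simp

lemma vertex_point:
 assumes T: "T : TT" and k: "k < 4"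
 shows "cell_face T {k} = vertex k"
proof -
 have S: "{k} <= {..<4}" "{k} ~= {}" using k by auto
 note f = cell_face[OF T S]
 have "cell_dim K (cell_face T {k}) = 0" using card_col[OF f(3)] f(2) by simp
 then obtain y where y: "cell_face T {k} = {y}" using zero_cell[OF f(3)] by blast
 have "vertex k <= cell_face T {k}" using f(2) by (auto simp: col_def)
 moreover have "vertex k ~= {}" using bij_betwE[OF vertex] k cell_nonempty by blast
 ultimately show ?thesis using y by auto
qed

text \<open>A punctured neighbourhood of the vertex is connected, and the tetrahedra of an orbit fill an open subset of it, by \<open>edge_orbit\<close>.\<close>

lemma vertex_orbit:
 assumes k: "k < 4" and T: "T1 : TT" "T2 : TT"
 shows "T2 : orb ({..<4} - {k}) T1"
proof (rule ccontr)
 let ?Ob = "orb ({..<4} - {k}) T1"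
 assume notin: "T2 ~: ?Ob"
 have Ob: "?Ob <= TT" by (rule orb_subset[OF T(1)]) auto
 define P where "P x \<longleftrightarrow> 0 < min (x k) (1 - x k)" for x :: "nat => real"
 have P: "openin (top_of_set Dl) {x : Dl. P x}"
  unfolding P_def by (rule openin_simplex_condition) (intro continuous_intros continuous_on_min)+
 have sat: "T' : ?Ob" if T: "T : TT" and h: "T : ?Ob" "T' : TT" "x : Dl" "P x" "cell_face T {a. 0 < x a} = cell_face T' {a. 0 < x a}" for T T' x
 proof -
  have x: "0 < x k" "x k < 1" using h(4) by (auto simp: P_def)
  have "EX l<4. l ~= k & 0 < x l"
  proof (rule ccontr)
   assume "~ ?thesis"
   hence "x l = 0" if "l : {..<4} - {k}" for l
   proof -
    have "~ 0 < x l" using `~ (EX l<4. l ~= k & 0 < x l)` that by blast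
    moreover have "0 <= x l" using h(3) by (simp add: bary_simplex_def)
    ultimately show ?thesis by simp
   qed
   hence "sum x {..<4} = x k" using k by (subst sum.remove[of _ k]) auto
   thus False using h(3) x(2) by (simp add: bary_simplex_def)
  qed
  then obtain l where l: "l < 4" "l ~= k" "0 < x l" by blast
  obtain i j where ij: "{..<4} = {k, l, i, j}" "distinct [k, l, i, j]" using four_colours[OF k l(1)] l(2) by metis
  have co: "colours i j k l" using ij k l unfolding colours_def by (metis distinct_length_2_or_more insertI1 insert_commute lessThan_iff)
  have "T' : orb {i, j} T" using x l cell_face_mono[OF T h(2) _ support(1)[OF h(3)] _ h(5)] edge_orbit[OF co T h(2)] by simp
  moreover have "{i, j} <= {..<4} - {k}" using ij by auto
  ultimately have "T' : orb ({..<4} - {k}) T" using orb_mono by blast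
  thus ?thesis using orb_eq[OF h(1) assms(2)] by auto
 qed
 have "(T : ?Ob) = (T' : ?Ob)" if h: "T : TT" "T' : TT" "x : Dl" "P x" "cell_face T {a. 0 < x a} = cell_face T' {a. 0 < x a}" for T T' x
  using sat[OF h(1) _ h(2-5)] sat[OF h(2) _ h(1,3,4) h(5)[symmetric]] by blast
 note val = tet_value[of P "%T. T : ?Ob", OF this]
 let ?A = "%v. {y : topspace R. P (coord y) & (tet y : ?Ob) = v}"
 have op: "openin R (?A v)" for v by (rule val(2)[OF _ _ _ _ _ P])
 obtain m where m: "m < 4" "k ~= m" by (rule that[of "if k = 0 then 1 else 0"]) auto
 define mk :: "real => nat => real" where "mk ep = (%a. if a = k then 1 - ep else if a = m then ep else 0)" for ep
 have mk: "mk ep : Dl" if "0 <= ep" "ep <= 1" for ep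
  using that four_colours[OF k m] k m by (force simp: mk_def bary_simplex_def)
 define x where "x = pt T1 (mk 0)"
 have apex: "pt T (mk 0) = x" if "T : TT" for T
  using pt_eq_face[OF that T(1) mk mk, of 0 0] vertex_point[OF that k] vertex_point[OF T(1) k] by (simp add: mk_def x_def)
 have xR: "x : topspace R" unfolding x_def by (rule pt(3)[OF T(1) mk]) simp_all
 have "openin R {y : topspace R. coord y k : {0<..}}" by (rule openin_continuous_map_preimage[OF continuous_coordinate]) simp
 moreover have "x : {y : topspace R. coord y k : {0<..}}" using xR pt(2)[OF T(1) mk, of 0] by (simp add: x_def mk_def)
 ultimately obtain B where B: "openin R B" "x : B" "B <= {y : topspace R. coord y k : {0<..}}"
  "two_contractible_pieces (subtopology R (B - {x}))" by (rule punctured_neighbourhood[OF manifold])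
 have conn: "connectedin R (B - {x})"
  using two_contractible_pieces_connected[OF B(4)] openin_subset[OF B(1)] by (auto simp: connectedin_def)
 have cov: "B - {x} <= ?A True Un ?A False"
 proof
  fix y assume y: "y : B - {x}"
  have yR: "y : topspace R" "0 < coord y k" using y B(3) by auto
  have D: "coord y : Dl" by (rule coord_simplex[OF yR(1)])
  have "coord y k < 1"
  proof (rule ccontr)
   assume ge: "~ coord y k < 1"
   have D': "!!a. 0 <= coord y a" "sum (coord y) {..<4} = 1" "!!a. a ~: {..<4} ==> coord y a = 0"
    using D by (auto simp: bary_simplex_def)
   have "sum (coord y) ({..<4} - {k}) = 1 - coord y k" using D'(2) k by (subst (asm) sum.remove[of _ k]) auto
   moreover have "0 <= sum (coord y) ({..<4} - {k})" by (rule sum_nonneg) (rule D'(1))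
   ultimately have eq: "coord y k = 1" "sum (coord y) ({..<4} - {k}) = 0" using ge by auto
   hence "ALL a:{..<4} - {k}. coord y a = 0" using D'(1) by (subst (asm) sum_nonneg_eq_0_iff) auto
   hence "coord y a = mk 0 a" for a using eq(1) D'(3)[of a] by (cases "a = k"; cases "a < 4") (auto simp: mk_def)
   hence "coord y = mk 0" by auto
   thus False using pt_onto[OF yR(1)] apex y by auto
  qed
  thus "y : ?A True Un ?A False" using yR by (simp add: P_def)
 qed
 have meets: "(B - {x}) Int ?A (T : ?Ob) ~= {}" if T: "T : TT" for T
 proof -
  obtain dl where dl: "0 < dl" "ALL y:Dl. (ALL a<4. \<bar>y a - mk 0 a\<bar> < dl) --> pt T y : B"
   using pt_neighbourhood[OF B(1) T mk[of 0]] apex[OF T] B(2) by auto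
  define ep where "ep = min (1/2) (dl / 2)"
  have ep: "0 < ep" "ep <= 1/2" "ep < dl" using dl(1) by (auto simp: ep_def)
  have "\<bar>mk ep a - mk 0 a\<bar> < dl" for a using ep by (simp add: mk_def)
  hence "pt T (mk ep) : B" using dl(2) mk[of ep] ep by simp
  moreover have "pt T (mk ep) ~= x"
  proof
   assume "pt T (mk ep) = x"
   hence "coord (pt T (mk ep)) k = coord (pt T (mk 0)) k" using apex[OF T] by simp
   thus False using pt(2)[OF T mk, of ep] pt(2)[OF T mk, of 0] ep by (simp add: mk_def)
  qed
  moreover have "pt T (mk ep) : ?A (T : ?Ob)"
  proof -
   have h: "P (mk ep)" "mk ep : Dl" using ep mk[of ep] by (auto simp: P_def mk_def)
   show ?thesis using val(1)[OF _ _ _ _ _ T h(2,1)] pt(2,3)[OF T h(2)] h(1) by simp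
  qed
  ultimately show ?thesis by blast
 qed
 have "T1 : ?Ob" by (rule orb_refl)
 hence m: "(B - {x}) Int ?A True ~= {}" "(B - {x}) Int ?A False ~= {}" using meets[OF T(1)] meets[OF T(2)] notin by auto
 have "~ connectedin R (B - {x})"
 proof
  assume "connectedin R (B - {x})"
  hence "~ (B - {x} <= A1 Un A2 & A1 Int A2 Int (B - {x}) = {} & A1 Int (B - {x}) ~= {} & A2 Int (B - {x}) ~= {})"
   if "openin R A1" "openin R A2" for A1 A2 using that unfolding connectedin by blast
  from this[OF op[of True] op[of False]] show False using cov m by auto
 qed
 thus False using conn by simp
qed

lemma cell_face_eq_iff:
 assumes T: "T : TT" "T' : TT" and S: "S <= {..<4}" "S ~= {}"
 shows "cell_face T S = cell_face T' S \<longleftrightarrow> T' : orb ({..<4} - S) T"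
proof
 assume "T' : orb ({..<4} - S) T"
 thus "cell_face T S = cell_face T' S" using cell_face_orb[OF T(1) _ S] by simp
next
 assume eq: "cell_face T S = cell_face T' S"
 obtain k where k: "k : S" "k < 4" using S by auto
 show "T' : orb ({..<4} - S) T"
 proof (cases "S = {k}")
  case True
  thus ?thesis using vertex_orbit[OF k(2) T] by simp
 next
  case False
  then obtain l where l: "l : S" "l ~= k" using k by blast
  hence l4: "l < 4" using S by auto
  obtain i j where ij: "{..<4} = {k, l, i, j}" "distinct [k, l, i, j]" using four_colours[OF k(2) l4] l(2) by metis
  have ij4: "i < 4" "j < 4" using ij(1) by auto
  have co: "colours i j k l" using ij(2) k(2) l4 ij4 by (auto simp: colours_def)
  show ?thesis
  proof (cases "i : S")
   case True
   show ?thesis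
   proof (cases "j : S")
    case True
    hence "S = {..<4}" using S(1) `i : S` k l ij(1) by auto
    thus ?thesis using eq cell_face_UNIV[OF T(1)] cell_face_UNIV[OF T(2)] orb_refl by simp
   next
    case False
    hence "S = {..<4} - {j}" "{..<4} - S = {j}" using S(1) `i : S` k l ij by auto
    thus ?thesis using triangle_neighbour[OF ij4(2) T] eq orb_refl orb_step[OF orb_refl T(1), of j "{j}"] by auto
   qed
  next
   case False
   show ?thesis
   proof (cases "j : S")
    case True
    hence "S = {..<4} - {i}" "{..<4} - S = {i}" using S(1) `i ~: S` k l ij by auto
    thus ?thesis using triangle_neighbour[OF ij4(1) T] eq orb_refl orb_step[OF orb_refl T(1), of i "{i}"] by auto
   next
    case False
    hence "S = {k, l}" "{..<4} - S = {i, j}" using S(1) `i ~: S` k l ij by auto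
    thus ?thesis using edge_orbit[OF co T] eq by simp
   qed
  qed
 qed
qed

lemma pt_eq_iff:
 assumes T: "T : TT" "T' : TT" and x: "x : Dl" "x' : Dl"
 shows "pt T x = pt T' x' \<longleftrightarrow> x = x' & T' : orb {a. a < 4 & x a = 0} T"
proof -
 have "x a = 0 \<longleftrightarrow> ~ 0 < x a" for a
 proof -
  have "0 <= x a" using x(1) by (simp add: bary_simplex_def)
  thus ?thesis by auto
 qed
 hence "{..<4} - {a. 0 < x a} = {a. a < 4 & x a = 0}" by auto
 thus ?thesis using pt_eq_face[OF T x] cell_face_eq_iff[OF T support[OF x(1)]] by simp
qed

lemma card_edges:
 assumes co: "colours i j k l"
 shows "card {e : cells K. col e = {k, l}} = card (orbits {i, j})"
proof -
 have S: "{k, l} <= {..<4}" "{k, l} ~= {}" using co by (auto simp: colours_def)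
 have C: "{..<4} - {k, l} = {i, j}" using colours_four[OF co] co by (auto simp: colours_def)
 have C4: "{i, j} <= {..<4}" using co by (auto simp: colours_def)
 define F where "F e = {T : TT. e : faces T}" for e
 have F: "F (cell_face T {k, l}) = orb {i, j} T" if T: "T : TT" for T
 proof (intro equalityI subsetI)
  fix T' assume "T' : F (cell_face T {k, l})"
  hence T': "T' : TT" "cell_face T {k, l} : faces T'" by (auto simp: F_def)
  thus "T' : orb {i, j} T" using cell_face_eq[OF T'] cell_face(2)[OF T S] cell_face_eq_iff[OF T T'(1) S] C by simp
 next
  fix T' assume h: "T' : orb {i, j} T"
  hence T': "T' : TT" using orb_subset[OF T C4] by blast
  thus "T' : F (cell_face T {k, l})" using cell_face_eq_iff[OF T T' S] C h cell_face(1)[OF T' S] by (simp add: F_def)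
 qed
 have cellT: "EX T:TT. e = cell_face T {k, l}" if e: "e : cells K" "col e = {k, l}" for e
 proof -
  obtain T where T: "T : TT" "e : faces T" using in_tetrahedron[OF e(1)] by blast
  thus ?thesis using cell_face_eq[OF T] e(2) by auto
 qed
 have "bij_betw F {e : cells K. col e = {k, l}} (orbits {i, j})"
  unfolding bij_betw_def
 proof
  show "inj_on F {e : cells K. col e = {k, l}}"
  proof (rule inj_onI)
   fix e e' assume e: "e : {e : cells K. col e = {k, l}}" and e': "e' : {e : cells K. col e = {k, l}}" and eq: "F e = F e'"
   obtain T where T: "T : TT" "e = cell_face T {k, l}" using cellT e by blast
   have "T : F e" using T cell_face(1)[OF T(1) S] by (simp add: F_def)
   hence "T : F e'" unfolding eq .
   thus "e = e'" using cell_face_eq[OF T(1)] T(2) e' by (force simp: F_def)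
  qed
  show "F ` {e : cells K. col e = {k, l}} = orbits {i, j}"
  proof (intro equalityI subsetI)
   fix X assume "X : F ` {e : cells K. col e = {k, l}}"
   then obtain e where e: "e : cells K" "col e = {k, l}" "X = F e" by blast
   obtain T where T: "T : TT" "e = cell_face T {k, l}" using cellT e(1,2) by blast
   thus "X : orbits {i, j}" using F[OF T(1)] e(3) by (auto simp: orbits_def)
  next
   fix X assume "X : orbits {i, j}"
   then obtain T where T: "T : TT" "X = orb {i, j} T" by (auto simp: orbits_def)
   show "X : F ` {e : cells K. col e = {k, l}}" using F[OF T(1)] T(2) cell_face(2,3)[OF T(1) S] by auto
  qed
 qed
 thus ?thesis by (rule bij_betw_same_card)
qed

lemma number_of_edges:
 "f_number K 1 = card (orbits {0,1}) + card (orbits {0,2}) + card (orbits {0,3})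
   + card (orbits {1,2}) + card (orbits {1,3}) + card (orbits {2,3})"
proof -
 let ?E = "%S. {e : cells K. col e = S}"
 let ?P = "{{0,1}, {0,2}, {0,3}, {1,2}, {1,3}, {2,3 :: nat}}"
 have "{e : cells K. cell_dim K e = 1} = (UN S:?P. ?E S)"
 proof (intro equalityI subsetI)
  fix e assume "e : {e : cells K. cell_dim K e = 1}"
  hence e: "e : cells K" "card (col e) = 2" using card_col[of e] by auto
  then obtain a b where ab: "col e = {a, b}" "a ~= b" by (auto simp: card_2_iff)
  hence "a : {0, 1, 2, 3}" "b : {0, 1, 2, 3}" using col_subset[of e] by auto
  hence "{a, b} : ?P" using ab(2) by (elim insertE emptyE) (simp_all add: insert_commute)
  moreover have "e : ?E {a, b}" using e(1) ab(1) by simp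
  ultimately show "e : (UN S:?P. ?E S)" by simp
 next
  fix e assume "e : (UN S:?P. ?E S)"
  then obtain S where S: "S : ?P" "e : ?E S" by auto
  have "card S = 2" using S(1) by auto
  moreover have e: "e : cells K" "col e = S" using S(2) by auto
  ultimately have "cell_dim K e = 1" using card_col[OF e(1)] by simp
  thus "e : {e : cells K. cell_dim K e = 1}" using e(1) by simp
 qed
 hence "f_number K 1 = card (UN S:?P. ?E S)" by (simp add: f_number_def)
 also have "... = (SUM S:?P. card (?E S))"
 proof (rule card_UN_disjoint)
  show "ALL S:?P. finite (?E S)" using finite_cells by simp
  show "ALL S:?P. ALL S':?P. S ~= S' --> ?E S Int ?E S' = {}" by blast
 qed simp
 also have "... = card (?E {0,1}) + card (?E {0,2}) + card (?E {0,3}) + card (?E {1,2}) + card (?E {1,3}) + card (?E {2,3})"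
  by (simp add: doubleton_eq_iff)
 also have "... = card (orbits {2,3}) + card (orbits {1,3}) + card (orbits {1,2}) + card (orbits {0,3}) + card (orbits {0,2}) + card (orbits {0,1})"
  by (subst card_edges[of 2 3 0 1], simp add: colours_def, subst card_edges[of 1 3 0 2], simp add: colours_def,
    subst card_edges[of 1 2 0 3], simp add: colours_def, subst card_edges[of 0 3 1 2], simp add: colours_def,
    subst card_edges[of 0 2 1 3], simp add: colours_def, subst card_edges[of 0 1 2 3], simp add: colours_def) simp
 finally show ?thesis by simp
qed

end

section \<open>Cocycles around a vertex\<close>

lemma difference_translate: "- (z + x) + (z + y) = - x + (y :: 'h :: group_add)"
 by (simp only: minus_add add.assoc minus_add_cancel)

lemma third_colour: "EX d<4. d ~: {a, k :: nat}"
proof -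
 have "{0, 1, 2 :: nat} ~= {a, k} Int {0, 1, 2}"
 proof
  assume "{0, 1, 2 :: nat} = {a, k} Int {0, 1, 2}"
  hence "{0, 1, 2 :: nat} <= {a, k}" by blast
  thus False by auto
 qed
 then obtain d where d: "d : {0, 1, 2}" "d ~: {a, k}" by blast
 have "d < 4" using d(1) by auto
 thus ?thesis using d(2) by blast
qed

context contracted_manifold
begin

text \<open>For a single colour this is the open star of a vertex, for several colours an intersection of open stars.\<close>

definition pos_part :: "nat set => 'a set" where
 "pos_part C = {y : topspace R. ALL a:C. 0 < coord y a}"

lemma pos_part_value:
 assumes f: "!!c T. c < 4 ==> c ~: C ==> T : TT ==> f (sg c T) = f T" and C: "C <= {..<4}"
 shows "T : TT ==> x : Dl ==> ALL a:C. 0 < x a ==> f (tet (pt T x)) = f T"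
  "openin R {y : pos_part C. f (tet y) = v}"
proof -
 have P: "f T = f T'" if h: "T : TT" "T' : TT" "x : Dl" "ALL a:C. 0 < x a" "cell_face T {a. 0 < x a} = cell_face T' {a. 0 < x a}" for T T' x
 proof -
  have "T' : orb {a. a < 4 & x a = 0} T" using pt_eq_iff[OF h(1,2,3,3)] pt_eq_face[OF h(1,2,3,3)] h(5) by simp
  hence "f T' = f T"
  proof (rule orb_const[OF _ h(1)])
   fix c S assume "c : {a. a < 4 & x a = 0}" "S : TT"
   thus "f (sg c S) = f S" using f[of c S] h(4) by force
  qed auto
  thus ?thesis by simp
 qed
 note val = tet_value[of "%x. ALL a:C. 0 < x a" f, OF this]
 show "T : TT ==> x : Dl ==> ALL a:C. 0 < x a ==> f (tet (pt T x)) = f T" by (rule val(1))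
 have "open (INT a:C. {x :: nat => real. 0 < x a})"
  by (intro open_INT finite_subset[OF C] ballI open_Collect_less continuous_intros) simp
 hence "openin (top_of_set Dl) (Dl Int (INT a:C. {x. 0 < x a}))" by auto
 moreover have "Dl Int (INT a:C. {x. 0 < x a}) = {x : Dl. ALL a:C. 0 < x a}" by auto
 ultimately have "openin R {y : topspace R. (ALL a:C. 0 < coord y a) & f (tet y) = v}" by (intro val(2)) auto
 thus "openin R {y : pos_part C. f (tet y) = v}" by (simp add: pos_part_def)
qed

lemma openin_pos_part: "C <= {..<4} ==> openin R (pos_part C)" using pos_part_value(2)[of C "%T. ()" "()"] by simp

lemma apex:
 assumes "T : TT" "T' : TT" "k < 4" "x : Dl" "{a. 0 < x a} = {k}"
 shows "pt T x = pt T' x"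
 using pt_eq_face[OF assms(1,2,4,4)] vertex_point[OF assms(1,3)] vertex_point[OF assms(2,3)] assms(5) by simp

text \<open>The increments \<open>z c\<close> can be integrated round every edge at the vertex \<open>k\<close>. The differences of these partial potentials \<open>w a\<close>, one for each
  other vertex \<open>a\<close>, form a Cech cocycle on a small punctured neighbourhood of \<open>k\<close>, for the covering by open stars of the edges
  at \<open>k\<close>. It is trivial, and corrects the partial potentials to a common one.\<close>

theorem potential_at_vertex:
 fixes z :: "nat => 'a set => 'h :: group_add"
 assumes k: "k < 4"
  and z: "!!c d. c < 4 ==> d < 4 ==> c ~= k ==> d ~= k ==> c ~= d ==>
   EX w. ALL T:TT. w (sg c T) = z c T + w T & w (sg d T) = z d T + w T"
 shows "EX u. ALL T:TT. ALL c<4. c ~= k --> u (sg c T) = z c T + u T"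
proof -
 define I where "I = {..<4} - {k}"
 have "EX w. ALL T:TT. ALL c:I. c ~= a --> w (sg c T) = z c T + w T" if a: "a : I" for a
 proof -
  have "k < 4" "a < 4" "k ~= a" using k a by (auto simp: I_def)
  then obtain c d where cd: "{..<4} = {k, a, c, d}" "distinct [k, a, c, d]" using four_colours by blast
  have "c < 4" "d < 4" using cd(1) by auto
  then obtain w where "ALL T:TT. w (sg c T) = z c T + w T & w (sg d T) = z d T + w T" using z[of c d] cd(2) by auto
  thus ?thesis unfolding I_def cd(1) by (intro exI[of _ w]) auto
 qed
 then obtain w where w: "!!a T c. a : I ==> T : TT ==> c : I ==> c ~= a ==> w a (sg c T) = z c T + w a T" by metis
 obtain T1 where T1: "T1 : TT" using nonempty_TT by blast
 define corner :: "nat => real" where "corner = (%a. if a = k then 1 else 0)"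
 have corner: "corner : Dl" "{a. 0 < corner a} = {k}" using k by (auto simp: corner_def bary_simplex_def)
 define x where "x = pt T1 corner"
 have xT: "pt T corner = x" if "T : TT" for T unfolding x_def by (rule apex[OF that T1 k corner])
 have xk: "x : pos_part {k}" using pt(2,3)[OF T1 corner(1)] by (simp add: pos_part_def x_def corner_def)
 have opk: "openin R (pos_part {k})" by (rule openin_pos_part) (use k in simp)
 obtain B where B: "openin R B" "x : B" "B <= pos_part {k}" "two_contractible_pieces (subtopology R (B - {x}))"
  by (rule punctured_neighbourhood[OF manifold opk xk])
 let ?S = "subtopology R (B - {x})"
 have BR: "B <= topspace R" by (rule openin_subset[OF B(1)])
 have topS: "topspace ?S = B - {x}" using BR by auto
 define V where "V a = (B - {x}) Int pos_part {a}" for a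
 define g where "g a b y = - w a (tet y) + w b (tet y)" for a b y
 have openV: "openin ?S (V a)" if "a : I" for a
  unfolding V_def by (subst Int_commute) (rule openin_subtopology_Int, rule openin_pos_part, use that in "simp add: I_def")
 have inv: "- w a (sg c T) + w b (sg c T) = - w a T + w b T"
  if h: "a : I" "b : I" "c < 4" "c ~: {k, a, b}" "T : TT" for a b c T
  using h w[OF h(1,5)] w[OF h(2,5)] h(4) by (simp add: I_def difference_translate)
 have gval: "g a b (pt T y) = - w a T + w b T"
  if h: "a : I" "b : I" "T : TT" "y : Dl" "0 < y k" "0 < y a" "0 < y b" for a b T y
  unfolding g_def using pos_part_value(1)[of "{k, a, b}" "%T. - w a T + w b T" T y] inv[OF h(1,2)] h k by (simp add: I_def)
 have gconst: "locally_const ?S (V a Int V b) (g a b)" if h: "a : I" "b : I" for a b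
  unfolding locally_const_def
 proof
  fix y assume y: "y : V a Int V b"
  let ?A = "{y' : pos_part {k, a, b}. - w a (tet y') + w b (tet y') = g a b y}"
  have "openin R ?A"
   by (rule pos_part_value(2)[of "{k, a, b}" "%T. - w a T + w b T"]) (use inv[OF h] h k in "auto simp: I_def")
  hence "openin ?S (?A Int (B - {x}))" by (rule openin_subtopology_Int)
  moreover have "y : ?A Int (B - {x})" using y B(3) by (auto simp: V_def pos_part_def g_def)
  moreover have "?A Int (B - {x}) <= V a Int V b" by (auto simp: V_def pos_part_def)
  ultimately show "EX U. openin ?S U & y : U & U <= V a Int V b & (ALL z:U. g a b z = g a b y)"
   by (intro exI[of _ "?A Int (B - {x})"] conjI) (auto simp: g_def)
 qed
 have cover: "topspace ?S = (UN a:I. V a)"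
 proof
  show "topspace ?S <= (UN a:I. V a)"
  proof
   fix y assume "y : topspace ?S"
   hence y: "y : B" "y ~= x" "y : topspace R" by auto
   have D: "coord y : Dl" by (rule coord_simplex[OF y(3)])
   have D': "!!a. 0 <= coord y a" "sum (coord y) {..<4} = 1" "!!a. ~ a < 4 ==> coord y a = 0"
    using D by (auto simp: bary_simplex_def)
   have "EX a:I. 0 < coord y a"
   proof (rule ccontr)
    assume neg: "~ ?thesis"
    have 0: "coord y a = 0" if "a ~= k" for a using that neg D'(1)[of a] D'(3) by (force simp: I_def)
    have "sum (coord y) {..<4} = coord y k" using k 0 by (subst sum.remove[of _ k]) auto
    hence "coord y a = corner a" for a using 0 D'(2) by (cases "a = k") (auto simp: corner_def)
    hence "coord y = corner" by auto
    hence "y = x" using tet[OF y(3)] xT[of "tet y"] by auto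
    thus False using y(2) by blast
   qed
   thus "y : (UN a:I. V a)" using y by (auto simp: V_def pos_part_def)
  qed
  show "(UN a:I. V a) <= topspace ?S" unfolding topS V_def by blast
 qed
 interpret cech_cocycle ?S I V g
 proof
  show "g a b y + g b c y = g a c y" for a b c y
   unfolding g_def by (simp add: add.assoc)
  show "openin ?S (V a)" if "a : I" for a by (rule openV[OF that])
  show "locally_const ?S (V a Int V b) (g a b)" if "a : I" "b : I" for a b by (rule gconst[OF that])
 qed (rule cover)
 obtain t where t: "!!a. a : I ==> locally_const ?S (V a) (t a)"
  "!!a b y. a : I ==> b : I ==> y : V a ==> y : V b ==> g a b y = t a y - t b y" using cocycle_trivial[OF B(4)] by blast
 have "EX dl. 0 < dl & (ALL y:Dl. (ALL a<4. \<bar>y a - corner a\<bar> < dl) --> pt T y : B)" if T: "T : TT" for T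
  using pt_neighbourhood[OF B(1) T corner(1)] xT[OF T] B(2) by simp
 then obtain dl where dl: "!!T. T : TT ==> 0 < dl T"
  "!!T y. T : TT ==> y : Dl ==> (ALL a<4. \<bar>y a - corner a\<bar> < dl T) ==> pt T y : B" by metis
 define ep where "ep = min (1/2) (Min (dl ` TT) / 2)"
 have minpos: "0 < Min (dl ` TT)" using dl(1) finite_TT nonempty_TT by simp
 have ep: "0 < ep" "ep <= 1/2" "!!T. T : TT ==> ep < dl T"
 proof -
  show "0 < ep" "ep <= 1/2" using minpos by (auto simp: ep_def)
  fix T assume "T : TT"
  hence "Min (dl ` TT) <= dl T" using finite_TT by simp
  thus "ep < dl T" using minpos by (simp add: ep_def)
 qed
 define mk where "mk c r = (%a. if a = k then 1 - ep else if a = c then r * ep / 3 else if a < 4 then (1 - r / 3) * ep / 2 else 0)" for c :: nat and r :: real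
 have mk: "mk c r : Dl" "!!T. T : TT ==> pt T (mk c r) : B - {x}" "!!a. a : I ==> a ~= c ==> 0 < mk c r a" "0 < mk c r k"
  if h: "c : I" "0 <= r" "r <= 1" for c r
 proof -
  have "k < 4" "c < 4" "k ~= c" using h k by (auto simp: I_def)
  then obtain a b where ab: "{..<4} = {k, c, a, b}" "distinct [k, c, a, b]" using four_colours by blast
  have ab4: "a < 4" "b < 4" using ab(1) by auto
  have "sum (mk c r) {..<4} = 1 - ep + r * ep / 3 + 2 * ((1 - r / 3) * ep / 2)"
   unfolding ab(1) using ab(2) ab4 by (simp add: mk_def)
  also have "... = 1" by (simp add: field_simps)
  finally have sum: "sum (mk c r) {..<4} = 1" .
  show D: "mk c r : Dl" using sum ep(1,2) h `k < 4` `c < 4` by (auto simp: bary_simplex_def mk_def)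
  show "0 < mk c r a" if "a : I" "a ~= c" for a using that ep(1) h by (auto simp: mk_def I_def)
  show "0 < mk c r k" using ep(2) by (simp add: mk_def)
  fix T assume T: "T : TT"
  have "\<bar>mk c r a - corner a\<bar> <= ep" for a using h(2,3) ep(1) by (simp add: mk_def corner_def)
  hence "pt T (mk c r) : B" using ep(3)[OF T] order_le_less_trans dl(2)[OF T D] by auto
  moreover have "pt T (mk c r) ~= x"
  proof
   assume "pt T (mk c r) = x"
   hence "mk c r = corner" using pt(2)[OF T D] pt(2)[OF T corner(1)] xT[OF T] by metis
   from fun_cong[OF this, of k] show False using ep(1) by (simp add: mk_def corner_def)
  qed
  ultimately show "pt T (mk c r) : B - {x}" by blast
 qed
 have inV: "pt T (mk c r) : V a" if h: "c : I" "0 <= r" "r <= 1" "T : TT" "a : I" "a ~= c" for c r T a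
  using mk[OF h(1-3)] h(4-6) pt(2,3)[OF h(4) mk(1)[OF h(1-3)]] by (auto simp: V_def pos_part_def)
 have centre: "mk c 1 = mk d 1" if "c : I" "d : I" for c d using that by (auto simp: mk_def I_def)
 have inV1: "pt T (mk c 1) : V a" if h: "c : I" "T : TT" "a : I" for c T a
 proof -
  have "EX d<4. d ~: {a, k}" by (rule third_colour)
  then obtain d where d: "d : I" "d ~= a" by (auto simp: I_def)
  thus ?thesis using inV[of d 1 T a] centre[OF h(1) d(1)] h by simp
 qed
 have connect: "t a (pt T (mk c 0)) = t a (pt T (mk c 1))" if h: "c : I" "T : TT" "a : I" "a ~= c" for c T a
 proof -
  have "continuous_on {0..1} (mk c)"
  proof (rule continuous_on_coordinatewise_then_product)
   fix i show "continuous_on {0..1} (%r. mk c r i)"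
    by (cases "i = k"; cases "i = c"; cases "i < 4") (auto simp: mk_def intro!: continuous_intros)
  qed
  hence "connectedin R ((%r. pt T (mk c r)) ` {0..1})"
   by (rule connectedin_pt_curve[OF h(2) connected_Icc]) (use mk(1)[OF h(1)] in auto)
  moreover have "(%r. pt T (mk c r)) ` {0..1} <= B - {x}" by (rule image_subsetI, rule mk(2)[OF h(1) _ _ h(2)]) simp_all
  ultimately have "connectedin ?S ((%r. pt T (mk c r)) ` {0..1})" by (simp only: connectedin_subtopology)
  thus ?thesis by (rule locally_const_connected[OF t(1)[OF h(3)]]) (use inV[OF h(1)] h in auto)
 qed
 obtain d0 where d0: "d0 : I" by (rule that[of "if k = 0 then 1 else 0"]) (auto simp: I_def)
 define y where "y T = pt T (mk d0 1)" for T
 have yV: "y T : V a" if "T : TT" "a : I" for T a unfolding y_def by (rule inV1[OF d0 that])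
 define u where "u T = w d0 T + t d0 (y T)" for T
 have u: "u T = w a T + t a (y T)" if h: "T : TT" "a : I" for T a
 proof -
  have pos: "0 < mk d0 1 k" "0 < mk d0 1 a" "0 < mk d0 1 d0"
   using yV[OF h] yV[OF h(1) d0] mk(4)[OF d0, of 1] pt(2)[OF h(1) mk(1)[OF d0]] by (auto simp: y_def V_def pos_part_def)
  have "g a d0 (y T) = - w a T + w d0 T"
   unfolding y_def by (rule gval[OF h(2) d0 h(1) mk(1)[OF d0] pos(1,2,3)]) simp_all
  moreover have "g a d0 (y T) = t a (y T) - t d0 (y T)" by (rule t(2)[OF h(2) d0 yV[OF h] yV[OF h(1) d0]])
  ultimately have "- w a T + w d0 T = t a (y T) - t d0 (y T)" by simp
  hence "w d0 T = w a T + (t a (y T) - t d0 (y T))" by (metis add.assoc add.left_neutral add.right_inverse)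
  thus ?thesis unfolding u_def by (simp add: add.assoc)
 qed
 have "u (sg c T) = z c T + u T" if h: "T : TT" "c < 4" "c ~= k" for c T
 proof -
  have c: "c : I" using h by (simp add: I_def)
  have "EX d<4. d ~: {c, k}" by (rule third_colour)
  then obtain a where a: "a : I" "a ~= c" by (auto simp: I_def)
  have sgT: "sg c T : TT" by (rule sg_in[OF h(2,1)])
  have "pt T (mk c 0) = pt (sg c T) (mk c 0)"
  proof -
   have D: "mk c 0 : Dl" by (rule mk(1)[OF c]) simp_all
   have "c : {a. a < 4 & mk c 0 a = 0}" using h by (simp add: mk_def)
   thus ?thesis using pt_eq_iff[OF h(1) sgT D D] orb_step[OF orb_refl h(1)] by simp
  qed
  hence "t a (y T) = t a (y (sg c T))" using connect[OF c h(1) a] connect[OF c sgT a] centre[OF c d0] by (metis y_def)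
  thus ?thesis using u[OF h(1) a(1)] u[OF sgT a(1)] w[OF a(1) h(1) c] a(2) by (simp add: add.assoc)
 qed
 thus ?thesis by blast
qed

text \<open>Each edge has two end points, so the sum of the inequalities of \<open>euler_vertex\<close> for the four vertices is four times this one.\<close>

lemma card_TT_bound:
 "card TT + 4 <= card (orbits {0,1}) + card (orbits {0,2}) + card (orbits {0,3})
   + card (orbits {1,2}) + card (orbits {1,3}) + card (orbits {2,3})"
proof -
 have V: "card TT + 4 <= 2 * (card (orbits {i, j}) + card (orbits {i, l}) + card (orbits {j, l}))"
  if co: "colours i j l k" for i j l k
 proof (rule euler_vertex)
  show "i < 4" "j < 4" "l < 4" "i ~= j" "i ~= l" "j ~= l" using co by (auto simp: colours_def)
  fix z :: "nat => 'a set => bit"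
  assume z: "!!c d. c : {i, j, l} ==> d : {i, j, l} ==> c ~= d ==>
     EX w. ALL T:TT. w (sg c T) = z c T + w T & w (sg d T) = z d T + w T"
  have k: "k < 4" "k ~: {i, j, l}" using co by (auto simp: colours_def)
  have rest: "c < 4 & c ~= k \<longleftrightarrow> c : {i, j, l}" for c
  proof -
   have "c < 4 \<longleftrightarrow> c : {i, j, l, k}" by (simp only: colours_four[OF co, symmetric] lessThan_iff)
   thus ?thesis using k(2) by auto
  qed
  have "EX u. ALL T:TT. ALL c<4. c ~= k --> u (sg c T) = z c T + u T"
  proof (rule potential_at_vertex[OF k(1)])
   fix c d :: nat assume "c < 4" "d < 4" "c ~= k" "d ~= k" "c ~= d"
   thus "EX w. ALL T:TT. w (sg c T) = z c T + w T & w (sg d T) = z d T + w T"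
    using rest[of c] rest[of d] by (intro z) simp_all
  qed
  then obtain u where u: "ALL T:TT. ALL c<4. c ~= k --> u (sg c T) = z c T + u T" by (elim exE)
  show "EX u. ALL T:TT. ALL c:{i, j, l}. u (sg c T) = z c T + u T"
  proof (rule exI[of _ u], intro ballI)
   fix T c assume T: "T : TT" and "c : {i, j, l}"
   thus "u (sg c T) = z c T + u T" using rest[of c] u by simp
  qed
 qed
 have "colours 1 2 3 0" "colours 0 2 3 1" "colours 0 1 3 2" "colours 0 1 2 3" by (simp_all add: colours_def)
 note v = this[THEN V]
 have sum: "t + 4 <= a + b + c + d + e + f" if "t + 4 <= 2 * (d + e + f)" "t + 4 <= 2 * (b + c + f)"
  "t + 4 <= 2 * (a + c + e)" "t + 4 <= 2 * (a + b + d)" for t a b c d e f :: nat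
  using add_mono[OF add_mono[OF that(1,2)] add_mono[OF that(3,4)]] by simp
 show ?thesis by (rule sum[OF v])
qed

end

section \<open>Coverings of the triangulated manifold\<close>

lemma openin_section_image:
 assumes cov: "cover_map E S p" and A: "openin S A"
  and s: "continuous_map (subtopology S A) E s" "!!y. y : A ==> p (s y) = y"
 shows "openin E (s ` A)"
proof (subst openin_subopen, intro ballI)
 fix e assume "e : s ` A"
 then obtain y where y: "y : A" "e = s y" by blast
 have AS: "A <= topspace S" by (rule openin_subset[OF A])
 have e: "e : topspace E" "p e = y" using y s AS by (auto simp: continuous_map_def)
 have "EX V s'. y : V & even_chart E S p V s'" using cov y(1) AS unfolding cover_map_def by blast
 then obtain V s' where V: "y : V" "even_chart E S p V s'" by blast
 note ch = even_chartD[OF V(2) e(1)]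
 let ?W = "s' e ` V"
 have pV: "p e : V" using e V by simp
 have W: "openin E ?W" by (rule ch(3)[OF pV])
 have eW: "e : ?W" using ch(2)[OF pV] pV by (metis image_eqI)
 let ?O = "{z : topspace (subtopology S A). s z : ?W}"
 have O: "openin S ?O" by (metis openin_continuous_map_preimage[OF s(1) W] openin_trans_full[OF _ A])
 have "openin E (?W Int {e' : topspace E. p e' : ?O})"
  using W openin_continuous_map_preimage[OF cover_map_continuous[OF cov] O] by auto
 moreover have "e : ?W Int {e' : topspace E. p e' : ?O}" using eW e y AS by auto
 moreover have "?W Int {e' : topspace E. p e' : ?O} <= s ` A"
 proof
  fix e' assume "e' : ?W Int {e' : topspace E. p e' : ?O}"
  hence e': "e' : ?W" "p e' : A" "s (p e') : ?W" by auto
  obtain v where v: "v : V" "e' = s' e v" using e'(1) by blast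
  obtain v' where v': "v' : V" "s (p e') = s' e v'" using e'(3) by blast
  have "p e' = v" using v ch(4)[OF pV v(1)] by simp
  moreover have "p (s (p e')) = v'" using v' ch(4)[OF pV v'(1)] by simp
  ultimately have "v' = v" using s(2)[OF e'(2)] by simp
  thus "e' : s ` A" using v v' e'(2) by force
 qed
 ultimately show "EX T. openin E T & e : T & T <= s ` A" by blast
qed

context contracted_manifold
begin

definition corner :: "nat => nat => real" where "corner a = (%b. if b = a then 1 else 0)"

definition centre :: "nat => real" where "centre = (%b. if b < 4 then 1/4 else 0)"

lemma corner: "a < 4 ==> corner a : Dl" by (auto simp: corner_def bary_simplex_def)

lemma centre: "centre : Dl" "a < 4 ==> 0 < centre a" by (simp_all add: centre_def bary_simplex_def)

lemma pos_part_subset: "pos_part C <= topspace R" by (auto simp: pos_part_def)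

lemma pt_in_pos_part: "T : TT ==> x : Dl ==> pt T x : pos_part C \<longleftrightarrow> (ALL a:C. 0 < x a)"
 using pt(2,3) by (simp add: pos_part_def)

text \<open>The star is contracted linearly in barycentric coordinates towards its vertex.\<close>

lemma contractible_open_star:
 assumes a: "a < 4"
 shows "contractible_space (subtopology R (pos_part {a}))"
proof -
 let ?U = "pos_part {a}"
 let ?X = "subtopology R ?U"
 have topX: "topspace ?X = ?U" using pos_part_subset by auto
 define line :: "real => (nat => real) => nat => real" where "line s x = (%b. (1 - s) * x b + s * corner a b)" for s x
 define H where "H z = pt (tet (snd z)) (line (fst z) (coord (snd z)))" for z :: "real \<times> 'a"
 have line: "line s x : Dl" if "0 <= s" "s <= 1" "x : Dl" for s x
  unfolding line_def by (rule bary_simplex_segment[OF that(3) corner[OF a] that(1,2)])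
 have line_a: "0 < line s x a" if "0 <= s" "s <= 1" "0 < x a" for s x
 proof (cases "s = 1")
  case False
  hence "0 < (1 - s) * x a" using that by simp
  thus ?thesis using that by (simp add: line_def corner_def)
 qed (simp add: line_def corner_def)
 have Hval: "H (s, y) = pt T (line s (coord y))" if h: "T : TT" "y : T" "0 <= s" "s <= 1" "0 < coord y a" for T s y
 proof -
  have yR: "y : topspace R" using cell_subset h(1,2) by (auto simp: TT_def)
  have D: "coord y : Dl" by (rule coord_simplex[OF yR])
  have t: "tet y : TT" "y = pt (tet y) (coord y)" using tet[OF yR] by auto
  have "tet y : orb {b. b < 4 & coord y b = 0} T" using pt_coord[OF h(1,2)] t(2) pt_eq_iff[OF h(1) t(1) D D] by simp
  moreover have "{b. b < 4 & coord y b = 0} <= {b. b < 4 & line s (coord y) b = 0}"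
   using h(5) by (auto simp: line_def corner_def)
  ultimately have "tet y : orb {b. b < 4 & line s (coord y) b = 0} T" using orb_mono by blast
  thus ?thesis using pt_eq_iff[OF h(1) t(1) line[OF h(3,4) D] line[OF h(3,4) D]] by (simp add: H_def)
 qed
 let ?I = "top_of_set {0..1 :: real}"
 have contH: "continuous_map (prod_topology ?I ?X) ?X H"
 proof -
  have "continuous_map (prod_topology ?I ?X) R H"
  proof (rule pasting_lemma_closed[where I = TT and T = "%T. {0..1} \<times> (T Int ?U)" and f = "%T z. pt T (line (fst z) (coord (snd z)))"])
   show "finite TT" by (rule finite_TT)
   fix T assume T: "T : TT"
   show "closedin (prod_topology ?I ?X) ({0..1} \<times> (T Int ?U))"
    using compact_cell(2)[of T] T closedin_subtopology_Int_closed[of R T ?U]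
    by (simp add: TT_def Int_commute closedin_prod_Times_iff)
   let ?Z = "subtopology (prod_topology ?I ?X) ({0..1} \<times> (T Int ?U))"
   have c1: "continuous_map ?Z euclideanreal fst"
    by (intro continuous_map_from_subtopology continuous_map_fst_of continuous_map_from_subtopology)
     (use continuous_map_fst continuous_map_into_fulltopology in fastforce)
   have c2: "continuous_map ?Z euclidean (%z. coord (snd z))"
   proof -
    have "continuous_map (prod_topology ?I ?X) euclidean (coord o snd)" using continuous_map_snd[of ?I ?X] continuous_coord
     by (metis continuous_map_compose continuous_map_in_subtopology)
    thus ?thesis by (simp add: o_def continuous_map_from_subtopology)
   qed
   have c3: "continuous_map ?Z euclideanreal (%z. coord (snd z) b)" for b
    using c2 continuous_map_componentwise_UNIV[of ?Z "%_. euclideanreal" "%z. coord (snd z)"]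
    by (simp add: euclidean_product_topology)
   have "continuous_map ?Z euclideanreal (%z. line (fst z) (coord (snd z)) b)" for b
    unfolding line_def by (intro continuous_intros c1 c3)
   hence "continuous_map ?Z (top_of_set Dl) (%z. line (fst z) (coord (snd z)))"
    using continuous_map_componentwise_UNIV[of ?Z "%_. euclideanreal" "%z. line (fst z) (coord (snd z))"] line coord_simplex by (auto simp: euclidean_product_topology continuous_map_in_subtopology)
   thus "continuous_map ?Z R (%z. pt T (line (fst z) (coord (snd z))))"
    using continuous_pt[OF T] continuous_map_compose by (fastforce simp: o_def)
  next
   fix T T' z assume h: "T : TT" "T' : TT" "z : topspace (prod_topology ?I ?X) Int {0..1} \<times> (T Int ?U) Int {0..1} \<times> (T' Int ?U)"
   obtain s y where z: "z = (s, y)" by (cases z)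
   have hy: "0 <= s" "s <= 1" "y : T" "y : T'" "0 < coord y a" using h(3) unfolding z by (auto simp: pos_part_def)
   show "pt T (line (fst z) (coord (snd z))) = pt T' (line (fst z) (coord (snd z)))"
    using Hval[OF h(1) hy(3,1,2,5)] Hval[OF h(2) hy(4,1,2,5)] unfolding z by simp
  next
   fix z assume z: "z : topspace (prod_topology ?I ?X)"
   obtain s y where sy: "z = (s, y)" by (cases z)
   have hy: "0 <= s" "s <= 1" "y : ?U" using z topX unfolding sy by auto
   hence yR: "y : topspace R" "0 < coord y a" by (auto simp: pos_part_def)
   obtain T where T: "T : TT" "y : T" using pt_onto[OF yR(1)] by blast
   show "EX T. T : TT & z : {0..1} \<times> (T Int ?U) & H z = pt T (line (fst z) (coord (snd z)))"
    using Hval[OF T hy(1,2) yR(2)] T hy by (auto simp: sy)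
  qed
  moreover have "H z : ?U" if z: "z : topspace (prod_topology ?I ?X)" for z
  proof -
   obtain s y where sy: "z = (s, y)" by (cases z)
   have hy: "0 <= s" "s <= 1" "y : ?U" using z topX unfolding sy by auto
   hence yR: "y : topspace R" "0 < coord y a" by (auto simp: pos_part_def)
   show ?thesis
    using tet[OF yR(1)] pt_in_pos_part[OF _ line[OF hy(1,2) coord_simplex[OF yR(1)]]] line_a[of s "coord y", OF hy(1,2) yR(2)]
    by (simp add: sy H_def)
  qed
  ultimately show ?thesis by (auto simp: continuous_map_in_subtopology)
 qed
 obtain T1 where T1: "T1 : TT" using nonempty_TT by blast
 have H0: "H (0, y) = y" if "y : ?U" for y using tet[of y] that by (simp add: H_def line_def pos_part_def)
 have H1: "H (1, y) = pt T1 (corner a)" if "y : ?U" for y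
  using that tet[of y] apex[OF _ T1 a corner[OF a]] by (simp add: pos_part_def corner_def H_def line_def)
 have "homotopic_with (%x. True) ?X ?X id (%x. pt T1 (corner a))"
  by (subst homotopic_with) (use contH H0 H1 topX in "auto")
 thus ?thesis unfolding contractible_space_def by blast
qed

end

locale covered_manifold = contracted_manifold K + deck_cover E "realization K" q G act
 for K :: "'a cell_complex" and E :: "'p topology" and q and G :: "('g, 'more) monoid_scheme" (structure) and act +
 fixes T0 :: "'a set" and y0 :: 'p
 assumes pieces: "two_contractible_pieces E" and T0: "T0 : TT" and y0: "y0 : topspace E" "q y0 = pt T0 centre"
begin

sublocale group G by (rule group_G)

definition sec :: "nat => 'a => 'p" where
 "sec a = (SOME s. section_through E R q (pos_part {a}) y0 s)"

lemma sec:
 assumes a: "a < 4"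
 shows "continuous_map (subtopology R (pos_part {a})) E (sec a)" "!!y. y : pos_part {a} ==> q (sec a y) = y"
  "sec a (pt T0 centre) = y0" "!!y. y : pos_part {a} ==> sec a y : topspace E"
proof -
 have "q y0 : pos_part {a}" using y0(2) pt_in_pos_part[OF T0 centre(1)] centre(2)[OF a] by simp
 hence "section_through E R q (pos_part {a}) y0 (sec a)"
  using section_through_contractible[OF cover pos_part_subset contractible_open_star[OF a] y0(1)]
  by (metis someI_ex sec_def)
 thus c: "continuous_map (subtopology R (pos_part {a})) E (sec a)" "!!y. y : pos_part {a} ==> q (sec a y) = y"
  "sec a (pt T0 centre) = y0" using y0(2) by (auto simp: section_through_def)
 show "!!y. y : pos_part {a} ==> sec a y : topspace E" using c(1) pos_part_subset by (auto simp: continuous_map_def)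
qed

lemma act_in: "g : carrier G ==> e : topspace E ==> act g e : topspace E" using act_cont by (auto simp: continuous_map_def)

lemma act_inv: "g : carrier G ==> e : topspace E ==> act (inv g) (act g e) = e"
 using act_mult[of "inv g" g e] act_one by (simp add: l_inv)

lemma act_cancel:
 assumes "g : carrier G" "g' : carrier G" "e : topspace E" "act g e = act g' e"
 shows "g = g'"
proof -
 have "inv g \<otimes> g' = \<one>"
  using act_mult[of "inv g" g' e] act_inv[OF assms(1,3)] assms act_free[of "inv g \<otimes> g'" e] by simp
 thus ?thesis using assms by (metis inv_closed inv_equality inv_inv)
qed

text \<open>The deck transformation that carries the section over the star of \<open>a\<close> to that over the star of \<open>b\<close>, at the centre of \<open>T\<close>.\<close>

definition h :: "nat => nat => 'a set => 'g" where
 "h a b T = (SOME g. g : carrier G & act g (sec a (pt T centre)) = sec b (pt T centre))"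

lemma sec_centre: "a < 4 ==> T : TT ==> pt T centre : pos_part {a}" using pt_in_pos_part centre by simp

lemma h:
 assumes "a < 4" "b < 4" "T : TT"
 shows "h a b T : carrier G" "act (h a b T) (sec a (pt T centre)) = sec b (pt T centre)"
proof -
 note ca = sec_centre[OF assms(1,3)] and cb = sec_centre[OF assms(2,3)]
 have "EX g. g : carrier G & act g (sec a (pt T centre)) = sec b (pt T centre)"
  using sec(2)[OF assms(1) ca] sec(2)[OF assms(2) cb] act_trans[OF sec(4)[OF assms(1) ca] sec(4)[OF assms(2) cb]] by auto
 hence "h a b T : carrier G & act (h a b T) (sec a (pt T centre)) = sec b (pt T centre)"
  unfolding h_def by (rule someI_ex)
 thus "h a b T : carrier G" "act (h a b T) (sec a (pt T centre)) = sec b (pt T centre)" by auto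
qed

lemma sec_transition:
 assumes ab: "a < 4" "b < 4" and T: "T : TT" and x: "x : Dl" "0 < x a" "0 < x b"
 shows "act (h a b T) (sec a (pt T x)) = sec b (pt T x)"
proof -
 let ?C = "{x : Dl. 0 < x a & 0 < x b}"
 let ?line = "%s c. (1 - s) * centre c + s * x c"
 have D: "?line s : Dl" if "s : {0..1}" for s using bary_simplex_segment[OF centre(1) x(1), of s] that by simp
 have pos: "0 < ?line s c" if "s : {0..1}" "c < 4" "0 < x c" for s c
 proof (cases "s = 0")
  case True thus ?thesis using centre(2)[OF that(2)] by simp
 next
  case False
  hence "0 < s * x c" "0 <= (1 - s) * centre c" using that centre(2)[OF that(2)] by auto
  thus ?thesis by simp
 qed
 have "continuous_map (top_of_set {0..1}) (top_of_set Dl) ?line" using space3_connected_line[of "{0..1}" centre x] D by auto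
 hence c: "continuous_map (top_of_set {0..1}) R (pt T o ?line)" using continuous_pt[OF T] by (rule continuous_map_compose)
 have into: "continuous_map (top_of_set {0..1}) (subtopology R (pos_part {c})) (pt T o ?line)" if "c < 4" "0 < x c" for c
  using c pt_in_pos_part[OF T D] pos[OF _ that] by (auto simp: continuous_map_in_subtopology)
 define F where "F = act (h a b T) o (sec a o (pt T o ?line))"
 define F' where "F' = sec b o (pt T o ?line)"
 let ?Y = "top_of_set {0..1 :: real}"
 have conn: "connected_space ?Y" by simp
 have cF: "continuous_map ?Y E F"
  unfolding F_def
  by (intro continuous_map_compose[OF _ act_cont[OF h(1)[OF ab T]]] continuous_map_compose[OF into sec(1)] ab x)
 have cF': "continuous_map ?Y E F'"
  unfolding F'_def by (intro continuous_map_compose[OF into sec(1)] ab x)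
 have start: "F 0 = F' 0" using h(2)[OF ab T] by (simp add: F_def F'_def)
 have over: "q (F s) = q (F' s)" if "s : topspace ?Y" for s
 proof -
  have s: "s : {0..1}" using that by simp
  show ?thesis
   using pt_in_pos_part[OF T D[OF s]] pos[OF s ab(1) x(2)] pos[OF s ab(2) x(3)] q_act[OF h(1)[OF ab T] sec(4)[OF ab(1)]] sec(2)[OF ab(1)] sec(2)[OF ab(2)]
   by (simp add: F_def F'_def)
 qed
 have "F 1 = F' 1" by (rule lift_unique[OF cover conn cF cF' over _ start]) simp_all
 thus ?thesis by (simp add: F_def F'_def)
qed

lemma h_unique:
 assumes "a < 4" "b < 4" "T : TT" "g : carrier G" "x : Dl" "0 < x a" "0 < x b" "act g (sec a (pt T x)) = sec b (pt T x)"
 shows "h a b T = g"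
proof (rule act_cancel)
 show "sec a (pt T x) : topspace E" by (rule sec(4)[OF assms(1)]) (use pt_in_pos_part[OF assms(3,5)] assms(6) in simp)
 show "act (h a b T) (sec a (pt T x)) = act g (sec a (pt T x))" using sec_transition[OF assms(1-3,5-7)] assms(8) by simp
qed (use h(1)[OF assms(1-3)] assms(4) in auto)

lemma h_composition:
 assumes "a < 4" "b < 4" "c < 4" "T : TT"
 shows "h b c T \<otimes> h a b T = h a c T"
proof -
 have "act (h b c T \<otimes> h a b T) (sec a (pt T centre)) = sec c (pt T centre)"
  using act_mult[OF h(1)[OF assms(2-4)] h(1)[OF assms(1,2,4)] sec(4)[OF assms(1) sec_centre[OF assms(1,4)]]]
   h(2)[OF assms(1,2,4)] h(2)[OF assms(2-4)] by simp
 moreover have "h b c T \<otimes> h a b T : carrier G" using h(1) assms by simp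
 ultimately have "h a c T = h b c T \<otimes> h a b T"
  by (intro h_unique[OF assms(1,3,4) _ centre(1) centre(2)[OF assms(1)] centre(2)[OF assms(3)]])
 thus ?thesis by (rule sym)
qed

lemma h_base: "a < 4 ==> b < 4 ==> h a b T0 = \<one>"
 by (rule h_unique[OF _ _ T0 one_closed centre(1) centre(2) centre(2)]) (simp_all add: sec(3) act_one y0)

lemma h_invariant:
 assumes abc: "a < 4" "b < 4" "c < 4" "c ~= a" "c ~= b" and T: "T : TT"
 shows "h a b (sg c T) = h a b T"
proof -
 define x where "x = (%d. if d < 4 & d ~= c then 1/3 else 0 :: real)"
 have "sum x ({..<4} - {c}) = (SUM d:{..<4} - {c}. 1/3)" by (rule sum.cong) (auto simp: x_def)
 hence "sum x {..<4} = 1" using abc(3) by (subst sum.remove[of _ c]) (auto simp: x_def)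
 hence x: "x : Dl" "0 < x a" "0 < x b" "x c = 0" using abc by (auto simp: bary_simplex_def x_def)
 have sgT: "sg c T : TT" by (rule sg_in[OF abc(3) T])
 have "pt T x = pt (sg c T) x" using x(4) abc(3) pt_eq_iff[OF T sgT x(1) x(1)] orb_step[OF orb_refl T] by simp
 hence "act (h a b T) (sec a (pt (sg c T) x)) = sec b (pt (sg c T) x)" using sec_transition[OF abc(1,2) T x(1,2,3)] by simp
 thus ?thesis by (rule h_unique[OF abc(1,2) sgT h(1)[OF abc(1,2) T] x(1,2,3)])
qed

lemma openin_sheet:
 assumes a: "a < 4" and g: "g : carrier G"
 shows "openin E ((%y. act g (sec a y)) ` pos_part {a})"
proof (rule openin_section_image[OF cover])
 show "openin R (pos_part {a})" by (rule openin_pos_part) (use a in simp)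
 show "continuous_map (subtopology R (pos_part {a})) E (%y. act g (sec a y))"
  using continuous_map_compose[OF sec(1)[OF a] act_cont[OF g]] by (simp add: o_def)
 show "q (act g (sec a y)) = y" if "y : pos_part {a}" for y using q_act[OF g sec(4)[OF a that]] sec(2)[OF a that] by simp
qed

lemma in_open_star: "y : topspace R ==> EX a<4. y : pos_part {a}"
proof -
 assume y: "y : topspace R"
 show ?thesis using support[OF coord_simplex[OF y]] y by (auto simp: pos_part_def)
qed

lemma in_sheet: "e : topspace E ==> a < 4 ==> q e : pos_part {a} ==> EX g:carrier G. e = act g (sec a (q e))"
 using act_trans[of "sec a (q e)" e] sec(2,4) by simp

lemma sheet_transition:
 assumes ab: "a < 4" "b < 4" and g: "g : carrier G" "g' : carrier G" and y: "y : pos_part {a}" "y' : pos_part {b}"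
  and eq: "act g (sec a y) = act g' (sec b y')"
 shows "y' = y" "g = g' \<otimes> h a b (tet y)"
proof -
 show yy: "y' = y"
  using q_act[OF g(1) sec(4)[OF ab(1) y(1)]] sec(2)[OF ab(1) y(1)] q_act[OF g(2) sec(4)[OF ab(2) y(2)]] sec(2)[OF ab(2) y(2)] eq
  by simp
 have yR: "y : topspace R" using y(1) by (simp add: pos_part_def)
 have T: "tet y : TT" "y = pt (tet y) (coord y)" using tet[OF yR] by auto
 have "act (h a b (tet y)) (sec a y) = sec b y"
  using sec_transition[OF ab T(1) coord_simplex[OF yR]] y yy T(2) by (simp add: pos_part_def)
 thus "g = g' \<otimes> h a b (tet y)"
  using act_mult[OF g(2) h(1)[OF ab T(1)] sec(4)[OF ab(1) y(1)]] eq yy act_cancel[OF _ g(1) sec(4)[OF ab(1) y(1)], of "g' \<otimes> h a b (tet y)"] g h(1)[OF ab T(1)]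
  by simp
qed

text \<open>The sheets \<open>act g (sec a (\<dots>))\<close> with \<open>g\<close> in \<open>H\<close> fill an open and closed subset of the connected space \<open>E\<close>.\<close>

lemma h_generate:
 assumes H: "subgroup H G" and hH: "!!a b T. a < 4 ==> b < 4 ==> T : TT ==> h a b T : H"
 shows "H = carrier G"
proof (rule ccontr)
 assume ne: "H ~= carrier G"
 interpret H: subgroup H G by (rule H)
 define N where "N X = (\<Union>a<4. UN g:X. (%y. act g (sec a y)) ` pos_part {a})" for X
 have op: "openin E (N X)" if "X <= carrier G" for X
  unfolding N_def by (intro openin_Union) (use openin_sheet that in "auto intro!: openin_Union")
 have cov: "topspace E <= N H Un N (carrier G - H)"
 proof
  fix e assume e: "e : topspace E"
  have "q e : topspace R" using cover_map_surj[OF cover] e by blast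
  then obtain a where a: "a < 4" "q e : pos_part {a}" using in_open_star by blast
  obtain g where g: "g : carrier G" "e = act g (sec a (q e))" using in_sheet[OF e a] by blast
  thus "e : N H Un N (carrier G - H)" unfolding N_def using a by (cases "g : H") blast+
 qed
 have disj: "N H Int N (carrier G - H) = {}"
 proof (rule ccontr)
  assume "N H Int N (carrier G - H) ~= {}"
  then obtain a b g g' y y' where m: "a < 4" "b < 4" "g : H" "g' : carrier G - H" "y : pos_part {a}" "y' : pos_part {b}"
   "act g' (sec b y') = act g (sec a y)" unfolding N_def by (auto simp: image_iff) (metis DiffI)
  have T: "tet y' : TT" using m(6) tet by (simp add: pos_part_def)
  have "g' = g \<otimes> h b a (tet y')" by (rule sheet_transition(2)[OF m(2,1) _ _ m(6,5,7)]) (use m(3,4) H.subset in auto)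
  thus False using H.m_closed[OF m(3) hH[OF m(2,1) T]] m(4) by simp
 qed
 have member: "act g y0 : N X" if "g : X" for g X using that sec(3)[of 0] sec_centre[OF _ T0] by (force simp: N_def)
 obtain g where g: "g : carrier G" "g ~: H" using ne H.subset by blast
 have "connected_space E" by (rule two_contractible_pieces_connected[OF pieces])
 moreover have "N H ~= {}" using member[of \<one> H] H.one_closed by blast
 moreover have "N (carrier G - H) ~= {}" using member[of g "carrier G - H"] g by blast
 ultimately show False using op[OF H.subset] op[OF Diff_subset] cov disj unfolding connected_space_def by blast
qed

sublocale gem_cocycle TT sg G h T0
proof
 show "orb ({..<4} - {c}) T = TT" if "c < 4" "T : TT" for c T
  using vertex_orbit[OF that] orb_subset[OF that(2), of "{..<4} - {c}"] by auto
qed (use T0 h(1) h_composition h_invariant h_base h_generate card_TT_bound in auto)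

text \<open>Pulled back to \<open>E\<close>, the functions \<open>- ka a T + ka b T\<close> form a Cech cocycle for the preimages of the open stars of the vertices.
  It is trivial, and the functions \<open>t a\<close> that trivialize it are constant on the sheets over the star of \<open>a\<close>, which are indexed by \<open>G\<close>.\<close>

lemma cocycle_on_cover:
 fixes ka :: "nat => 'a set => 'h :: group_add"
 assumes inv: "!!a b c T. a < 4 ==> b < 4 ==> c < 4 ==> a ~= b ==> c ~= a ==> c ~= b ==> T : TT ==>
   - ka a (sg c T) + ka b (sg c T) = - ka a T + ka b T"
 shows "EX t. ALL a<4 :: nat. ALL b<4 :: nat. ALL T:TT. ALL g:carrier G. - ka a T + ka b T = t a (g \<otimes> h a b T) - t b g"
proof -
 define V where "V a = {e : topspace E. q e : pos_part {a}}" for a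
 define f where "f a b e = - ka a (tet (q e)) + ka b (tet (q e))" for a b e
 have qE: "continuous_map E R q" by (rule cover_map_continuous[OF cover])
 have inv': "- ka a (sg c T) + ka b (sg c T) = - ka a T + ka b T"
  if "a < 4" "b < 4" "c < 4" "c ~: {a, b}" "T : TT" for a b c T
  using inv[OF that(1-3) _ _ _ that(5)] that(4) by (cases "a = b") auto
 interpret cech: cech_cocycle E "{..<4}" V f
 proof
  show "openin E (V a)" if "a : {..<4}" for a
   unfolding V_def by (rule openin_continuous_map_preimage[OF qE openin_pos_part]) (use that in simp)
  show "topspace E = (UN a:{..<4}. V a)" using in_open_star cover_map_surj[OF cover] unfolding V_def by blast
  show "f a b e + f b c e = f a c e" for a b c e unfolding f_def by (simp add: add.assoc)
  show "locally_const E (V a Int V b) (f a b)" if ab: "a : {..<4}" "b : {..<4}" for a b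
   unfolding locally_const_def
  proof
   fix e assume e: "e : V a Int V b"
   let ?A = "{y : pos_part {a, b}. - ka a (tet y) + ka b (tet y) = f a b e}"
   have "openin R ?A" by (rule pos_part_value(2)[of "{a, b}" "%T. - ka a T + ka b T"]) (use inv' ab in auto)
   hence "openin E {e' : topspace E. q e' : ?A}" by (rule openin_continuous_map_preimage[OF qE])
   moreover have "e : {e' : topspace E. q e' : ?A}" using e by (auto simp: V_def f_def pos_part_def)
   moreover have "{e' : topspace E. q e' : ?A} <= V a Int V b" by (auto simp: V_def pos_part_def)
   moreover have "ALL e':{e' : topspace E. q e' : ?A}. f a b e' = f a b e" by (simp add: f_def)
   ultimately show "EX U. openin E U & e : U & U <= V a Int V b & (ALL z:U. f a b z = f a b e)" by blast
  qed
 qed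
 obtain t' where t': "!!a. a : {..<4} ==> locally_const E (V a) (t' a)"
  "!!a b e. a : {..<4} ==> b : {..<4} ==> e : V a ==> e : V b ==> f a b e = t' a e - t' b e"
  using cech.cocycle_trivial[OF pieces] by blast
 define t where "t a g = t' a (act g y0)" for a g
 have t: "t' a (act g (sec a y)) = t a g" if a: "a < 4" "g : carrier G" "y : pos_part {a}" for a g y
 proof -
  let ?s = "%y. act g (sec a y)"
  have a': "a : {..<4}" using a(1) by simp
  have "connectedin R (pos_part {a})"
   using contractible_open_star[OF a(1)] contractible_imp_path_connected_space path_connected_imp_connected_space pos_part_subset
   by (auto simp: connectedin_def)
  hence "connectedin (subtopology R (pos_part {a})) (pos_part {a})" by simp
  moreover have "continuous_map (subtopology R (pos_part {a})) E ?s"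
   using continuous_map_compose[OF sec(1)[OF a(1)] act_cont[OF a(2)]] by (simp add: o_def)
  ultimately have "connectedin E (?s ` pos_part {a})" using connectedin_continuous_map_image by blast
  moreover have "?s ` pos_part {a} <= V a"
   using act_in[OF a(2) sec(4)[OF a(1)]] q_act[OF a(2) sec(4)[OF a(1)]] sec(2)[OF a(1)] by (auto simp: V_def)
  ultimately have "t' a (?s y) = t' a (?s (pt T0 centre))"
   by (rule locally_const_connected[OF t'(1)[OF a']]) (use a sec_centre[OF a(1) T0] in auto)
  thus ?thesis using sec(3)[OF a(1)] by (simp add: t_def)
 qed
 show ?thesis
 proof (intro exI[of _ t] allI impI ballI)
  fix a b :: nat and T g assume ab: "a < 4" "b < 4" and T: "T : TT" and g: "g : carrier G"
  let ?y = "pt T centre"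
  let ?e = "act g (sec b ?y)"
  note ya = sec_centre[OF ab(1) T] and yb = sec_centre[OF ab(2) T]
  have hc: "h a b T : carrier G" by (rule h(1)[OF ab T])
  have e: "?e = act (g \<otimes> h a b T) (sec a ?y)" using act_mult[OF g hc sec(4)[OF ab(1) ya]] h(2)[OF ab T] by simp
  have eE: "?e : topspace E" by (rule act_in[OF g sec(4)[OF ab(2) yb]])
  have qe: "q ?e = ?y" using q_act[OF g sec(4)[OF ab(2) yb]] sec(2)[OF ab(2) yb] by simp
  have eV: "?e : V a" "?e : V b" using eE qe ya yb by (auto simp: V_def)
  have "f a b ?e = t' a ?e - t' b ?e" using t'(2)[OF _ _ eV] ab by simp
  also have "t' a ?e = t a (g \<otimes> h a b T)" unfolding e by (rule t[OF ab(1) _ ya]) (use g hc in simp)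
  also have "t' b ?e = t b g" by (rule t[OF ab(2) g yb])
  also have "f a b ?e = - ka a T + ka b T"
   unfolding f_def qe using pos_part_value(1)[of "{a, b}" "%T. - ka a T + ka b T", OF inv'[OF ab] _ T centre(1)] ab centre(2) by auto
  finally show "- ka a T + ka b T = t a (g \<otimes> h a b T) - t b g" .
 qed
qed

text \<open>The increments of \<open>c\<close> across the faces opposite to \<open>i\<close> can be integrated at the vertices \<open>k\<close> and \<open>l\<close>, by \<open>potential_at_vertex\<close>.
  The two integrals, together with \<open>0\<close> for \<open>i\<close> and \<open>c\<close> for \<open>j\<close>, form a family as in \<open>cocycle_on_cover\<close>.\<close>

lemma label_on_cover:
 fixes c :: "'a set => 'h :: group_add"
 assumes co: "colours i j k l"
  and kl: "!!T. T : TT ==> c (sg k T) = c T & c (sg l T) = c T"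
  and w: "EX w. ALL T:TT. w (sg j T) = w T & w (sg i T) = c (sg i T) - c T + w T"
 shows "EX t s. ALL T:TT. ALL g:carrier G. c T = t (g \<otimes> h i j T) - s g"
proof -
 have d: "i < 4" "j < 4" "k < 4" "l < 4" "distinct [i, j, k, l]" using co by (auto simp: colours_def)
 have four: "a : {i, j, k, l}" if "a < 4" for a using colours_four[OF co] that by auto
 obtain w where w: "ALL T:TT. w (sg j T) = w T & w (sg i T) = c (sg i T) - c T + w T" using w by blast
 define z :: "nat => 'a set => 'h" where "z a T = (if a = i then c (sg i T) - c T else 0)" for a T
 have pot: "EX u. ALL T:TT. ALL a<4. a ~= m --> u (sg a T) = z a T + u T" if m: "m : {k, l}" for m
 proof (rule potential_at_vertex)
  show "m < 4" using m d by auto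
  fix a b :: nat assume ab: "a < 4" "b < 4" "a ~= m" "b ~= m" "a ~= b"
  show "EX w. ALL T:TT. w (sg a T) = z a T + w T & w (sg b T) = z b T + w T"
  proof (cases "a ~= i & b ~= i")
   case True
   thus ?thesis by (intro exI[of _ "%_. 0"]) (simp add: z_def)
  next
   case False
   show ?thesis
   proof (cases "a = j | b = j")
    case True
    thus ?thesis using False w d(5) by (auto simp: z_def)
   next
    case False': False
    have "c (sg a T) = z a T + c T & c (sg b T) = z b T + c T" if "T : TT" for T
     using four[OF ab(1)] four[OF ab(2)] False' kl[OF that] d(5) by (auto simp: z_def)
    thus ?thesis by blast
   qed
  qed
 qed
 obtain u where u: "ALL T:TT. ALL a<4. a ~= k --> u (sg a T) = z a T + u T" using pot[of k] by auto
 obtain v where v: "ALL T:TT. ALL a<4. a ~= l --> v (sg a T) = z a T + v T" using pot[of l] by auto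
 define ka where "ka a = (if a = i then (%_. 0) else if a = j then c else if a = k then u else v)" for a
 have ka: "ka i = (%_. 0)" "ka j = c" "ka k = u" "ka l = v" using d(5) by (auto simp: ka_def)
 have step: "ka a (sg b T) = z b T + ka a T" if "T : TT" "b < 4" "a < 4" "b ~= a" "(a, b) ~= (i, b)" "(a, b) ~= (j, b) | b ~= i | True" for a b T
  using that u v kl four[OF that(3)] four[OF that(2)] d(5) by (auto simp: ka z_def)
 have inv: "- ka a (sg b T) + ka a' (sg b T) = - ka a T + ka a' T"
  if h: "a < 4" "a' < 4" "b < 4" "b ~= a" "b ~= a'" "T : TT" for a a' b T
 proof (cases "b = i")
  case True
  thus ?thesis using h step[OF h(6,3,1)] step[OF h(6,3,2)] by (simp add: difference_translate)
 next
  case False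
  have "ka m (sg b T) = ka m T" if "m < 4" "b ~= m" for m
   using that u v kl[OF h(6)] h(3,6) four[OF that(1)] four[OF h(3)] d(5) False by (auto simp: ka z_def)
  thus ?thesis using h by simp
 qed
 have "EX t. ALL a<4 :: nat. ALL b<4 :: nat. ALL T:TT. ALL g:carrier G. - ka a T + ka b T = t a (g \<otimes> h a b T) - t b g"
  by (rule cocycle_on_cover) (rule inv)
 then obtain t where t: "ALL a<4. ALL b<4. ALL T:TT. ALL g:carrier G. - ka a T + ka b T = t a (g \<otimes> h a b T) - t b g" by blast
 have "c T = t i (g \<otimes> h i j T) - t j g" if "T : TT" "g : carrier G" for T g using t d(1,2) that ka(1,2) by auto
 thus ?thesis by blast
qed

text \<open>Averaging \<open>c T = t (g \<otimes> h i j T) - s g\<close> over the finite group removes the dependence on \<open>T\<close>.\<close>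

lemma real_label_constant:
 assumes fin: "finite (carrier G)" and co: "colours i j k l"
  and kl: "!!T. T : TT ==> c (sg k T) = c T & c (sg l T) = c T"
  and w: "EX w. ALL T:TT. w (sg j T) = w T & w (sg i T) = c (sg i T) - c T + w T"
  and T: "T : TT" "T' : TT"
 shows "(c :: 'a set => real) T = c T'"
proof -
 have d: "i < 4" "j < 4" using co by (auto simp: colours_def)
 obtain t s where ts: "!!T g. T : TT ==> g : carrier G ==> c T = t (g \<otimes> h i j T) - s g"
  using label_on_cover[OF co kl w] by blast
 have "real (card (carrier G)) * c T = sum t (carrier G) - sum s (carrier G)" if T: "T : TT" for T
 proof -
  have "real (card (carrier G)) * c T = (SUM g:carrier G. c T)" by simp
  also have "... = (SUM g:carrier G. t (g \<otimes> h i j T) - s g)" by (rule sum.cong) (use ts[OF T] in auto)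
  also have "... = (SUM g:carrier G. t (g \<otimes> h i j T)) - sum s (carrier G)" by (simp add: sum_subtractf)
  also have "(SUM g:carrier G. t (g \<otimes> h i j T)) = sum t (carrier G)"
  proof (rule sum.reindex_bij_witness[of _ "%g. g \<otimes> inv (h i j T)" "%g. g \<otimes> h i j T"])
  qed (use h(1)[OF d T] in "auto simp: m_assoc")
  finally show ?thesis .
 qed
 hence "real (card (carrier G)) * c T = real (card (carrier G)) * c T'" using T by simp
 moreover have "card (carrier G) ~= 0" using fin one_closed by auto
 ultimately show ?thesis by simp
qed

text \<open>As \<open>c T0 = 0\<close>, the functions \<open>s\<close> and \<open>t\<close> with \<open>c T = t (g \<otimes> h i j T) - s g\<close> coincide. Hence \<open>c T + c T'\<close> is
  \<open>t (h i j T' \<otimes> h i j T) - t \<one>\<close>, which is symmetric in \<open>T\<close> and \<open>T'\<close> for abelian \<open>G\<close>.\<close>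

lemma label_values_commute:
 fixes c :: "'a set => 'h :: group_add"
 assumes comm: "!!x y. x : carrier G ==> y : carrier G ==> x \<otimes> y = y \<otimes> x" and co: "colours i j k l"
  and kl: "!!T. T : TT ==> c (sg k T) = c T & c (sg l T) = c T"
  and w: "EX w. ALL T:TT. w (sg j T) = w T & w (sg i T) = c (sg i T) - c T + w T"
  and c0: "c T0 = 0" and T: "T : TT" "T' : TT"
 shows "c T + c T' = c T' + c T"
proof -
 have d: "i < 4" "j < 4" using co by (auto simp: colours_def)
 obtain t s where ts: "!!T g. T : TT ==> g : carrier G ==> c T = t (g \<otimes> h i j T) - s g"
  using label_on_cover[OF co kl w] by blast
 have s: "s g = t g" if "g : carrier G" for g using ts[OF T0 that] h_base[OF d] c0 that by simp
 have prod: "c X + c Y = t (h i j Y \<otimes> h i j X) - t \<one>" if "X : TT" "Y : TT" for X Y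
 proof -
  have hX: "h i j X : carrier G" "h i j Y : carrier G" using h(1)[OF d] that by auto
  have "c X = t (h i j Y \<otimes> h i j X) - t (h i j Y)" using ts[OF that(1) hX(2)] s[OF hX(2)] by simp
  moreover have "c Y = t (h i j Y) - t \<one>" using ts[OF that(2) one_closed] s[OF one_closed] hX by simp
  ultimately show ?thesis by (simp add: add_diff_eq)
 qed
 show ?thesis using prod[OF T] prod[OF T(2,1)] comm[OF h(1)[OF d T(1)] h(1)[OF d T(2)]] by simp
qed

end

section \<open>The bound on the second entry of the h-vector\<close>

lemma (in gem_cocycle) many_edges:
 assumes r: "!!S. S <= carrier G ==> finite S ==> generate G S = carrier G ==> r <= card S"
  and co: "colours i j k l"
 shows "r + 1 <= card (orbits {i, j})"
proof -
 have kl: "k < 4" "l < 4" "k ~= l" using co by (auto simp: colours_def)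
 define L where "L = h k l ` TT"
 have L: "L <= carrier G" "finite L" using h_in[OF kl(1,2)] finite_TT by (auto simp: L_def)
 have "L <= (%e. h k l (SOME X. X : e)) ` orbits {i, j}"
 proof
  fix v assume "v : L"
  then obtain T where T: "T : TT" "v = h k l T" by (auto simp: L_def)
  let ?e = "orb {i, j} T"
  have e: "?e : orbits {i, j}" using T(1) by (auto simp: orbits_def)
  have "v = h k l (SOME X. X : ?e)" using h_orbit[OF colours_swap[OF co] e orb_refl] by (metis someI[of _ T] orb_refl T(2))
  thus "v : (%e. h k l (SOME X. X : e)) ` orbits {i, j}" using e by blast
 qed
 hence card_L: "card L <= card (orbits {i, j})" by (rule surj_card_le[OF finite_orbits])
 have one: "\<one> : L" using h_T0[OF kl(1,2)] T0 by (force simp: L_def)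
 let ?S = "L - {\<one>}"
 have S: "?S <= carrier G" "finite ?S" using L by auto
 have "generate G ?S = carrier G"
 proof (rule generated_by_one_pair[OF kl])
  show sub: "subgroup (generate G ?S) G" by (rule G.generate_is_subgroup[OF S(1)])
  fix T assume "T : TT"
  hence "h k l T : L" by (simp add: L_def)
  thus "h k l T : generate G ?S" using subgroup.one_closed[OF sub] by (cases "h k l T = \<one>") (auto intro: generate.incl)
 qed
 hence "r <= card ?S" by (rule r[OF S])
 moreover have "card L = Suc (card ?S)" by (rule card.remove[OF L(2) one])
 ultimately show ?thesis using card_L by simp
qed

lemma (in covered_manifold) extremal:
 assumes r: "!!S. S <= carrier G ==> finite S ==> generate G S = carrier G ==> r <= card S"
  and small: "h2 3 K <= 6 * int r"
 shows "extremal_gem TT sg G h T0 r"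
proof -
 have choose: "(3 + 1 choose 2 :: nat) = 6" by (simp add: eval_nat_numeral)
 have "h2 3 K = int (f_number K 1) - 6" unfolding h2_def choose using four_vertices by simp
 hence sum: "f_number K 1 <= 6 * r + 6" using small by simp
 have many: "r + 1 <= card (orbits {i, j})" if "colours i j k l" for i j k l by (rule many_edges[OF r that])
 have "colours 0 1 2 3" "colours 0 2 1 3" "colours 0 3 1 2" "colours 1 2 0 3" "colours 1 3 0 2" "colours 2 3 0 1"
  by (simp_all add: colours_def)
 note ge = this[THEN many]
 have six: "a = m & b = m & c = m & d = m & e = m & f = m"
  if "m <= a" "m <= b" "m <= c" "m <= d" "m <= e" "m <= f" "a + b + c + d + e + f <= 6 * m" for a b c d e f m :: nat
  using that by simp
 have all: "card (orbits {0,1}) = r + 1 & card (orbits {0,2}) = r + 1 & card (orbits {0,3}) = r + 1 &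
   card (orbits {1,2}) = r + 1 & card (orbits {1,3}) = r + 1 & card (orbits {2,3}) = r + 1"
  by (rule six) (use ge sum number_of_edges in simp_all)
 show ?thesis
 proof
  fix i j k l assume "colours i j k l"
  hence "i < 4" "j < 4" "i ~= j" by (auto simp: colours_def)
  hence "i : {0, 1, 2, 3}" "j : {0, 1, 2, 3}" "i ~= j" by auto
  thus "card (orbits {i, j}) = r + 1" using all by (elim insertE emptyE) (simp_all add: insert_commute)
 qed
qed

lemma generators_integer_mod_group:
 assumes p: "3 <= p" and S: "generate (integer_mod_group p) S = carrier (integer_mod_group p)" "finite S"
 shows "1 <= card S"
proof (rule ccontr)
 assume "~ 1 <= card S"
 hence "S = {}" using S(2) by (simp add: not_le)
 hence "{0..<int p} = {0}"
  using S(1) group.generate_empty[of "integer_mod_group p"] p by (simp add: carrier_integer_mod_group)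
 moreover have "1 : {0..<int p}" using p by simp
 ultimately show False by simp
qed

lemma generators_Q8:
 assumes S: "S <= carrier Q8_group" "finite S" "generate Q8_group S = carrier Q8_group"
 shows "2 <= card S"
proof (rule ccontr)
 interpret Q: group Q8_group by (rule group_Q8)
 assume "~ 2 <= card S"
 hence "card S <= 1" by simp
 then obtain x where x: "S <= {x}" "x : carrier Q8_group"
  using S(1,2) Q.one_closed by (metis card_0_eq card_1_singletonE empty_subsetI insert_subset le_less less_one order_refl)
 have gen: "carrier Q8_group <= {x [^]\<^bsub>Q\<^esub> (k :: int) |k. k : UNIV}"
  using S(3) Q.generate_pow[OF x(2)] Q.mono_generate[OF x(1)] by simp
 have "quat_i : carrier Q8_group" "quat_j : carrier Q8_group" by (auto simp: Q8_group_def Q8_def)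
 then obtain k l :: int where kl: "quat_i = x [^]\<^bsub>Q\<^esub> k" "quat_j = x [^]\<^bsub>Q\<^esub> l" using gen by blast
 have "quat_mult quat_i quat_j = x [^]\<^bsub>Q\<^esub> (k + l)" "quat_mult quat_j quat_i = x [^]\<^bsub>Q\<^esub> (l + k)"
  unfolding kl Q.int_pow_mult[OF x(2)] by (simp_all add: Q8_group_def)
 hence "quat_mult quat_i quat_j = quat_mult quat_j quat_i" by (simp add: add.commute)
 thus False by (simp add: quat_mult_def quat_i_def quat_j_def)
qed

lemma generators_Z3:
 assumes S: "finite S" "generate Z3_group S = carrier Z3_group"
 shows "3 <= card S"
proof (rule ccontr)
 interpret Z: group Z3_group by (rule group_Z3)
 assume "~ 3 <= card S"
 hence card: "card S <= 2" by simp
 have "dim (real_vec ` S) <= card (real_vec ` S)" by (rule dim_le_card') (use S(1) in simp)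
 also have "... <= 2" using card_image_le[OF S(1), of real_vec] card by simp
 finally have "dim (real_vec ` S) < DIM(real ^ 3)" by simp
 hence "EX a. a ~= 0 & (ALL z:span (real_vec ` S). orthogonal a z)" by (rule orthogonal_to_subspace_exists) blast
 then obtain a where a: "a ~= 0" "ALL z:span (real_vec ` S). orthogonal a z" by blast
 have aS: "a \<bullet> real_vec q = 0" if "q : S" for q using a(2) that by (simp add: orthogonal_def span_base)
 have "subgroup {q. a \<bullet> real_vec q = 0} Z3_group" by (rule subgroup_kernel_real_vec)
 hence "generate Z3_group S <= {q. a \<bullet> real_vec q = 0}" by (intro Z.generate_subgroup_incl) (use aS in auto)
 hence "a \<bullet> real_vec q = 0" for q using S(2) by (auto simp: Z3_group_def)
 thus False using a(1) real_vec_orthogonal_all by simp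
qed

lemma lens_not_extremal:
 assumes "covered_manifold K E q (integer_mod_group p) act T0 y0" and p: "3 <= p" and small: "h2 3 K <= 6 * int 1"
 shows False
proof -
 interpret covered_manifold K E q "integer_mod_group p" act T0 y0 by (rule assms(1))
 have ext: "extremal_gem TT sg (integer_mod_group p) h T0 1"
  by (rule extremal[OF _ small]) (rule generators_integer_mod_group[OF p])
 have fin: "finite (carrier (integer_mod_group p))" using p by (simp add: carrier_integer_mod_group)
 have "lens_gem TT sg p h T0"
  by (rule lens_gem.intro[OF ext]) (unfold_locales, rule p, rule real_label_constant[OF fin], assumption+)
 thus False by (rule lens_gem.not_extremal)
qed

lemma Q8_not_extremal:
 assumes "covered_manifold K E q Q8_group act T0 y0" and small: "h2 3 K <= 6 * int 2"
 shows False
proof -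
 interpret covered_manifold K E q Q8_group act T0 y0 by (rule assms(1))
 have ext: "extremal_gem TT sg Q8_group h T0 2" by (rule extremal[OF _ small]) (rule generators_Q8)
 have fin: "finite (carrier Q8_group)" by (simp add: Q8_group_def Q8_def)
 have "Q8_gem TT sg h T0" by (rule Q8_gem.intro[OF ext]) (unfold_locales, rule real_label_constant[OF fin], assumption+)
 thus False by (rule Q8_gem.not_extremal)
qed

lemma torus_not_extremal:
 assumes "covered_manifold K E q Z3_group act T0 y0" and small: "h2 3 K <= 6 * int 3"
 shows False
proof -
 interpret covered_manifold K E q Z3_group act T0 y0 by (rule assms(1))
 have ext: "extremal_gem TT sg Z3_group h T0 3" by (rule extremal[OF _ small]) (rule generators_Z3)
 have comm: "x \<otimes>\<^bsub>Z3_group\<^esub> y = y \<otimes>\<^bsub>Z3_group\<^esub> x" for x y by (simp add: Z3_group_def)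
 have "T3_gem TT sg h T0" by (rule T3_gem.intro[OF ext]) (unfold_locales, rule label_values_commute[OF comm], assumption+)
 thus False by (rule T3_gem.not_extremal)
qed

lemma contracted_manifold_of_pseudotriangulation:
 assumes M: "closed_manifold 3 M" and X: "pseudotriangulation 3 X M" "contracted 3 X"
 shows "contracted_manifold X"
proof
 show "simplicial_cell_complex 3 X" "f_number X 0 = 4" using X(2) by (simp_all add: contracted_def)
 have hom: "M homeomorphic_space realization X" using X(1) by (simp add: pseudotriangulation_def)
 show "compact_space (realization X)" using M homeomorphic_compact_space[OF hom] by (simp add: closed_manifold_def)
 obtain f f' where f: "homeomorphic_maps (realization X) M f f'"
  using hom by (metis homeomorphic_space_def homeomorphic_space_sym)
 have hf: "homeomorphic_map (realization X) M f" using f homeomorphic_map_maps by blast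
 show "three_manifold (realization X)"
 proof (rule three_manifoldI)
  fix x assume x: "x : topspace (realization X)"
  have "f x : topspace M" using homeomorphic_imp_surjective_map[OF hf] x by blast
  then obtain U where U: "openin M U" "f x : U" "subtopology M U homeomorphic_space Euclidean_space 3"
   using M unfolding closed_manifold_def by blast
  let ?V = "{y : topspace (realization X). f y : U}"
  have "openin (realization X) ?V"
   using homeomorphic_imp_continuous_map[OF hf] U(1) by (rule openin_continuous_map_preimage)
  moreover have "homeomorphic_map (subtopology (realization X) ?V) (subtopology M U) f"
   by (rule homeomorphic_map_subtopologies[OF hf])
    (use homeomorphic_imp_surjective_map[OF hf] openin_subset[OF U(1)] in auto)
  hence "subtopology (realization X) ?V homeomorphic_space Euclidean_space 3"
   using U(3) homeomorphic_map_imp_homeomorphic_space homeomorphic_space_trans by blast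
  ultimately show "EX U. openin (realization X) U & x : U & subtopology (realization X) U homeomorphic_space Euclidean_space 3"
   using x U(2) by auto
 qed
qed

text \<open>It remains to exclude the extremal case, for any group action on \<open>E\<close> with a quotient \<open>N\<close> homeomorphic to \<open>M\<close>: then \<open>E\<close> covers both \<open>M\<close>, for
  the bound on the fundamental group, and the realization of \<open>X\<close>.\<close>

lemma h2_bound:
 fixes P :: "'p::real_normed_vector set" and X :: "'a cell_complex"
 assumes M: "closed_manifold 3 M" and X: "pseudotriangulation 3 X M" "contracted 3 X" and x0: "x0 : topspace M"
  and orb: "orbit_map G E N q act" and N: "M homeomorphic_space N"
  and E: "E = top_of_set P" "simply_connected P" "two_contractible_pieces E"
  and gen: "L <= carrier G" "finite L" "generate G L = carrier G" "card L <= r"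
  and large: "!!q T0 y0. covered_manifold X E q G act T0 y0 ==> h2 3 X <= 6 * int r ==> False"
 shows "h2 3 X > 6 * int (min_generators (fundamental_group M x0))"
proof -
 interpret orbit_map G E N q act by (rule orb)
 obtain f where "homeomorphic_map N M f" using N homeomorphic_space homeomorphic_space_sym by metis
 note q1 = deck_cover_homeomorphic[OF this]
 have "min_generators (fundamental_group M x0) <= card L"
  by (rule min_generators_fundamental_group_le[OF q1 E(1,2) x0 gen(1-3)])
 hence m: "min_generators (fundamental_group M x0) <= r" using gen(4) by simp
 have "N homeomorphic_space realization X"
  using X(1) N homeomorphic_space_sym homeomorphic_space_trans unfolding pseudotriangulation_def by metis
 then obtain f2 where "homeomorphic_map N (realization X) f2" using homeomorphic_space by metis
 note q2 = deck_cover_homeomorphic[OF this]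
 let ?q2 = "f2 o q"
 interpret contracted_manifold X by (rule contracted_manifold_of_pseudotriangulation[OF M X])
 interpret deck_cover E "realization X" "?q2" G act by (rule q2)
 obtain T0 where T0: "T0 : TT" using nonempty_TT by blast
 have "pt T0 centre : ?q2 ` topspace E" using cover_map_surj[OF cover] pt(3)[OF T0 centre(1)] by simp
 then obtain y0 where y0: "y0 : topspace E" "?q2 y0 = pt T0 centre" by auto
 have "covered_manifold X E ?q2 G act T0 y0" by unfold_locales (use E(3) T0 y0 in auto)
 thus ?thesis using large m by force
qed

theorem corollary1p7:
 fixes X :: "'a cell_complex" and M :: "'b topology" and x0 :: 'b
 assumes "closed_manifold 3 M"
  and "pseudotriangulation 3 X M"
  and "contracted 3 X"
  and "M homeomorphic_space sphere3_mod_Q8 | M homeomorphic_space torus3 |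
     (EX p q. 3 <= p & coprime (int p) q & M homeomorphic_space lens_space p q)"
  and "x0 : topspace M"
 shows "h2 3 X > 6 * int (min_generators (fundamental_group M x0))" using assms(4)
proof (elim disjE exE conjE)
 assume N: "M homeomorphic_space sphere3_mod_Q8"
 show ?thesis
 proof (rule h2_bound[OF assms(1-3,5) Q8_orbit_map N sphere3_eq simply_connected_sphere3 two_contractible_pieces_sphere3])
  show "{quat_i, quat_j} <= carrier Q8_group" by (auto simp: Q8_group_def Q8_def)
  show "generate Q8_group {quat_i, quat_j} = carrier Q8_group" by (rule generate_Q8)
  show "card {quat_i, quat_j} <= 2" by (simp add: card_insert_if)
 qed (simp, rule Q8_not_extremal)
next
 assume N: "M homeomorphic_space torus3"
 show ?thesis
 proof (rule h2_bound[OF assms(1-3,5) torus_orbit_map N refl])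
  show "simply_connected (UNIV :: (real \<times> real \<times> real) set)" by (rule convex_imp_simply_connected) simp
  show "two_contractible_pieces (top_of_set (UNIV :: (real \<times> real \<times> real) set))"
  proof (rule two_contractible_pieces_contractible)
   show "contractible_space (top_of_set (UNIV :: (real \<times> real \<times> real) set))"
    unfolding contractible_space_top_of_set by (rule convex_imp_contractible) simp
  qed simp
  show "{(1,0,0), (0,1,0), (0,0,1)} <= carrier Z3_group" by (simp add: Z3_group_def)
  show "generate Z3_group {(1,0,0), (0,1,0), (0,0,1)} = carrier Z3_group" by (rule generate_Z3)
  show "card {(1,0,0), (0,1,0), (0,0,1 :: int)} <= 3" by (simp add: card_insert_if)
 qed (simp, rule torus_not_extremal)
next
 fix p q assume p: "3 <= p" and pq: "coprime (int p) q" and N: "M homeomorphic_space lens_space p q"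
 show ?thesis
 proof (rule h2_bound[OF assms(1-3,5) lens_orbit_map[OF p pq] N sphere3_eq simply_connected_sphere3 two_contractible_pieces_sphere3])
  show "{1} <= carrier (integer_mod_group p)" using p by simp
  show "generate (integer_mod_group p) {1} = carrier (integer_mod_group p)" by (rule generate_integer_mod_group[OF p])
  show "card {1 :: int} <= 1" by simp
 qed (simp, rule lens_not_extremal[OF _ p])
qed

end
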